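(* Let $g\ge 0$ be an integer, $m$ a real number with $m\neq -1$, and $\underline h=(h_{-1},h,h_1,\dots,h_{2g})\in\mathbb C^{2(g+1)}$ such that the polynomial $$f(x)=x^{2g+2}+2h_{-1}x^{2g+1}+\Bigl(2h+\tfrac{m}{1+m}h_{-1}^2\Bigr)x^{2g}+2h_1x^{2g-1}+\cdots+2h_{2g}$$ has no double root. Let $C$ be the smooth compact hyperelliptic curve of $y^2=f(x)$, $\infty^{\pm}$ its two points at infinity, and let $T_{\underline h}\subset\mathbb C^{3(g+1)}$ be the complex level set of the generalized Lagrange top defined in the context. Then: (1) $T_{\underline h}$ is a smooth complex manifold biholomorphic to $J(C,\infty^\pm)\setminus\Theta$, where $J(C,\infty^\pm)$ is the generalized Jacobian of $C$ with respect to the modulus $\infty^++\infty^-$ and $\Theta$ is a theta divisor, namely $\Theta=J(C,\infty^\pm)\setminus\mathcal A\bigl(\mathrm{Div}^{+,g+1}_0(\breve C)\bigr)$. (2) The Hamiltonian flows of the generalized Lagrange top restricted to $T_{\underline h}$ induce linear flows on $J(C,\infty^\pm)$. The corresponding vector fields $\{\,\cdot\,,H_{-1}\}$, $\{\,\cdot\,,H\}$ and $\{\,\cdot\,,H_i\}$, $i\in\{1,2,\dots,g-1\}$, have a Lax pair representation obtained from the Lax pair $$2\sqrt{-1}\,\frac{d}{dt}\widetilde\Gamma(x)=\Bigl[\widetilde\Gamma(x),\frac{\widetilde\Gamma(a)}{x-a}\Bigr]$$ by substituting $a\in\mathbb P^1$ and using the linear change of variables which expresses the coefficients of $U,V,W$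 (the entries of $\widetilde\Gamma$) through the variables $\omega_i,\gamma_{j,k}$, as given in the context.
   Context: Phase space and Hamiltonians: coordinates on $\mathbb C^{3(g+1)}$ are $\omega_1,\omega_2,\omega_3$ and $\gamma_{i,k}$ ($1\le i\le g$, $1\le k\le 3$). Put $\gamma_{0,1}=\omega_1$, $\gamma_{0,2}=\omega_2$, $\gamma_{0,3}=(1+m)\omega_3$, and $$U(x)=x^{g+1}+(\gamma_{0,3}-\sqrt{-1}\gamma_{0,2})x^g-\sum_{i=1}^g(\gamma_{i,3}-\sqrt{-1}\gamma_{i,2})x^{g-i},$$ $$W(x)=x^{g+1}+(\gamma_{0,3}+\sqrt{-1}\gamma_{0,2})x^g-\sum_{i=1}^g(\gamma_{i,3}+\sqrt{-1}\gamma_{i,2})x^{g-i},$$ $$V(x)=\gamma_{0,1}x^g-\sum_{i=1}^g\gamma_{i,1}x^{g-i},\qquad \widetilde\Gamma(x)=\begin{pmatrix} V(x) & U(x) \\ W(x) & -V(x) \end{pmatrix}.$$ These formulas are the linear change of variables between the coefficients of $U,V,W$ and the variables $\omega_i,\gamma_{j,k}$. Define functions $H_{-1},H_0,\dots,H_{2g}$ by $V(x)^2+U(x)W(x)=x^{2g+2}+\sum_{k=-1}^{2g}2H_k\,x^{2g-k}$, and $H=H_0-\frac{m}{2(1+m)}H_{-1}^2$. In particular $H_{-1}=(1+m)\omega_3$ and $H=\frac12(\omega_1^2+\omega_2^2+(1+m)\omega_3^2)-\gamma_{1,3}$ (with $\gamma_{1,3}=0$ if $g=0$). Poisson bracket: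 put $G_{0,k}=\gamma_{0,k}$, $G_{i,k}=-\gamma_{i,k}$ for $1\le i\le g$, and $G_{i,k}=0$ for $i>g$. The bracket is $\{G_{i,k},G_{j,l}\}=\sum_{c=1}^3\Lambda_{kl}^cG_{i+j,c}$, where $\Lambda_{kl}^c$ is skew in $k,l$ with $\Lambda_{12}=(0,0,-1)$, $\Lambda_{13}=(0,1,0)$, $\Lambda_{23}=(-1,0,0)$ (components indexed by $c=1,2,3$). The generalized Lagrange top is the Hamiltonian system $\dot z=\{z,H\}$; $H_{-1},H_0,\dots,H_{g-1}$ are first integrals in involution and $H_g,\dots,H_{2g}$ are Casimirs. Level set: $T_{\underline h}$ is the set of points of $\mathbb C^{3(g+1)}$ with $H_{-1}=h_{-1}$, $H=h$, $H_k=h_k$ for $1\le k\le 2g$. Through the linear change of variables it is identified with the set of triples $(U,V,W)$ of complex polynomials with $U$ and $W$ monic of degree $g+1$, $V$ of degree at most $g$, and $V^2+UW=f$. Generalized Jacobian: $\breve C=C\setminus\{\infty^+,\infty^-\}$ and $\iota(x,y)=(x,-y)$ is the hyperelliptic involution. $J(C,\infty^\pm)$ is the group of degree-zero divisors on $C$ with support disjoint from $\{\infty^+,\infty^-\}$, modulo the relation: $D_1\sim D_2$ iff there is a meromorphic function $\varphi$ on $C$ with $(\varphi)=D_1-D_2$ and $\varphi-1$ vanishing at both $\infty^+$ and $\infty^-$. Analytically, with $\omega=(dx/y,\,x\,dx/y,\dots,x^g\,dx/y)$, it is $\mathbb C^{g+1}/\Lambda_{2g+1}$ with $\Lambda_{2g+1}=\{\oint_c\omega: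 c\in H_1(\breve C,\mathbb Z)\}$. Abel–Jacobi map: $\mathrm{Div}^{+,g+1}_0(\breve C)$ is the set of positive divisors $D=\sum_{i=1}^{g+1}P_i$ of degree $g+1$ on $\breve C$ having the property $\mathrm{Supp}(D)\cap\mathrm{Supp}(\iota(D))=\emptyset$. For a fixed $D_0=\sum_{i=1}^{g+1}W_i$ in this set, $\mathcal A(D)=\int_{D_0}^D\omega=\sum_{i=1}^{g+1}\int_{W_i}^{P_i}\omega\in J(C,\infty^\pm)$.
   Formalization: Supp(D)∩Supp(ι(D))=∅ is read so that a point fixed by ι may occur in D with multiplicity one (excluding such points makes (1) false, e.g. g=0); in (2) each field's Lax pair is a linear combination of those for g+1 values of a, with coefficients depending on H_{-1}. *)

theory Defs
  imports
    "HOL-Complex_Analysis.Complex_Analysis"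
    "HOL-Homology.Homology"
begin

section \<open>Several complex variables\<close>

definition holomorphic_map :: "(complex^'a \<Rightarrow> complex^'b) \<Rightarrow> (complex^'a) set \<Rightarrow> bool" where
  "holomorphic_map F S \<longleftrightarrow> open S \<and>
     (\<forall>z\<in>S. \<exists>L. Vector_Spaces.linear (*s) (*s) L \<and> (F has_derivative L) (at z))"

text \<open>Embedded \<open>d\<close>-dimensional complex submanifold, through slice charts \<open>\<psi>\<close>
  (with holomorphic inverse \<open>\<xi>\<close>); the coordinates in \<open>B\<close> are local coordinates on \<open>S\<close>.\<close>
definition complex_submanifold :: "nat \<Rightarrow> (complex^'a) set \<Rightarrow> bool" where
  "complex_submanifold d S \<longleftrightarrow>
     (\<forall>p\<in>S. \<exists>N N' B. \<exists>\<psi> \<xi> :: complex^'a \<Rightarrow> complex^'a.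
        p \<in> N \<and> holomorphic_map \<psi> N \<and> holomorphic_map \<xi> N' \<and>
        \<psi> ` N = N' \<and> (\<forall>z\<in>N. \<xi> (\<psi> z) = z) \<and> card B = d \<and>
        (\<forall>z\<in>N. z \<in> S \<longleftrightarrow> (\<forall>a. a \<notin> B \<longrightarrow> \<psi> z $ a = 0)))"

text \<open>The complex structure of a manifold \<open>M\<close> covered by \<open>p : \<complex>\<^sup>n \<rightarrow> M\<close> is the one for
  which \<open>p\<close> is a local biholomorphism: maps into \<open>M\<close> are holomorphic iff they lift locally to
  holomorphic maps into \<open>\<complex>\<^sup>n\<close>, and maps from an open \<open>M' \<subseteq> M\<close> are holomorphic iff their composition
  with \<open>p\<close> is. Functions on the submanifold \<open>S\<close> are holomorphic iff they extend
  holomorphically to the ambient space, locally.\<close>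
definition biholomorphic_onto ::
  "(complex^'b \<Rightarrow> 'm) \<Rightarrow> (complex^'a \<Rightarrow> 'm) \<Rightarrow> (complex^'a) set \<Rightarrow> 'm set \<Rightarrow> bool" where
  "biholomorphic_onto p \<Phi> S M' \<longleftrightarrow>
     bij_betw \<Phi> S M' \<and>
     (\<forall>z\<in>S. \<exists>N L. z \<in> N \<and> holomorphic_map L N \<and> (\<forall>w\<in>N \<inter> S. \<Phi> w = p (L w))) \<and>
     holomorphic_map (\<lambda>u. inv_into S \<Phi> (p u)) (p -` M')"

text \<open>Solution of \<open>dz/dt = X z\<close> in complex time.\<close>
definition integral_curve ::
  "(complex^'a \<Rightarrow> complex^'a) \<Rightarrow> complex set \<Rightarrow> (complex \<Rightarrow> complex^'a) \<Rightarrow> bool" where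
  "integral_curve X I \<zeta> \<longleftrightarrow>
     (\<forall>t\<in>I. \<forall>a. ((\<lambda>\<tau>. \<zeta> \<tau> $ a) has_field_derivative X (\<zeta> t) $ a) (at t))"


section \<open>The generalized Lagrange top\<close>

text \<open>A type \<open>'n\<close> with \<open>g + 1\<close> elements indexes the coordinates \<open>0, \<dots>, g\<close>, in
  the order of its \<^class>\<open>enum\<close> list.\<close>
definition ix :: "nat \<Rightarrow> 'n::enum" where
  "ix i = Enum.enum ! i"

definition pos :: "'n::enum \<Rightarrow> nat" where
  "pos j = (LEAST i. Enum.enum ! i = j)"

text \<open>The phase space \<open>\<complex>\<^sup>3\<^sup>(\<^sup>g\<^sup>+\<^sup>1\<^sup>)\<close> is \<^typ>\<open>complex ^ ('n::enum \<times> 3)\<close>: the coordinate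
  \<open>(ix 0, k)\<close> is \<open>\<omega>\<^sub>k\<close>, and \<open>(ix i, k)\<close> is \<open>\<gamma>\<^sub>i\<^sub>,\<^sub>k\<close> for \<open>1 \<le> i \<le> g\<close>.
  The index \<open>k\<close> has values \<open>1\<close>, \<open>2\<close>, \<open>3\<close> in the three-element type \<^typ>\<open>3\<close> (where \<open>3 = 0\<close>).\<close>
definition gam :: "real \<Rightarrow> complex ^ ('n::enum \<times> 3) \<Rightarrow> nat \<Rightarrow> 3 \<Rightarrow> complex" where
  "gam m z i k =
     (if i = 0 \<and> k = 3 then (1 + of_real m) * z $ (ix 0, 3) else z $ (ix i, k))"

definition U_poly :: "nat \<Rightarrow> real \<Rightarrow> complex ^ ('n::enum \<times> 3) \<Rightarrow> complex poly" where
  "U_poly g m z = Polynomial.monom 1 (g + 1) + Polynomial.monom (gam m z 0 3 - \<i> * gam m z 0 2) g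
     - (\<Sum>i=1..g. Polynomial.monom (gam m z i 3 - \<i> * gam m z i 2) (g - i))"

definition W_poly :: "nat \<Rightarrow> real \<Rightarrow> complex ^ ('n::enum \<times> 3) \<Rightarrow> complex poly" where
  "W_poly g m z = Polynomial.monom 1 (g + 1) + Polynomial.monom (gam m z 0 3 + \<i> * gam m z 0 2) g
     - (\<Sum>i=1..g. Polynomial.monom (gam m z i 3 + \<i> * gam m z i 2) (g - i))"

definition V_poly :: "nat \<Rightarrow> real \<Rightarrow> complex ^ ('n::enum \<times> 3) \<Rightarrow> complex poly" where
  "V_poly g m z = Polynomial.monom (gam m z 0 1) g - (\<Sum>i=1..g. Polynomial.monom (gam m z i 1) (g - i))"

text \<open>\<open>H\<^sub>k\<close> for \<open>-1 \<le> k \<le> 2g\<close>.\<close>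
definition Hk :: "nat \<Rightarrow> real \<Rightarrow> int \<Rightarrow> complex ^ ('n::enum \<times> 3) \<Rightarrow> complex" where
  "Hk g m k z =
     Polynomial.coeff (V_poly g m z ^ 2 + U_poly g m z * W_poly g m z) (nat (2 * int g - k)) / 2"

definition Htop :: "nat \<Rightarrow> real \<Rightarrow> complex ^ ('n::enum \<times> 3) \<Rightarrow> complex" where
  "Htop g m z = Hk g m 0 z - of_real (m / (2 * (1 + m))) * (Hk g m (-1) z)\<^sup>2"

definition Lam :: "3 \<Rightarrow> 3 \<Rightarrow> 3 \<Rightarrow> complex" where
  "Lam k l c =
     (if (k, l, c) \<in> {(1, 2, 3), (2, 3, 1), (3, 1, 2)} then -1
      else if (k, l, c) \<in> {(2, 1, 3), (3, 2, 1), (1, 3, 2)} then 1 else 0)"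

definition Gcoord :: "nat \<Rightarrow> real \<Rightarrow> nat \<Rightarrow> 3 \<Rightarrow> complex ^ ('n::enum \<times> 3) \<Rightarrow> complex" where
  "Gcoord g m i k z = (if i = 0 then gam m z 0 k else if i \<le> g then - gam m z i k else 0)"

text \<open>The vector whose only non-zero \<open>G\<close>-coordinate is \<open>G\<^sub>i\<^sub>,\<^sub>k = 1\<close>.\<close>
definition Gdir :: "real \<Rightarrow> nat \<Rightarrow> 3 \<Rightarrow> complex ^ ('n::enum \<times> 3)" where
  "Gdir m i k =
     axis (ix i, k) (if i = 0 then if k = 3 then 1 / (1 + of_real m) else 1 else -1)"

definition pdG :: "real \<Rightarrow> nat \<Rightarrow> 3 \<Rightarrow> (complex ^ ('n::enum \<times> 3) \<Rightarrow> complex)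
    \<Rightarrow> complex ^ ('n \<times> 3) \<Rightarrow> complex" where
  "pdG m i k F z = deriv (\<lambda>t. F (z + t *s Gdir m i k)) 0"

text \<open>The biderivation with \<open>{G\<^sub>i\<^sub>,\<^sub>k, G\<^sub>j\<^sub>,\<^sub>l} = \<Sum>\<^sub>c \<Lambda>\<^sup>c\<^sub>k\<^sub>l G\<^sub>i\<^sub>+\<^sub>j\<^sub>,\<^sub>c\<close>.\<close>
definition poisson :: "nat \<Rightarrow> real \<Rightarrow> (complex ^ ('n::enum \<times> 3) \<Rightarrow> complex)
    \<Rightarrow> (complex ^ ('n \<times> 3) \<Rightarrow> complex) \<Rightarrow> complex ^ ('n \<times> 3) \<Rightarrow> complex" where
  "poisson g m F K z =
     (\<Sum>i\<le>g. \<Sum>j\<le>g. \<Sum>k\<in>UNIV. \<Sum>l\<in>UNIV.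
        pdG m i k F z * pdG m j l K z * (\<Sum>c\<in>UNIV. Lam k l c * Gcoord g m (i + j) c z))"

text \<open>The vector field \<open>{\<cdot>, K}\<close>.\<close>
definition ham_field :: "nat \<Rightarrow> real \<Rightarrow> (complex ^ ('n::enum \<times> 3) \<Rightarrow> complex)
    \<Rightarrow> complex ^ ('n \<times> 3) \<Rightarrow> complex ^ ('n \<times> 3)" where
  "ham_field g m K z = (\<chi> a. poisson g m (\<lambda>w. w $ a) K z)"

definition hamiltonians :: "nat \<Rightarrow> real \<Rightarrow> (complex ^ ('n::enum \<times> 3) \<Rightarrow> complex) set" where
  "hamiltonians g m = {Hk g m (-1), Htop g m} \<union> Hk g m ` {1..int g - 1}"

definition level_set :: "nat \<Rightarrow> real \<Rightarrow> complex \<Rightarrow> complex \<Rightarrow> (nat \<Rightarrow> complex)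
    \<Rightarrow> (complex ^ ('n::enum \<times> 3)) set" where
  "level_set g m hm1 h hs =
     {z. Hk g m (-1) z = hm1 \<and> Htop g m z = h \<and> (\<forall>k\<in>{1..2*g}. Hk g m (int k) z = hs k)}"

definition spectral_poly ::
  "nat \<Rightarrow> real \<Rightarrow> complex \<Rightarrow> complex \<Rightarrow> (nat \<Rightarrow> complex) \<Rightarrow> complex poly" where
  "spectral_poly g m hm1 h hs =
     Polynomial.monom 1 (2*g + 2) + Polynomial.monom (2 * hm1) (2*g + 1)
     + Polynomial.monom (2 * h + of_real (m / (1 + m)) * hm1\<^sup>2) (2*g)
     + (\<Sum>k=1..2*g. Polynomial.monom (2 * hs k) (2*g - k))"


section \<open>Lax pairs\<close>

definition lax_matrix ::
  "nat \<Rightarrow> real \<Rightarrow> complex ^ ('n::enum \<times> 3) \<Rightarrow> complex \<Rightarrow> complex^2^2" where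
  "lax_matrix g m z x =
     vector [vector [poly (V_poly g m z) x, poly (U_poly g m z) x],
             vector [poly (W_poly g m z) x, - poly (V_poly g m z) x]]"

text \<open>Second matrix of the Lax pair for the parameter value \<open>a \<in> \<P>\<^sup>1\<close>, where \<^term>\<open>None\<close> is the
  point at infinity. As \<open>a \<rightarrow> \<infinity>\<close> the matrix grows like \<open>a\<^sup>g\<close>, so its value at infinity is the
  limit after division by \<open>a\<^sup>g\<close>. Note that \<^term>\<open>mat c ** A\<close> is the scalar multiple \<open>c A\<close>.\<close>
definition lax_partner :: "nat \<Rightarrow> real \<Rightarrow> complex ^ ('n::enum \<times> 3) \<Rightarrow> complex option
    \<Rightarrow> complex \<Rightarrow> complex^2^2" where
  "lax_partner g m z a x =
     (case a of
        Some b \<Rightarrow> mat (1 / (x - b)) ** lax_matrix g m z b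
      | None \<Rightarrow> Lim at_infinity (\<lambda>b. mat (1 / b ^ g) ** (mat (1 / (x - b)) ** lax_matrix g m z b)))"

text \<open>\<open>dz/dt = X z\<close> is equivalent to the Lax equation
  \<open>2 \<i> d/dt \<Gamma>(x) = [\<Gamma>(x), \<Sum>\<^sub>a c\<^sub>a P\<^sub>a(x)]\<close>, where \<open>P\<^sub>a\<close> is \<^const>\<open>lax_partner\<close> at \<open>a\<close> and
  the coefficients \<open>c\<^sub>a\<close> may depend on the value of the first integral \<open>H\<^sub>-\<^sub>1\<close>.\<close>
definition lax_representation :: "nat \<Rightarrow> real \<Rightarrow> complex option set
    \<Rightarrow> (complex option \<Rightarrow> complex \<Rightarrow> complex)
    \<Rightarrow> (complex ^ ('n::enum \<times> 3) \<Rightarrow> complex ^ ('n \<times> 3)) \<Rightarrow> bool" where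
  "lax_representation g m A c X \<longleftrightarrow>
     (\<forall>I \<zeta>. open I \<longrightarrow>
        (integral_curve X I \<zeta> \<longleftrightarrow>
         (\<forall>t\<in>I. \<forall>x. Some x \<notin> A \<longrightarrow> (\<forall>r s.
            ((\<lambda>\<tau>. 2 * \<i> * lax_matrix g m (\<zeta> \<tau>) x $ r $ s) has_field_derivative
              (let M = lax_matrix g m (\<zeta> t) x;
                   P = (\<Sum>a\<in>A. mat (c a (Hk g m (-1) (\<zeta> t))) ** lax_partner g m (\<zeta> t) a x)
               in (M ** P - P ** M) $ r $ s)) (at t)))))"


section \<open>The hyperelliptic curve\<close>

text \<open>The affine part of the curve \<open>y\<^sup>2 = f(x)\<close>, that is, the curve without \<open>\<infinity>\<^sup>+\<close>, \<open>\<infinity>\<^sup>-\<close>.\<close>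
definition curve :: "complex poly \<Rightarrow> (complex \<times> complex) set" where
  "curve f = {(x, y). y\<^sup>2 = poly f x}"

definition hinv :: "complex \<times> complex \<Rightarrow> complex \<times> complex" where
  "hinv P = (fst P, - snd P)"

definition local_param ::
  "complex poly \<Rightarrow> complex \<times> complex \<Rightarrow> (complex \<Rightarrow> complex \<times> complex) \<Rightarrow> bool" where
  "local_param f P c \<longleftrightarrow>
     c 0 = P \<and> (\<lambda>t. fst (c t)) analytic_on {0} \<and> (\<lambda>t. snd (c t)) analytic_on {0} \<and>
     (deriv (\<lambda>t. fst (c t)) 0, deriv (\<lambda>t. snd (c t)) 0) \<noteq> (0, 0) \<and>
     (\<forall>\<^sub>F t in nhds 0. c t \<in> curve f)"

text \<open>The chart \<open>t = 1/x\<close> at \<open>\<infinity>\<^sup>+\<close> (\<open>s = 1\<close>) and \<open>\<infinity>\<^sup>-\<close> (\<open>s = -1\<close>), the points where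
  \<open>y / x\<^sup>g\<^sup>+\<^sup>1\<close> is \<open>1\<close> and \<open>-1\<close>.\<close>
definition infinity_param ::
  "nat \<Rightarrow> complex poly \<Rightarrow> complex \<Rightarrow> (complex \<Rightarrow> complex \<times> complex) \<Rightarrow> bool" where
  "infinity_param g f s c \<longleftrightarrow>
     (\<forall>\<^sub>F t in at 0. fst (c t) = 1 / t \<and> c t \<in> curve f) \<and>
     ((\<lambda>t. snd (c t) * t ^ (g + 1)) \<longlongrightarrow> s) (at 0)"

text \<open>A divisor with support disjoint from \<open>{\<infinity>\<^sup>+, \<infinity>\<^sup>-}\<close>.\<close>
type_synonym divisor = "(complex \<times> complex) \<Rightarrow>\<^sub>0 int"

definition div_degree :: "divisor \<Rightarrow> int" where
  "div_degree D = (\<Sum>P\<in>Poly_Mapping.keys D. Poly_Mapping.lookup D P)"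

definition divisors0 :: "complex poly \<Rightarrow> divisor set" where
  "divisors0 f = {D. Poly_Mapping.keys D \<subseteq> curve f \<and> div_degree D = 0}"

text \<open>\<open>\<phi>\<close> is a meromorphic function on the compact curve with divisor \<open>E\<close>, equal to \<open>1\<close> at
  \<open>\<infinity>\<^sup>+\<close> and \<open>\<infinity>\<^sup>-\<close>. The values of \<open>\<phi>\<close> at its poles are irrelevant.\<close>
definition modulus_function ::
  "nat \<Rightarrow> complex poly \<Rightarrow> (complex \<times> complex \<Rightarrow> complex) \<Rightarrow> divisor \<Rightarrow> bool" where
  "modulus_function g f \<phi> E \<longleftrightarrow>
     (\<forall>P\<in>curve f. \<forall>c. local_param f P c \<longrightarrow>
        (\<lambda>t. \<phi> (c t)) meromorphic_on {0} \<and> (\<exists>\<^sub>F t in at 0. \<phi> (c t) \<noteq> 0) \<and>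
        zorder (\<lambda>t. \<phi> (c t)) 0 = Poly_Mapping.lookup E P) \<and>
     (\<forall>s\<in>{1, -1}. \<forall>c. infinity_param g f s c \<longrightarrow>
        (\<lambda>t. \<phi> (c t)) meromorphic_on {0} \<and> ((\<lambda>t. \<phi> (c t)) \<longlongrightarrow> 1) (at 0))"

definition modulus_equiv :: "nat \<Rightarrow> complex poly \<Rightarrow> divisor rel" where
  "modulus_equiv g f =
     {(D1, D2). D1 \<in> divisors0 f \<and> D2 \<in> divisors0 f \<and> (\<exists>\<phi>. modulus_function g f \<phi> (D1 - D2))}"

definition gen_jacobian :: "nat \<Rightarrow> complex poly \<Rightarrow> divisor set set" where
  "gen_jacobian g f = divisors0 f // modulus_equiv g f"


section \<open>Abelian integrals\<close>

text \<open>The differential \<open>x\<^sup>j dx / y\<close> at a point of the curve, on a tangent vector. Where \<open>y = 0\<close> the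
  relation \<open>2 y dy = f'(x) dx\<close> is used.\<close>
definition omega_form ::
  "complex poly \<Rightarrow> nat \<Rightarrow> complex \<times> complex \<Rightarrow> complex \<times> complex \<Rightarrow> complex" where
  "omega_form f j P v =
     fst P ^ j * (if snd P \<noteq> 0 then fst v / snd P else 2 * snd v / poly (pderiv f) (fst P))"

text \<open>The component at the index \<open>j\<close> is the integral of \<open>x\<^sup>j dx / y\<close>, \<open>0 \<le> j \<le> g\<close>.\<close>
definition omega_integral ::
  "complex poly \<Rightarrow> (real \<Rightarrow> complex \<times> complex) \<Rightarrow> (complex, 'n::enum) vec" where
  "omega_integral f q =
     (\<chi> j. integral {0..1} (\<lambda>t. omega_form f (pos j) (q t) (vector_derivative q (at t))))"

definition simplex_path :: "((nat \<Rightarrow> real) \<Rightarrow> 'a) \<Rightarrow> real \<Rightarrow> 'a" where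
  "simplex_path \<sigma> t = \<sigma> (\<lambda>i. if i = 0 then 1 - t else if i = 1 then t else 0)"

text \<open>Every class in \<open>H\<^sub>1\<close> is represented by a piecewise smooth cycle, over which one integrates.\<close>
definition period_lattice :: "complex poly \<Rightarrow> (complex, 'n::enum) vec set" where
  "period_lattice f =
     {(\<Sum>\<sigma>\<in>Poly_Mapping.keys c. of_int (Poly_Mapping.lookup c \<sigma>) *s omega_integral f (simplex_path \<sigma>))
      | c C. C \<in> carrier (homology_group 1 (top_of_set (curve f))) \<and> c \<in> C \<and>
             (\<forall>\<sigma>\<in>Poly_Mapping.keys c. valid_path (simplex_path \<sigma>))}"

text \<open>\<open>z\<close> is a value of the integral of \<open>\<omega>\<close> over a chain of paths with boundary \<open>E\<close>.\<close>
definition divisor_integral :: "complex poly \<Rightarrow> divisor \<Rightarrow> (complex, 'n::enum) vec \<Rightarrow> bool" where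
  "divisor_integral f E z \<longleftrightarrow>
     (\<exists>qs. (\<forall>q\<in>set qs. valid_path q \<and> path_image q \<subseteq> curve f) \<and>
           E = (\<Sum>q\<leftarrow>qs. frag_of (pathfinish q) - frag_of (pathstart q)) \<and>
           z = (\<Sum>q\<leftarrow>qs. omega_integral f q))"

text \<open>The covering \<open>\<complex>\<^sup>g\<^sup>+\<^sup>1 \<rightarrow> \<complex>\<^sup>g\<^sup>+\<^sup>1 / \<Lambda> = J(C, \<infinity>\<^sup>\<plusminus>)\<close>: the identification of the quotient with the
  group of divisor classes sends the class of \<open>E\<close> to the integral of \<open>\<omega>\<close> over a chain with
  boundary \<open>E\<close>, modulo periods.\<close>
definition jac_proj :: "nat \<Rightarrow> complex poly \<Rightarrow> (complex, 'n::enum) vec \<Rightarrow> divisor set" where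
  "jac_proj g f u =
     (THE c. c \<in> gen_jacobian g f \<and>
        (\<exists>E\<in>c. \<exists>z. divisor_integral f E z \<and> u - z \<in> period_lattice f))"

text \<open>The positive divisors \<open>P\<^sub>1 + \<dots> + P\<^sub>g\<^sub>+\<^sub>1\<close> with \<open>P\<^sub>i \<noteq> \<iota>(P\<^sub>j)\<close> for \<open>i \<noteq> j\<close>. This is how the
  disjointness of \<open>Supp D\<close> and \<open>Supp \<iota>(D)\<close> has to be understood at the fixed points of \<open>\<iota>\<close>: a
  point with \<open>y = 0\<close> may occur in \<open>D\<close>, but only once. (Excluding such points altogether, one would miss the
  points of the level sets at which \<open>U\<close> and \<open>V\<close> have a common root.)\<close>
definition Div0 :: "nat \<Rightarrow> complex poly \<Rightarrow> divisor set" where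
  "Div0 g f =
     {D. Poly_Mapping.keys D \<subseteq> curve f \<and> (\<forall>P. 0 \<le> Poly_Mapping.lookup D P) \<and>
         div_degree D = int g + 1 \<and>
         (\<forall>P\<in>Poly_Mapping.keys D. hinv P \<in> Poly_Mapping.keys D \<longrightarrow>
            hinv P = P \<and> Poly_Mapping.lookup D P = 1)}"

text \<open>The map depends on \<open>'n\<close> only through the type of the integral, hence the first argument.\<close>
definition abel_jacobi ::
  "'n::enum itself \<Rightarrow> nat \<Rightarrow> complex poly \<Rightarrow> divisor \<Rightarrow> divisor \<Rightarrow> divisor set" where
  "abel_jacobi _ g f D0 D = jac_proj g f (SOME z :: (complex, 'n) vec. divisor_integral f (D - D0) z)"

definition theta_divisor ::
  "'n::enum itself \<Rightarrow> nat \<Rightarrow> complex poly \<Rightarrow> divisor \<Rightarrow> divisor set set" where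
  "theta_divisor n g f D0 = gen_jacobian g f - abel_jacobi n g f D0 ` Div0 g f"

end

theory Submission
 imports Defs "HOL-Computational_Algebra.Computational_Algebra"
begin

text \<open>A triple with \<open>V\<^sup>2 + U W = f\<close> is determined by the divisor of zeros of \<open>U\<close> and \<open>y - V\<close>, which ranges over
 \<open>Div0\<close>, and the classes of these divisors are pairwise distinct. Local families of equivalent divisors yield a homomorphism
 from \<open>\<complex>\<^sup>g\<^sup>+\<^sup>1\<close> to divisor classes that inverts integration of the differentials; this is Abel's theorem with modulus.
 Near each point the level set is parametrized by replacing points of the divisor, and the coordinate derivatives are the
 right hand sides of the Lax equations. The Hamiltonian fields are combinations of these, with coefficients depending
 only on \<open>H\<^sub>-\<^sub>1\<close>, hence linear on the Jacobian.\<close>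

text \<open>Every equivalence of divisors comes from one kind of function, a quotient of two
  functions \<open>y - V\<close> with polynomial \<open>V\<close>. Such quotients move
  \<open>g + 2\<close> points with distinct abscissae in a one-parameter family along which the
  integrals of the \<open>g + 1\<close> differentials have constant sums, so any displacement of one
  point is compensated by displacements of \<open>g + 1\<close> others. The obstacle to integrating
  directly is monodromy: integrals along paths are multivalued, a homomorphism defined on all of
  \<complex>^(g+1) is not. A divisor whose integral is a period is then principal because the end
  points of a cycle cancel, and this makes the description in \<open>jac_proj\<close> unique. That
  equivalent members of \<open>Div0\<close> are equal rests on Liouville's theorem. If the poles of
  \<open>phi\<close> are bounded by the divisor of \<open>(U, V)\<close>, the product of
  \<open>(phi - phi o hinv) / y\<close> with \<open>U\<close> depends only on \<open>x\<close>, is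
  bounded near every point and tends to 0 at infinity, since \<open>phi\<close> is 1 at both
  infinite points.\<close>

abbreviation (input) "lookup \<equiv> Poly_Mapping.lookup"
abbreviation (input) "keys \<equiv> Poly_Mapping.keys"
type_synonym 'n phase = "complex ^ ('n \<times> 3)"

no_notation fps_nth (infixl "$" 75)
hide_const (open) up_ring.coeff up_ring.monom Coset.order module.smult

section \<open>Functions on the curve and their divisors\<close>

text \<open>\<open>modulus_function\<close> only asks that the zeros do not fill a punctured
  neighbourhood. For a meromorphic function an accumulation of zeros would already force identical
  vanishing nearby.\<close>

lemma meromorphic_eventually_nonzero: assumes "phi meromorphic_on {z::complex}" "\<exists>\<^sub>F t in at z. phi t ~= 0"
 shows "\<forall>\<^sub>F t in at z. phi t ~= 0"
proof (rule ccontr)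
 assume "\<not> ?thesis"
 then have "\<exists>\<^sub>F t in at z. phi t = 0" by (simp add: frequently_def)
 then have "\<forall>\<^sub>F t in at z. phi t = 0" using assms(1) by (intro not_essential_frequently_0_imp_eventually_0)
   (auto simp: meromorphic_at_iff)
 then show False using assms(2) by (simp add: frequently_def)
qed

lemma analytic_on_poly_compose [analytic_intros]: "xi analytic_on A ==> (%t. poly p (xi t :: complex)) analytic_on A"
 by (induction p) (auto intro!: analytic_intros)

text \<open>Factoring \<open>N\<close> as \<open>(x - a)^k q\<close> with \<open>q(a)\<close>
  nonzero shows that orders get multiplied by the ramification index of \<open>xi\<close> at 0. For
  local parameters of the curve this index is 1 off the branch points and 2 at them.\<close>

lemma zorder_poly_compose:
 assumes an: "xi analytic_on {0::complex}" and xi: "xi 0 = a" and fr: "\<exists>\<^sub>F t in at 0. xi t ~= a"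
  and N: "N ~= (0::complex poly)" shows "zorder (%t. poly N (xi t)) 0 = int (order a N) * zorder (%t. xi t - a) 0"
  and "\<forall>\<^sub>F t in at 0. poly N (xi t) ~= 0"
proof -
 obtain q where q: "N = [:-a, 1:] ^ order a N * q" "\<not> [:-a, 1:] dvd q" using order_decomp[OF N] by blast
 have qa: "poly q a ~= 0" using q(2) poly_eq_0_iff_dvd by blast
 have N_eq: "(%t. poly N (xi t)) = (%t. (xi t - a) ^ order a N * poly q (xi t))" by (subst q(1)) (auto simp: poly_power)
 have anq: "(%t. poly q (xi t)) analytic_on {0}" using an by (rule analytic_on_poly_compose)
 have an1: "(%t. xi t - a) analytic_on {0}" using an by (intro analytic_intros)
 have fr1: "\<exists>\<^sub>F t in at 0. xi t - a ~= 0" using fr by simp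
 have ev1: "\<forall>\<^sub>F t in at 0. xi t - a ~= 0"
  by (rule meromorphic_eventually_nonzero[OF analytic_on_imp_meromorphic_on[OF an1] fr1])
 have "isCont (%t. poly q (xi t)) 0" using anq analytic_at_imp_isCont by blast
 then have evq: "\<forall>\<^sub>F t in at 0. poly q (xi t) ~= 0" using qa xi by (metis continuous_within tendsto_imp_eventually_ne)
 show "\<forall>\<^sub>F t in at 0. poly N (xi t) ~= 0" unfolding N_eq[THEN fun_cong] using ev1 evq by eventually_elim auto
 have evp: "\<forall>\<^sub>F t in at 0. (xi t - a) ^ order a N ~= 0" using ev1 by eventually_elim auto
 have "zorder (%t. poly N (xi t)) 0 = zorder (%t. (xi t - a) ^ order a N) 0 + zorder (%t. poly q (xi t)) 0"
  unfolding N_eq using evp evq by (intro zorder_mult analytic_on_imp_meromorphic_on anq analytic_intros an eventually_frequently) auto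
 also have "zorder (%t. (xi t - a) ^ order a N) 0 = int (order a N) * zorder (%t. xi t - a) 0"
  by (intro zorder_power analytic_on_imp_meromorphic_on an1 fr1)
 also have "zorder (%t. poly q (xi t)) 0 = 0" by (rule zorder_eq_0I[OF anq]) (use qa xi in auto)
 finally show "zorder (%t. poly N (xi t)) 0 = int (order a N) * zorder (%t. xi t - a) 0" by simp
qed

text \<open>The points \<open>(a, V(a))\<close> over the roots of \<open>N\<close>, with
  multiplicity. When \<open>N\<close> divides \<open>f - V^2\<close> they lie on the curve, and
  \<open>(N, V)\<close> is Mumford's description of the divisor.\<close>

definition mdiv :: "complex poly => complex poly => divisor" where
 "mdiv N V = (\<Sum>a | poly N a = 0. frag_cmul (int (order a N)) (frag_of (a, poly V a)))"

lemma lookup_mdiv: assumes "N ~= 0" shows "lookup (mdiv N V) (a, b) = (if b = poly V a then int (order a N) else 0)"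
proof -
 have fin: "finite {a. poly N a = 0}" using assms poly_roots_finite by blast
 have "lookup (mdiv N V) (a, b) = (\<Sum>x | poly N x = 0. if x = a \<and> b = poly V a then int (order a N) else 0)"
  unfolding mdiv_def lookup_sum by (intro sum.cong) (auto simp: lookup_single)
 also have "\<dots> = (if b = poly V a then int (order a N) else 0)" using fin assms order_root[of N a] by (cases "b = poly V a") auto
 finally show ?thesis .
qed

lemma divisor_eqI:
 fixes D E :: divisor assumes "\<And>a b. lookup D (a, b) = lookup E (a, b)" shows "D = E" by (rule poly_mapping_eqI) (use assms in auto)

lemma mdiv_mult: assumes "N ~= 0" "M ~= 0" shows "mdiv (N * M) V = mdiv N V + mdiv M V"
 by (rule divisor_eqI) (use assms in \<open>auto simp: lookup_mdiv lookup_add order_mult\<close>)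

lemma mdiv_cong: assumes "\<And>a. poly N a = 0 ==> poly V a = poly V' a" shows "mdiv N V = mdiv N V'"
 unfolding mdiv_def using assms by (intro sum.cong) auto

lemma mdiv_uminus [simp]: "mdiv (- N) V = mdiv N V" unfolding mdiv_def by simp

lemma mdiv_linear [simp]: "mdiv [:-a, 1:] V = frag_of (a, poly V a)"
proof (rule divisor_eqI)
 fix x b
 have "order x [:-a, 1:] = (if x = a then 1 else 0)" using order_power_n_n[of a 1] by (auto intro: order_0I)
 then show "lookup (mdiv [:-a, 1:] V) (x, b) = lookup (frag_of (a, poly V a)) (x, b)"
  by (subst lookup_mdiv) (auto simp: lookup_single when_def)
qed

lemma mdiv_1 [simp]: "mdiv 1 V = 0" by (simp add: mdiv_def)

lemma mdiv_prod_linear: assumes "finite A" shows "mdiv (\<Prod>i\<in>A. [:- x i, 1:]) V = (\<Sum>i\<in>A. frag_of (x i, poly V (x i)))"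
 using assms
proof (induction A rule: finite_induct)
 case (insert i A)
 have "(\<Prod>i\<in>A. [:- x i, 1:]) ~= 0" using insert by (auto simp: prod_zero_iff)
 with insert show ?case by (simp add: mdiv_mult del: mult_pCons_left)
qed simp

lemma div_degree_sum: assumes "finite S" "keys D \<subseteq> S" shows "div_degree D = (\<Sum>P\<in>S. lookup D P)"
 unfolding div_degree_def using assms by (intro sum.mono_neutral_left) (auto simp: in_keys_iff)

lemma div_degree_add: "div_degree (D + E) = div_degree D + div_degree E"
proof -
 let ?S = "keys D \<union> keys E"
 have "keys (D + E) \<subseteq> ?S" by (rule keys_add)
 then show ?thesis by (subst (1 2 3) div_degree_sum[of ?S]) (auto simp: lookup_add sum.distrib)
qed

lemma div_degree_uminus: "div_degree (- D) = - div_degree D" by (simp add: div_degree_def sum_negf)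

lemma div_degree_cmul: "div_degree (frag_cmul k D) = k * div_degree D" by (subst (1 2) div_degree_sum[of "keys D"])
  (auto simp: sum_distrib_left in_keys_iff)

lemma div_degree_diff: "div_degree (D - E) = div_degree D - div_degree E" using div_degree_add[of D "- E"] by (simp add: div_degree_uminus)

lemma div_degree_0 [simp]: "div_degree 0 = 0" by (simp add: div_degree_def)

lemma div_degree_frag_of [simp]: "div_degree (frag_of P) = 1" by (simp add: div_degree_def)

lemma div_degree_setsum: "div_degree (\<Sum>i\<in>A. D i) = (\<Sum>i\<in>A. div_degree (D i))"
 by (induction A rule: infinite_finite_induct) (auto simp: div_degree_add)

lemma keys_diff_subset: "keys (D - E) \<subseteq> keys D \<union> keys (E :: divisor)" by (auto simp: in_keys_iff lookup_minus)

lemma divisors0_add: "D \<in> divisors0 f ==> E \<in> divisors0 f ==> D + E \<in> divisors0 f"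
 using keys_add[of D E] by (auto simp: divisors0_def div_degree_add)

lemma divisors0_diff: "D \<in> divisors0 f ==> E \<in> divisors0 f ==> D - E \<in> divisors0 f"
 using keys_diff_subset[of D E] by (auto simp: divisors0_def div_degree_diff)

lemma divisors0_0 [simp]: "0 \<in> divisors0 f" by (auto simp: divisors0_def)

lemma divisors0_sum: "(\<And>i. i \<in> A ==> D i \<in> divisors0 f) ==> (\<Sum>i\<in>A. D i) \<in> divisors0 f"
 by (induction A rule: infinite_finite_induct) (auto intro: divisors0_add)

lemma divisors0_frag: "P \<in> curve f ==> Q \<in> curve f ==> frag_of P - frag_of Q \<in> divisors0 f"
 using keys_diff_subset[of "frag_of P" "frag_of Q"] by (auto simp: divisors0_def div_degree_diff)

lemma div_degree_mdiv: assumes "N ~= 0" shows "div_degree (mdiv N V) = int (degree N)"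
proof -
 have "finite {a. poly N a = 0}" using assms poly_roots_finite by blast
 have "div_degree (mdiv N V) = int (\<Sum>a | poly N a = 0. order a N)" unfolding mdiv_def by (simp add: div_degree_setsum div_degree_cmul)
 also have "(\<Sum>a | poly N a = 0. order a N) = degree N"
  proof -
  have "size (proots N) = (\<Sum>a\<in>set_mset (proots N). order a N)" using assms by (simp add: size_multiset_overloaded_eq)
  then show ?thesis using assms by (simp add: size_proots_complex)
 qed
 finally show ?thesis .
qed

lemma keys_mdiv: assumes "N ~= 0" shows "keys (mdiv N V) = {(a, poly V a) | a. poly N a = 0}"
 using assms order_root[of N] by (auto simp: in_keys_iff lookup_mdiv split: if_splits)

locale hyperelliptic =
 fixes g :: nat and f :: "complex poly" assumes degree_f: "degree f = 2 * g + 2" and lead_f: "lead_coeff f = 1"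
  and squarefree_f: "rsquarefree f"
begin

lemma f_nz: "f ~= 0" using lead_f by auto

lemma pderiv_f_nz: "poly f a = 0 ==> poly (pderiv f) a ~= 0" using squarefree_f rsquarefree_roots by blast

lemma order_f: "poly f a = 0 ==> order a f = 1"
 using squarefree_f f_nz order_root[of f a] unfolding rsquarefree_def by (metis not_gr_zero)

text \<open>The roots of a square are multiple and those of \<open>f\<close> are simple. As
  \<open>f\<close> has degree at least 2, a square root of \<open>f\<close> would be nonconstant and
  so would have a root.\<close>

lemma f_minus_square_nz: "f - V\<^sup>2 ~= 0"
proof
 assume "f - V\<^sup>2 = 0"
 then have fV: "f = V\<^sup>2" by simp
 then have "degree V ~= 0" using degree_f degree_power_le[of V 2] by auto
 then obtain a where a: "poly V a = 0" using fundamental_theorem_of_algebra[of V] by (auto simp: constant_degree)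
 have "V ~= 0" using fV f_nz by auto
 with a have "order a f \<ge> 2" unfolding fV power2_eq_square using order_root[of V a] by (subst order_mult) auto
 with order_f[of a] a fV show False by auto
qed

text \<open>Differentiating \<open>et^2 = f(xi)\<close> at 0 gives
  \<open>2 b et' = f'(a) xi'\<close>. If \<open>b\<close> is nonzero then \<open>xi'\<close> cannot
  vanish and \<open>x\<close> is a local coordinate. If \<open>b = 0\<close> then
  \<open>f'(a)\<close> is nonzero, so \<open>xi' = 0\<close>, \<open>y\<close> is the local
  coordinate and \<open>xi - a\<close> has order 2.\<close>

lemma local_paramE: assumes c: "local_param f (a, b) c"
 obtains xi et where "\<And>t. c t = (xi t, et t)" "xi analytic_on {0}" "et analytic_on {0}" "xi 0 = a" "et 0 = b"
  "\<forall>\<^sub>F t in nhds 0. (et t)\<^sup>2 = poly f (xi t)" "b\<^sup>2 = poly f a"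
  "\<forall>\<^sub>F t in at 0. xi t ~= a" "b ~= 0 ==> zorder (%t. xi t - a) 0 = 1"
  "b = 0 ==> zorder (%t. xi t - a) 0 = 2" "b = 0 ==> zorder et 0 = 1"
  "\<forall>\<^sub>F t in at 0. et t ~= 0"
proof -
 define xi where "xi = (%t. fst (c t))"
 define et where "et = (%t. snd (c t))"
 have an: "xi analytic_on {0}" "et analytic_on {0}" and c0: "xi 0 = a" "et 0 = b" and der: "(deriv xi 0, deriv et 0) ~= (0, 0)"
  using c by (auto simp: local_param_def xi_def et_def)
 have ev: "\<forall>\<^sub>F t in nhds 0. (et t)\<^sup>2 = poly f (xi t)" using c unfolding local_param_def
  by (auto elim!: eventually_mono simp: curve_def xi_def et_def split: prod.splits)
 then have b: "b\<^sup>2 = poly f a" using c0 eventually_nhds_x_imp_x by fastforce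
 have dxi: "DERIV xi 0 :> deriv xi 0" and det: "DERIV et 0 :> deriv et 0"
  using an analytic_on_imp_differentiable_at DERIV_deriv_iff_field_differentiable by blast+
 have "DERIV (%t. (et t)\<^sup>2 - poly f (xi t)) 0 :> 2 * b * deriv et 0 - poly (pderiv f) a * deriv xi 0"
  using c0 by (auto intro!: derivative_eq_intros dxi det DERIV_chain2[OF poly_DERIV])
 moreover have "DERIV (%t. (et t)\<^sup>2 - poly f (xi t)) 0 :> 0"
  by (rule DERIV_cong_ev[THEN iffD2, of _ _ _ "%_. 0"]) (use ev in \<open>auto elim: eventually_mono\<close>)
 ultimately have rel: "2 * b * deriv et 0 = poly (pderiv f) a * deriv xi 0"
  using DERIV_unique by fastforce
 have nonconst: "\<exists>\<^sub>F t in at 0. h t ~= h 0" if "h analytic_on {0}" "deriv h 0 ~= 0" for h :: "complex => complex"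
 proof (rule ccontr)
  assume "\<not> ?thesis"
  then have "\<forall>\<^sub>F t in nhds 0. h t = h 0" by (simp add: frequently_def eventually_at_filter) (auto elim: eventually_mono)
  then have "deriv h 0 = deriv (%_. h 0) 0" by (intro deriv_cong_ev) auto
  with that show False by simp
 qed
 have zo1: "zorder (%t. h t - h 0) 0 = 1" if h: "h analytic_on {0}" "deriv h 0 ~= 0" for h :: "complex => complex"
 proof -
  obtain r where "r > 0" and hol: "h holomorphic_on ball 0 r" using h(1) by (auto simp: analytic_on_def)
  then show ?thesis by (intro zorder_zero_eqI[of _ "ball 0 r" 0 1])
    (use h in \<open>auto intro!: holomorphic_intros hol simp: deriv_diff analytic_on_imp_differentiable_at\<close>)
 qed
 have et2: "\<forall>\<^sub>F t in at 0. poly f (xi t) = et t * et t"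
  using ev by (auto simp: eventually_at_filter power2_eq_square elim!: eventually_mono)
 have *: "(\<forall>\<^sub>F t in at 0. xi t ~= a) \<and> (b ~= 0 --> zorder (%t. xi t - a) 0 = 1) \<and>
  (b = 0 --> zorder (%t. xi t - a) 0 = 2 \<and> zorder et 0 = 1) \<and> (\<forall>\<^sub>F t in at 0. et t ~= 0)"
 proof (cases "b = 0")
  case False
  have "deriv xi 0 ~= 0" using rel der False by auto
  then have "\<exists>\<^sub>F t in at 0. xi t - a ~= 0" using nonconst[of xi] an c0 by auto
  then have "\<forall>\<^sub>F t in at 0. xi t - a ~= 0"
   by (intro meromorphic_eventually_nonzero analytic_on_imp_meromorphic_on analytic_intros an)
  moreover have "\<forall>\<^sub>F t in at 0. et t ~= 0"
   using analytic_at_imp_isCont[OF an(2)] False c0 by (metis continuous_within tendsto_imp_eventually_ne)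
  ultimately show ?thesis using zo1[of xi] \<open>deriv xi 0 ~= 0\<close> an c0 False by simp
 next
  case True
  then have fa: "poly f a = 0" using b by simp
  with rel True have "deriv xi 0 = 0" using pderiv_f_nz by simp
  then have d: "deriv et 0 ~= 0" using der by simp
  then have et1: "zorder et 0 = 1" using zo1[of et] an c0 True by simp
  have fr: "\<exists>\<^sub>F t in at 0. et t ~= 0" using nonconst[of et] an c0 True d by auto
  have evet: "\<forall>\<^sub>F t in at 0. et t ~= 0" by (intro meromorphic_eventually_nonzero analytic_on_imp_meromorphic_on an fr)
  have evxi: "\<forall>\<^sub>F t in at 0. xi t ~= a" using evet et2 by eventually_elim (use fa in auto)
  have "zorder (%t. poly f (xi t)) 0 = zorder (%t. et t * et t) 0" by (rule zorder_cong[OF et2 refl])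
  also have "\<dots> = 2" using et1 zorder_mult[of et 0 et] an fr by (simp add: analytic_on_imp_meromorphic_on)
  finally have "zorder (%t. xi t - a) 0 = 2"
   using zorder_poly_compose(1)[OF an(1) c0(1) eventually_frequently[OF _ evxi] f_nz] order_f[OF fa] by simp
  with evxi evet et1 True show ?thesis by simp
 qed
 show ?thesis by (rule that[of xi et]) (use * an c0 ev b in \<open>auto simp: xi_def et_def\<close>)
qed

text \<open>The product of \<open>y - V\<close> and \<open>y + V\<close> is \<open>f - V^2\<close>.
  Where \<open>y\<close> is nonzero at most one factor vanishes and carries the whole order. At a
  branch point on the graph of \<open>V\<close>, \<open>y\<close> has order 1 and \<open>V\<close>
  has order at least 2 (or is zero), so \<open>y - V\<close> has order 1, which matches a simple
  root of \<open>f - V^2\<close>.\<close>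

lemma zorder_y_minus: assumes c: "local_param f P c" shows "(%t. snd (c t) - poly V (fst (c t))) meromorphic_on {0}"
  and "\<forall>\<^sub>F t in at 0. snd (c t) - poly V (fst (c t)) ~= 0"
  and "zorder (%t. snd (c t) - poly V (fst (c t))) 0 = lookup (mdiv (f - V\<^sup>2) V) P"
proof -
 obtain a b where P: "P = (a, b)" by force
 obtain xi et where ce: "\<And>t. c t = (xi t, et t)" and an: "xi analytic_on {0}" "et analytic_on {0}"
  and c0: "xi 0 = a" "et 0 = b" and ev: "\<forall>\<^sub>F t in nhds 0. (et t)\<^sup>2 = poly f (xi t)" and b: "b\<^sup>2 = poly f a"
  and ne: "\<forall>\<^sub>F t in at 0. xi t ~= a" and z1: "b ~= 0 ==> zorder (%t. xi t - a) 0 = 1"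
  and z2: "b = 0 ==> zorder (%t. xi t - a) 0 = 2" and z3: "b = 0 ==> zorder et 0 = 1"
  and evet: "\<forall>\<^sub>F t in at 0. et t ~= 0" by (rule local_paramE[OF c[unfolded P]]) blast
 let ?N = "f - V\<^sup>2"
 let ?m = "%t. et t - poly V (xi t)" and ?p = "%t. et t + poly V (xi t)"
 have N: "?N ~= 0" by (rule f_minus_square_nz)
 have anm: "?m analytic_on {0}" "?p analytic_on {0}" by (intro analytic_intros an)+
 have prod: "\<forall>\<^sub>F t in at 0. poly ?N (xi t) = ?m t * ?p t"
  using ev by (auto simp: eventually_at_filter algebra_simps power2_eq_square elim!: eventually_mono)
 have fr: "\<exists>\<^sub>F t in at 0. xi t ~= a" using ne by (intro eventually_frequently) auto
 note zN = zorder_poly_compose[OF an(1) c0(1) fr N]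
 have evm: "\<forall>\<^sub>F t in at 0. ?m t ~= 0" and evp: "\<forall>\<^sub>F t in at 0. ?p t ~= 0"
  using zN(2) prod by (eventually_elim, auto)+
 have sumz: "zorder (%t. poly ?N (xi t)) 0 = zorder ?m 0 + zorder ?p 0" using zorder_cong[OF prod refl] evm evp
  by (simp add: zorder_mult analytic_on_imp_meromorphic_on anm eventually_frequently)
 have "zorder ?m 0 = lookup (mdiv ?N V) (a, b)"
 proof (cases "b = poly V a")
  case False
  then show ?thesis using zorder_eq_0I[OF anm(1)] c0 by (simp add: lookup_mdiv[OF N])
 next
  case True
  show ?thesis
  proof (cases "b = 0")
   case False
   then have "zorder ?p 0 = 0" using zorder_eq_0I[OF anm(2)] c0 True by simp
   then show ?thesis using sumz zN(1) z1[OF False] True by (simp add: lookup_mdiv[OF N])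
  next
   case b0: True
   have Va: "poly V a = 0" and fa: "poly f a = 0" using True b b0 by auto
   have "zorder ?m 0 = 1"
   proof (cases "V = 0")
    case True then show ?thesis using z3 b0 by simp
   next
    case False
    have "zorder (%t. poly V (xi t)) 0 = int (order a V) * 2"
     using zorder_poly_compose(1)[OF an(1) c0(1) fr False] z2 b0 by simp
    moreover have "order a V \<ge> 1" using Va False order_root[of V a] by simp
    ultimately have "zorder et 0 < zorder (%t. poly V (xi t)) 0" using z3 b0 by simp
    then show ?thesis using z3 b0 zorder_diff1[of et 0 "%t. poly V (xi t)"] evet
      zorder_poly_compose(2)[OF an(1) c0(1) fr False] an
     by (simp add: eventually_frequently analytic_on_imp_meromorphic_on analytic_on_poly_compose)
   qed
   moreover have "order a ?N = 1"
   proof -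
    have "poly ?N a = 0" using fa Va by simp
    moreover have "poly (pderiv ?N) a ~= 0"
     using Va pderiv_f_nz[OF fa] by (simp add: pderiv_diff power2_eq_square pderiv_mult)
    ultimately have "order a (pderiv ?N) = 0" "order a ?N ~= 0"
     using order_root order_0I N by blast+
    then show ?thesis using order_pderiv[of ?N a] \<open>poly ?N a = 0\<close> N by simp
   qed
   ultimately show ?thesis using True by (simp add: lookup_mdiv[OF N])
  qed
 qed
 then show "zorder (%t. snd (c t) - poly V (fst (c t))) 0 = lookup (mdiv ?N V) P" by (simp add: ce P)
 show "(%t. snd (c t) - poly V (fst (c t))) meromorphic_on {0}" by (simp add: ce analytic_on_imp_meromorphic_on anm)
 show "\<forall>\<^sub>F t in at 0. snd (c t) - poly V (fst (c t)) ~= 0" using evm by (simp add: ce)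
qed

end

lemma poly_ext: "(\<And>x. poly p x = poly q x) ==> p = (q :: complex poly)" using poly_eq_poly_eq_iff by blast

lemma tendsto_poly_recip: assumes "degree q <= n"
 shows "((%t::complex. poly q (1 / t) * t ^ n) \<longlongrightarrow> coeff q n) (at 0)"
proof -
 have "((%t::complex. \<Sum>i\<le>n. coeff q i * t ^ (n - i)) \<longlongrightarrow> (\<Sum>i\<le>n. coeff q i * 0 ^ (n - i))) (at 0)"
  by (intro tendsto_intros)
 also have "(\<Sum>i\<le>n. coeff q i * 0 ^ (n - i)) = (\<Sum>i\<le>n. if i = n then coeff q i else 0)"
  by (intro sum.cong) (auto simp: power_0_left)
 also have "\<dots> = coeff q n" by simp
 finally show ?thesis
 proof (rule Lim_transform_eventually)
  have "(\<Sum>i\<le>n. coeff q i * t ^ (n - i)) = poly q (1 / t) * t ^ n" if "t ~= 0" for t :: complex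
  proof -
   have "poly q (1 / t) = (\<Sum>i\<le>n. coeff q i * (1 / t) ^ i)" unfolding poly_altdef using assms
    by (intro sum.mono_neutral_left) (auto simp: coeff_eq_0)
   then show ?thesis using that by (simp add: sum_distrib_right sum_distrib_left power_diff field_simps power_one_over)
  qed
  then show "\<forall>\<^sub>F t in at 0. (\<Sum>i\<le>n. coeff q i * t ^ (n - i)) = poly q (1 / t) * t ^ n"
   by (simp add: eventually_at_filter)
 qed
qed

section \<open>Principal divisors with modulus\<close>

context hyperelliptic
begin

definition prin :: "divisor set" where "prin = {E \<in> divisors0 f. \<exists>phi. modulus_function g f phi E}"

lemma prin_divisors0: "E \<in> prin ==> E \<in> divisors0 f" by (simp add: prin_def)

lemma prin_0: "0 \<in> prin" by (auto simp: prin_def modulus_function_def intro!: exI[of _ "%_. 1"] zorder_const)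

lemma prin_diff: assumes "D \<in> prin" "E \<in> prin" shows "D - E \<in> prin"
proof -
 obtain phi psi where phi: "modulus_function g f phi D" and psi: "modulus_function g f psi E" using assms by (auto simp: prin_def)
 have "modulus_function g f (%P. phi P / psi P) (D - E)" unfolding modulus_function_def
 proof (intro conjI ballI allI impI)
  fix P c assume P: "P \<in> curve f" and c: "local_param f P c"
  have 1: "(%t. phi (c t)) meromorphic_on {0}" "\<exists>\<^sub>F t in at 0. phi (c t) ~= 0"
   "zorder (%t. phi (c t)) 0 = lookup D P" using phi P c by (auto simp: modulus_function_def)
  have 2: "(%t. psi (c t)) meromorphic_on {0}" "\<exists>\<^sub>F t in at 0. psi (c t) ~= 0"
   "zorder (%t. psi (c t)) 0 = lookup E P" using psi P c by (auto simp: modulus_function_def)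
  show "(%t. phi (c t) / psi (c t)) meromorphic_on {0}" by (intro meromorphic_intros 1 2)
  show "zorder (%t. phi (c t) / psi (c t)) 0 = lookup (D - E) P"
   using zorder_divide[OF 1(1,2) 2(1,2)] 1(3) 2(3) by (simp add: lookup_minus)
  have "\<forall>\<^sub>F t in at 0. phi (c t) / psi (c t) ~= 0"
   using meromorphic_eventually_nonzero[OF 1(1,2)] meromorphic_eventually_nonzero[OF 2(1,2)] by eventually_elim auto
  then show "\<exists>\<^sub>F t in at 0. phi (c t) / psi (c t) ~= 0" by (intro eventually_frequently) auto
 next
  fix s :: complex and c assume s: "s \<in> {1, -1}" and c: "infinity_param g f s c"
  show "(%t. phi (c t) / psi (c t)) meromorphic_on {0}"
   using phi psi s c by (intro meromorphic_intros) (auto simp: modulus_function_def)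
  have "((%t. phi (c t) / psi (c t)) \<longlongrightarrow> 1 / 1) (at 0)"
   using phi psi s c by (intro tendsto_intros) (auto simp: modulus_function_def)
  then show "((%t. phi (c t) / psi (c t)) \<longlongrightarrow> 1) (at 0)" by simp
 qed
 moreover have "D - E \<in> divisors0 f" using assms by (auto intro: divisors0_diff prin_divisors0)
 ultimately show ?thesis by (auto simp: prin_def)
qed

lemma prin_uminus: "E \<in> prin ==> - E \<in> prin" using prin_diff[OF prin_0] by simp

lemma prin_add: "D \<in> prin ==> E \<in> prin ==> D + E \<in> prin"
 using prin_diff[of D "- E"] prin_uminus by simp

lemma prin_sum: "(\<And>i. i \<in> A ==> D i \<in> prin) ==> (\<Sum>i\<in>A. D i) \<in> prin"
 by (induction A rule: infinite_finite_induct) (auto intro: prin_add prin_0)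

lemma modulus_equiv_iff:
 "(D, E) \<in> modulus_equiv g f \<longleftrightarrow> D \<in> divisors0 f \<and> E \<in> divisors0 f \<and> D - E \<in> prin"
 by (auto simp: modulus_equiv_def prin_def divisors0_diff)

lemma equiv_modulus_equiv: "equiv (divisors0 f) (modulus_equiv g f)"
proof (rule equivI)
 show "modulus_equiv g f \<subseteq> divisors0 f \<times> divisors0 f" by (auto simp: modulus_equiv_iff)
 show "refl_on (divisors0 f) (modulus_equiv g f)" by (auto simp: refl_on_def modulus_equiv_iff prin_0)
 show "sym (modulus_equiv g f)" using prin_uminus by (fastforce simp: sym_def modulus_equiv_iff)
 show "trans (modulus_equiv g f)" using prin_add by (fastforce simp: trans_def modulus_equiv_iff)
qed

text \<open>\<open>infinity_param\<close> prescribes \<open>x\<close> but only a limit for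
  \<open>y\<close>, so meromorphy of \<open>y\<close> has to be recovered from the equation of the
  curve: \<open>y t^(g+1)\<close> is a square root of the reflected polynomial, and its nonzero
  limit \<open>s\<close> selects the branch.\<close>

lemma infinity_param_meromorphic: assumes s: "s \<in> {1, -1}" and c: "infinity_param g f s c"
 shows "(%t. snd (c t)) meromorphic_on {0}" "(%t. fst (c t)) meromorphic_on {0}"
  "\<forall>\<^sub>F t in at 0. (snd (c t))\<^sup>2 = poly f (1 / t) \<and> fst (c t) = 1 / t"
  "((%t. snd (c t) * t ^ (g + 1)) \<longlongrightarrow> s) (at 0)"
proof -
 have ev: "\<forall>\<^sub>F t in at 0. fst (c t) = 1 / t \<and> c t \<in> curve f"
  and lim: "((%t. snd (c t) * t ^ (g + 1)) \<longlongrightarrow> s) (at 0)" using c by (auto simp: infinity_param_def)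
 then show "((%t. snd (c t) * t ^ (g + 1)) \<longlongrightarrow> s) (at 0)" by simp
 have ev': "\<forall>\<^sub>F t in at 0. (snd (c t))\<^sup>2 = poly f (1 / t) \<and> fst (c t) = 1 / t"
  using ev by eventually_elim (auto simp: curve_def split: prod.splits)
 then show "\<forall>\<^sub>F t in at 0. (snd (c t))\<^sup>2 = poly f (1 / t) \<and> fst (c t) = 1 / t" .
 have "(%t::complex. 1 / t) meromorphic_on {0}" by (intro meromorphic_intros)
 then show "(%t. fst (c t)) meromorphic_on {0}"
  by (subst meromorphic_on_cong[of _ _ "%t. 1 / t"]) (use ev in \<open>auto elim: eventually_mono\<close>)
 \<comment> \<open>The holomorphic branch with value \<open>s\<close> at 0. It has the same square
   as \<open>y t^(g+1)\<close>, and the sum of the two tends to \<open>2 s\<close>, so they agree on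
   a punctured neighbourhood.\<close>
 define F where "F = (%t. s * csqrt (poly (reflect_poly f) t))"
 have F0: "poly (reflect_poly f) 0 = 1" using lead_f by simp
 have "(%t. csqrt (poly (reflect_poly f) t)) analytic_on {0}"
  by (rule analytic_on_csqrt') (use F0 in \<open>auto intro!: analytic_intros\<close>)
 then have Fan: "F analytic_on {0}" unfolding F_def by (rule analytic_on_mult[OF analytic_on_const])
 have "(F \<longlongrightarrow> F 0) (at 0)" using analytic_at_imp_isCont[OF Fan] by (simp add: continuous_within)
 then have "((%t. snd (c t) * t ^ (g + 1) + F t) \<longlongrightarrow> s + F 0) (at 0)" by (intro tendsto_intros lim)
 moreover have "s + F 0 ~= 0" using s F0 by (auto simp: F_def)
 ultimately have "\<forall>\<^sub>F t in at 0. snd (c t) * t ^ (g + 1) + F t ~= 0"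
  using tendsto_imp_eventually_ne by blast
 then have "\<forall>\<^sub>F t in at 0. snd (c t) = F t / t ^ (g + 1)" using ev' eventually_neq_at_within[of 0 0]
 proof eventually_elim
  case (elim t)
  have "(snd (c t) * t ^ (g + 1))\<^sup>2 = t ^ (2 * g + 2) * poly f (inverse t)" using elim power_mult[of t "g + 1" 2]
   by (simp add: power_mult_distrib inverse_eq_divide algebra_simps del: power_Suc)
  also have "\<dots> = poly (reflect_poly f) t" using elim degree_f by (simp add: poly_reflect_poly_nz)
  also have "\<dots> = (F t)\<^sup>2" using s by (auto simp: F_def power_mult_distrib)
  finally have "(snd (c t) * t ^ (g + 1) - F t) * (snd (c t) * t ^ (g + 1) + F t) = 0" by (simp add: power2_eq_square algebra_simps)
  with elim have "snd (c t) * t ^ (g + 1) = F t" by simp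
  with elim show ?case by (simp add: eq_divide_eq)
 qed
 moreover have "(%t. F t / t ^ (g + 1)) meromorphic_on {0}"
  using Fan by (intro meromorphic_intros analytic_on_imp_meromorphic_on)
 ultimately show "(%t. snd (c t)) meromorphic_on {0}"
  by (subst meromorphic_on_cong[of _ _ "%t. F t / t ^ (g + 1)"]) auto
qed

lemma meromorphic_poly_compose: "xi meromorphic_on A ==> (%t. poly q (xi t :: complex)) meromorphic_on A"
 by (induction q) (auto intro!: meromorphic_intros)

lemma keys_mdiv_subset_curve: assumes "N dvd V\<^sup>2 - f" "N ~= 0" shows "keys (mdiv N V) \<subseteq> curve f"
proof -
 obtain K where "V\<^sup>2 - f = N * K" using assms(1) by (auto simp: dvd_def)
 then have "(poly V a)\<^sup>2 = poly f a" if "poly N a = 0" for a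
  using that by (metis eq_iff_diff_eq_0 mult_zero_left poly_diff poly_mult poly_power)
 then show ?thesis using assms(2) by (auto simp: keys_mdiv curve_def)
qed

lemma mdiv_diff_divisors0: assumes "N dvd V\<^sup>2 - f" "M dvd L\<^sup>2 - f" "N ~= 0" "M ~= 0" "degree N = degree M"
 shows "mdiv N V - mdiv M L \<in> divisors0 f" using assms keys_diff_subset[of "mdiv N V" "mdiv M L"] keys_mdiv_subset_curve
 by (auto simp: divisors0_def div_degree_diff div_degree_mdiv)

text \<open>\<open>L^2 - f\<close> has degree at most \<open>2 deg p - 2\<close>, so
  \<open>K\<close> has smaller degree than \<open>p\<close> and the perturbed polynomial keeps the
  leading term of \<open>p\<close>: no root escapes to infinity as \<open>be\<close> varies.\<close>

lemma rotate_degree: assumes L: "L\<^sup>2 - f = p * K" and p: "g + 1 < degree p" "degree L < degree p"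
 shows "degree K < degree p" "K ~= 0" "degree (p + smult (2 * be) L + smult (be\<^sup>2) K) = degree p"
  "coeff (p + smult (2 * be) L + smult (be\<^sup>2) K) (degree p) = lead_coeff p"
proof -
 show K: "K ~= 0" using L f_minus_square_nz[of L] by auto
 have pnz: "p ~= 0" using p by auto
 have "degree (L\<^sup>2 - f) <= 2 * degree p - 2" using p degree_f degree_power_le[of L 2] by (intro degree_diff_le) auto
 then show dK: "degree K < degree p" using L K pnz p by (simp add: degree_mult_eq)
 show "coeff (p + smult (2 * be) L + smult (be\<^sup>2) K) (degree p) = lead_coeff p" using dK p by (simp add: coeff_eq_0)
 have "degree (smult (2 * be) L + smult (be\<^sup>2) K) < degree p" using dK p by (intro degree_add_less) auto
 then show "degree (p + smult (2 * be) L + smult (be\<^sup>2) K) = degree p" by (simp add: degree_add_eq_left add.assoc)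
qed

text \<open>The divisors of zeros of \<open>y - L - be K\<close> for varying \<open>be\<close> share the part lying over \<open>K = 0\<close>, so that the
 quotients of these functions compare the parts lying over the roots of \<open>p\<close>. At infinity
 \<open>K / (y - L) = - (y + L) / p\<close> vanishes for degree reasons.\<close>
lemma prin_rotate: assumes L: "L\<^sup>2 - f = p * K" and p: "g + 1 < degree p" "degree L < degree p"
 shows "mdiv (p + smult (2 * be) L + smult (be\<^sup>2) K) (L + smult be K) - mdiv p L \<in> prin"
proof -
 define R where "R = p + smult (2 * be) L + smult (be\<^sup>2) K"
 define V where "V = L + smult be K"
 have V: "V\<^sup>2 - f = R * K"
 proof (rule poly_ext)
  fix x
  have "(poly L x)\<^sup>2 - poly f x = poly p x * poly K x" by (metis L poly_diff poly_mult poly_power)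
  then show "poly (V\<^sup>2 - f) x = poly (R * K) x" by (simp add: R_def V_def power2_eq_square algebra_simps)
 qed
 note rd = rotate_degree[OF L p]
 have pnz: "p ~= 0" "R ~= 0" using p rd(3)[of be] by (auto simp: R_def)
 have eq: "f - V\<^sup>2 = - (R * K)" "f - L\<^sup>2 = - (p * K)" using V L by (metis minus_diff_eq)+
 have mK: "mdiv K V = mdiv K L" by (rule mdiv_cong) (simp add: V_def)
 have D: "mdiv (f - V\<^sup>2) V - mdiv (f - L\<^sup>2) L = mdiv R V - mdiv p L" unfolding eq using mK pnz rd(2) by (simp add: mdiv_mult)
 have "modulus_function g f (%P. (snd P - poly V (fst P)) / (snd P - poly L (fst P))) (mdiv R V - mdiv p L)"
  unfolding modulus_function_def
 proof (intro conjI ballI allI impI)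
  fix P c assume c: "local_param f P c"
  note z = zorder_y_minus[OF c, of V] zorder_y_minus[OF c, of L]
  show "(%t. (snd (c t) - poly V (fst (c t))) / (snd (c t) - poly L (fst (c t)))) meromorphic_on {0}"
   by (intro meromorphic_intros z)
  show "zorder (%t. (snd (c t) - poly V (fst (c t))) / (snd (c t) - poly L (fst (c t)))) 0 =
    lookup (mdiv R V - mdiv p L) P"
   using z by (subst zorder_divide) (auto intro!: eventually_frequently simp flip: D simp: lookup_minus)
  have "\<forall>\<^sub>F t in at 0. (snd (c t) - poly V (fst (c t))) / (snd (c t) - poly L (fst (c t))) ~= 0"
   using z(2,5) by eventually_elim auto
  then show "\<exists>\<^sub>F t in at 0. (snd (c t) - poly V (fst (c t))) / (snd (c t) - poly L (fst (c t))) ~= 0"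
   by (intro eventually_frequently) auto
 next
  fix s :: complex and c assume s: "s \<in> {1, -1}" and c: "infinity_param g f s c"
  note i = infinity_param_meromorphic[OF s c]
  show "(%t. (snd (c t) - poly V (fst (c t))) / (snd (c t) - poly L (fst (c t)))) meromorphic_on {0}"
   by (intro meromorphic_intros meromorphic_poly_compose i)
  \<comment> \<open>In the parameter \<open>t = 1/x\<close> the quotient \<open>(y + L) / p\<close>
    is \<open>t\<close> times a function with a finite limit: \<open>n >= g + 1\<close> bounds
    \<open>y t^n\<close>, and \<open>p\<close> has degree \<open>n + 1\<close>. The spare factor
    \<open>t\<close> makes the quotient tend to 0.\<close>
  let ?n = "degree p - 1"
  have n: "degree L <= ?n" "?n = g + 1 + (?n - (g + 1))" "degree p = Suc ?n" using p by auto
  have l1: "((%t. poly p (1 / t) * t ^ degree p) \<longlongrightarrow> lead_coeff p) (at 0)" by (rule tendsto_poly_recip) simp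
  have l2: "((%t. snd (c t) * t ^ (g + 1) * t ^ (?n - (g + 1)) + poly L (1 / t) * t ^ ?n) \<longlongrightarrow>
    s * 0 ^ (?n - (g + 1)) + coeff L ?n) (at 0)"
   by (intro tendsto_add tendsto_mult i(4) tendsto_poly_recip n(1) tendsto_power tendsto_ident_at)
  have "((%t. 1 + be * (t * (snd (c t) * t ^ (g + 1) * t ^ (?n - (g + 1)) + poly L (1 / t) * t ^ ?n)
     / (poly p (1 / t) * t ^ degree p))) \<longlongrightarrow>
    1 + be * (0 * (s * 0 ^ (?n - (g + 1)) + coeff L ?n) / lead_coeff p)) (at 0)" using pnz by (intro tendsto_intros l1 l2) auto
  then have l3: "((%t. 1 + be * (t * (snd (c t) * t ^ (g + 1) * t ^ (?n - (g + 1)) + poly L (1 / t) * t ^ ?n)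
     / (poly p (1 / t) * t ^ degree p))) \<longlongrightarrow> 1) (at 0)" by simp
  have pne: "\<forall>\<^sub>F t in at 0. poly p (1 / t) * t ^ degree p ~= 0" using l1 pnz by (intro tendsto_imp_eventually_ne) auto
  have kne: "\<forall>\<^sub>F t in at 0. poly K (1 / t) * t ^ degree K ~= 0"
   using tendsto_poly_recip[of K "degree K"] rd(2) by (intro tendsto_imp_eventually_ne) auto
  show "((%t. (snd (c t) - poly V (fst (c t))) / (snd (c t) - poly L (fst (c t)))) \<longlongrightarrow> 1) (at 0)"
  proof (rule Lim_transform_eventually[OF l3])
   show "\<forall>\<^sub>F t in at 0. 1 + be * (t * (snd (c t) * t ^ (g + 1) * t ^ (?n - (g + 1)) + poly L (1 / t) * t ^ ?n)
     / (poly p (1 / t) * t ^ degree p)) = (snd (c t) - poly V (fst (c t))) / (snd (c t) - poly L (fst (c t)))"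
    using pne kne i(3) eventually_neq_at_within[of 0 0]
   proof eventually_elim
    case (elim t)
    let ?y = "snd (c t)" and ?x = "1 / t"
    have "(poly L ?x)\<^sup>2 - poly f ?x = poly p ?x * poly K ?x" by (metis L poly_diff poly_mult poly_power)
    then have pk: "(?y - poly L ?x) * (?y + poly L ?x) = - (poly p ?x * poly K ?x)"
     using elim by (simp add: power2_eq_square algebra_simps)
    then have ne: "?y - poly L ?x ~= 0" using elim by auto
    have tn: "t ^ (g + 1) * t ^ (?n - (g + 1)) = t ^ ?n" using n(2) by (metis power_add)
    have tp: "t ^ degree p = t * t ^ ?n" by (metis n(3) power_Suc)
    have "t * (?y * (t ^ (g + 1) * t ^ (?n - (g + 1))) + poly L ?x * t ^ ?n) = (?y + poly L ?x) * t ^ degree p"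
     unfolding tn tp by (simp only: distrib_left distrib_right ac_simps)
    then have "t * (?y * t ^ (g + 1) * t ^ (?n - (g + 1)) + poly L ?x * t ^ ?n) = (?y + poly L ?x) * t ^ degree p"
     by (simp only: mult.assoc)
    then have "1 + be * (t * (?y * t ^ (g + 1) * t ^ (?n - (g + 1)) + poly L ?x * t ^ ?n)
     / (poly p ?x * t ^ degree p)) = 1 + be * ((?y + poly L ?x) / poly p ?x)" using elim by simp
    also have "(?y + poly L ?x) / poly p ?x = - poly K ?x / (?y - poly L ?x)" using pk ne elim by (simp add: field_simps)
    also have "1 + be * (- poly K ?x / (?y - poly L ?x)) = (?y - poly V ?x) / (?y - poly L ?x)"
     using ne by (simp add: V_def field_simps)
    finally show ?case using elim by simp
   qed
  qed
 qed
 moreover have "mdiv R V - mdiv p L \<in> divisors0 f"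
  using V L pnz rd(3)[of be] by (intro mdiv_diff_divisors0) (auto simp: R_def)
 ultimately show ?thesis unfolding prin_def R_def V_def by blast
qed

end

section \<open>Local parameters and the differentials\<close>

context hyperelliptic
begin

text \<open>A parametrization \<open>t \<mapsto> (xi t, et t)\<close> of a piece of the curve on which \<open>dx / y\<close> is \<open>rho dt\<close>. Unlike
 \<open>xi' / et\<close>, the density \<open>rho\<close> has no singularity at the branch points.\<close>
definition chart :: "(complex => complex) => (complex => complex) => (complex => complex) => complex set => bool" where
 "chart xi et rho B \<longleftrightarrow> open B \<and> rho holomorphic_on B \<and>
   (\<forall>t\<in>B. (et t)\<^sup>2 = poly f (xi t) \<and> rho t ~= 0 \<and>
    DERIV xi t :> rho t * et t \<and>
    DERIV et t :> poly (pderiv f) (xi t) * rho t / 2)"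

lemma chart_subset: "chart xi et rho B ==> open B' ==> B' \<subseteq> B ==> chart xi et rho B'"
 unfolding chart_def by (auto intro: holomorphic_on_subset)

lemma chart_holomorphic: assumes "chart xi et rho B" shows "xi holomorphic_on B" "et holomorphic_on B" "rho holomorphic_on B"
 using assms by (auto simp: chart_def holomorphic_on_open)

lemma chart_curve: "chart xi et rho B ==> t \<in> B ==> (xi t, et t) \<in> curve f"
 by (auto simp: chart_def curve_def)

text \<open>The parameter \<open>tau\<close> is \<open>x\<close> away from the branch points and \<open>y\<close> at the branch points.\<close>
definition chart_at where
 "chart_at P tau xi et rho r eps \<longleftrightarrow> (tau = fst \<or> tau = snd) \<and> r > 0 \<and> eps > 0 \<and> chart xi et rho (ball (tau P) r) \<and>
  (xi (tau P), et (tau P)) = P \<and> (\<forall>t. tau (xi t, et t) = t) \<and>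
  (\<forall>Q\<in>curve f. dist Q P < eps --> tau Q \<in> ball (tau P) r \<and> (xi (tau Q), et (tau Q)) = Q)"

text \<open>The root is taken of \<open>f / y0^2\<close>, which is close to 1 and hence avoids the
  cut of \<open>csqrt\<close>. Its values have nonnegative real part, while \<open>y / y0\<close>
  for a nearby point lies within 1 of 1; this decides the sign and shows that the chart covers a
  neighbourhood.\<close>

lemma nonbranch_chart: assumes P: "(x0, y0) \<in> curve f" and y0: "y0 ~= 0"
 shows "\<exists>et r eps. chart_at (x0, y0) fst (%t. t) et (%t. 1 / et t) r eps"
proof -
 have f0: "poly f x0 = y0\<^sup>2" using P by (simp add: curve_def)
 have "isCont (%x. poly f x / y0\<^sup>2) x0" using y0 by (intro continuous_intros) auto
 then obtain r where r: "r > 0" "\<And>x. dist x x0 < r ==> dist (poly f x / y0\<^sup>2) 1 < 1"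
  unfolding continuous_at_eps_delta using f0 y0 by (force dest: spec[of _ 1])
 have Re: "Re (poly f x / y0\<^sup>2) > 0" if "x \<in> ball x0 r" for x
 proof -
  have "cmod (poly f x / y0\<^sup>2 - 1) < 1" using r(2)[of x] that by (simp add: dist_commute flip: dist_norm)
  then show ?thesis using abs_Re_le_cmod[of "poly f x / y0\<^sup>2 - 1"] by simp
 qed
 then have nr: "poly f x / y0\<^sup>2 \<notin> \<real>\<^sub>\<le>\<^sub>0" if "x \<in> ball x0 r" for x
  using Re[OF that] unfolding complex_nonpos_Reals_iff by linarith
 define et where "et = (%x. y0 * csqrt (poly f x / y0\<^sup>2))"
 have etsq: "(et x)\<^sup>2 = poly f x" for x using y0 by (simp add: et_def power_mult_distrib)
 have nz: "et x ~= 0" if "x \<in> ball x0 r" for x using Re[OF that] y0 by (auto simp: et_def)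
 have hol: "et holomorphic_on ball x0 r" unfolding et_def using nr y0 by (intro holomorphic_intros) auto
 have der: "DERIV et x :> poly (pderiv f) x * (1 / et x) / 2" if x: "x \<in> ball x0 r" for x
 proof -
  have d: "DERIV et x :> deriv et x" using hol x by (simp add: holomorphic_derivI)
  have "DERIV (%x. (et x)\<^sup>2) x :> 2 * et x * deriv et x" by (auto intro!: derivative_eq_intros d)
  then have "2 * et x * deriv et x = poly (pderiv f) x" unfolding etsq using DERIV_unique poly_DERIV by blast
  then have "deriv et x = poly (pderiv f) x * (1 / et x) / 2" using nz[OF x] by (simp add: field_simps)
  with d show ?thesis by simp
 qed
 have ch: "chart (%t. t) et (%t. 1 / et t) (ball x0 r)"
  unfolding chart_def using nz etsq der hol by (auto intro!: holomorphic_intros)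
 have "fst Q \<in> ball x0 r \<and> snd Q = et (fst Q)" if Q: "Q \<in> curve f" "dist Q (x0, y0) < min r (cmod y0)" for Q
 proof -
  obtain x y where xy: "Q = (x, y)" by force
  have d: "dist x x0 < r" "dist y y0 < cmod y0" using Q(2) dist_fst_le[of Q "(x0, y0)"] dist_snd_le[of Q "(x0, y0)"] xy by auto
  have "y = et x"
  proof (rule ccontr)
   assume "y ~= et x"
   moreover have "y\<^sup>2 = (et x)\<^sup>2" using Q(1) xy etsq by (simp add: curve_def)
   ultimately have "y / y0 = - csqrt (poly f x / y0\<^sup>2)"
    using y0 by (auto simp: power2_eq_iff et_def)
   then have "Re (y / y0) <= 0" using csqrt_principal[of "poly f x / y0\<^sup>2"] by auto
   moreover have "cmod (y / y0 - 1) < 1"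
    using d(2) y0 by (simp add: dist_norm divide_simps flip: norm_divide) (simp add: norm_divide)
   ultimately show False using abs_Re_le_cmod[of "y / y0 - 1"] by simp
  qed
  then show ?thesis using d xy by (simp add: dist_commute)
 qed
 moreover have "et x0 = y0" using f0 y0 by (simp add: et_def)
 ultimately have "chart_at (x0, y0) fst (%t. t) et (%t. 1 / et t) r (min r (cmod y0))"
  unfolding chart_at_def using r y0 ch by (auto simp: prod_eq_iff)
 then show ?thesis by blast
qed

text \<open>At a simple root \<open>f\<close> is locally invertible with inverse \<open>G\<close>,
  so \<open>y^2 = f(x)\<close> is solved by \<open>x = G(y^2)\<close>, and
  \<open>dx / y = 2 dy / f'(x)\<close> gives the density.\<close>

lemma branch_chart: assumes P: "(x0, 0) \<in> curve f" shows "\<exists>xi rho r eps. chart_at (x0, 0) snd xi (%t. t) rho r eps"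
proof -
 have f0: "poly f x0 = 0" using P by (simp add: curve_def)
 have hol: "poly f holomorphic_on UNIV" by (intro holomorphic_intros)
 have df: "deriv (poly f) x = poly (pderiv f) x" for x by (rule DERIV_imp_deriv[OF poly_DERIV])
 obtain r1 where r1: "r1 > 0" "inj_on (poly f) (ball x0 r1)" by (rule has_complex_derivative_locally_injective[of "poly f" UNIV x0])
   (use pderiv_f_nz[OF f0] df hol in auto)
 obtain G where G: "G holomorphic_on poly f ` ball x0 r1"
  "\<And>z. z \<in> ball x0 r1 ==> deriv (poly f) z * deriv G (poly f z) = 1"
  "\<And>z. z \<in> ball x0 r1 ==> G (poly f z) = z" by (rule holomorphic_has_inverse[of "poly f" "ball x0 r1"])
   (use r1 hol in \<open>auto intro: holomorphic_on_subset\<close>)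
 have op: "open (poly f ` ball x0 r1)" using open_mapping_thm3[of "poly f" "ball x0 r1"] r1 hol holomorphic_on_subset by blast
 moreover have "0 \<in> poly f ` ball x0 r1" using f0 r1 by force
 ultimately obtain r0 where r0: "r0 > 0" "ball 0 r0 \<subseteq> poly f ` ball x0 r1" by (rule openE)
 \<comment> \<open>The bound 1 ensures \<open>|t^2| <= |t| < r0\<close>.\<close>
 define r where "r = min 1 r0"
 have r: "r > 0" using r0 by (simp add: r_def)
 have sq: "t\<^sup>2 \<in> poly f ` ball x0 r1" if "t \<in> ball 0 r" for t :: complex
 proof -
  have "cmod t < 1" "cmod t < r0" using that by (auto simp: r_def)
  then have "cmod t * cmod t < r0" using mult_left_le_one_le[of "cmod t" "cmod t"] by force
  then have "t\<^sup>2 \<in> ball 0 r0" by (simp add: norm_mult power2_eq_square)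
  then show ?thesis using r0 by auto
 qed
 define xi where "xi = (%t. G (t\<^sup>2))"
 define rho where "rho = (%t. 2 / poly (pderiv f) (xi t))"
 have xi: "xi t \<in> ball x0 r1" "poly f (xi t) = t\<^sup>2" if "t \<in> ball 0 r" for t using sq[OF that] G(3) unfolding xi_def by force+
 have dnz: "poly (pderiv f) (xi t) ~= 0" "deriv G (t\<^sup>2) = 1 / poly (pderiv f) (xi t)" if "t \<in> ball 0 r" for t
  using G(2)[OF xi(1)[OF that]] xi(2)[OF that] by (auto simp: df eq_divide_eq mult.commute)
 have dxi: "DERIV xi t :> rho t * t" if t: "t \<in> ball 0 r" for t
 proof -
  have "DERIV G (t\<^sup>2) :> deriv G (t\<^sup>2)" using G(1) op sq[OF t] by (simp add: holomorphic_derivI)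
  then have "DERIV (%t. G (t\<^sup>2)) t :> deriv G (t\<^sup>2) * (2 * t)"
   by (rule DERIV_chain2) (auto intro!: derivative_eq_intros)
  then show ?thesis using dnz[OF t] by (simp add: xi_def rho_def)
 qed
 have hxi: "xi holomorphic_on ball 0 r" unfolding holomorphic_on_open[OF open_ball] using dxi by blast
 have ch: "chart xi (%t. t) rho (ball 0 r)" unfolding chart_def using dxi xi dnz
  by (auto simp: rho_def intro!: holomorphic_intros derivative_eq_intros holomorphic_on_compose[OF hxi, unfolded o_def])
 have "snd Q \<in> ball 0 r \<and> fst Q = xi (snd Q)" if Q: "Q \<in> curve f" "dist Q (x0, 0) < min r r1" for Q
 proof -
  obtain x y where xy: "Q = (x, y)" by force
  have d: "dist x x0 < r1" "dist y 0 < r" using Q(2) dist_fst_le[of Q "(x0, 0)"] dist_snd_le[of Q "(x0, 0)"] xy by auto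
  have "G (y\<^sup>2) = x" using Q(1) G(3)[of x] d xy by (simp add: curve_def dist_commute)
  then show ?thesis using xy d by (simp add: xi_def)
 qed
 moreover have "xi 0 = x0" using G(3)[of x0] r1 f0 by (simp add: xi_def)
 ultimately have "chart_at (x0, 0) snd xi (%t. t) rho r (min r r1)"
  unfolding chart_at_def using r r1 ch by (auto simp: prod_eq_iff)
 then show ?thesis by blast
qed

lemma chart_exists: assumes P: "P \<in> curve f" shows "\<exists>tau xi et rho r eps. chart_at P tau xi et rho r eps"
proof (cases P)
 case (Pair x0 y0)
 then show ?thesis using assms nonbranch_chart[of x0 y0] branch_chart[of x0] by blast
qed

end

section \<open>Families of equivalent divisors\<close>

lemma degree_linear_prod: "finite I ==> degree (\<Prod>i\<in>I. [:- x i, 1::complex:]) = card I"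
 by (subst degree_prod_eq_sum_degree) auto

lemma lead_coeff_linear_prod: "lead_coeff (\<Prod>i\<in>I. [:- x i, 1::complex:]) = 1" by (simp add: lead_coeff_prod)

lemma poly_eq_0_of_roots: assumes "finite A" "\<And>a. a \<in> A ==> poly q a = 0" "degree q < card A"
 shows "q = (0 :: complex poly)"
proof (rule ccontr)
 assume "q ~= 0"
 then have "card A <= card {a. poly q a = 0}" using assms poly_roots_finite by (intro card_mono) auto
 also have "\<dots> <= degree q" using \<open>q ~= 0\<close> by (simp add: card_poly_roots_bound)
 finally show False using assms(3) by simp
qed

lemma poly_interpolation:
 fixes v :: "complex => complex" assumes "finite A"
 shows "\<exists>L. degree L <= card A - 1 \<and> (\<forall>a\<in>A. poly L a = v a)" using assms
proof (induction A rule: finite_induct)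
 case empty
 show ?case by (intro exI[of _ 0]) auto
next
 case (insert b A)
 then obtain L where L: "degree L <= card A - 1" "\<forall>a\<in>A. poly L a = v a" by blast
 define P where "P = (\<Prod>a\<in>A. [:- a, 1:])"
 have P: "poly P a = 0 \<longleftrightarrow> a \<in> A" for a using insert by (auto simp: P_def poly_prod)
 have "degree P = card A" unfolding P_def by (rule degree_linear_prod[OF insert(1)])
 then have "degree (L + smult ((v b - poly L b) / poly P b) P) <= card A"
  using L(1) by (intro degree_add_le) (auto intro: order_trans[OF degree_smult_le])
 with L P insert show ?case by (intro exI[of _ "L + smult ((v b - poly L b) / poly P b) P"]) auto
qed

lemma poly_eq_linear_prod: assumes I: "finite I" "inj_on x I" and R: "degree R = card I" "lead_coeff R = 1"
  and roots: "\<And>i. i \<in> I ==> poly R (x i) = 0" shows "R = (\<Prod>i\<in>I. [:- x i, 1::complex:])"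
proof (cases "card I = 0")
 case True
 then have "I = {}" using I by simp
 moreover obtain c where "R = [:c:]" using R True by (metis degree_eq_zeroE)
 moreover have "c = 1" using R(2) \<open>R = [:c:]\<close> by simp
 ultimately show ?thesis by simp
next
 case False
 let ?P = "\<Prod>i\<in>I. [:- x i, 1:]"
 have P: "degree ?P = card I" "lead_coeff ?P = 1" by (rule degree_linear_prod[OF I(1)], rule lead_coeff_linear_prod)
 have "degree (R - ?P) < card I"
 proof (rule degree_lessI)
  show "R - ?P ~= 0 \<or> 0 < card I" using False by simp
  have "coeff ?P (card I) = 1" "coeff R (card I) = 1" using P R by metis+
  then show "\<forall>k\<ge>card I. coeff (R - ?P) k = 0" using R(1) P(1) by (auto simp: coeff_eq_0 le_less)
 qed
 then have "R - ?P = 0" using I roots by (intro poly_eq_0_of_roots[of "x ` I"]) (auto simp: poly_prod card_image)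
 then show ?thesis by simp
qed

lemma pderiv_linear_prod: assumes "finite I" "i \<in> I"
 shows "poly (pderiv (\<Prod>i\<in>I. [:- x i, 1::complex:])) (x i) = (\<Prod>j\<in>I - {i}. x i - x j)"
proof -
 have "(\<Prod>i\<in>I. [:- x i, 1:]) = [:- x i, 1:] * (\<Prod>j\<in>I - {i}. [:- x j, 1:])"
  using assms by (simp add: prod.remove del: mult_pCons_left)
 then show ?thesis by (simp add: pderiv_mult pderiv_pCons poly_prod del: mult_pCons_left)
qed

text \<open>Compare the coefficients of \<open>x\<^sup>n\<^sup>-\<^sup>1\<close> in Lagrange's interpolation formula for \<open>x\<^sup>j\<close>.\<close>
lemma sum_power_over_pderiv:
 fixes x :: "'i => complex" assumes I: "finite I" "inj_on x I" and j: "j + 2 <= card I"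
 shows "(\<Sum>i\<in>I. x i ^ j / poly (pderiv (\<Prod>i\<in>I. [:- x i, 1:])) (x i)) = 0"
proof -
 define R where "R = (\<Prod>i\<in>I. [:- x i, 1:])"
 define q where "q = (%i. \<Prod>k\<in>I - {i}. [:- x k, 1:])"
 define Q where "Q = (\<Sum>i\<in>I. smult (x i ^ j / poly (pderiv R) (x i)) (q i))"
 have dq: "degree (q i) = card I - 1" "coeff (q i) (card I - 1) = 1" if "i \<in> I" for i
 proof -
  have 1: "degree (q i) = card I - 1" unfolding q_def using degree_linear_prod[of "I - {i}"] I(1) that by simp
  have 2: "lead_coeff (q i) = 1" unfolding q_def by (rule lead_coeff_linear_prod)
  show "degree (q i) = card I - 1" "coeff (q i) (card I - 1) = 1" using 1 2 by auto
 qed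
 have R': "poly (pderiv R) (x i) = poly (q i) (x i)" "poly (q i) (x i) ~= 0" if "i \<in> I" for i
  using pderiv_linear_prod[OF I(1) that, of x] I that by (auto simp: R_def q_def poly_prod inj_on_def)
 have q0: "poly (q k) (x i) = 0" if "i \<in> I" "k \<in> I" "k ~= i" for i k using that I(1) by (auto simp: q_def poly_prod)
 have Qx: "poly Q (x i) = x i ^ j" if i: "i \<in> I" for i
 proof -
  have "poly Q (x i) = (\<Sum>k\<in>I. if k = i then x i ^ j else 0)" unfolding Q_def poly_sum using R' q0 i by (intro sum.cong) auto
  then show ?thesis using I(1) i by simp
 qed
 have "degree Q <= card I - 1" unfolding Q_def using dq(1) by (intro degree_sum_le I) (auto intro: order_trans[OF degree_smult_le])
 then have "degree (Q - monom 1 j) < card I" using j degree_monom_le[of "1::complex" j] degree_diff_le_max[of Q "monom 1 j"] by linarith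
 then have "Q - monom 1 j = 0" using I Qx by (intro poly_eq_0_of_roots[of "x ` I"]) (auto simp: card_image poly_monom)
 \<comment> \<open>By \<open>j + 2 <= card I\<close> the index \<open>card I - 1\<close> lies beyond
   the degree of \<open>x^j\<close>.\<close>
 then have "coeff Q (card I - 1) = 0" using j by simp
 moreover have "coeff Q (card I - 1) = (\<Sum>i\<in>I. x i ^ j / poly (pderiv R) (x i))"
  unfolding Q_def coeff_sum using dq(2) by (intro sum.cong) auto
 ultimately show ?thesis by (simp add: R_def)
qed

lemma holomorphic_local_inverse: assumes hol: "b holomorphic_on B" "open B" "s \<in> B" and d: "deriv b s ~= 0"
 shows "\<exists>G del. del > 0 \<and> G (b s) = s \<and> (\<forall>be\<in>ball (b s) del. G be \<in> B \<and> b (G be) = be \<and>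
  deriv b (G be) ~= 0 \<and> DERIV G be :> 1 / deriv b (G be))"
proof -
 obtain r where r: "r > 0" "ball s r \<subseteq> B" "inj_on b (ball s r)"
  by (rule has_complex_derivative_locally_injective[OF hol(1) hol(3) hol(2) d])
 have hol': "b holomorphic_on ball s r" using hol(1) r(2) holomorphic_on_subset by blast
 obtain G where G: "G holomorphic_on b ` ball s r"
  "\<And>z. z \<in> ball s r ==> deriv b z * deriv G (b z) = 1" "\<And>z. z \<in> ball s r ==> G (b z) = z"
  by (rule holomorphic_has_inverse[of b "ball s r"]) (use r hol' in auto)
 have op: "open (b ` ball s r)" using open_mapping_thm3[OF hol' open_ball r(3)] .
 moreover have "b s \<in> b ` ball s r" using r(1) by auto
 ultimately obtain del where del: "del > 0" "ball (b s) del \<subseteq> b ` ball s r" by (rule openE)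
 have "G be \<in> B \<and> b (G be) = be \<and> deriv b (G be) ~= 0 \<and> DERIV G be :> 1 / deriv b (G be)"
  if be: "be \<in> ball (b s) del" for be
 proof -
  obtain z where z: "z \<in> ball s r" "be = b z" using be del(2) by blast
  have "DERIV G be :> deriv G be" using G(1) op z by (simp add: holomorphic_derivI)
  moreover have "deriv b z ~= 0" "deriv G be = 1 / deriv b z"
   using G(2)[OF z(1)] z(2) by (auto simp: eq_divide_eq mult.commute)
  ultimately show ?thesis using G(3)[OF z(1)] z r(2) by auto
 qed
 then show ?thesis using del(1) G(3)[of s] r(1) by (intro exI[of _ G] exI[of _ del]) auto
qed

text \<open>Near a branch point \<open>b'\<close> is found from the relation
  \<open>y = L + b K\<close>. Eliminating \<open>p\<close> and \<open>f'\<close> with the other two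
  relations leaves a multiple of \<open>K\<close>, which can be cancelled.\<close>

lemma rotation_derivative_branch:
 fixes L :: complex assumes 1: "p + 2 * b * L + b\<^sup>2 * K = 0" and 2: "2 * L * L' - f' = p' * K + p * K'" and 3: "y = L + b * K"
 and 4: "(L' + b * K') * (r * y) + d * K = f' * r / 2"  and K: "K ~= 0" shows "d = - (r * (p' + 2 * b * L' + b\<^sup>2 * K')) / 2"
proof -
 have p: "p = - (2 * b * L + b\<^sup>2 * K)" unfolding eq_neg_iff_add_eq_0 using 1 by (simp only: add.assoc)
 have f': "f' = 2 * L * L' - p' * K - p * K'" using 2 by (metis add_diff_cancel_left' diff_add_cancel diff_add_eq_diff_diff_swap)
 have "d * K = f' * r / 2 - (L' + b * K') * (r * y)" unfolding 4[symmetric] by simp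
 also have "\<dots> = - (r * (p' + 2 * b * L' + b\<^sup>2 * K')) / 2 * K" unfolding f' p 3 by (simp add: field_simps power2_eq_square)
 finally show ?thesis using K by (simp only: mult_right_cancel[OF K])
qed

text \<open>Where \<open>y\<close> is nonzero, \<open>b'\<close> is found by differentiating
  \<open>p + 2 b L + b^2 K = 0\<close> along the chart; the coefficient of \<open>b'\<close> is
  \<open>2 (L + b K) = 2 y\<close>.\<close>

lemma rotation_derivative_nonbranch:
 fixes R :: complex assumes "R * (r * y) + 2 * d * v = 0" "y = v" "y ~= 0" shows "d = - (r * R) / 2"
proof -
 have "(2 * d + r * R) * y = 0" using assms(1,2) by (simp add: algebra_simps)
 then have "2 * d = - (r * R)" using assms(3) by (metis eq_neg_iff_add_eq_0 mult_eq_0_iff)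
 then have "2 * d / 2 = - (r * R) / 2" by (simp only:)
 then show ?thesis by simp
qed

lemma open_nonzero_set:
 fixes h :: "complex => complex" assumes "continuous_on B h" "open B" shows "open {t \<in> B. h t ~= 0}"
proof -
 have "open (B \<inter> h -` (- {0}))" using assms by (intro continuous_open_preimage) auto
 also have "B \<inter> h -` (- {0}) = {t \<in> B. h t ~= 0}" by auto
 finally show ?thesis .
qed

lemma derivative_of_combination:
 fixes t :: complex assumes "DERIV et t :> e" "DERIV l t :> l' * c" "DERIV k t :> k' * c" "DERIV b t :> d"
  and S: "open S" "t \<in> S" "\<And>x. x \<in> S ==> et x = l x + b x * k x" shows "(l' + b t * k') * c + d * k t = e"
proof -
 have "DERIV (%x. l x + b x * k x) t :> l' * c + (d * k t + k' * c * b t)" by (intro DERIV_add DERIV_mult assms)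
 then have "DERIV et t :> l' * c + (d * k t + k' * c * b t)"
  using S(1,2) by (rule has_field_derivative_transform_within_open) (rule S(3)[symmetric])
 then have "e = l' * c + (d * k t + k' * c * b t)" using assms(1) DERIV_unique by blast
 then show ?thesis by (simp add: algebra_simps)
qed

lemma derivative_of_quadratic_combination:
 fixes t :: complex assumes "DERIV p t :> p' * c" "DERIV l t :> l' * c" "DERIV k t :> k' * c" "DERIV b t :> d"
  and S: "open S" "t \<in> S" "\<And>x. x \<in> S ==> p x + 2 * b x * l x + (b x)\<^sup>2 * k x = 0"
 shows "(p' + 2 * b t * l' + (b t)\<^sup>2 * k') * c + 2 * d * (l t + b t * k t) = 0"
proof -
 have "((%x. p x + 2 * b x * l x + (b x)\<^sup>2 * k x) has_field_derivative
   p' * c + (2 * d * l t + l' * c * (2 * b t)) + (2 * b t * d * k t + k' * c * (b t)\<^sup>2)) (at t)"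
  by (rule derivative_eq_intros assms refl)+ (simp add: algebra_simps)
 moreover have "DERIV (%x. p x + 2 * b x * l x + (b x)\<^sup>2 * k x) t :> 0"
  by (rule has_field_derivative_transform_within_open[OF DERIV_const[of 0] S(1,2)]) (use S(3) in auto)
 ultimately have "p' * c + (2 * d * l t + l' * c * (2 * b t)) + (2 * b t * d * k t + k' * c * (b t)\<^sup>2) = 0"
  using DERIV_unique by blast
 then show ?thesis by (simp add: algebra_simps)
qed

context hyperelliptic
begin

text \<open>\<open>b\<close> is the parameter value at which the family passes through the moving
  point. From \<open>(y - L) (y + L) = - p K\<close> there are two expressions for it,
  \<open>- p / (y + L)\<close> and \<open>(y - L) / K\<close>. The first is regular where
  \<open>y\<close> is nonzero, as \<open>y + L = 2 y\<close> at \<open>s\<close>. At a branch point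
  \<open>L = 0\<close> and \<open>- f' = p' K\<close>, so \<open>K\<close> is nonzero and the second
  applies.\<close>

lemma rotation_parameter: assumes ch: "chart xi et rho B" and s: "s \<in> B" and L: "L\<^sup>2 - f = p * K"
  and p: "poly p (xi s) = 0" "poly (pderiv p) (xi s) ~= 0" and ets: "et s = poly L (xi s)"
 shows "\<exists>b B'. open B' \<and> s \<in> B' \<and> B' \<subseteq> B \<and> b s = 0 \<and> (\<forall>t\<in>B'.
  poly (p + smult (2 * b t) L + smult ((b t)\<^sup>2) K) (xi t) = 0 \<and>
  et t = poly L (xi t) + b t * poly K (xi t) \<and>
  DERIV b t :> - (rho t * poly (pderiv (p + smult (2 * b t) L + smult ((b t)\<^sup>2) K)) (xi t)) / 2)"
proof -
 note hol = chart_holomorphic[OF ch]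
 have opB: "open B" and sq: "\<And>t. t \<in> B ==> (et t)\<^sup>2 = poly f (xi t)"
  and dxi: "\<And>t. t \<in> B ==> DERIV xi t :> rho t * et t"
  and det: "\<And>t. t \<in> B ==> DERIV et t :> poly (pderiv f) (xi t) * rho t / 2" using ch by (auto simp: chart_def)
 have dp: "DERIV (%t. poly q (xi t)) t :> poly (pderiv q) (xi t) * (rho t * et t)" if "t \<in> B" for q t
  by (rule DERIV_chain2[OF poly_DERIV dxi[OF that]])
 have hp: "(%t. poly q (xi t)) holomorphic_on B" for q using dp opB by (auto simp: holomorphic_on_open)
 have Lx: "(poly L x)\<^sup>2 - poly f x = poly p x * poly K x" for x by (metis L poly_diff poly_mult poly_power)
 have fac: "(et t - poly L (xi t)) * (et t + poly L (xi t)) = - (poly p (xi t) * poly K (xi t))" if "t \<in> B" for t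
  using sq[OF that] Lx[of "xi t"] by (simp add: power2_eq_square algebra_simps)
 have L': "2 * poly L x * poly (pderiv L) x - poly (pderiv f) x
   = poly (pderiv p) x * poly K x + poly p x * poly (pderiv K) x" for x using arg_cong[OF L, of "%q. poly (pderiv q) x"]
  by (simp add: pderiv_diff power2_eq_square pderiv_mult algebra_simps)
 have pdR: "poly (pderiv (p + smult (2 * be) L + smult (be\<^sup>2) K)) x =
   poly (pderiv p) x + 2 * be * poly (pderiv L) x + be\<^sup>2 * poly (pderiv K) x" for be x by (simp add: pderiv_add pderiv_smult)
 show ?thesis
 proof (cases "et s = 0")
  case False
  define b where "b = (%t. - poly p (xi t) / (et t + poly L (xi t)))"
  define B' where "B' = {t \<in> B. et t + poly L (xi t) ~= 0} \<inter> {t \<in> B. et t ~= 0}"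
  have "continuous_on B (%t. et t + poly L (xi t))" "continuous_on B et"
   by (intro continuous_on_add holomorphic_on_imp_continuous_on hol hp)+
  then have op: "open B'" unfolding B'_def by (intro open_Int open_nonzero_set opB)
  have sB: "s \<in> B'" using s ets False by (auto simp: B'_def)
  have id1: "et t = poly L (xi t) + b t * poly K (xi t)" if "t \<in> B'" for t
   using that fac[of t] by (auto simp: B'_def b_def field_simps)
  have id2: "poly p (xi t) + 2 * b t * poly L (xi t) + (b t)\<^sup>2 * poly K (xi t) = 0" if "t \<in> B'" for t
  proof -
   have "b t * (et t + poly L (xi t)) = - poly p (xi t)" using that by (auto simp: B'_def b_def)
   then show ?thesis using id1[OF that] by (simp add: power2_eq_square algebra_simps)
  qed
  have "DERIV b t :> - (rho t * poly (pderiv (p + smult (2 * b t) L + smult ((b t)\<^sup>2) K)) (xi t)) / 2" if t: "t \<in> B'" for t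
  proof -
   let ?R' = "poly (pderiv p) (xi t) + 2 * b t * poly (pderiv L) (xi t) + (b t)\<^sup>2 * poly (pderiv K) (xi t)"
   have tB: "t \<in> B" "et t ~= 0" "et t + poly L (xi t) ~= 0" using t by (auto simp: B'_def)
   have "b holomorphic_on B'" unfolding b_def by (intro holomorphic_on_divide holomorphic_on_minus holomorphic_on_diff holomorphic_on_add
      holomorphic_on_subset[OF hp] holomorphic_on_subset[OF hol(2)]) (auto simp: B'_def)
   then have db: "DERIV b t :> deriv b t" using op t by (simp add: holomorphic_derivI)
   have "?R' * (rho t * et t) + 2 * deriv b t * (poly L (xi t) + b t * poly K (xi t)) = 0"
    by (rule derivative_of_quadratic_combination[OF dp[OF tB(1), of p] dp[OF tB(1), of L] dp[OF tB(1), of K] db op t id2])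
   then have "deriv b t = - (rho t * ?R') / 2" using id1[OF t] tB(2) by (rule rotation_derivative_nonbranch)
   then have "deriv b t = - (rho t * poly (pderiv (p + smult (2 * b t) L + smult ((b t)\<^sup>2) K)) (xi t)) / 2" unfolding pdR .
   then show ?thesis using db by simp
  qed
  moreover have "b s = 0" using p by (simp add: b_def)
  moreover have "B' \<subseteq> B" by (auto simp: B'_def)
  ultimately show ?thesis using op sB id1 id2
   by (intro exI[of _ b] exI[of _ B']) auto
 next
  case True
  then have Ls: "poly L (xi s) = 0" using ets by simp
  have fs: "poly f (xi s) = 0" using sq[OF s] True by simp
  have Ks: "poly K (xi s) ~= 0" using L'[of "xi s"] p(1) Ls pderiv_f_nz[OF fs] by auto
  define b where "b = (%t. (et t - poly L (xi t)) / poly K (xi t))"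
  define B' where "B' = {t \<in> B. poly K (xi t) ~= 0}"
  have "continuous_on B (%t. poly K (xi t))" by (intro continuous_on_add holomorphic_on_imp_continuous_on hol hp)+
  then have op: "open B'" unfolding B'_def by (intro open_Int open_nonzero_set opB)
  have sB: "s \<in> B'" using s Ks by (auto simp: B'_def)
  have id1: "et t = poly L (xi t) + b t * poly K (xi t)" if "t \<in> B'" for t using that by (auto simp: B'_def b_def)
  have id2: "poly p (xi t) + 2 * b t * poly L (xi t) + (b t)\<^sup>2 * poly K (xi t) = 0" if "t \<in> B'" for t
  proof -
   have "b t * poly K (xi t) * (2 * poly L (xi t) + b t * poly K (xi t)) = - (poly p (xi t) * poly K (xi t))"
    using fac[of t] id1[OF that] that by (simp add: B'_def algebra_simps)
   then have "poly K (xi t) * (poly p (xi t) + 2 * b t * poly L (xi t) + (b t)\<^sup>2 * poly K (xi t)) = 0"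
    by (simp add: power2_eq_square algebra_simps)
   then show ?thesis using that by (simp add: B'_def)
  qed
  have "DERIV b t :> - (rho t * poly (pderiv (p + smult (2 * b t) L + smult ((b t)\<^sup>2) K)) (xi t)) / 2" if t: "t \<in> B'" for t
  proof -
   have tB: "t \<in> B" "poly K (xi t) ~= 0" using t by (auto simp: B'_def)
   have "b holomorphic_on B'" unfolding b_def by (intro holomorphic_on_divide holomorphic_on_minus holomorphic_on_diff holomorphic_on_add
      holomorphic_on_subset[OF hp] holomorphic_on_subset[OF hol(2)]) (auto simp: B'_def)
   then have db: "DERIV b t :> deriv b t" using op t by (simp add: holomorphic_derivI)
   let ?x = "xi t" and ?be = "b t"
   let ?R' = "poly (pderiv p) ?x + 2 * ?be * poly (pderiv L) ?x + ?be\<^sup>2 * poly (pderiv K) ?x"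
   have 1: "(poly (pderiv L) ?x + ?be * poly (pderiv K) ?x) * (rho t * et t) + deriv b t * poly K ?x
     = poly (pderiv f) ?x * rho t / 2"
    by (rule derivative_of_combination[OF det[OF tB(1)] dp[OF tB(1), of L] dp[OF tB(1), of K] db op t id1])
   have "deriv b t = - (rho t * ?R') / 2" by (rule rotation_derivative_branch[OF id2[OF t] L'[of ?x] id1[OF t] 1 tB(2)])
   then show ?thesis using db unfolding pdR by simp
  qed
  moreover have "b s = 0" using True Ls by (simp add: b_def)
  moreover have "B' \<subseteq> B" by (auto simp: B'_def)
  ultimately show ?thesis using op sB id1 id2
   by (intro exI[of _ b] exI[of _ B']) auto
 qed
qed

end

lemma linear_prod_dvd: assumes "finite I" "inj_on x I" "\<And>i. i \<in> I ==> poly q (x i) = (0::complex)"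
 shows "(\<Prod>i\<in>I. [:- x i, 1:]) dvd q" using assms
proof (induction I arbitrary: q rule: finite_induct)
 case (insert k I)
 then have "[:- x k, 1:] dvd q" using poly_eq_0_iff_dvd by blast
 then obtain r where r: "q = [:- x k, 1:] * r" by (auto simp: dvd_def)
 have "poly r (x i) = 0" if "i \<in> I" for i
 proof -
  have "x i ~= x k" using insert that by (auto simp: inj_on_def)
  moreover have "poly q (x i) = 0" using insert that by blast
  ultimately show ?thesis unfolding r by (simp del: mult_pCons_left)
 qed
 then have "(\<Prod>i\<in>I. [:- x i, 1:]) dvd r" using insert by (intro insert.IH) auto
 then show ?case unfolding r using insert by (simp add: mult_dvd_mono del: mult_pCons_left)
qed simp

context hyperelliptic
begin

text \<open>Interpolate the \<open>g + 2\<close> points by \<open>L\<close> and let \<open>p\<close>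
  vanish at their abscissae; the degree \<open>g + 2\<close> is large enough for
  \<open>prin_rotate\<close>. Each point follows the inverse \<open>T i\<close> of its own parameter
  function \<open>b i\<close>, whose derivative is nonzero because the roots of \<open>p\<close> are
  simple. As long as the abscissae stay distinct, the moved points account for all roots of the
  rotated polynomial.\<close>

lemma rotation_family:
 fixes I :: "'i set" assumes I: "finite I" "card I = g + 2" "inj_on (%i. xi i (s i)) I"
  and ch: "\<And>i. i \<in> I ==> chart (xi i) (et i) (rho i) (B i)" "\<And>i. i \<in> I ==> s i \<in> B i"
 shows "\<exists>T T' del. del > 0 \<and> (\<forall>i\<in>I. T i 0 = s i) \<and> (\<forall>be\<in>ball 0 del.
  (\<forall>i\<in>I. T i be \<in> B i \<and> T' i be ~= 0 \<and> DERIV (T i) be :> T' i be) \<and>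
  (\<Sum>i\<in>I. frag_of (xi i (T i be), et i (T i be)) - frag_of (xi i (s i), et i (s i))) \<in> prin \<and>
  (\<forall>j\<le>g. (\<Sum>i\<in>I. xi i (T i be) ^ j * rho i (T i be) * T' i be) = 0))"
proof -
 define x where "x = (%i. xi i (s i))"
 have inj: "inj_on x I" using I(3) by (simp add: x_def)
 have Ine: "I ~= {}" using I by auto
 obtain L where L: "degree L <= card (x ` I) - 1" "\<forall>a\<in>x ` I. poly L a = et (inv_into I x a) (s (inv_into I x a))"
  using poly_interpolation[of "x ` I" "%a. et (inv_into I x a) (s (inv_into I x a))"] I(1) by blast
 have Lx: "poly L (x i) = et i (s i)" if "i \<in> I" for i using L(2) that inj by (simp add: inv_into_f_f)
 have dL: "degree L <= g + 1" using L(1) I inj by (simp add: card_image)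
 define p where "p = (\<Prod>i\<in>I. [:- x i, 1:])"
 have dp: "degree p = g + 2" "lead_coeff p = 1"
  unfolding p_def using degree_linear_prod[OF I(1), of x] I(2) lead_coeff_linear_prod[of x I] by auto
 have "p dvd L\<^sup>2 - f" unfolding p_def
 proof (rule linear_prod_dvd[OF I(1) inj])
  fix i assume "i \<in> I"
  then show "poly (L\<^sup>2 - f) (x i) = 0" using Lx[of i] ch[of i] by (auto simp: chart_def x_def)
 qed
 then obtain K where K: "L\<^sup>2 - f = p * K" by (auto simp: dvd_def)
 have p0: "poly p (x i) = 0" if "i \<in> I" for i using that I(1) by (auto simp: p_def poly_prod)
 have p1: "poly (pderiv p) (x i) ~= 0" if "i \<in> I" for i
  unfolding p_def pderiv_linear_prod[OF I(1) that] using I(1) inj that by (auto simp: inj_on_def)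
 define R where "R = (%be. p + smult (2 * be) L + smult (be\<^sup>2) K)"
 have rd: "degree (R be) = g + 2" "lead_coeff (R be) = 1" for be using rotate_degree(3,4)[OF K, of be] dp dL by (auto simp: R_def)
 define P where "P = (%i b B'. open B' \<and> s i \<in> B' \<and> B' \<subseteq> B i \<and> b (s i) = 0 \<and> (\<forall>t\<in>B'.
  poly (R (b t)) (xi i t) = 0 \<and> et i t = poly L (xi i t) + b t * poly K (xi i t) \<and>
  DERIV b t :> - (rho i t * poly (pderiv (R (b t))) (xi i t)) / 2))"
 have "\<exists>b B'. P i b B'" if "i \<in> I" for i
  unfolding R_def P_def using p0 p1 Lx K ch that by (intro rotation_parameter) (auto simp: x_def)
 then obtain b B' where P: "\<And>i. i \<in> I ==> P i (b i) (B' i)" by metis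
 have b: "open (B' i)" "s i \<in> B' i" "B' i \<subseteq> B i" "b i (s i) = 0"
  and b1: "\<And>t. t \<in> B' i ==> poly (R (b i t)) (xi i t) = 0"
  and b2: "\<And>t. t \<in> B' i ==> et i t = poly L (xi i t) + b i t * poly K (xi i t)"
  and b3: "\<And>t. t \<in> B' i ==> DERIV (b i) t :> - (rho i t * poly (pderiv (R (b i t))) (xi i t)) / 2"
  if "i \<in> I" for i using P[OF that] unfolding P_def by auto
 have db: "deriv (b i) t = - (rho i t * poly (pderiv (R (b i t))) (xi i t)) / 2" if "i \<in> I" "t \<in> B' i" for i t
  using b3[OF that] by (rule DERIV_imp_deriv)
 have rhonz: "rho i t ~= 0" if "i \<in> I" "t \<in> B' i" for i t
  using ch(1)[OF that(1)] b(3)[OF that(1)] that(2) by (auto simp: chart_def)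
 define Q where "Q = (%i G del. del > 0 \<and> G (b i (s i)) = s i \<and> (\<forall>be\<in>ball (b i (s i)) del. G be \<in> B' i \<and> b i (G be) = be \<and>
  deriv (b i) (G be) ~= 0 \<and> DERIV G be :> 1 / deriv (b i) (G be)))"
 have "\<exists>G del. Q i G del" if i: "i \<in> I" for i
 proof -
  have "b i holomorphic_on B' i" unfolding holomorphic_on_open[OF b(1)[OF i]] using b3[OF i] by blast
  moreover have "deriv (b i) (s i) ~= 0"
   unfolding db[OF i b(2)[OF i]] b(4)[OF i] using rhonz[OF i b(2)[OF i]] p1[OF i] by (simp add: R_def x_def)
  ultimately show ?thesis unfolding Q_def using b(1,2)[OF i] by (intro holomorphic_local_inverse)
 qed
 then obtain T d where Q: "\<And>i. i \<in> I ==> Q i (T i) (d i)" by metis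
 have d: "d i > 0" "T i 0 = s i" and T1: "\<And>be. be \<in> ball 0 (d i) ==> T i be \<in> B' i"
  and T2: "\<And>be. be \<in> ball 0 (d i) ==> b i (T i be) = be"
  and T3: "\<And>be. be \<in> ball 0 (d i) ==> deriv (b i) (T i be) ~= 0"
  and T4: "\<And>be. be \<in> ball 0 (d i) ==> DERIV (T i) be :> 1 / deriv (b i) (T i be)" if "i \<in> I" for i
  using Q[OF that] b(4)[OF that] unfolding Q_def by auto
 define d1 where "d1 = Min (d ` I)"
 have d1: "d1 > 0" "\<And>i. i \<in> I ==> d1 <= d i" using I(1) Ine d(1) by (auto simp: d1_def)
 have cont: "isCont (%be. xi i (T i be)) 0" if i: "i \<in> I" for i
 proof -
  have "isCont (T i) 0" using T4[OF i, of 0] d(1)[OF i] DERIV_isCont by auto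
  moreover have "isCont (xi i) (s i)"
   using ch(1)[OF i] ch(2)[OF i] unfolding chart_def by (blast intro: DERIV_isCont)
  ultimately show ?thesis using d(2)[OF i] by (simp add: isCont_o2)
 qed
 have "\<forall>\<^sub>F be in nhds 0. \<forall>q\<in>{q \<in> I \<times> I. fst q ~= snd q}. xi (fst q) (T (fst q) be) ~= xi (snd q) (T (snd q) be)"
 proof (rule eventually_ball_finite)
  show "finite {q \<in> I \<times> I. fst q ~= snd q}" using I(1) by simp
  show "\<forall>q\<in>{q \<in> I \<times> I. fst q ~= snd q}. \<forall>\<^sub>F be in nhds 0. xi (fst q) (T (fst q) be) ~= xi (snd q) (T (snd q) be)"
  proof
   fix q assume "q \<in> {q \<in> I \<times> I. fst q ~= snd q}"
   then have q: "fst q \<in> I" "snd q \<in> I" "fst q ~= snd q" by auto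
   have "isCont (%be. xi (fst q) (T (fst q) be) - xi (snd q) (T (snd q) be)) 0" by (intro continuous_intros cont q)
   moreover have ne: "xi (fst q) (T (fst q) 0) - xi (snd q) (T (snd q) 0) ~= 0"
    using q inj d(2) by (auto simp: x_def inj_on_def)
   ultimately have "\<forall>\<^sub>F be in at 0. xi (fst q) (T (fst q) be) - xi (snd q) (T (snd q) be) ~= 0"
    unfolding isCont_def by (rule tendsto_imp_eventually_ne)
   then have "\<forall>\<^sub>F be in nhds 0. xi (fst q) (T (fst q) be) - xi (snd q) (T (snd q) be) ~= 0"
    using ne by (simp add: eventually_nhds_conv_at)
   then show "\<forall>\<^sub>F be in nhds 0. xi (fst q) (T (fst q) be) ~= xi (snd q) (T (snd q) be)" by eventually_elim auto
  qed
 qed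
 then obtain d2 where d2: "d2 > 0" "\<And>be. dist be 0 < d2 ==> inj_on (%i. xi i (T i be)) I"
  unfolding eventually_nhds_metric inj_on_def by fastforce
 define del where "del = min d1 d2"
 show ?thesis
 proof (rule exI[of _ T], rule exI[of _ "%i be. 1 / deriv (b i) (T i be)"], rule exI[of _ del], intro conjI ballI allI impI)
  show "del > 0" using d1 d2 by (simp add: del_def)
  show "T i 0 = s i" if "i \<in> I" for i using d(2)[OF that] .
  fix be :: complex assume be: "be \<in> ball 0 del"
  have bei: "be \<in> ball 0 (d i)" if "i \<in> I" for i using be d1(2)[OF that] by (auto simp: del_def)
  have inj': "inj_on (%i. xi i (T i be)) I" using be by (intro d2(2)) (auto simp: del_def)
  show "T i be \<in> B i" "1 / deriv (b i) (T i be) ~= 0" "DERIV (T i) be :> 1 / deriv (b i) (T i be)" if "i \<in> I" for i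
   using T1[OF that bei[OF that]] T3[OF that bei[OF that]] T4[OF that bei[OF that]] b(3)[OF that] by auto
  have R0: "poly (R be) (xi i (T i be)) = 0" "et i (T i be) = poly (L + smult be K) (xi i (T i be))" if "i \<in> I" for i
   using b1[OF that T1[OF that bei[OF that]]] b2[OF that T1[OF that bei[OF that]]] T2[OF that bei[OF that]] by auto
  \<comment> \<open>A monic polynomial of degree \<open>g + 2\<close> with \<open>g + 2\<close>
    distinct known roots; hence its divisor is exactly the sum of the moved points.\<close>
  have Req: "R be = (\<Prod>i\<in>I. [:- xi i (T i be), 1:])" using R0(1) rd[of be] I by (intro poly_eq_linear_prod inj') auto
  have "mdiv (R be) (L + smult be K) - mdiv p L \<in> prin" unfolding R_def using dp dL by (intro prin_rotate K) auto
  also have "mdiv (R be) (L + smult be K) - mdiv p L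
    = (\<Sum>i\<in>I. frag_of (xi i (T i be), et i (T i be)) - frag_of (xi i (s i), et i (s i)))"
   unfolding Req p_def mdiv_prod_linear[OF I(1)] using R0(2) Lx by (simp add: sum_subtractf x_def del: poly_add poly_smult)
  finally show "(\<Sum>i\<in>I. frag_of (xi i (T i be), et i (T i be)) - frag_of (xi i (s i), et i (s i))) \<in> prin" .
  fix j assume j: "j <= g"
  \<comment> \<open>\<open>T i\<close> moves with speed \<open>1 / b' = - 2 / (rho R')\<close>, so
    the density \<open>rho\<close> cancels and the vanishing sum from Lagrange interpolation is
    left.\<close>
  have "(\<Sum>i\<in>I. xi i (T i be) ^ j * rho i (T i be) * (1 / deriv (b i) (T i be)))
    = (\<Sum>i\<in>I. - 2 * (xi i (T i be) ^ j / poly (pderiv (R be)) (xi i (T i be))))"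
  proof (rule sum.cong[OF refl])
   fix i assume i: "i \<in> I"
   note Ti = T1[OF i bei[OF i]]
   show "xi i (T i be) ^ j * rho i (T i be) * (1 / deriv (b i) (T i be))
     = - 2 * (xi i (T i be) ^ j / poly (pderiv (R be)) (xi i (T i be)))"
    using rhonz[OF i Ti] unfolding db[OF i Ti] T2[OF i bei[OF i]] by simp
  qed
  also have "\<dots> = - 2 * (\<Sum>i\<in>I. xi i (T i be) ^ j / poly (pderiv (R be)) (xi i (T i be)))" by (simp add: sum_distrib_left)
  also have "(\<Sum>i\<in>I. xi i (T i be) ^ j / poly (pderiv (R be)) (xi i (T i be))) = 0"
   unfolding Req using I(2) j by (intro sum_power_over_pderiv I inj') auto
  finally show "(\<Sum>i\<in>I. xi i (T i be) ^ j * rho i (T i be) * (1 / deriv (b i) (T i be))) = 0" by simp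
 qed
qed

text \<open>All speeds in \<open>rotation_family\<close> are nonzero, so any of the points may serve
  as the parameter. The motion of one point can thus be prescribed, and the other
  \<open>g + 1\<close> become dependent on it.\<close>

lemma equivalent_family:
 fixes I :: "'i set" assumes I: "finite I" "card I = g + 2" "inj_on (%i. xi i (s i)) I" and k: "k \<in> I"
  and ch: "\<And>i. i \<in> I ==> chart (xi i) (et i) (rho i) (B i)" "\<And>i. i \<in> I ==> s i \<in> B i"
 shows "\<exists>S S' del. del > 0 \<and> (\<forall>i\<in>I. S i (s k) = s i) \<and> (\<forall>t\<in>ball (s k) del. S k t = t \<and>
  (\<forall>i\<in>I. S i t \<in> B i \<and> DERIV (S i) t :> S' i t) \<and>
  (\<Sum>i\<in>I. frag_of (xi i (S i t), et i (S i t)) - frag_of (xi i (s i), et i (s i))) \<in> prin \<and>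
  (\<forall>j\<le>g. (\<Sum>i\<in>I. xi i (S i t) ^ j * rho i (S i t) * S' i t) = 0))"
proof -
 obtain T T' del where fam: "del > 0 \<and> (\<forall>i\<in>I. T i 0 = s i) \<and> (\<forall>be\<in>ball 0 del.
  (\<forall>i\<in>I. T i be \<in> B i \<and> T' i be ~= 0 \<and> DERIV (T i) be :> T' i be) \<and>
  (\<Sum>i\<in>I. frag_of (xi i (T i be), et i (T i be)) - frag_of (xi i (s i), et i (s i))) \<in> prin \<and>
  (\<forall>j\<le>g. (\<Sum>i\<in>I. xi i (T i be) ^ j * rho i (T i be) * T' i be) = 0))"
  using rotation_family[where xi = xi and s = s and et = et and rho = rho and B = B and I = I, OF I ch] by blast
 then have del: "del > 0" and T0: "\<And>i. i \<in> I ==> T i 0 = s i"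
  and T: "\<And>be i. be \<in> ball 0 del ==> i \<in> I ==> T i be \<in> B i \<and> T' i be ~= 0 \<and> DERIV (T i) be :> T' i be"
  and T2: "\<And>be. be \<in> ball 0 del ==> (\<Sum>i\<in>I. frag_of (xi i (T i be), et i (T i be)) - frag_of (xi i (s i), et i (s i))) \<in> prin"
  and T3: "\<And>be j. be \<in> ball 0 del ==> j <= g ==> (\<Sum>i\<in>I. xi i (T i be) ^ j * rho i (T i be) * T' i be) = 0"
  by blast+
 have dT: "deriv (T k) be = T' k be" if "be \<in> ball 0 del" for be using T[OF that k] DERIV_imp_deriv by blast
 have "T k holomorphic_on ball 0 del" unfolding holomorphic_on_open[OF open_ball] using T[OF _ k] by blast
 moreover have "deriv (T k) 0 ~= 0" using dT[of 0] T[of 0 k] k del by auto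
 ultimately obtain G d where d: "d > 0" "G (T k 0) = 0"
  and G: "\<And>t. t \<in> ball (T k 0) d ==> G t \<in> ball 0 del \<and> T k (G t) = t \<and> deriv (T k) (G t) ~= 0 \<and>
   DERIV G t :> 1 / deriv (T k) (G t)" using holomorphic_local_inverse[of "T k" "ball 0 del" 0] del by auto
 show ?thesis
 proof (rule exI[of _ "%i t. T i (G t)"], rule exI[of _ "%i t. T' i (G t) * (1 / T' k (G t))"], rule exI[of _ d],
   intro conjI ballI allI impI)
  show "d > 0" by fact
  show "T i (G (s k)) = s i" if "i \<in> I" for i using d(2) T0[OF k] T0[OF that] by simp
  fix t assume "t \<in> ball (s k) d"
  then have t: "t \<in> ball (T k 0) d" using T0[OF k] by simp
  note Gt = G[OF t]
  then have Gb: "G t \<in> ball 0 del" by blast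
  show "T k (G t) = t" using Gt by blast
  show "T i (G t) \<in> B i" if "i \<in> I" for i using T[OF Gb that] by blast
  show "DERIV (%t. T i (G t)) t :> T' i (G t) * (1 / T' k (G t))" if "i \<in> I" for i
   by (rule DERIV_chain2) (use T[OF Gb that] Gt dT[OF Gb] in auto)
  show "(\<Sum>i\<in>I. frag_of (xi i (T i (G t)), et i (T i (G t))) - frag_of (xi i (s i), et i (s i))) \<in> prin" by (rule T2[OF Gb])
  fix j assume j: "j <= g"
  have "(\<Sum>i\<in>I. xi i (T i (G t)) ^ j * rho i (T i (G t)) * (T' i (G t) * (1 / T' k (G t))))
    = (\<Sum>i\<in>I. xi i (T i (G t)) ^ j * rho i (T i (G t)) * T' i (G t)) * (1 / T' k (G t))"
   unfolding sum_distrib_right by (simp add: mult.assoc)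
  also have "\<dots> = 0" using T3[OF Gb j] by simp
  finally show "(\<Sum>i\<in>I. xi i (T i (G t)) ^ j * rho i (T i (G t)) * (T' i (G t) * (1 / T' k (G t)))) = 0" .
 qed
qed

end

section \<open>Holomorphic functions of several variables\<close>

lemma clinear_iff:
 fixes L :: "complex^'a => complex^'b"
 shows "Vector_Spaces.linear (*s) (*s) L \<longleftrightarrow> (\<forall>x y. L (x + y) = L x + L y) \<and> (\<forall>c x. L (c *s x) = c *s L x)"
 by (auto simp: Vector_Spaces.linear_iff vec.vector_space_axioms)

text \<open>Continuity of the partial derivatives is part of the definition because the inverse function theorem asks
 for it.\<close>
definition holo_on :: "(complex^'a => complex) => (complex^'a) set => bool" where
 "holo_on F S \<longleftrightarrow> open S \<and> (\<exists>D. (\<forall>a. continuous_on S (D a)) \<and>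
   (\<forall>z\<in>S. FDERIV F z :> (%h. \<Sum>a\<in>UNIV. D a z * h $ a)))"

definition holo_at :: "(complex^'a => complex) => complex^'a => bool" where
 "holo_at F z \<longleftrightarrow> (\<exists>S. z \<in> S \<and> holo_on F S)"

lemma holo_on_subset: "holo_on F S ==> open S' ==> S' \<subseteq> S ==> holo_on F S'"
 unfolding holo_on_def by (blast intro: continuous_on_subset)

lemma holo_on_continuous: "holo_on F S ==> continuous_on S F" unfolding holo_on_def
 by (blast intro: continuous_at_imp_continuous_on has_derivative_continuous)

lemma holo_on_const: "open S ==> holo_on (%z. c) S"
 unfolding holo_on_def by (intro conjI exI[of _ "%_ _. 0"]) auto

lemma holo_on_coord: "open S ==> holo_on (%z. z $ a) S"
proof -
 assume S: "open S"
 have "FDERIV (%z::complex^'a. z $ a) z :> (%h. \<Sum>b\<in>UNIV. (if b = a then 1 else 0) * h $ b)" for z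
 proof -
  have "(%h::complex^'a. \<Sum>b\<in>UNIV. (if b = a then 1 else 0) * h $ b) = (%h. h $ a)"
   by (auto simp: if_distrib[of "%x. x * _"] cong: if_cong)
  then show ?thesis by (simp add: bounded_linear_imp_has_derivative bounded_linear_vec_nth)
 qed
 then show ?thesis using S unfolding holo_on_def by (intro conjI exI[of _ "%b _. if b = a then 1 else 0"]) auto
qed

lemma assumes "holo_on F S" "holo_on G S"
 shows holo_on_add: "holo_on (%z. F z + G z) S" and holo_on_mult: "holo_on (%z. F z * G z) S"
proof -
 obtain D where D: "\<forall>a. continuous_on S (D a)" "\<forall>z\<in>S. FDERIV F z :> (%h. \<Sum>a\<in>UNIV. D a z * h $ a)" "open S"
  using assms(1) unfolding holo_on_def by blast
 obtain E where E: "\<forall>a. continuous_on S (E a)" "\<forall>z\<in>S. FDERIV G z :> (%h. \<Sum>a\<in>UNIV. E a z * h $ a)"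
  using assms(2) unfolding holo_on_def by blast
 have "FDERIV (%z. F z + G z) z :> (%h. \<Sum>a\<in>UNIV. (D a z + E a z) * h $ a)" if "z \<in> S" for z
  using has_derivative_add[OF D(2)[rule_format, OF that] E(2)[rule_format, OF that]] by (simp add: sum.distrib distrib_right)
 then show "holo_on (%z. F z + G z) S" using D(1,3) E(1) unfolding holo_on_def
  by (intro conjI exI[of _ "%a z. D a z + E a z"]) (auto intro!: continuous_intros)
 have "FDERIV (%z. F z * G z) z :> (%h. \<Sum>a\<in>UNIV. (F z * E a z + D a z * G z) * h $ a)" if "z \<in> S" for z
 proof -
  have "(%h. \<Sum>a\<in>UNIV. (F z * E a z + D a z * G z) * h $ a)
    = (%h. F z * (\<Sum>a\<in>UNIV. E a z * h $ a) + (\<Sum>a\<in>UNIV. D a z * h $ a) * G z)"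
   by (rule ext) (simp add: sum_distrib_left sum_distrib_right algebra_simps flip: sum.distrib)
  then show ?thesis using has_derivative_mult[OF D(2)[rule_format, OF that] E(2)[rule_format, OF that]] by simp
 qed
 then show "holo_on (%z. F z * G z) S" using D(1,3) E(1) holo_on_continuous[OF assms(1)] holo_on_continuous[OF assms(2)] unfolding holo_on_def
  by (intro conjI exI[of _ "%a z. F z * E a z + D a z * G z"]) (auto intro!: continuous_intros)
qed

lemma holo_on_compose: assumes F: "holo_on F S" and G: "G holomorphic_on U" "open U" "\<And>z. z \<in> S ==> F z \<in> U"
 shows "holo_on (%z. G (F z)) S"
proof -
 obtain D where D: "\<forall>a. continuous_on S (D a)" "\<forall>z\<in>S. FDERIV F z :> (%h. \<Sum>a\<in>UNIV. D a z * h $ a)" "open S"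
  using F unfolding holo_on_def by blast
 have "FDERIV (%z. G (F z)) z :> (%h. \<Sum>a\<in>UNIV. (deriv G (F z) * D a z) * h $ a)" if z: "z \<in> S" for z
 proof -
  have "FDERIV G (F z) :> (*) (deriv G (F z))"
   using holomorphic_derivI[OF G(1,2) G(3)[OF z], of UNIV] by (simp add: has_field_derivative_def)
  from has_derivative_compose[OF D(2)[rule_format, OF z] this]
  show ?thesis by (simp add: sum_distrib_left mult.assoc)
 qed
 moreover have "continuous_on S (%z. deriv G (F z))"
  using G holo_on_continuous[OF F]
  by (intro continuous_on_compose2[OF holomorphic_on_imp_continuous_on[OF holomorphic_deriv[OF G(1,2)]]]) auto
 ultimately show ?thesis using D(1,3) unfolding holo_on_def
  by (intro conjI exI[of _ "%a z. deriv G (F z) * D a z"]) (auto intro!: continuous_intros)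
qed

lemma holo_at_isCont: "holo_at F z ==> isCont F z"
 unfolding holo_at_def holo_on_def by (blast intro: has_derivative_continuous)

lemma holo_at_combine:
 assumes "holo_at F z" "holo_at G z" "\<And>S. holo_on F S ==> holo_on G S ==> holo_on H S" shows "holo_at H z"
proof -
 obtain S T where "z \<in> S" "holo_on F S" "z \<in> T" "holo_on G T" using assms(1,2) by (auto simp: holo_at_def)
 moreover from this have "open (S \<inter> T)" by (auto simp: holo_on_def)
 ultimately have "holo_on H (S \<inter> T)" by (intro assms(3)) (auto intro: holo_on_subset)
 then show ?thesis using \<open>z \<in> S\<close> \<open>z \<in> T\<close> by (auto simp: holo_at_def)
qed

named_theorems holo_intros

lemma holo_at_const [holo_intros]: "holo_at (%z. c) z" using holo_on_const[OF open_UNIV] by (auto simp: holo_at_def)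

lemma holo_at_coord [holo_intros]: "holo_at (%z. z $ a) z" using holo_on_coord[OF open_UNIV] by (auto simp: holo_at_def)

lemma holo_at_add [holo_intros]: "holo_at F z ==> holo_at G z ==> holo_at (%z. F z + G z) z"
 by (rule holo_at_combine[of F z G]) (auto intro: holo_on_add)

lemma holo_at_mult [holo_intros]: "holo_at F z ==> holo_at G z ==> holo_at (%z. F z * G z) z"
 by (rule holo_at_combine[of F z G]) (auto intro: holo_on_mult)

lemma holo_at_uminus [holo_intros]: "holo_at F z ==> holo_at (%z. - F z) z"
 using holo_at_mult[of "%z. - 1" z F] holo_at_const[of "- 1" z] by simp

lemma holo_at_diff [holo_intros]: "holo_at F z ==> holo_at G z ==> holo_at (%z. F z - G z) z"
 using holo_at_add[of F z "%z. - G z"] holo_at_uminus[of G z] by simp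

lemma holo_at_sum [holo_intros]: "(\<And>i. i \<in> A ==> holo_at (F i) z) ==> holo_at (%z. \<Sum>i\<in>A. F i z) z"
 by (induction A rule: infinite_finite_induct) (simp_all add: holo_at_const holo_at_add)

lemma holo_at_power [holo_intros]: "holo_at F z ==> holo_at (%z. F z ^ n) z"
 by (induction n) (simp_all add: holo_at_const holo_at_mult)

lemma holo_at_compose: assumes F: "holo_at F z" and G: "G holomorphic_on U" "open U" "F z \<in> U" shows "holo_at (%z. G (F z)) z"
proof -
 obtain S where S: "z \<in> S" "holo_on F S" using F by (auto simp: holo_at_def)
 define T where "T = S \<inter> F -` U"
 have "open T" unfolding T_def using S holo_on_continuous G by (intro continuous_open_preimage) (auto simp: holo_on_def)
 then have "holo_on (%z. G (F z)) T" using S G by (intro holo_on_compose[of F T G U]) (auto simp: T_def intro: holo_on_subset)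
 then show ?thesis unfolding holo_at_def using S G by (intro exI[of _ T]) (auto simp: T_def)
qed

lemma holo_at_divide [holo_intros]: assumes "holo_at F z" "holo_at G z" "G z ~= 0" shows "holo_at (%z. F z / G z) z"
proof -
 have "holo_at (%z. inverse (G z)) z"
  using assms by (intro holo_at_compose[of G z inverse "- {0}"]) (auto intro!: holomorphic_intros)
 then show ?thesis using holo_at_mult[OF assms(1)] by (simp add: divide_inverse)
qed

lemma holo_at_eventually: assumes "holo_at F z" shows "\<forall>\<^sub>F w in nhds z. holo_at F w"
proof -
 obtain S where "z \<in> S" "holo_on F S" "open S" using assms by (auto simp: holo_at_def holo_on_def)
 then show ?thesis unfolding eventually_nhds holo_at_def by blast
qed

lemma has_derivative_vec_iff:
 "FDERIV F z :> F' \<longleftrightarrow> (\<forall>j. FDERIV (%z. F z $ j) z :> (%h. F' h $ j))"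
 for F :: "'x::real_normed_vector => complex^'b"
proof
 assume "FDERIV F z :> F'"
 then show "\<forall>j. FDERIV (%z. F z $ j) z :> (%h. F' h $ j)"
  by (auto intro: bounded_linear.has_derivative[OF bounded_linear_vec_nth])
next
 assume *: "\<forall>j. FDERIV (%z. F z $ j) z :> (%h. F' h $ j)"
 have "FDERIV (%z. F z \<bullet> i) z :> (%h. F' h \<bullet> i)" if i: "i \<in> Basis" for i
 proof -
  obtain j e where "i = axis j e" using i unfolding Basis_vec_def by blast
  then have "(%z. F z \<bullet> i) = (%z. F z $ j \<bullet> e)" "(%z. F' z \<bullet> i) = (%z. F' z $ j \<bullet> e)"
   by (auto simp: inner_axis)
  then show ?thesis using * by (auto intro: bounded_linear.has_derivative[OF bounded_linear_inner_left])
 qed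
 then show "FDERIV F z :> F'" by (subst has_derivative_componentwise_within) auto
qed

lemma holo_on_vec:
 fixes F :: "complex^'a => complex^'b" assumes "\<And>j. holo_on (%z. F z $ j) S"
 shows "\<exists>D. (\<forall>j a. continuous_on S (D j a)) \<and> (\<forall>z\<in>S. FDERIV F z :> (%h. \<chi> j. \<Sum>a\<in>UNIV. D j a z * h $ a))"
proof -
 have "\<forall>j. \<exists>D. (\<forall>a. continuous_on S (D a)) \<and>
   (\<forall>z\<in>S. FDERIV (%z. F z $ j) z :> (%h. \<Sum>a\<in>UNIV. D a z * h $ a))"
  using assms unfolding holo_on_def by blast
 then obtain D where "\<forall>j. (\<forall>a. continuous_on S (D j a)) \<and>
   (\<forall>z\<in>S. FDERIV (%z. F z $ j) z :> (%h. \<Sum>a\<in>UNIV. D j a z * h $ a))" by (rule choice[THEN exE])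
 then show ?thesis by (intro exI[of _ D]) (auto simp: has_derivative_vec_iff)
qed

lemma clinear_matrix: "Vector_Spaces.linear (*s) (*s) (%h::complex^'a. \<chi> j. \<Sum>a\<in>UNIV. M j a * h $ a)"
 by (auto simp: clinear_iff vec_eq_iff distrib_left sum.distrib sum_distrib_left mult.assoc mult.left_commute)

lemma holomorphic_map_holo:
 fixes F :: "complex^'a => complex^'b" assumes "open S" "\<And>j z. z \<in> S ==> holo_at (%z. F z $ j) z"
 shows "holomorphic_map F S" unfolding holomorphic_map_def
proof (intro conjI ballI assms(1))
 fix z assume z: "z \<in> S"
 have "\<forall>j. \<exists>D. FDERIV (%z. F z $ j) z :> (%h. \<Sum>a\<in>UNIV. D a * h $ a)"
 proof
  fix j
  show "\<exists>D. FDERIV (%z. F z $ j) z :> (%h. \<Sum>a\<in>UNIV. D a * h $ a)"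
  proof -
   obtain S' D where "z \<in> S'" "\<forall>z\<in>S'. FDERIV (%z. F z $ j) z :> (%h. \<Sum>a\<in>UNIV. D a z * h $ a)"
    using assms(2)[OF z, of j] unfolding holo_at_def holo_on_def by blast
   then show ?thesis by (intro exI[of _ "%a. D a z"]) blast
  qed
 qed
 then obtain D where "\<forall>j. FDERIV (%z. F z $ j) z :> (%h. \<Sum>a\<in>UNIV. D j a * h $ a)"
  by (rule choice[THEN exE])
 then have "FDERIV F z :> (%h. \<chi> j. \<Sum>a\<in>UNIV. D j a * h $ a)" by (simp add: has_derivative_vec_iff)
 then show "\<exists>L. Vector_Spaces.linear (*s) (*s) L \<and> FDERIV F z :> L" using clinear_matrix by blast
qed

lemma holomorphic_map_compose: assumes "holomorphic_map F S" "holomorphic_map G T" "F ` S \<subseteq> T"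
 shows "holomorphic_map (%z. G (F z)) S" unfolding holomorphic_map_def
proof (intro conjI ballI)
 show "open S" using assms(1) by (simp add: holomorphic_map_def)
 fix z assume z: "z \<in> S"
 obtain L where L: "Vector_Spaces.linear (*s) (*s) L" "FDERIV F z :> L" using assms(1) z unfolding holomorphic_map_def by blast
 obtain M where M: "Vector_Spaces.linear (*s) (*s) M" "FDERIV G (F z) :> M" using assms(2,3) z unfolding holomorphic_map_def by blast
 have "FDERIV (%z. G (F z)) z :> (%h. M (L h))" by (rule has_derivative_compose[OF L(2) M(2)])
 moreover have "Vector_Spaces.linear (*s) (*s) (%h. M (L h))"
  using L(1) M(1) by (simp add: clinear_iff)
 ultimately show "\<exists>L. Vector_Spaces.linear (*s) (*s) L \<and> FDERIV (%z. G (F z)) z :> L" by blast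
qed

lemma holomorphic_map_subset: "holomorphic_map F S ==> open T ==> T \<subseteq> S ==> holomorphic_map F T"
 unfolding holomorphic_map_def by blast

lemma holomorphic_map_continuous: "holomorphic_map F S ==> continuous_on S F"
 unfolding holomorphic_map_def by (blast intro: continuous_at_imp_continuous_on has_derivative_continuous)

text \<open>The real inverse function theorem, for a derivative that is complex linear; its inverse
  is again complex linear, so the local inverse is holomorphic. In finite dimension injectivity of
  the derivative already yields a left inverse.\<close>

theorem holomorphic_inverse_function:
 fixes F :: "complex^'a => complex^'a" assumes hol: "\<And>j. holo_at (%z. F z $ j) z0" and N: "open N" "z0 \<in> N"
  and F': "FDERIV F z0 :> F'" "\<And>h. F' h = 0 ==> h = 0"
 shows "\<exists>U V G. open U \<and> z0 \<in> U \<and> U \<subseteq> N \<and> open V \<and> F ` U = V \<and> (\<forall>z\<in>U. G (F z) = z) \<and>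
  (\<forall>y\<in>V. G y \<in> U \<and> F (G y) = y) \<and> holomorphic_map F U \<and> holomorphic_map G V"
proof -
 have "\<forall>j. \<exists>S. z0 \<in> S \<and> holo_on (%z. F z $ j) S" using hol by (simp add: holo_at_def)
 then obtain T where T: "\<forall>j. z0 \<in> T j \<and> holo_on (%z. F z $ j) (T j)" by (rule choice[THEN exE])
 define S where "S = N \<inter> (\<Inter>j. T j)"
 have opS: "open S" "z0 \<in> S" unfolding S_def using T N by (auto simp: holo_on_def intro!: open_Int open_INT)
 have "holo_on (%z. F z $ j) S" for j
 proof (rule holo_on_subset)
  show "holo_on (%z. F z $ j) (T j)" using T by blast
  show "S \<subseteq> T j" unfolding S_def by blast
 qed (fact opS(1))
 then obtain D where D: "\<And>j a. continuous_on S (D j a)"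
  and dF: "\<And>z. z \<in> S ==> FDERIV F z :> (%h. \<chi> j. \<Sum>a\<in>UNIV. D j a z * h $ a)"
  using holo_on_vec[of F S] by blast
 define f' where "f' = (%z. Blinfun (%h. \<chi> j. \<Sum>a\<in>UNIV. D j a z * h $ a))"
 have f': "blinfun_apply (f' z) = (%h. \<chi> j. \<Sum>a\<in>UNIV. D j a z * h $ a)" if "z \<in> S" for z
  unfolding f'_def by (rule bounded_linear_Blinfun_apply) (use dF[OF that] has_derivative_bounded_linear in blast)
 have F'eq: "F' = blinfun_apply (f' z0)" using has_derivative_unique[OF F'(1) dF[OF opS(2)]] f'[OF opS(2)] by simp
 have contf: "continuous_on S f'"
 proof (rule continuous_on_blinfun_componentwise)
  fix i :: "complex^'a"
  have "continuous_on S (%z. \<chi> j. \<Sum>a\<in>UNIV. D j a z * i $ a)" by (intro continuous_intros D)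
  then show "continuous_on S (%z. blinfun_apply (f' z) i)" by (rule continuous_on_eq) (simp add: f')
 qed
 have "linear F'" unfolding F'eq by (rule bounded_linear.linear[OF blinfun.bounded_linear_right])
 moreover have "inj F'"
  using F'(2) \<open>linear F'\<close> by (simp add: linear_injective_0)
 ultimately obtain g where g: "linear g" "g \<circ> F' = id" using linear_injective_left_inverse by blast
 then have bl: "bounded_linear g" by (simp add: linear_conv_bounded_linear)
 have inv: "Blinfun g o\<^sub>L f' z0 = id_blinfun"
  by (rule blinfun_eqI) (use g(2) in \<open>simp add: bounded_linear_Blinfun_apply[OF bl] F'eq o_def fun_eq_iff\<close>)
 show ?thesis
 proof (rule inverse_function_theorem[OF opS(1) _ contf opS(2) inv])
  show "FDERIV F z :> blinfun_apply (f' z)" if "z \<in> S" for z using dF[OF that] f'[OF that] by simp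
  fix U V G G'
  assume U: "open U" "U \<subseteq> S" "z0 \<in> U" "open V" "F z0 \<in> V" "homeomorphism U V F G"
   and G: "\<And>y. y \<in> V ==> FDERIV G y :> (G' y)"
   "\<And>y. y \<in> V ==> G' y = Hilbert_Choice.inv (blinfun_apply (f' (G y)))"
   "\<And>y. y \<in> V ==> bij (blinfun_apply (f' (G y)))"
  have GU: "G y \<in> U" if "y \<in> V" for y using U(6) that by (auto simp: homeomorphism_def)
  have "holomorphic_map G V" unfolding holomorphic_map_def
  proof (intro conjI ballI U(4))
   fix y assume y: "y \<in> V"
   let ?A = "blinfun_apply (f' (G y))"
   have "G y \<in> S" using GU[OF y] U(2) by blast
   then have A: "Vector_Spaces.linear (*s) (*s) ?A" unfolding f'[OF \<open>G y \<in> S\<close>] by (intro clinear_matrix)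
   have AI: "?A (G' y x) = x" for x using G(2,3)[OF y] by (simp add: bij_is_surj surj_f_inv_f)
   have inj: "inj ?A" using G(3)[OF y] bij_is_inj by blast
   have "G' y (x + x') = G' y x + G' y x'" for x x' by (rule injD[OF inj]) (use A in \<open>simp add: clinear_iff AI\<close>)
   moreover have "G' y (c *s x) = c *s G' y x" for x c
    by (rule injD[OF inj]) (use A in \<open>simp add: clinear_iff AI\<close>)
   ultimately show "\<exists>L. Vector_Spaces.linear (*s) (*s) L \<and> FDERIV G y :> L"
    using G(1)[OF y] by (intro exI[of _ "G' y"]) (simp add: clinear_iff)
  qed
  moreover have "holomorphic_map F U"
   unfolding holomorphic_map_def
  proof (intro conjI ballI exI)
   fix z assume "z \<in> U"
   then show "FDERIV F z :> (%h. \<chi> j. \<Sum>a\<in>UNIV. D j a z * h $ a)" using dF U(2) by blast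
   show "Vector_Spaces.linear (*s) (*s) (%h::complex^'a. \<chi> j. \<Sum>a\<in>UNIV. D j a z * h $ a)" by (rule clinear_matrix)
  qed (fact U(1))
  moreover have "F ` U = V" "\<forall>z\<in>U. G (F z) = z" "\<forall>y\<in>V. G y \<in> U \<and> F (G y) = y"
   using U(6) by (auto simp: homeomorphism_def)
  moreover have "U \<subseteq> N" using U(2) by (auto simp: S_def)
  ultimately show ?thesis using U(1,3,4) by blast
 qed
qed

section \<open>The exponential map of the generalized Jacobian\<close>

lemma enum_bij: "bij_betw (%i. Enum.enum ! i) {..<CARD('n)} (UNIV :: 'n::enum set)"
proof -
 have len: "length (Enum.enum :: 'n list) = CARD('n)" using enum_distinct[where 'a = 'n] by (metis UNIV_enum distinct_card)
 have "inj_on (%i. (Enum.enum :: 'n list) ! i) {..<CARD('n)}"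
  using enum_distinct[where 'a = 'n] len by (auto simp: inj_on_def nth_eq_iff_index_eq)
 moreover have "(%i. (Enum.enum :: 'n list) ! i) ` {..<CARD('n)} = UNIV"
  using len by (metis UNIV_enum lessThan_atLeast0 list.set_map map_nth set_upt)
 ultimately show ?thesis by (simp add: bij_betw_def)
qed

lemma pos_props: "Enum.enum ! pos j = (j :: 'n::enum)" "pos j < CARD('n)"
proof -
 obtain i where i: "i < CARD('n)" "Enum.enum ! i = j" using enum_bij[where 'n = 'n] by (metis UNIV_I bij_betw_def imageE lessThan_iff)
 show "Enum.enum ! pos j = j" unfolding pos_def by (rule LeastI[of _ i]) (rule i)
 have "pos j <= i" unfolding pos_def by (rule Least_le) (rule i)
 then show "pos j < CARD('n)" using i by simp
qed

lemma ix_pos [simp]: "ix (pos j) = j" by (simp add: ix_def pos_props)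

lemma pos_ix: "i < CARD('n::enum) ==> pos (ix i :: 'n) = i" using pos_props[of "ix i :: 'n"] enum_bij[where 'n = 'n]
 by (auto simp: ix_def bij_betw_def inj_on_def)

lemma pos_inj: "inj (pos :: 'n::enum => nat)" by (rule inj_on_inverseI[of _ ix]) simp

lemma pos_image: "range (pos :: 'n::enum => nat) = {..<CARD('n)}"
proof -
 have "i \<in> range (pos :: 'n => nat)" if "i < CARD('n)" for i using pos_ix[OF that] by (metis rangeI)
 then show ?thesis using pos_props(2) by auto
qed

text \<open>Sufficiently large natural numbers avoid a finite set; they are assigned to the indices
  by \<open>pos\<close>.\<close>

lemma exists_points: assumes "finite X" shows "\<exists>a :: 'n::enum => complex. inj a \<and> (\<forall>i. a i \<notin> X)"
proof -
 have "finite {n. of_nat n \<in> X}" using assms by (rule finite_vimageI[unfolded vimage_def]) (simp add: inj_on_def)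
 then obtain N where N: "\<And>n. of_nat n \<in> X ==> n < N"
  by (metis (mono_tags) finite_nat_set_iff_bounded mem_Collect_eq)
 have "inj (%i::'n. of_nat (N + pos i) :: complex)" using pos_inj by (auto simp: inj_def simp del: of_nat_add)
 moreover have "\<forall>i::'n. (of_nat (N + pos i) :: complex) \<notin> X" using N by fastforce
 ultimately show ?thesis by blast
qed

text \<open>A homomorphism into a quotient group that is only defined near \<open>0\<close> extends to the whole vector space by
 \<open>E u = n e (u / n)\<close> for large \<open>n\<close>.\<close>
lemma local_hom_extension:
 fixes e :: "'v::real_normed_vector => 'g::ab_group_add"
 assumes P0: "0 \<in> P" and Pd: "\<And>x y. x \<in> P ==> y \<in> P ==> x - y \<in> P" and del: "del > 0"
  and hom: "\<And>u v. norm u < del ==> norm v < del ==> e (u + v) - e u - e v \<in> P"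
 shows "\<exists>E. (\<forall>u v. E (u + v) - E u - E v \<in> P) \<and> (\<forall>u. norm u < del --> E u - e u \<in> P)"
proof -
 have Pa: "x + y \<in> P" if "x \<in> P" "y \<in> P" for x y using Pd[OF that(1) Pd[OF P0 that(2)]] by simp
 have Pt: "x - z \<in> P" if "x - y \<in> P" "y - z \<in> P" for x y z using Pa[OF that] by simp
 have Ps: "y - x \<in> P" if "x - y \<in> P" for x y using Pd[OF P0 that] by simp
 define mul :: "nat => 'g => 'g" where "mul = (%n D. \<Sum>i<n. D)"
 have mul_Suc: "mul (Suc n) D = mul n D + D" and mul_0: "mul 0 D = 0" and mul_1: "mul (Suc 0) D = D" for n D by (simp_all add: mul_def)
 have mul_add: "mul (m + n) D = mul m D + mul n D" for m n D by (induction n) (simp_all add: mul_Suc mul_0 add.assoc)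
 have mul_mul: "mul (m * n) D = mul m (mul n D)" for m n D by (induction m) (simp_all add: mul_Suc mul_0 mul_add add.commute)
 have mulP: "mul n D - mul n D' \<in> P" if "D - D' \<in> P" for n D D'
 proof (induction n)
  case (Suc n)
  have "mul (Suc n) D - mul (Suc n) D' = (mul n D - mul n D') + (D - D')" by (simp add: mul_Suc)
  then show ?case using Pa[OF Suc that] by simp
 qed (simp add: mul_0 P0)
 have mulD: "mul n (D + D') = mul n D + mul n D'" for n D D' by (simp add: mul_def sum.distrib)
 have e0: "e 0 \<in> P" using Ps[of "e 0" "e 0 + e 0"] hom[of 0 0] del by simp
 have A: "e (real j *\<^sub>R w) - mul j (e w) \<in> P" if "norm (real j *\<^sub>R w) < del" for j w using that
 proof (induction j)
  case 0
  then show ?case using e0 by (simp add: mul_0)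
 next
  case (Suc j)
  have le: "norm (real j *\<^sub>R w) <= norm (real (Suc j) *\<^sub>R w)" "norm w <= norm (real (Suc j) *\<^sub>R w)"
   using mult_right_mono[of 1 "real (Suc j)" "norm w"] by (auto simp: mult_right_mono)
  have 1: "e (real j *\<^sub>R w + w) - e (real j *\<^sub>R w) - e w \<in> P" using le Suc.prems by (intro hom) linarith+
  have 2: "e (real j *\<^sub>R w) - mul j (e w) \<in> P" using le Suc.prems by (intro Suc.IH) linarith
  have "e (real (Suc j) *\<^sub>R w) - mul (Suc j) (e w)
    = (e (real j *\<^sub>R w + w) - e (real j *\<^sub>R w) - e w) + (e (real j *\<^sub>R w) - mul j (e w))"
   by (simp add: mul_Suc scaleR_left_distrib add.commute)
  then show ?case using Pa[OF 1 2] by simp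
 qed
 \<comment> \<open>Refining the division from \<open>n\<close> to \<open>n k\<close> parts does not
   change the class, so two admissible numbers of parts are compared through their product.\<close>
 have B: "mul n (e ((1 / real n) *\<^sub>R u)) - mul (n * k) (e ((1 / real (n * k)) *\<^sub>R u)) \<in> P"
  if "n > 0" "k > 0" "norm ((1 / real n) *\<^sub>R u) < del" for n k u
 proof -
  have "real k *\<^sub>R (1 / real (n * k)) *\<^sub>R u = (1 / real n) *\<^sub>R u" using that by simp
  then have "e ((1 / real n) *\<^sub>R u) - mul k (e ((1 / real (n * k)) *\<^sub>R u)) \<in> P"
   using A[of k "(1 / real (n * k)) *\<^sub>R u"] that(3) by (simp only:)
  then show ?thesis unfolding mul_mul by (rule mulP)
 qed
 have small: "norm ((1 / real n) *\<^sub>R u) < del" if "n \<ge> nat \<lceil>r / del\<rceil> + 1" "norm u <= r" for n u r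
 proof -
  have "r / del < real n" using that(1) by linarith
  then have "norm u < real n * del" using that(2) del by (simp add: pos_divide_less_eq)
  moreover have "real n > 0" using that(1) by simp
  ultimately show ?thesis by (simp add: pos_divide_less_eq mult.commute)
 qed
 define N where "N = (%u::'v. nat \<lceil>norm u / del\<rceil> + 1)"
 define E where "E = (%u. mul (N u) (e ((1 / real (N u)) *\<^sub>R u)))"
 have C: "E u - mul n (e ((1 / real n) *\<^sub>R u)) \<in> P" if n: "n > 0" "norm ((1 / real n) *\<^sub>R u) < del" for n u
 proof -
  have Nu: "N u > 0" "norm ((1 / real (N u)) *\<^sub>R u) < del" using small[of "norm u" "N u" u] by (auto simp: N_def)
  have 1: "E u - mul (N u * n) (e ((1 / real (N u * n)) *\<^sub>R u)) \<in> P" unfolding E_def by (rule B[OF Nu(1) n(1) Nu(2)])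
  have 2: "mul n (e ((1 / real n) *\<^sub>R u)) - mul (n * N u) (e ((1 / real (n * N u)) *\<^sub>R u)) \<in> P"
   by (rule B[OF n(1) Nu(1) n(2)])
  show ?thesis using Pt[OF 1 Ps[OF 2[unfolded mult.commute[of n "N u"]]]] .
 qed
 have "E (u + v) - E u - E v \<in> P" for u v
 proof -
  define n where "n = nat \<lceil>(norm u + norm v) / del\<rceil> + 1"
  have n: "n > 0" by (simp add: n_def)
  have s: "norm ((1 / real n) *\<^sub>R u) < del" "norm ((1 / real n) *\<^sub>R v) < del" "norm ((1 / real n) *\<^sub>R (u + v)) < del"
   by (rule small[of "norm u + norm v"]; simp add: n_def norm_triangle_ineq)+
  have h: "e ((1 / real n) *\<^sub>R (u + v)) - (e ((1 / real n) *\<^sub>R u) + e ((1 / real n) *\<^sub>R v)) \<in> P"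
   using hom[OF s(1,2)] by (simp add: scaleR_right_distrib diff_diff_add)
  have "E (u + v) - (E u + E v) = (E (u + v) - mul n (e ((1 / real n) *\<^sub>R (u + v))))
   + (mul n (e ((1 / real n) *\<^sub>R (u + v))) - mul n (e ((1 / real n) *\<^sub>R u) + e ((1 / real n) *\<^sub>R v)))
   - ((E u - mul n (e ((1 / real n) *\<^sub>R u))) + (E v - mul n (e ((1 / real n) *\<^sub>R v))))"
   unfolding mulD by (simp add: algebra_simps)
  also have "\<dots> \<in> P" by (intro Pd Pa C n s mulP h)
  finally show ?thesis by (simp add: diff_diff_add)
 qed
 moreover have "E u - e u \<in> P" if "norm u < del" for u
  using C[of 1 u] that by (simp add: mul_1)
 ultimately show ?thesis by blast
qed

section \<open>Abel sums of g + 1 points in local coordinates\<close>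

context hyperelliptic
begin

text \<open>Non-branch points with distinct abscissae \<open>a i\<close>, sections \<open>et i\<close> of the curve over discs \<open>B i\<close> around them, and
 primitives of the differentials on these discs.\<close>
definition coords :: "('n::enum => complex) => ('n => complex => complex) => ('n => complex set)
  => ('n => nat => complex => complex) => bool" where
 "coords a et B F \<longleftrightarrow> inj a \<and> (\<forall>i. chart (%t. t) (et i) (%t. 1 / et i t) (B i) \<and> a i \<in> B i \<and> (\<forall>j. F i j (a i) = 0) \<and>
   (\<forall>j. \<forall>t\<in>B i. DERIV (F i j) t :> t ^ j / et i t))"

text \<open>The Abel map of \<open>g + 1\<close> points that start over \<open>a\<close> and end
  over \<open>x\<close>, written with primitives vanishing at \<open>a\<close>. It and
  \<open>moved\<close>, the end points minus the starting points, describe the same displacement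
  analytically and as a divisor.\<close>

definition abel_sum :: "('n::enum => nat => complex => complex) => (complex, 'n) vec => (complex, 'n) vec" where
 "abel_sum F x = (\<chi> j. \<Sum>i\<in>UNIV. F i (pos j) (x $ i))"

definition moved :: "('n::enum => complex) => ('n => complex => complex) => (complex, 'n) vec => divisor" where
 "moved a et x = (\<Sum>i\<in>UNIV. frag_of (x $ i, et i (x $ i)) - frag_of (a i, et i (a i)))"

lemma coordsD: assumes "coords a et B F"
 shows "inj a" "chart (%t. t) (et i) (%t. 1 / et i t) (B i)" "a i \<in> B i" "F i j (a i) = 0" "open (B i)"
  "t \<in> B i ==> DERIV (F i j) t :> t ^ j / et i t" "t \<in> B i ==> et i t ~= 0"
  "t \<in> B i ==> (t, et i t) \<in> curve f" using assms by (auto simp: coords_def chart_def curve_def)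

text \<open>\<open>b\<close> selects the sheet over each abscissa. The bound \<open>r0\<close> on
  the radii makes it possible to keep two such systems apart.\<close>

lemma coords_exist:
 fixes a b :: "'n::enum => complex"
 assumes a: "inj a" and b: "\<And>i. (b i)\<^sup>2 = poly f (a i)" "\<And>i. b i ~= 0" and r0: "r0 > 0"
 shows "\<exists>et B F. coords a et B F \<and> (\<forall>i. et i (a i) = b i \<and> B i \<subseteq> ball (a i) r0 \<and> (\<exists>r>0. B i = ball (a i) r))"
proof -
 have "\<exists>et r. r > 0 \<and> r <= r0 \<and> chart (%t. t) et (%t. 1 / et t) (ball (a i) r) \<and> et (a i) = b i" for i
 proof -
  obtain et r eps where "chart_at (a i, b i) fst (%t. t) et (%t. 1 / et t) r eps"
   using nonbranch_chart[of "a i" "b i"] b by (auto simp: curve_def)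
  then have "chart (%t. t) et (%t. 1 / et t) (ball (a i) r)" "et (a i) = b i" "r > 0" by (auto simp: chart_at_def)
  moreover from this have "chart (%t. t) et (%t. 1 / et t) (ball (a i) (min r r0))"
   by (elim chart_subset) auto
  ultimately show ?thesis using r0 by (intro exI[of _ et] exI[of _ "min r r0"]) auto
 qed
 then have "\<forall>i. \<exists>et r. r > 0 \<and> r <= r0 \<and> chart (%t. t) et (%t. 1 / et t) (ball (a i) r) \<and> et (a i) = b i" by blast
 then obtain et where "\<forall>i. \<exists>r. r > 0 \<and> r <= r0 \<and> chart (%t. t) (et i) (%t. 1 / et i t) (ball (a i) r) \<and> et i (a i) = b i"
  by (rule choice[THEN exE])
 then obtain r where r: "\<forall>i. r i > 0 \<and> r i <= r0 \<and> chart (%t. t) (et i) (%t. 1 / et i t) (ball (a i) (r i)) \<and> et i (a i) = b i"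
  by (rule choice[THEN exE])
 have "\<forall>i j. \<exists>F. F (a i) = 0 \<and> (\<forall>t\<in>ball (a i) (r i). DERIV F t :> t ^ j / et i t)"
 proof (intro allI)
  fix i j
  have "(%t. t ^ j * (1 / et i t)) holomorphic_on ball (a i) (r i)"
   using r by (intro holomorphic_intros chart_holomorphic(3)) auto
  then obtain F where F: "\<And>t. t \<in> ball (a i) (r i) ==>
    (F has_field_derivative t ^ j * (1 / et i t)) (at t within ball (a i) (r i))"
   by (rule holomorphic_convex_primitive'[OF convex_ball open_ball]) blast
  have "DERIV (%t. F t - F (a i)) t :> t ^ j / et i t" if "t \<in> ball (a i) (r i)" for t
   using F[OF that] unfolding at_within_open[OF that open_ball] by (auto intro!: derivative_eq_intros)
  then show "\<exists>F. F (a i) = 0 \<and> (\<forall>t\<in>ball (a i) (r i). DERIV F t :> t ^ j / et i t)"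
   by (intro exI[of _ "%t. F t - F (a i)"]) auto
 qed
 then have "\<forall>i. \<exists>F. \<forall>j. F j (a i) = 0 \<and> (\<forall>t\<in>ball (a i) (r i). DERIV (F j) t :> t ^ j / et i t)"
  by (intro allI choice) blast
 then obtain F where F: "\<forall>i j. F i j (a i) = 0 \<and> (\<forall>t\<in>ball (a i) (r i). DERIV (F i j) t :> t ^ j / et i t)"
  by (rule choice[THEN exE])
 have "coords a et (%i. ball (a i) (r i)) F" unfolding coords_def using a r F by auto
 then show ?thesis using r by (intro exI[of _ et] exI[of _ "%i. ball (a i) (r i)"] exI[of _ F]) (auto intro!: subset_ball)
qed

lemma abel_sum_a: "coords a et B F ==> abel_sum F (\<chi> i. a i) = 0" by (simp add: abel_sum_def vec_eq_iff coordsD(4))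

lemma moved_a: "moved a et (\<chi> i. a i) = 0" by (simp add: moved_def)

text \<open>Testing the vanishing moments against the polynomial that is 1 at \<open>x i\<close> and
  0 at the other nodes isolates \<open>w i\<close>.\<close>

lemma vandermonde:
 fixes w :: "'n::enum => complex"
 assumes "inj x" "\<And>j. j < CARD('n) ==> (\<Sum>i\<in>UNIV. x i ^ j * w i) = 0" shows "w i = 0"
proof -
 obtain L where L: "degree L <= card (range x) - 1" "\<forall>y\<in>range x. poly L y = (if y = x i then 1 else 0)"
  using poly_interpolation[of "range x" "%y. if y = x i then 1 else 0"] by auto
 have dL: "degree L < CARD('n)" using L(1) card_image[OF assms(1)] zero_less_card_finite[where 'a='n] by linarith
 have "w i = (\<Sum>k\<in>UNIV. poly L (x k) * w k)"
 proof -
  have "(\<Sum>k\<in>UNIV. poly L (x k) * w k) = (\<Sum>k\<in>UNIV. if k = i then w k else 0)"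
   using L(2) assms(1) by (intro sum.cong) (auto simp: inj_def)
  then show ?thesis by simp
 qed
 also have "\<dots> = (\<Sum>k\<in>UNIV. \<Sum>j\<le>degree L. coeff L j * (x k ^ j * w k))"
  by (simp add: poly_altdef sum_distrib_right mult.assoc)
 also have "\<dots> = (\<Sum>j\<le>degree L. coeff L j * (\<Sum>k\<in>UNIV. x k ^ j * w k))"
  by (subst sum.swap) (simp add: sum_distrib_left)
 also have "\<dots> = 0" using dL assms(2) by simp
 finally show ?thesis .
qed

lemma abel_sum_derivative: assumes c: "coords a et B F" and x: "\<And>i. x $ i \<in> B i"
 shows "FDERIV (abel_sum F) x :> (%h. \<chi> j. \<Sum>i\<in>UNIV. x $ i ^ pos j / et i (x $ i) * h $ i)"
  and "holo_at (%x. abel_sum F x $ j) x"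
proof -
 have 1: "FDERIV (%x. F i (pos j) (x $ i)) x :> (%h. x $ i ^ pos j / et i (x $ i) * h $ i)" for i j
  using has_derivative_compose[OF bounded_linear_imp_has_derivative[OF bounded_linear_vec_nth]
    coordsD(6)[OF c x, unfolded has_field_derivative_def]] .
 show "FDERIV (abel_sum F) x :> (%h. \<chi> j. \<Sum>i\<in>UNIV. x $ i ^ pos j / et i (x $ i) * h $ i)"
  unfolding has_derivative_vec_iff abel_sum_def vec_lambda_beta by (intro allI has_derivative_sum 1)
 have "F i (pos j) holomorphic_on B i" for i unfolding holomorphic_on_open[OF coordsD(5)[OF c]] using coordsD(6)[OF c] by blast
 then show "holo_at (%x. abel_sum F x $ j) x" unfolding abel_sum_def using x
  by (auto intro!: holo_at_sum holo_at_compose[OF holo_at_coord] coordsD(5)[OF c])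
qed

text \<open>The derivative of \<open>abel_sum\<close> at \<open>a\<close> has the entries
  \<open>a_i^j / y_i\<close>, a Vandermonde matrix with columns scaled by nonzero factors, so it is
  invertible for distinct abscissae. The neighbourhood is shrunk to keep the abscissae distinct, as
  the families of equivalent divisors require.\<close>

lemma coords_inverse:
 fixes a :: "'n::enum => complex" assumes c: "coords a et B F"
 shows "\<exists>U V J. open U \<and> (\<chi> i. a i) \<in> U \<and> (\<forall>x\<in>U. inj (%i. x $ i) \<and> (\<forall>i. x $ i \<in> B i)) \<and> open V \<and> 0 \<in> V \<and>
  abel_sum F ` U = V \<and> (\<forall>x\<in>U. J (abel_sum F x) = x) \<and> (\<forall>u\<in>V. J u \<in> U \<and> abel_sum F (J u) = u) \<and>
  holomorphic_map (abel_sum F) U \<and> holomorphic_map J V"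
proof -
 let ?a = "\<chi> i. a i"
 define N where "N = (\<Inter>i. (%x::(complex, 'n) vec. x $ i) -` B i) \<inter> (\<Inter>i. \<Inter>k\<in>-{i}. {x. x $ i - x $ k ~= 0})"
 have opN: "open N" unfolding N_def
  by (intro open_Int open_INT finite open_vimage coordsD(5)[OF c] ballI continuous_intros open_Collect_neq)
 have aN: "?a \<in> N" using coordsD(1,3)[OF c] by (auto simp: N_def inj_def)
 have ab: "?a $ i \<in> B i" for i using coordsD(3)[OF c] by simp
 have "\<exists>U V J. open U \<and> ?a \<in> U \<and> U \<subseteq> N \<and> open V \<and> abel_sum F ` U = V \<and> (\<forall>x\<in>U. J (abel_sum F x) = x) \<and>
  (\<forall>u\<in>V. J u \<in> U \<and> abel_sum F (J u) = u) \<and> holomorphic_map (abel_sum F) U \<and> holomorphic_map J V"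
 proof (rule holomorphic_inverse_function[OF abel_sum_derivative(2)[OF c ab] opN aN abel_sum_derivative(1)[OF c ab]])
  fix h :: "(complex, 'n) vec"
  assume h: "(\<chi> j. \<Sum>i\<in>UNIV. ?a $ i ^ pos j / et i (?a $ i) * h $ i) = (0 :: (complex, 'n) vec)"
  have "h $ i / et i (a i) = 0" for i
  proof (rule vandermonde[of a])
   fix j assume "j < CARD('n)"
   then have "pos (ix j :: 'n) = j" by (rule pos_ix)
   moreover have "(\<Sum>i\<in>UNIV. a i ^ pos (ix j :: 'n) / et i (a i) * h $ i) = 0"
    using arg_cong[OF h, of "%v. v $ ix j"] by simp
   ultimately show "(\<Sum>i\<in>UNIV. a i ^ j * (h $ i / et i (a i))) = 0" by simp
  qed (rule coordsD(1)[OF c])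
  then show "h = 0" using coordsD(7)[OF c coordsD(3)[OF c]] by (simp add: vec_eq_iff)
 qed
 then obtain U V J where UVJ: "open U \<and> ?a \<in> U \<and> U \<subseteq> N \<and> open V \<and> abel_sum F ` U = V \<and> (\<forall>x\<in>U. J (abel_sum F x) = x) \<and>
  (\<forall>u\<in>V. J u \<in> U \<and> abel_sum F (J u) = u) \<and> holomorphic_map (abel_sum F) U \<and> holomorphic_map J V" by blast
 then have "0 \<in> V" using abel_sum_a[OF c] by (metis image_eqI)
 moreover have "\<forall>x\<in>U. inj (%i. x $ i) \<and> (\<forall>i. x $ i \<in> B i)"
  using UVJ unfolding N_def inj_def by fastforce
 ultimately show ?thesis using UVJ by blast
qed

end

lemma sum_UNIV_option:
 fixes h :: "'n::finite option => 'g::comm_monoid_add" shows "(\<Sum>i\<in>UNIV. h i) = h None + (\<Sum>i\<in>UNIV. h (Some i))"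
 by (simp add: UNIV_option_conv sum.reindex)

context hyperelliptic
begin

definition coord_nbhd :: "('n::enum => complex) => ('n => complex => complex) => ('n => complex set)
  => ('n => nat => complex => complex) => (complex, 'n) vec set => (complex, 'n) vec set
  => ((complex, 'n) vec => (complex, 'n) vec) => bool" where
 "coord_nbhd a et B F U V J \<longleftrightarrow> coords a et B F \<and> open U \<and> (\<chi> i. a i) \<in> U \<and>
  (\<forall>x\<in>U. inj (%i. x $ i) \<and> (\<forall>i. x $ i \<in> B i)) \<and> open V \<and> 0 \<in> V \<and>
  abel_sum F ` U = V \<and> (\<forall>x\<in>U. J (abel_sum F x) = x) \<and> (\<forall>u\<in>V. J u \<in> U \<and> abel_sum F (J u) = u) \<and>
  holomorphic_map (abel_sum F) U \<and> holomorphic_map J V"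

lemma coord_nbhd_exists: "coords a et B F ==> \<exists>U V J. coord_nbhd a et B F U V J"
 using coords_inverse[of a et B F] unfolding coord_nbhd_def by blast

lemma coord_nbhdD: assumes "coord_nbhd a et B F U V J"
 shows "coords a et B F" "open U" "(\<chi> i. a i) \<in> U" "x \<in> U ==> inj (%i. x $ i)" "x \<in> U ==> x $ i \<in> B i"
  "open V" "0 \<in> V" "x \<in> U ==> abel_sum F x \<in> V" "x \<in> U ==> J (abel_sum F x) = x"
  "u \<in> V ==> J u \<in> U" "u \<in> V ==> abel_sum F (J u) = u" "J 0 = (\<chi> i. a i)" "holomorphic_map J V"
proof -
 note A = assms[unfolded coord_nbhd_def]
 show "J 0 = (\<chi> i. a i)" using A abel_sum_a[of a et B F] by metis
qed (use assms in \<open>auto simp: coord_nbhd_def\<close>)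

definition diff_vec :: "(nat => complex => complex) => complex => (complex, 'n::enum) vec" where
 "diff_vec G t = (\<chi> j. G (pos j) t)"

text \<open>The \<open>g + 1\<close> coordinate points and the extra point form a set as in
  \<open>equivalent_family\<close>, parametrized by the extra one. The sum of all primitives is
  constant along the family, so the Abel sum of the coordinate points loses exactly what the extra
  point gains.\<close>

lemma move_local:
 fixes x :: "(complex, 'n::enum) vec" assumes card: "CARD('n) = g + 1" and nb: "coord_nbhd a et B F U V J" and x: "x \<in> U"
  and ch: "chart xi' et' rho' B'" "t1 \<in> B'" and ne: "\<And>i. xi' t1 ~= x $ i"
  and G: "\<And>j t. t \<in> B' ==> DERIV (G j) t :> xi' t ^ j * rho' t"
 shows "\<exists>del>0. \<forall>t\<in>ball t1 del. t \<in> B' \<and> (\<exists>y\<in>U. abel_sum F y = abel_sum F x - (diff_vec G t - diff_vec G t1) \<and>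
  (moved a et y + frag_of (xi' t, et' t)) - (moved a et x + frag_of (xi' t1, et' t1)) \<in> prin)"
  (is "\<exists>del>0. \<forall>t\<in>ball t1 del. t \<in> B' \<and> (\<exists>y\<in>U. ?P y t)")
proof -
 note c = coord_nbhdD(1)[OF nb]
 \<comment> \<open>The index type with one element added: \<open>None\<close> is the extra point,
   \<open>Some i\<close> are the coordinate points.\<close>
 define \<Xi> where "\<Xi> = case_option xi' (%i::'n. %t. t)"
 define H where "H = case_option et' et"
 define R where "R = case_option rho' (%i t. 1 / et i t)"
 define BB where "BB = case_option B' B"
 define s where "s = case_option t1 (%i. x $ i)"
 have card': "card (UNIV :: 'n option set) = g + 2" using card by (simp add: card_UNIV_option)
 have inj: "inj_on (%i. \<Xi> i (s i)) UNIV"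
  using ne coord_nbhdD(4)[OF nb x] by (auto simp: inj_def \<Xi>_def s_def split: option.splits) metis+
 have chs: "chart (\<Xi> i) (H i) (R i) (BB i)" "s i \<in> BB i" for i using ch coordsD(2)[OF c] coord_nbhdD(5)[OF nb x]
  by (auto simp: \<Xi>_def H_def R_def BB_def s_def split: option.splits)
 obtain S S' del where fam: "del > 0 \<and> (\<forall>i\<in>UNIV. S i (s None) = s i) \<and> (\<forall>t\<in>ball (s None) del. S None t = t \<and>
  (\<forall>i\<in>UNIV. S i t \<in> BB i \<and> DERIV (S i) t :> S' i t) \<and>
  (\<Sum>i\<in>UNIV. frag_of (\<Xi> i (S i t), H i (S i t)) - frag_of (\<Xi> i (s i), H i (s i))) \<in> prin \<and>
  (\<forall>j\<le>g. (\<Sum>i\<in>UNIV. \<Xi> i (S i t) ^ j * R i (S i t) * S' i t) = 0))"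
  using equivalent_family[where xi = \<Xi> and s = s and et = H and rho = R and B = BB, OF finite card' inj UNIV_I chs] by blast
 have sN: "s None = t1" by (simp add: s_def)
 have del: "del > 0" and S0: "\<And>i. S i t1 = s i" and SN: "\<And>t. t \<in> ball t1 del ==> S None t = t"
  and SB: "\<And>t i. t \<in> ball t1 del ==> S i t \<in> BB i"
  and dS: "\<And>t i. t \<in> ball t1 del ==> DERIV (S i) t :> S' i t"
  and pr: "\<And>t. t \<in> ball t1 del ==> (\<Sum>i\<in>UNIV. frag_of (\<Xi> i (S i t), H i (S i t)) - frag_of (\<Xi> i (s i), H i (s i))) \<in> prin"
  and sm: "\<And>t j. t \<in> ball t1 del ==> j <= g ==> (\<Sum>i\<in>UNIV. \<Xi> i (S i t) ^ j * R i (S i t) * S' i t) = 0"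
  using fam unfolding sN by blast+
 define y where "y = (%t. \<chi> i. S (Some i) t)"
 have y1: "y t1 = x" by (simp add: y_def S0 s_def vec_eq_iff)
 have "isCont (S i) t1" for i using dS[of t1 i] del by (auto intro: DERIV_isCont)
 then have "isCont y t1" unfolding y_def isCont_def by (intro vec_tendstoI) simp
 then have "\<forall>\<^sub>F t in nhds t1. y t \<in> U" using x y1 coord_nbhdD(2)[OF nb] unfolding isCont_def
  by (intro topological_tendstoD) (auto simp: tendsto_at_iff_tendsto_nhds)
 then obtain del' where del': "del' > 0" "\<And>t. dist t t1 < del' ==> y t \<in> U"
  unfolding eventually_nhds_metric by blast
 \<comment> \<open>The total integral of the \<open>j\<close>-th differential over all
   \<open>g + 2\<close> points; its derivative is the vanishing moment sum.\<close>
 define h where "h = (%j t. (\<Sum>i\<in>UNIV. F i j (S (Some i) t)) + G j (S None t))"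
 have h0: "DERIV (h j) t :> 0" if t: "t \<in> ball t1 del" and j: "j <= g" for j t
 proof -
  have SBi: "S (Some i) t \<in> B i" "S None t \<in> B'" for i using SB[OF t, of "Some i"] SB[OF t, of None] by (simp_all add: BB_def)
  have d1: "((%t. F i j (S (Some i) t)) has_field_derivative
    \<Xi> (Some i) (S (Some i) t) ^ j * R (Some i) (S (Some i) t) * S' (Some i) t) (at t)" for i
   using DERIV_chain2[OF coordsD(6)[OF c SBi(1)] dS[OF t]] by (simp add: \<Xi>_def R_def)
  have d2: "DERIV (%t. G j (S None t)) t :> \<Xi> None (S None t) ^ j * R None (S None t) * S' None t"
   using DERIV_chain2[OF G[OF SBi(2)] dS[OF t]] by (simp add: \<Xi>_def R_def)
  have "DERIV (h j) t :> ((\<Sum>i\<in>UNIV. \<Xi> (Some i) (S (Some i) t) ^ j * R (Some i) (S (Some i) t) * S' (Some i) t)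
    + \<Xi> None (S None t) ^ j * R None (S None t) * S' None t)" unfolding h_def by (intro DERIV_add DERIV_sum d1 d2)
  moreover have "(\<Sum>i\<in>UNIV. \<Xi> (Some i) (S (Some i) t) ^ j * R (Some i) (S (Some i) t) * S' (Some i) t)
    + \<Xi> None (S None t) ^ j * R None (S None t) * S' None t = 0" using sm[OF t j] by (simp add: sum_UNIV_option add.commute)
  ultimately show ?thesis by simp
 qed
 have hc: "h j t = h j t1" if t: "t \<in> ball t1 del" and j: "j <= g" for j t
 proof -
  have "\<exists>c. \<forall>t\<in>ball t1 del. h j t = c"
   using h0[OF _ j] by (intro has_field_derivative_zero_constant) (auto intro: has_field_derivative_at_within)
  then show ?thesis using t del by (metis centre_in_ball)
 qed
 show ?thesis
 proof (intro exI[of _ "min del del'"] conjI ballI)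
  show "min del del' > 0" using del del' by simp
  fix t assume "t \<in> ball t1 (min del del')"
  then have t: "t \<in> ball t1 del" and yU: "y t \<in> U" using del'(2)[of t] by (auto simp: dist_commute)
  show "t \<in> B'" using SB[OF t, of None] SN[OF t] by (simp add: BB_def)
  show "\<exists>y\<in>U. ?P y t"
  proof (intro bexI[OF _ yU] conjI)
   have "(\<Sum>i\<in>UNIV. F i (pos j) (y t $ i)) = (\<Sum>i\<in>UNIV. F i (pos j) (x $ i)) - (G (pos j) t - G (pos j) t1)" for j :: 'n
    using hc[OF t, of "pos j"] pos_props(2)[of j] card SN[OF t] S0 by (simp add: h_def y_def s_def algebra_simps)
   then show "abel_sum F (y t) = abel_sum F x - (diff_vec G t - diff_vec G t1)" by (simp add: abel_sum_def diff_vec_def vec_eq_iff)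
   have "(moved a et (y t) + frag_of (xi' t, et' t)) - (moved a et x + frag_of (xi' t1, et' t1))
    = (\<Sum>i\<in>UNIV. frag_of (\<Xi> i (S i t), H i (S i t)) - frag_of (\<Xi> i (s i), H i (s i)))"
    unfolding sum_UNIV_option using SN[OF t] by (simp add: moved_def y_def \<Xi>_def H_def s_def sum_subtractf algebra_simps)
   then show "(moved a et (y t) + frag_of (xi' t, et' t)) - (moved a et x + frag_of (xi' t1, et' t1)) \<in> prin" using pr[OF t] by simp
  qed
 qed
qed

text \<open>Equivalence of the total divisors is an equivalence relation that is locally trivial on
  a connected set. The local motions fit together because \<open>J\<close> recovers the coordinate
  points from their Abel sum; therefore the displaced value has to remain in \<open>V\<close>
  throughout.\<close>

lemma move_global:
 fixes u :: "(complex, 'n::enum) vec" assumes card: "CARD('n) = g + 1" and nb: "coord_nbhd a et B F U V J"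
  and ch: "chart xi' et' rho' B'" "connected B'" "t0 \<in> B'" "t \<in> B'"
  and ne: "\<And>x i t. x \<in> U ==> t \<in> B' ==> xi' t ~= x $ i"
  and G: "\<And>j t. t \<in> B' ==> DERIV (G j) t :> xi' t ^ j * rho' t"
  and V: "\<And>t. t \<in> B' ==> u - (diff_vec G t - diff_vec G t0) \<in> V"
 shows "(moved a et (J (u - (diff_vec G t - diff_vec G t0))) + frag_of (xi' t, et' t))
  - (moved a et (J u) + frag_of (xi' t0, et' t0)) \<in> prin"
proof -
 define D where "D = (%t. moved a et (J (u - (diff_vec G t - diff_vec G t0))) + frag_of (xi' t, et' t))"
 have "D t - D t0 \<in> prin"
 proof (rule connected_equivalence_relation[OF ch(2,4,3), of "%t t'. D t - D t' \<in> prin"])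
  show "D x - D z \<in> prin" if "D x - D y \<in> prin" "D y - D z \<in> prin" for x y z using prin_add[OF that] by simp
  show "D y - D x \<in> prin" if "D x - D y \<in> prin" for x y using prin_uminus[OF that] by simp
  fix t1 assume t1: "t1 \<in> B'"
  let ?u = "u - (diff_vec G t1 - diff_vec G t0)"
  have x: "J ?u \<in> U" "abel_sum F (J ?u) = ?u" using coord_nbhdD(10,11)[OF nb V[OF t1]] by auto
  have "\<exists>del>0. \<forall>t\<in>ball t1 del. t \<in> B' \<and> (\<exists>y\<in>U. abel_sum F y = abel_sum F (J ?u) - (diff_vec G t - diff_vec G t1) \<and>
   (moved a et y + frag_of (xi' t, et' t)) - (moved a et (J ?u) + frag_of (xi' t1, et' t1)) \<in> prin)"
   by (rule move_local[OF card nb x(1) ch(1) t1 ne[OF x(1) t1] G])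
  then obtain del where del: "del > 0" and m: "\<And>t. t \<in> ball t1 del ==> t \<in> B'"
   "\<And>t. t \<in> ball t1 del ==> \<exists>y\<in>U. abel_sum F y = abel_sum F (J ?u) - (diff_vec G t - diff_vec G t1) \<and>
   (moved a et y + frag_of (xi' t, et' t)) - (moved a et (J ?u) + frag_of (xi' t1, et' t1)) \<in> prin" by blast
  have "D t1 - D t \<in> prin" if t: "t \<in> ball t1 del" for t
  proof -
   obtain y where y: "y \<in> U" "abel_sum F y = abel_sum F (J ?u) - (diff_vec G t - diff_vec G t1)"
    "(moved a et y + frag_of (xi' t, et' t)) - (moved a et (J ?u) + frag_of (xi' t1, et' t1)) \<in> prin" using m(2)[OF t] by blast
   have "abel_sum F y = u - (diff_vec G t - diff_vec G t0)" using y(2) x(2) by (simp add: algebra_simps)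
   then have "J (u - (diff_vec G t - diff_vec G t0)) = y" using coord_nbhdD(9)[OF nb y(1)] by simp
   then have "D t - D t1 \<in> prin" using y(3) by (simp add: D_def)
   then show ?thesis using prin_uminus by fastforce
  qed
  moreover have "openin (top_of_set B') (ball t1 del)"
   using m(1) by (intro open_subset) auto
  ultimately show "\<exists>T. openin (top_of_set B') T \<and> t1 \<in> T \<and> (\<forall>x\<in>T. D t1 - D x \<in> prin)"
   using del by (intro exI[of _ "ball t1 del"]) auto
 qed
 then show ?thesis by (simp add: D_def)
qed

lemma diff_vec_continuous: assumes "\<And>j. \<exists>d. DERIV (G j) t :> d"
 shows "isCont (diff_vec G :: complex => (complex, 'n::enum) vec) t" unfolding isCont_def diff_vec_def[abs_def]
proof (rule vec_tendstoI)
 fix i :: 'n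
 have "isCont (G (pos i)) t" using assms DERIV_isCont by blast
 then show "((%x. (\<chi> j. G (pos j) x) $ i) \<longlongrightarrow> (\<chi> j. G (pos j) t) $ i) (at t)" by (simp add: isCont_def)
qed

lemma isCont_ballE:
 fixes h :: "complex => 'b::metric_space" assumes "isCont h t" "e > 0"
 shows "\<exists>d>0. \<forall>s\<in>ball t d. dist (h s) (h t) < e"
proof -
 obtain d where "d > 0" "\<And>s. dist s t < d ==> dist (h s) (h t) < e"
  using assms unfolding continuous_at_eps_delta by blast
 then show ?thesis by (intro exI[of _ d]) (auto simp: dist_commute)
qed

text \<open>The points of the second system are moved to \<open>J2 v\<close> one at a time while the
  first system absorbs each displacement. In total the first system moves by \<open>- v\<close>,
  whatever its starting position \<open>u\<close>; this independence of \<open>u\<close> is the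
  source of additivity.\<close>

lemma cross_move:
 fixes a a2 :: "'n::enum => complex"
 assumes card: "CARD('n) = g + 1" and nb: "coord_nbhd a et B F U V J" and nb2: "coord_nbhd a2 et2 B2 F2 U2 V2 J2"
  and disj: "\<And>x i k t. x \<in> U ==> t \<in> B2 k ==> t ~= x $ i"
 shows "\<exists>del>0. \<forall>u v. norm u < del --> norm v < del --> moved a et (J (u - v)) - moved a et (J u) + moved a2 et2 (J2 v) \<in> prin"
proof -
 note c2 = coord_nbhdD(1)[OF nb2]
 obtain eps where eps: "eps > 0" "ball 0 eps \<subseteq> V" using coord_nbhdD(6,7)[OF nb] openE by blast
 define N where "N = real CARD('n)"
 have N: "N > 0" by (simp add: N_def)
 \<comment> \<open>At most \<open>N\<close> displacements of norm below \<open>e1\<close> amount to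
   \<open>eps / 2\<close>; the other half of \<open>eps\<close> is reserved for
   \<open>u\<close>.\<close>
 define e1 where "e1 = eps / (2 * N)"
 have e1: "e1 > 0" using eps N by (simp add: e1_def)
 let ?\<gamma> = "%k. diff_vec (F2 k) :: complex => (complex, 'n) vec"
 have g0: "?\<gamma> k (a2 k) = 0" for k by (simp add: diff_vec_def vec_eq_iff coordsD(4)[OF c2])
 have "\<forall>k. \<exists>r>0. ball (a2 k) r \<subseteq> B2 k \<and> (\<forall>t\<in>ball (a2 k) r. norm (?\<gamma> k t) < e1)" (is "\<forall>k. ?Q k")
 proof
  fix k
  obtain r1 where r1: "r1 > 0" "ball (a2 k) r1 \<subseteq> B2 k" using coordsD(3,5)[OF c2] openE by blast
  have "isCont (?\<gamma> k) (a2 k)" using coordsD(6)[OF c2 coordsD(3)[OF c2]] by (intro diff_vec_continuous) blast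
  then obtain r2 where r2: "r2 > 0" "\<forall>t\<in>ball (a2 k) r2. dist (?\<gamma> k t) (?\<gamma> k (a2 k)) < e1"
   using isCont_ballE e1 by blast
  show "?Q k" using r1 r2 g0 by (intro exI[of _ "min r1 r2"]) auto
 qed
 then obtain r where r: "\<forall>k. r k > 0 \<and> ball (a2 k) (r k) \<subseteq> B2 k \<and> (\<forall>t\<in>ball (a2 k) (r k). norm (?\<gamma> k t) < e1)"
  by (rule choice[THEN exE])
 have "continuous_on V2 J2" using holomorphic_map_continuous[OF coord_nbhdD(13)[OF nb2]] .
 then have "isCont J2 0" using coord_nbhdD(6,7)[OF nb2] continuous_on_eq_continuous_at by blast
 moreover have "open {x. \<forall>k. x $ k \<in> ball (a2 k) (r k)}"
 proof -
  have "{x. \<forall>k. x $ k \<in> ball (a2 k) (r k)} = (\<Inter>k. (%x. x $ k) -` ball (a2 k) (r k))" by auto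
  then show ?thesis by (auto intro!: open_INT open_vimage continuous_intros)
 qed
 moreover have "J2 0 \<in> {x. \<forall>k. x $ k \<in> ball (a2 k) (r k)}" using r coord_nbhdD(12)[OF nb2] by simp
 ultimately have "\<forall>\<^sub>F v in nhds 0. J2 v \<in> {x. \<forall>k. x $ k \<in> ball (a2 k) (r k)}"
  unfolding isCont_def by (intro topological_tendstoD) (auto simp: tendsto_at_iff_tendsto_nhds)
 then obtain d1 where d1: "d1 > 0" "\<And>v. norm v < d1 ==> J2 v $ k \<in> ball (a2 k) (r k)" for k
  unfolding eventually_nhds_metric by auto
 obtain d2 where d2: "d2 > 0" "ball 0 d2 \<subseteq> V2" using coord_nbhdD(6,7)[OF nb2] openE by blast
 define del where "del = min (min d1 d2) (eps / 2)"
 show ?thesis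
 proof (intro exI[of _ del] conjI allI impI)
  show "del > 0" using d1 d2 eps by (simp add: del_def)
  fix u v :: "(complex, 'n) vec" assume u: "norm u < del" and v: "norm v < del"
  define x where "x = J2 v"
  have xr: "x $ k \<in> ball (a2 k) (r k)" for k using d1(2) v by (simp add: x_def del_def)
  have vV: "v \<in> V2" using d2(2) v by (auto simp: del_def)
  have v_eq: "v = (\<Sum>k\<in>UNIV. ?\<gamma> k (x $ k))"
   using coord_nbhdD(11)[OF nb2 vV] by (simp add: x_def abel_sum_def diff_vec_def vec_eq_iff)
  have "moved a et (J (u - (\<Sum>k\<in>A. ?\<gamma> k (x $ k)))) - moved a et (J u)
    + (\<Sum>k\<in>A. frag_of (x $ k, et2 k (x $ k)) - frag_of (a2 k, et2 k (a2 k))) \<in> prin" for A :: "'n set" using finite[of A]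
  proof (induction A rule: finite_induct)
   case empty
   then show ?case by (simp add: prin_0)
  next
   case (insert k A)
   define u' where "u' = u - (\<Sum>k\<in>A. ?\<gamma> k (x $ k))"
   have chk: "chart (%t. t) (et2 k) (%t. 1 / et2 k t) (ball (a2 k) (r k))"
    using chart_subset[OF coordsD(2)[OF c2, of k], of "ball (a2 k) (r k)"] r by auto
   have inV: "u' - (?\<gamma> k t - ?\<gamma> k (a2 k)) \<in> V" if t: "t \<in> ball (a2 k) (r k)" for t
   proof -
    have "norm (\<Sum>k\<in>A. ?\<gamma> k (x $ k)) <= real (card A) * e1"
     using r xr by (intro sum_norm_bound) (auto intro: less_imp_le)
    moreover have "norm (?\<gamma> k t) < e1" using r t by blast
    moreover have "real (card A) + 1 <= N"
     using insert card_mono[of UNIV "insert k A"] by (simp add: N_def)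
    then have "real (card A) * e1 + e1 <= N * e1" using e1 by (metis distrib_right less_imp_le mult_1 mult_right_mono)
    moreover have "N * e1 = eps / 2" using N by (simp add: e1_def)
    moreover have "norm u < eps / 2" using u by (simp add: del_def)
    moreover have "norm (u' - ?\<gamma> k t) <= norm u + norm (\<Sum>k\<in>A. ?\<gamma> k (x $ k)) + norm (?\<gamma> k t)"
     unfolding u'_def by (rule order_trans[OF norm_triangle_ineq4 add_right_mono[OF norm_triangle_ineq4]])
    ultimately have "norm (u' - ?\<gamma> k t) < eps" by linarith
    then show ?thesis using eps(2) g0 by auto
   qed
   have "(moved a et (J (u' - (?\<gamma> k (x $ k) - ?\<gamma> k (a2 k)))) + frag_of (x $ k, et2 k (x $ k)))
    - (moved a et (J u') + frag_of (a2 k, et2 k (a2 k))) \<in> prin"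
   proof (rule move_global[OF card nb chk])
    show "DERIV (F2 k j) t :> t ^ j * (1 / et2 k t)" if "t \<in> ball (a2 k) (r k)" for j t
    proof -
     have "t \<in> B2 k" using r that by blast
     then show ?thesis using coordsD(6)[OF c2, of t k j] by simp
    qed
    show "t ~= y $ i" if "y \<in> U" "t \<in> ball (a2 k) (r k)" for y i t using disj[OF that(1), of t k i] r that(2) by blast
   qed (use xr r inV in auto)
   from prin_add[OF this insert.IH[folded u'_def]]
   show ?case using insert(1,2) g0 by (simp add: u'_def algebra_simps)
  qed
  from this[of UNIV] show "moved a et (J (u - v)) - moved a et (J u) + moved a2 et2 (J2 v) \<in> prin"
   unfolding v_eq[symmetric] by (simp add: moved_def x_def)
 qed
qed

text \<open>Starting from the value 0, the motion from \<open>s\<close> to \<open>t\<close> along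
  the chart pushes the coordinate points by minus the integral, so \<open>E (- w)\<close> is the
  class of minus the displacement, and additivity turns this around. The margin \<open>2 r\<close>
  keeps the moving abscissa, which strays by less than \<open>r\<close>, away from the coordinate
  points, which also stray by less than \<open>r\<close>.\<close>

lemma local_exp_at_chart:
 fixes E :: "(complex, 'n::enum) vec => divisor" assumes card: "CARD('n) = g + 1" and nb: "coord_nbhd a et B F U V J"
  and hom: "\<And>u v. E (u + v) - E u - E v \<in> prin"
  and E: "del > 0" "\<And>u. norm u < del ==> E u - moved a et (J u) \<in> prin" and ch: "chart xi et' rho B'" "s \<in> B'"
  and G: "\<And>j t. t \<in> B' ==> DERIV (G j) t :> xi t ^ j * rho t"
  and r: "r > 0" "\<And>x i. x \<in> U ==> dist (x $ i) (a i) < r" "\<And>i. dist (xi s) (a i) \<ge> 2 * r"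
 shows "\<exists>d>0. ball s d \<subseteq> B' \<and> (\<forall>t\<in>ball s d. E (diff_vec G t - diff_vec G s)
  - (frag_of (xi t, et' t) - frag_of (xi s, et' s)) \<in> prin)"
proof -
 let ?\<gamma> = "diff_vec G :: complex => (complex, 'n) vec"
 have opB: "open B'" using ch by (simp add: chart_def)
 obtain d0 where d0: "d0 > 0" "ball s d0 \<subseteq> B'" using opB ch(2) openE by blast
 obtain eps where eps: "eps > 0" "ball 0 eps \<subseteq> V" using coord_nbhdD(6,7)[OF nb] openE by blast
 have "isCont ?\<gamma> s" using G[OF ch(2)] by (intro diff_vec_continuous) blast
 then obtain d1 where d1: "d1 > 0" "\<forall>t\<in>ball s d1. dist (?\<gamma> t) (?\<gamma> s) < min del eps"
  using isCont_ballE[of s ?\<gamma> "min del eps"] eps(1) E(1) by fastforce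
 have "isCont xi s" using ch unfolding chart_def by (blast intro: DERIV_isCont)
 then obtain d2 where d2: "d2 > 0" "\<forall>t\<in>ball s d2. dist (xi t) (xi s) < r" using isCont_ballE r(1) by blast
 define d where "d = min d0 (min d1 d2)"
 have d: "d > 0" "ball s d \<subseteq> B'" using d0 d1 d2 by (auto simp: d_def)
 have dd: "dist (?\<gamma> t) (?\<gamma> s) < min del eps" "dist (xi t) (xi s) < r" if "t \<in> ball s d" for t
  using that d1(2) d2(2) by (auto simp: d_def)
 have "E (?\<gamma> t - ?\<gamma> s) - (frag_of (xi t, et' t) - frag_of (xi s, et' s)) \<in> prin" if t: "t \<in> ball s d" for t
 proof -
  let ?w = "?\<gamma> t - ?\<gamma> s"
  have "(moved a et (J (0 - (?\<gamma> t - ?\<gamma> s))) + frag_of (xi t, et' t)) - (moved a et (J 0) + frag_of (xi s, et' s)) \<in> prin"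
  proof (rule move_global[OF card nb chart_subset[OF ch(1) open_ball d(2)]])
   show "xi t' ~= x $ i" if "x \<in> U" "t' \<in> ball s d" for x i t'
   proof
    assume "xi t' = x $ i"
    then have "dist (xi s) (a i) < r + r"
     using r(2)[OF that(1), of i] dd(2)[OF that(2)] dist_triangle[of "xi s" "a i" "xi t'"] by (simp add: dist_commute)
    with r(3)[of i] show False by simp
   qed
   show "0 - (?\<gamma> t' - ?\<gamma> s) \<in> V" if "t' \<in> ball s d" for t'
    using eps(2) dd(1)[OF that] by (auto simp: dist_norm norm_minus_commute)
   show "DERIV (G j) t' :> xi t' ^ j * rho t'" if "t' \<in> ball s d" for j t' using G d(2) that by blast
  qed (use d(1) t in auto)
  then have 1: "moved a et (J (- ?w)) + (frag_of (xi t, et' t) - frag_of (xi s, et' s)) \<in> prin"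
   by (simp add: coord_nbhdD(12)[OF nb] moved_a add_diff_eq)
  have 2: "E (- ?w) - moved a et (J (- ?w)) \<in> prin" using dd(1)[OF t] by (intro E(2)) (simp add: dist_norm norm_minus_commute)
  have 3: "E (?w + - ?w) - E ?w - E (- ?w) \<in> prin" by (rule hom)
  have 4: "E (0 + 0) - E 0 - E 0 \<in> prin" by (rule hom)
  have "E ?w - (frag_of (xi t, et' t) - frag_of (xi s, et' s))
   = - (E (?w + - ?w) - E ?w - E (- ?w)) - (E (0 + 0) - E 0 - E 0) - (E (- ?w) - moved a et (J (- ?w)))
    - (moved a et (J (- ?w)) + (frag_of (xi t, et' t) - frag_of (xi s, et' s)))" by simp
  also have "\<dots> \<in> prin" by (intro prin_diff prin_uminus 1 2 3 4)
  finally show ?thesis .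
 qed
 then show ?thesis using d by blast
qed

text \<open>A homomorphism modulo \<open>prin\<close> that sends the integral over a short arc to
  the class of its end point minus its starting point. It is required on every chart, so that
  arbitrary paths can be cut into arcs.\<close>

definition exp_like :: "((complex, 'n::enum) vec => divisor) => bool" where
 "exp_like E \<longleftrightarrow> (\<forall>u v. E (u + v) - E u - E v \<in> prin) \<and>
  (\<forall>xi et rho B s G. chart xi et rho B \<and> s \<in> B \<and> (\<forall>j. \<forall>t\<in>B. DERIV (G j) t :> xi t ^ j * rho t) -->
   (\<exists>d>0. ball s d \<subseteq> B \<and> (\<forall>t\<in>ball s d. E (diff_vec G t - diff_vec G s)
    - (frag_of (xi t, et t) - frag_of (xi s, et s)) \<in> prin)))"

text \<open>One coordinate system defines \<open>e\<close> near 0. A second one, far from it, serves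
  twice: additivity of \<open>e\<close> comes from moving the second system, and points close to the
  abscissae of the first are handled by representing \<open>E\<close> through the second.\<close>

theorem abel_exp_exists: assumes card: "CARD('n::enum) = g + 1" shows "\<exists>E :: (complex, 'n) vec => divisor. exp_like E"
proof -
 have finX: "finite {x. poly f x = 0}" using f_nz by (rule poly_roots_finite)
 obtain a1 :: "'n => complex" where a1: "inj a1" "\<And>i. poly f (a1 i) ~= 0" using exists_points[OF finX] by auto
 have "finite ({x. poly f x = 0} \<union> range a1)" using finX by simp
 from exists_points[OF this, where 'n = 'n]
 obtain a2 :: "'n => complex" where a2': "inj a2" "\<forall>i. a2 i \<notin> {x. poly f x = 0} \<union> range a1" by blast
 have a2: "inj a2" "poly f (a2 i) ~= 0" "a1 i ~= a2 k" for i k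
  using a2'(1) a2'(2)[rule_format, of i] a2'(2)[rule_format, of k] rangeI[of a1 i] by (simp_all, metis)
 \<comment> \<open>A quarter of the least distance between the systems: a point within
   \<open>2 r\<close> of the first is at distance at least \<open>2 r\<close> from the
   second.\<close>
 define r where "r = Min ((%(i, k). dist (a1 i) (a2 k)) ` UNIV) / 4"
 have r0: "r > 0" using a2(3) by (auto simp: r_def)
 have r4: "4 * r <= dist (a1 i) (a2 k)" for i k unfolding r_def by (auto intro!: Min_le simp: image_iff)
 obtain et1 B1 F1 where c1: "coords a1 et1 B1 F1" and B1: "\<And>i. B1 i \<subseteq> ball (a1 i) r"
  using coords_exist[of a1 "%i. csqrt (poly f (a1 i))" r] a1 r0 by auto
 obtain et2 B2 F2 where c2: "coords a2 et2 B2 F2" and B2: "\<And>i. B2 i \<subseteq> ball (a2 i) r"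
  using coords_exist[of a2 "%i. csqrt (poly f (a2 i))" r] a2 r0 by auto
 obtain U1 V1 J1 where nb1: "coord_nbhd a1 et1 B1 F1 U1 V1 J1" using coord_nbhd_exists[OF c1] by blast
 obtain U2 V2 J2 where nb2: "coord_nbhd a2 et2 B2 F2 U2 V2 J2" using coord_nbhd_exists[OF c2] by blast
 have U1r: "dist (x $ i) (a1 i) < r" if "x \<in> U1" for x i using coord_nbhdD(5)[OF nb1 that, of i] B1[of i] by (auto simp: dist_commute)
 have U2r: "dist (x $ i) (a2 i) < r" if "x \<in> U2" for x i using coord_nbhdD(5)[OF nb2 that, of i] B2[of i] by (auto simp: dist_commute)
 have disj: "t ~= x $ i" if "x \<in> U1" "t \<in> B2 k" for x i k t
 proof
  assume "t = x $ i"
  moreover have "dist t (a2 k) < r" using that(2) B2[of k] by (auto simp: dist_commute)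
  ultimately show False
   using U1r[OF that(1), of i] r4[of i k] dist_triangle[of "a1 i" "a2 k" t] r0 by (simp add: dist_commute)
 qed
 have "\<exists>del>0. \<forall>u v. norm u < del --> norm v < del -->
   moved a1 et1 (J1 (u - v)) - moved a1 et1 (J1 u) + moved a2 et2 (J2 v) \<in> prin" by (rule cross_move[OF card nb1 nb2]) (rule disj)
 then obtain del where del: "del > 0"
  and cr: "\<And>u v. norm u < del ==> norm v < del ==> moved a1 et1 (J1 (u - v)) - moved a1 et1 (J1 u) + moved a2 et2 (J2 v) \<in> prin"
  by blast
 define e where "e = (%u. moved a1 et1 (J1 u))"
 have e0: "e 0 = 0" using coord_nbhdD(12)[OF nb1] by (simp add: e_def moved_a)
 have e2: "e (- v) + moved a2 et2 (J2 v) \<in> prin" if "norm v < del" for v using cr[of 0 v] that del e0 by (simp add: e_def)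
 \<comment> \<open>Both \<open>e (u + v) - e u\<close> and \<open>e v\<close> are equivalent to
   minus the divisor by which the second system moves for the value \<open>- v\<close>.\<close>
 have "e (u + v) - e u - e v \<in> prin" if "norm u < del" "norm v < del" for u v
  using prin_diff[OF cr[of u "- v"] e2[of "- v"]] that by (simp add: e_def algebra_simps)
 then obtain E where hom: "\<And>u v. E (u + v) - E u - E v \<in> prin" and E1: "\<And>u. norm u < del ==> E u - e u \<in> prin"
  using local_hom_extension[of prin del e] prin_0 prin_diff del by blast
 have E2: "E v - moved a2 et2 (J2 v) \<in> prin" if v: "norm v < del" for v
 proof -
  have 1: "E (v + - v) - E v - E (- v) \<in> prin" "E (0 + 0) - E 0 - E 0 \<in> prin" by (rule hom)+
  have 2: "E (- v) - e (- v) \<in> prin" using v by (intro E1) simp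
  have "E v - moved a2 et2 (J2 v) = - (E (v + - v) - E v - E (- v)) - (E (0 + 0) - E 0 - E 0)
    - (E (- v) - e (- v)) - (e (- v) + moved a2 et2 (J2 v))" by simp
  also have "\<dots> \<in> prin" by (intro prin_diff prin_uminus 1 2 e2 v)
  finally show ?thesis .
 qed
 have "\<exists>d>0. ball s d \<subseteq> B \<and> (\<forall>t\<in>ball s d. E (diff_vec G t - diff_vec G s)
    - (frag_of (xi t, et t) - frag_of (xi s, et s)) \<in> prin)"
  if ch: "chart xi et rho B" "s \<in> B" and G: "\<And>j t. t \<in> B ==> DERIV (G j) t :> xi t ^ j * rho t" for xi et rho B s G
 proof (cases "\<forall>i. dist (xi s) (a1 i) \<ge> 2 * r")
  case True
  then show ?thesis by (intro local_exp_at_chart[OF card nb1 hom del E1[unfolded e_def] ch G r0 U1r]) auto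
 next
  case False
  then obtain i where "\<not> dist (xi s) (a1 i) \<ge> 2 * r" by blast
  then have i: "dist (xi s) (a1 i) < 2 * r" by simp
  have "dist (xi s) (a2 k) \<ge> 2 * r" for k using i r4[of i k] dist_triangle[of "a1 i" "a2 k" "xi s"] by (simp add: dist_commute)
  then show ?thesis by (intro local_exp_at_chart[OF card nb2 hom del E2 ch G r0 U2r]) auto
 qed
 then show ?thesis using hom unfolding exp_like_def by (intro exI[of _ E]) auto
qed

end

section \<open>Integrals along paths and the exponential map\<close>

context hyperelliptic
begin

definition abel_exp :: "(complex, 'n::enum) vec => divisor" where "abel_exp = (SOME E. exp_like E)"

lemma exp_like_abel_exp: "CARD('n::enum) = g + 1 ==> exp_like (abel_exp :: (complex, 'n) vec => divisor)"
 unfolding abel_exp_def using abel_exp_exists[where 'n = 'n] by (intro someI_ex[of exp_like])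

lemma exp_add: "exp_like E ==> E (u + v) - (E u + E v) \<in> prin" by (simp add: exp_like_def diff_diff_add)

lemma exp_chart: assumes "exp_like E" "chart xi et rho B" "s \<in> B"
  "\<And>j t. t \<in> B ==> DERIV (G j) t :> xi t ^ j * rho t"
 shows "\<exists>d>0. ball s d \<subseteq> B \<and> (\<forall>t\<in>ball s d. E (diff_vec G t - diff_vec G s)
    - (frag_of (xi t, et t) - frag_of (xi s, et s)) \<in> prin)"
 using assms(1)[unfolded exp_like_def, THEN conjunct2, rule_format, of xi et rho B s G] assms(2-4) by blast

lemma exp_0: "exp_like E ==> E 0 \<in> prin" using exp_add[of E 0 0] prin_uminus[of "- E 0"] by simp

lemma exp_diff: "exp_like E ==> E (u - v) - (E u - E v) \<in> prin"
 using prin_uminus[OF exp_add[of E "u - v" v]] by (simp add: algebra_simps)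

lemma exp_uminus: "exp_like E ==> E (- v) + E v \<in> prin" using prin_add[OF exp_diff[of E 0 v] exp_0[of E]] by simp

lemma exp_sum: "exp_like E ==> E (\<Sum>i\<in>A. u i) - (\<Sum>i\<in>A. E (u i)) \<in> prin"
proof (induction A rule: infinite_finite_induct)
 case (insert i A)
 then show ?case using prin_add[OF exp_add[of E "u i" "\<Sum>i\<in>A. u i"] insert.IH] by (simp add: algebra_simps)
qed (simp_all add: exp_0)

lemma exp_of_nat: "exp_like E ==> E (of_nat n *s u) - frag_cmul (int n) (E u) \<in> prin"
proof (induction n)
 case 0
 then show ?case using exp_0 by (simp add: vec_eq_iff zero_vec_def[symmetric])
next
 case (Suc n)
 have "of_nat (Suc n) *s u = of_nat n *s u + u" by (simp add: vec_eq_iff algebra_simps)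
 moreover have "frag_cmul (int (Suc n)) (E u) = frag_cmul (int n) (E u) + E u"
  by (simp add: frag_cmul_distrib add.commute)
 moreover have "E (of_nat n *s u + u) - (E (of_nat n *s u) + E u) + (E (of_nat n *s u) - frag_cmul (int n) (E u)) \<in> prin"
  by (rule prin_add[OF exp_add[OF Suc.prems] Suc.IH[OF Suc.prems]])
 moreover have "X - (A + U) + (A - C) = X - (C + U)" for X C U A :: divisor by simp
 ultimately show ?case by (simp only:)
qed

lemma exp_of_int: "exp_like E ==> E (of_int k *s u) - frag_cmul k (E u) \<in> prin"
proof (cases k rule: int_cases2)
 case (nonneg n)
 then show "exp_like E ==> ?thesis" using exp_of_nat[of E n u] by simp
next
 case (nonpos n)
 assume E: "exp_like E"
 have "of_int k *s u = - (of_nat n *s u)" using nonpos by (simp add: vec_eq_iff)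
 moreover have "frag_cmul (- int n) (E u) = - frag_cmul (int n) (E u)"
  by (rule poly_mapping_eqI) simp
 moreover have "E (- (of_nat n *s u)) + E (of_nat n *s u) - (E (of_nat n *s u) - frag_cmul (int n) (E u)) \<in> prin"
  by (rule prin_diff[OF exp_uminus[OF E] exp_of_nat[OF E]])
 moreover have "X + Y - (Y - C) = X - - C" for X Y C :: divisor by simp
 ultimately show ?thesis using nonpos by (simp only:)
qed

text \<open>The density \<open>rho\<close> unifies the two cases in \<open>omega_form\<close>: for
  nonzero \<open>y\<close> the factor \<open>y\<close> in \<open>dx\<close> cancels, and for
  \<open>y = 0\<close> the factor \<open>f'(x) / 2\<close> in \<open>dy\<close> does.\<close>

lemma omega_form_chart: assumes ch: "chart xi et rho B" "t \<in> B"
 shows "omega_form f j (xi t, et t) (rho t * et t * v, poly (pderiv f) (xi t) * rho t / 2 * v) = xi t ^ j * rho t * v"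
proof (cases "et t = 0")
 case True
 then have "poly f (xi t) = 0" using ch by (auto simp: chart_def)
 then have "poly (pderiv f) (xi t) ~= 0" by (rule pderiv_f_nz)
 then show ?thesis using True by (simp add: omega_form_def)
qed (simp add: omega_form_def)

text \<open>Inside a chart the integrand is the derivative of the primitives composed with the
  parameter path \<open>sg\<close>, except at the finitely many corners in \<open>S\<close>, which
  the fundamental theorem of calculus tolerates.\<close>

lemma has_integral_chart:
 fixes sg :: "real => complex"
 assumes ch: "chart xi et rho B" and ab: "a <= b" and sg: "continuous_on {a..b} sg" "\<And>y. y \<in> {a..b} ==> sg y \<in> B"
  and S: "finite S" and d: "\<And>y. y \<in> {a<..<b} - S ==> (sg has_vector_derivative sg' y) (at y)"
  and q: "\<And>y. y \<in> {a<..<b} ==> q y = (xi (sg y), et (sg y))"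
  and G: "\<And>j t. t \<in> B ==> DERIV (G j) t :> xi t ^ j * rho t"
 shows "((%s. \<chi> j. omega_form f (pos j) (q s) (vector_derivative q (at s))) has_integral
  (diff_vec G (sg b) - diff_vec G (sg a) :: (complex, 'n::enum) vec)) {a..b}"
proof (rule fundamental_theorem_of_calculus_interior_strong[OF S ab])
 have cG: "continuous_on B (diff_vec G :: complex => (complex, 'n) vec)"
  by (intro continuous_at_imp_continuous_on ballI diff_vec_continuous) (use G in blast)
 show "continuous_on {a..b} (%y. diff_vec G (sg y) :: (complex, 'n) vec)"
  by (rule continuous_on_compose2[OF cG sg(1)]) (use sg(2) in auto)
 fix y assume y: "y \<in> {a<..<b} - S"
 then have yB: "sg y \<in> B" using sg(2) by auto
 let ?v = "sg' y" and ?t = "sg y"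
 have dxi: "DERIV xi ?t :> rho ?t * et ?t" and det: "DERIV et ?t :> poly (pderiv f) (xi ?t) * rho ?t / 2"
  using ch yB by (auto simp: chart_def)
 have "((%y. (xi (sg y), et (sg y))) has_vector_derivative (rho ?t * et ?t * ?v, poly (pderiv f) (xi ?t) * rho ?t / 2 * ?v)) (at y)"
  using field_vector_diff_chain_at[OF d[OF y] dxi] field_vector_diff_chain_at[OF d[OF y] det]
  by (intro has_vector_derivative_Pair) (simp_all add: o_def mult.commute)
 then have "(q has_vector_derivative (rho ?t * et ?t * ?v, poly (pderiv f) (xi ?t) * rho ?t / 2 * ?v)) (at y)"
  by (rule has_vector_derivative_transform_within_open[where S = "{a<..<b}"]) (use q y in auto)
 then have "vector_derivative q (at y) = (rho ?t * et ?t * ?v, poly (pderiv f) (xi ?t) * rho ?t / 2 * ?v)" by (rule vector_derivative_at)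
 then have om: "omega_form f j (q y) (vector_derivative q (at y)) = xi ?t ^ j * rho ?t * ?v" for j
  using omega_form_chart[OF ch yB] q y by auto
 have "((%y. G j (sg y)) has_vector_derivative xi ?t ^ j * rho ?t * ?v) (at y)" for j
  using field_vector_diff_chain_at[OF d[OF y] G[OF yB]] by (simp add: o_def mult.commute)
 then show "((%y. diff_vec G (sg y)) has_vector_derivative
   (\<chi> j. omega_form f (pos j) (q y) (vector_derivative q (at y)) :: (complex, 'n) vec)) (at y)"
  unfolding om by (simp add: diff_vec_def has_vector_derivative_def has_derivative_vec_iff)
qed

lemma chart_primitive: assumes "chart xi et rho (ball s r)"
 shows "\<exists>G. \<forall>j. \<forall>t\<in>ball s r. DERIV (G j) t :> xi t ^ j * rho t"
proof -
 have "\<exists>G. \<forall>t\<in>ball s r. DERIV G t :> xi t ^ j * rho t" for j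
 proof -
  have "(%t. xi t ^ j * rho t) holomorphic_on ball s r" by (intro holomorphic_intros chart_holomorphic[OF assms])
  then obtain G where G: "\<And>t. t \<in> ball s r ==> (G has_field_derivative xi t ^ j * rho t) (at t within ball s r)"
   by (rule holomorphic_convex_primitive'[OF convex_ball open_ball]) blast
  then show ?thesis using at_within_open[OF _ open_ball, of _ s r] by (intro exI[of _ G]) metis
 qed
 then show ?thesis by metis
qed

text \<open>The path is cut into pieces that lie in charts. The bisection principle
  \<open>Bolzano\<close> does this: the claim passes to unions of adjacent intervals and holds on
  all small enough intervals around each point.\<close>

lemma path_exp: assumes card: "CARD('n::enum) = g + 1" and E: "exp_like (E :: (complex, 'n) vec => divisor)"
  and q: "valid_path q" "path_image q \<subseteq> curve f"
 shows "E (omega_integral f q) - (frag_of (pathfinish q) - frag_of (pathstart q)) \<in> prin"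
proof -
 define w where "w = (%s. (\<chi> j. omega_form f (pos j) (q s) (vector_derivative q (at s))) :: (complex, 'n) vec)"
 obtain S D where S: "finite S" "continuous_on {0..1} q"
  and D: "\<And>y. y \<in> {0..1} - S ==> (q has_vector_derivative D y) (at y)"
  using q(1) unfolding valid_path_def piecewise_C1_differentiable_on_def C1_differentiable_on_def by blast
 have qc: "q y \<in> curve f" if "y \<in> {0..1}" for y using q(2) that by (auto simp: path_image_def)
 \<comment> \<open>Existence of the integral is carried along with the equivalence, so that both can
   be combined over adjacent intervals.\<close>
 define Q where "Q = (%a b. 0 <= a \<and> a <= b \<and> b <= 1 --> (\<exists>z. (w has_integral z) {a..b} \<and> E z - (frag_of (q b) - frag_of (q a)) \<in> prin))"
 have "0 <= (1 :: real)" by simp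
 then have "Q 0 1"
 proof (induction rule: Bolzano)
  case (trans a b c)
  show ?case unfolding Q_def
  proof (intro impI)
   assume "0 <= a \<and> a <= c \<and> c <= 1"
   then obtain z1 z2 where z: "(w has_integral z1) {a..b}" "E z1 - (frag_of (q b) - frag_of (q a)) \<in> prin"
    "(w has_integral z2) {b..c}" "E z2 - (frag_of (q c) - frag_of (q b)) \<in> prin" using trans unfolding Q_def by auto
   have "(w has_integral z1 + z2) {a..c}" by (rule has_integral_combine[OF _ _ z(1,3)]) (use trans in auto)
   moreover have "E (z1 + z2) - (frag_of (q c) - frag_of (q a)) \<in> prin"
    using prin_add[OF exp_add[OF E, of z1 z2] prin_add[OF z(2,4)]] by (simp add: algebra_simps)
   ultimately show "\<exists>z. (w has_integral z) {a..c} \<and> E z - (frag_of (q c) - frag_of (q a)) \<in> prin" by blast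
  qed
 next
  case (local x)
  then have x: "x \<in> {0..1}" by simp
  obtain tau xi et rho r eps where ca: "chart_at (q x) tau xi et rho r eps" using chart_exists[OF qc[OF x]] by blast
  define s where "s = tau (q x)"
  have tau: "tau = fst \<or> tau = snd" and r: "r > 0" "eps > 0" and ch: "chart xi et rho (ball s r)"
   and ctau: "\<And>P. P \<in> curve f ==> dist P (q x) < eps ==> tau P \<in> ball s r \<and> (xi (tau P), et (tau P)) = P"
   using ca unfolding chart_at_def s_def by auto
  obtain G where G: "\<And>j t. t \<in> ball s r ==> DERIV (G j) t :> xi t ^ j * rho t"
   using chart_primitive[OF ch] by blast
  have "s \<in> ball s r" using r by simp
  then obtain d where d: "d > 0"
   "\<And>t. t \<in> ball s d ==> E (diff_vec G t - diff_vec G s) - (frag_of (xi t, et t) - frag_of (xi s, et s)) \<in> prin"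
   using exp_chart[where G = G, OF E ch _ G] by blast
  have taud: "dist (tau P) (tau P') <= dist P P'" for P P' using tau dist_fst_le[of P P'] dist_snd_le[of P P'] by auto
  have tauc: "continuous_on A tau" for A using tau by (auto intro!: continuous_intros)
  have bl: "bounded_linear tau" using tau bounded_linear_fst bounded_linear_snd by auto
  have "\<exists>del>0. \<forall>y\<in>{0..1}. dist y x < del --> dist (q y) (q x) < min eps d"
  proof -
   have "min eps d > 0" using r d(1) by simp
   then show ?thesis using S(2) x unfolding continuous_on_iff by blast
  qed
  then obtain del where del: "del > 0" "\<And>y. y \<in> {0..1} ==> dist y x < del ==> dist (q y) (q x) < min eps d" by blast
  show ?case
  proof (intro exI[of _ del] conjI allI impI del(1))
   fix a b assume ab: "a <= x \<and> x <= b \<and> b - a < del"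
   show "Q a b" unfolding Q_def
   proof
    assume ab': "0 <= a \<and> a <= b \<and> b <= 1"
    have near: "dist (q y) (q x) < eps" "dist (q y) (q x) < d" "y \<in> {0..1}" if "y \<in> {a..b}" for y
     using del(2)[of y] that ab ab' by (auto simp: dist_real_def)
    have qy: "tau (q y) \<in> ball s r" "(xi (tau (q y)), et (tau (q y))) = q y" "tau (q y) \<in> ball s d" if "y \<in> {a..b}" for y
     using ctau[OF qc[OF near(3)[OF that]] near(1)[OF that]] near(2)[OF that] taud[of "q y" "q x"] by (auto simp: s_def dist_commute)
    have "(w has_integral (diff_vec G (tau (q b)) - diff_vec G (tau (q a)))) {a..b}" unfolding w_def
    proof (rule has_integral_chart[OF ch _ _ _ S(1)])
     show "continuous_on {a..b} (%y. tau (q y))"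
      by (rule continuous_on_compose2[OF tauc[of UNIV]]) (use S(2) ab' in \<open>auto intro: continuous_on_subset\<close>)
     show "((%y. tau (q y)) has_vector_derivative tau (D y)) (at y)" if "y \<in> {a<..<b} - S" for y
      using bounded_linear.has_vector_derivative[OF bl D[of y]] that ab' by auto
     show "q y = (xi (tau (q y)), et (tau (q y)))" if "y \<in> {a<..<b}" for y using qy(2)[of y] that by auto
    qed (use ab ab' qy G in auto)
    moreover have "E (diff_vec G (tau (q b)) - diff_vec G (tau (q a))) - (frag_of (q b) - frag_of (q a)) \<in> prin"
    proof -
     have ab'': "a \<in> {a..b}" "b \<in> {a..b}" using ab' by auto
     let ?x = "diff_vec G (tau (q b)) - diff_vec G s :: (complex, 'n) vec" and ?y = "diff_vec G (tau (q a)) - diff_vec G s :: (complex, 'n) vec"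
     have "E (?x - ?y) - (E ?x - E ?y) \<in> prin" by (rule exp_diff[OF E])
     from prin_add[OF this prin_diff[OF d(2)[OF qy(3)[OF ab''(2)]] d(2)[OF qy(3)[OF ab''(1)]]]]
     moreover have "?x - ?y = diff_vec G (tau (q b)) - diff_vec G (tau (q a))" by simp
     moreover have "X - (Y - Z) + (Y - (Qb - Qs) - (Z - (Qa - Qs))) = X - (Qb - Qa)" for X Y Z Qa Qb Qs :: divisor
      by simp
     ultimately show ?thesis unfolding qy(2)[OF ab''(1)] qy(2)[OF ab''(2)] by (simp only:)
    qed
    ultimately show "\<exists>z. (w has_integral z) {a..b} \<and> E z - (frag_of (q b) - frag_of (q a)) \<in> prin" by blast
   qed
  qed
 qed
 then obtain z where z: "(w has_integral z) {0..1}" "E z - (frag_of (q 1) - frag_of (q 0)) \<in> prin" unfolding Q_def by auto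
 have "((%s. w s $ j) has_integral z $ j) {0..1}" for j
  using has_integral_linear[OF z(1) bounded_linear_vec_nth[of j]] by (simp add: o_def)
 then have "omega_integral f q = z" by (simp add: omega_integral_def vec_eq_iff w_def integral_unique)
 then show ?thesis using z(2) by (simp add: pathfinish_def pathstart_def)
qed

theorem divisor_integral_exp: assumes card: "CARD('n::enum) = g + 1" and E: "exp_like (E :: (complex, 'n) vec => divisor)"
  and D: "divisor_integral f D z" shows "E z - D \<in> prin"
proof -
 obtain qs where qs: "\<forall>q\<in>set qs. valid_path q \<and> path_image q \<subseteq> curve f"
  "D = (\<Sum>q\<leftarrow>qs. frag_of (pathfinish q) - frag_of (pathstart q))" "z = (\<Sum>q\<leftarrow>qs. omega_integral f q)"
  using D unfolding divisor_integral_def by blast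
 have "E (\<Sum>q\<leftarrow>qs. omega_integral f q) - (\<Sum>q\<leftarrow>qs. frag_of (pathfinish q) - frag_of (pathstart q)) \<in> prin"
  using qs(1)
 proof (induction qs)
  case (Cons q qs)
  have "E (omega_integral f q) - (frag_of (pathfinish q) - frag_of (pathstart q)) \<in> prin"
   using Cons.prems by (intro path_exp[OF card E]) auto
  then have "E (omega_integral f q) - (frag_of (pathfinish q) - frag_of (pathstart q)) +
   (E (\<Sum>q\<leftarrow>qs. omega_integral f q) - (\<Sum>q\<leftarrow>qs. frag_of (pathfinish q) - frag_of (pathstart q))) \<in> prin"
   using Cons.prems by (intro prin_add Cons.IH) auto
  from prin_add[OF exp_add[OF E, of "omega_integral f q" "\<Sum>q\<leftarrow>qs. omega_integral f q"] this]
  have "E (omega_integral f q + (\<Sum>q\<leftarrow>qs. omega_integral f q)) -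
   (frag_of (pathfinish q) - frag_of (pathstart q) + (\<Sum>q\<leftarrow>qs. frag_of (pathfinish q) - frag_of (pathstart q))) \<in> prin"
   (is "?X - (?Q + ?S) \<in> prin")
  proof -
   have "X - (Y + Z) + (Y - Q + (Z - S)) = X - (Q + S)" for X Y Z Q S :: divisor by simp
   then show ?thesis using \<open>_ - (_ + _) + (_ - ?Q + (_ - ?S)) \<in> prin\<close> by (simp only:)
  qed
  then show ?case by (simp only: list.map sum_list.Cons)
 qed (simp add: exp_0[OF E])
 then show ?thesis using qs by simp
qed

end

section \<open>Connectedness of the curve and chains with given boundary\<close>

context hyperelliptic
begin

lemma chart_path: assumes ch: "chart xi et rho B" and B: "convex B" and s: "s \<in> B" and t: "t \<in> B"
 shows "\<exists>q. valid_path q \<and> path_image q \<subseteq> curve f \<and> pathstart q = (xi s, et s) \<and> pathfinish q = (xi t, et t) \<and>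
  (\<forall>G. (\<forall>j. \<forall>t\<in>B. DERIV (G j) t :> xi t ^ j * rho t) -->
   omega_integral f q = (diff_vec G t - diff_vec G s :: (complex, 'n::enum) vec))"
proof -
 define l where "l = linepath s t"
 define q where "q = (%y. (xi (l y), et (l y)))"
 have lB: "l y \<in> B" if "y \<in> {0..1}" for y using that convexD_alt[OF B s t, of y] by (simp add: l_def linepath_def)
 have dl: "(l has_vector_derivative (t - s)) (at y)" for y
  unfolding l_def linepath_def by (auto intro!: derivative_eq_intros simp: algebra_simps)
 have cl: "continuous_on A l" for A unfolding l_def by (rule continuous_on_linepath)
 define D where "D = (%y. (rho (l y) * et (l y) * (t - s), poly (pderiv f) (xi (l y)) * rho (l y) / 2 * (t - s)))"
 have dq: "(q has_vector_derivative D y) (at y)" if "y \<in> {0..1}" for y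
 proof -
  have dxi: "DERIV xi (l y) :> rho (l y) * et (l y)" and det: "DERIV et (l y) :> poly (pderiv f) (xi (l y)) * rho (l y) / 2"
   using ch lB[OF that] by (auto simp: chart_def)
  show ?thesis unfolding q_def D_def using field_vector_diff_chain_at[OF dl dxi] field_vector_diff_chain_at[OF dl det]
   by (intro has_vector_derivative_Pair) (simp_all add: o_def mult.commute)
 qed
 have cc: "continuous_on {0..1} (%y. h (l y))" if "h holomorphic_on B" for h
  by (rule continuous_on_compose2[OF holomorphic_on_imp_continuous_on[OF that] cl]) (use lB in auto)
 note hol = chart_holomorphic[OF ch]
 have "continuous_on {0..1} D" unfolding D_def by (intro continuous_intros cc hol) auto
 then have "q C1_differentiable_on {0..1}" unfolding C1_differentiable_on_def using dq by blast
 then have vp: "valid_path q" unfolding valid_path_def by (rule C1_differentiable_imp_piecewise)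
 have im: "path_image q \<subseteq> curve f" using chart_curve[OF ch lB] by (auto simp: path_image_def q_def)
 have ends: "pathstart q = (xi s, et s)" "pathfinish q = (xi t, et t)"
  by (auto simp: pathstart_def pathfinish_def q_def l_def linepath_def)
 have "omega_integral f q = (diff_vec G t - diff_vec G s :: (complex, 'n) vec)"
  if G: "\<forall>j. \<forall>t\<in>B. DERIV (G j) t :> xi t ^ j * rho t" for G
 proof -
  have "((%y. \<chi> j. omega_form f (pos j) (q y) (vector_derivative q (at y))) has_integral
   (diff_vec G (l 1) - diff_vec G (l 0) :: (complex, 'n) vec)) {0..1}"
  proof (rule has_integral_chart[OF ch _ cl lB finite.emptyI dl])
   show "q y = (xi (l y), et (l y))" for y by (simp add: q_def)
   show "DERIV (G j) t :> xi t ^ j * rho t" if "t \<in> B" for j t using G that by blast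
  qed auto
  then have z: "((%y. \<chi> j. omega_form f (pos j) (q y) (vector_derivative q (at y))) has_integral
   (diff_vec G t - diff_vec G s :: (complex, 'n) vec)) {0..1}" by (simp add: l_def linepath_def)
  have "((%y. omega_form f (pos j) (q y) (vector_derivative q (at y))) has_integral
    (diff_vec G t - diff_vec G s :: (complex, 'n) vec) $ j) {0..1}" for j
   using has_integral_linear[OF z bounded_linear_vec_nth[of j]] by (simp add: o_def)
  then show ?thesis by (simp add: omega_integral_def vec_eq_iff integral_unique)
 qed
 then show ?thesis using vp im ends by (intro exI[of _ q]) auto
qed

definition joined :: "complex \<times> complex => complex \<times> complex => bool" where
 "joined P Q \<longleftrightarrow> (\<exists>q. valid_path q \<and> path_image q \<subseteq> curve f \<and> pathstart q = P \<and> pathfinish q = Q)"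

lemma joined_sym: "joined P Q ==> joined Q P"
 unfolding joined_def by (metis path_image_reversepath pathfinish_reversepath pathstart_reversepath valid_path_imp_reverse)

lemma joined_trans: "joined P Q ==> joined Q R ==> joined P R" unfolding joined_def
proof (elim exE conjE)
 fix p q assume *: "valid_path p" "path_image p \<subseteq> curve f" "pathstart p = P" "pathfinish p = Q"
  "valid_path q" "path_image q \<subseteq> curve f" "pathstart q = Q" "pathfinish q = R"
 show "\<exists>q. valid_path q \<and> path_image q \<subseteq> curve f \<and> pathstart q = P \<and> pathfinish q = R"
  using * by (intro exI[of _ "p +++ q"]) (auto intro: valid_path_join simp: path_image_join)
qed

lemma joined_chart: assumes "chart xi et rho (ball a r)" "s \<in> ball a r" "t \<in> ball a r" shows "joined (xi s, et s) (xi t, et t)"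
 using chart_path[OF assms(1) convex_ball assms(2,3)] unfolding joined_def by blast

lemma joined_near: assumes P: "P \<in> curve f" shows "\<exists>eps>0. \<forall>Q\<in>curve f. dist Q P < eps --> joined P Q"
proof -
 obtain tau xi et rho r eps where ca: "chart_at P tau xi et rho r eps" using chart_exists[OF P] by blast
 then have eps: "eps > 0" "r > 0" "chart xi et rho (ball (tau P) r)" "(xi (tau P), et (tau P)) = P"
  and *: "\<And>Q. Q \<in> curve f ==> dist Q P < eps ==> tau Q \<in> ball (tau P) r \<and> (xi (tau Q), et (tau Q)) = Q"
  unfolding chart_at_def by auto
 have "joined P Q" if "Q \<in> curve f" "dist Q P < eps" for Q
  using joined_chart[OF eps(3), of "tau P" "tau Q"] *[OF that] eps(2,4) by simp
 then show ?thesis using eps(1) by blast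
qed

text \<open>The abscissa is a nonconstant holomorphic function of the chart parameter, hence an open
  map.\<close>

lemma joined_projection_open: assumes P: "P \<in> curve f"
 shows "\<exists>U. open U \<and> fst P \<in> U \<and> (\<forall>x\<in>U. \<exists>y. (x, y) \<in> curve f \<and> joined P (x, y))"
proof -
 obtain tau xi et rho r eps where ca: "chart_at P tau xi et rho r eps" using chart_exists[OF P] by blast
 define s where "s = tau P"
 have r: "r > 0" and ch: "chart xi et rho (ball s r)" and cs: "(xi s, et s) = P" using ca unfolding chart_at_def s_def by auto
 \<comment> \<open>A constant \<open>x\<close> would give \<open>rho y = 0\<close>, so
   \<open>y = 0\<close> on the whole disc; then \<open>f\<close> and \<open>f'\<close> would vanish
   together, against the simplicity of the roots.\<close>
 have "\<not> xi constant_on ball s r"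
 proof
  assume "xi constant_on ball s r"
  then obtain c where c: "\<And>t. t \<in> ball s r ==> xi t = c" by (auto simp: constant_on_def)
  have chp: "(et t)\<^sup>2 = poly f (xi t)" "rho t ~= 0" "DERIV xi t :> rho t * et t"
   "DERIV et t :> poly (pderiv f) (xi t) * rho t / 2" if "t \<in> ball s r" for t using ch that by (auto simp: chart_def)
  have et0: "et t = 0" if t: "t \<in> ball s r" for t
  proof -
   have "DERIV xi t :> 0" by (rule has_field_derivative_transform_within_open[OF DERIV_const[of c] open_ball t]) (simp add: c)
   then have "rho t * et t = 0" using chp(3)[OF t] DERIV_unique by blast
   then show ?thesis using chp(2)[OF t] by simp
  qed
  have s: "s \<in> ball s r" using r by simp
  have "DERIV et s :> 0" by (rule has_field_derivative_transform_within_open[OF DERIV_const[of 0] open_ball s]) (simp add: et0)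
  then have "poly (pderiv f) (xi s) * rho s / 2 = 0" using chp(4)[OF s] DERIV_unique by blast
  moreover have "poly f (xi s) = 0" using chp(1)[OF s] et0[OF s] by simp
  ultimately show False using pderiv_f_nz chp(2)[OF s] by auto
 qed
 then have "open (xi ` ball s r)" by (intro open_mapping_thm[OF chart_holomorphic(1)[OF ch] open_ball connected_ball open_ball order_refl])
 moreover have "fst P \<in> xi ` ball s r" using cs r by (metis centre_in_ball fst_conv image_eqI)
 moreover have "\<exists>y. (xi t, y) \<in> curve f \<and> joined P (xi t, y)" if t: "t \<in> ball s r" for t
  using chart_curve[OF ch t] joined_chart[OF ch, of s t] r t cs by auto
 ultimately show ?thesis by (intro exI[of _ "xi ` ball s r"]) blast
qed

text \<open>The projection to \<open>x\<close> is proper: \<open>|y|^2 = |f(x)|\<close> keeps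
  \<open>y\<close> bounded when \<open>x\<close> converges.\<close>

lemma curve_closed_bounded_lift: assumes "x \<longlonglongrightarrow> l" "\<And>n. (x n, y n) \<in> curve f"
 shows "\<exists>b k. strict_mono k \<and> (y \<circ> k) \<longlonglongrightarrow> b \<and> (l, b) \<in> curve f"
proof -
 have lim: "(%n. poly f (x n)) \<longlonglongrightarrow> poly f l"
  using assms(1) by (intro isCont_tendsto_compose[of l "poly f"]) auto
 then obtain M where M: "\<And>n. norm (poly f (x n)) <= M" using convergent_imp_Bseq[OF convergentI[OF lim]] by (auto simp: Bseq_def)
 have "norm (y n) <= M + 1" for n
 proof -
  have "norm (y n) * norm (y n) <= M" using M[of n] assms(2)[of n] by (simp add: curve_def power2_eq_square flip: norm_mult)
  moreover have "2 * norm (y n) <= norm (y n) * norm (y n) + 1"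
   using zero_le_power2[of "norm (y n) - 1"] by (simp add: power2_eq_square algebra_simps)
  moreover have "0 <= M" using M[of n] norm_ge_zero order_trans by blast
  ultimately show ?thesis by linarith
 qed
 then have "bounded (range y)" unfolding bounded_iff by blast
 then obtain b k where k: "strict_mono k" "(y \<circ> k) \<longlonglongrightarrow> b" using bounded_imp_convergent_subsequence by blast
 have "(%n. (y (k n))\<^sup>2) \<longlonglongrightarrow> b\<^sup>2" using k(2) by (intro tendsto_intros) (simp add: o_def)
 moreover have "(%n. (y (k n))\<^sup>2) \<longlonglongrightarrow> poly f l"
  using LIMSEQ_subseq_LIMSEQ[OF lim k(1)] assms(2) by (simp add: curve_def o_def)
 ultimately have "b\<^sup>2 = poly f l" using LIMSEQ_unique by blast
 then show ?thesis using k by (auto simp: curve_def)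
qed

text \<open>The abscissae of points reachable from \<open>P\<close> form an open set by the open
  mapping theorem and a closed one by properness, so all of \<complex>. In particular a root of
  \<open>f\<close> is reached, and over it lies a single point of the curve, to which therefore
  every point is joined.\<close>

lemma curve_joined: assumes P: "P \<in> curve f" and Q: "Q \<in> curve f" shows "joined P Q"
proof -
 obtain e where e: "poly f e = 0" using fundamental_theorem_of_algebra[of f] degree_f by (auto simp: constant_degree)
 have "joined P (e, 0)" if P: "P \<in> curve f" for P
 proof -
  define X where "X = {x. \<exists>y. (x, y) \<in> curve f \<and> joined P (x, y)}"
  have "open X" unfolding open_subopen[of X]
  proof
   fix x assume "x \<in> X"
   then obtain y where y: "(x, y) \<in> curve f" "joined P (x, y)" by (auto simp: X_def)
   obtain U where U: "open U" "x \<in> U" "\<And>x'. x' \<in> U ==> \<exists>y'. (x', y') \<in> curve f \<and> joined (x, y) (x', y')"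
    using joined_projection_open[OF y(1)] by auto
   have "U \<subseteq> X" using U(3) joined_trans[OF y(2)] unfolding X_def by blast
   then show "\<exists>T. open T \<and> x \<in> T \<and> T \<subseteq> X" using U by blast
  qed
  moreover have "closed X"
   unfolding closed_sequential_limits
  proof (intro allI impI)
   fix x l assume "(\<forall>n. x n \<in> X) \<and> x \<longlonglongrightarrow> l"
   then have xX: "\<forall>n. \<exists>y. (x n, y) \<in> curve f \<and> joined P (x n, y)" and xl: "x \<longlonglongrightarrow> l" by (auto simp: X_def)
   obtain y where y: "\<forall>n. (x n, y n) \<in> curve f \<and> joined P (x n, y n)" using xX by (rule choice[THEN exE])
   obtain b k where k: "strict_mono k" "(y \<circ> k) \<longlonglongrightarrow> b" "(l, b) \<in> curve f"
    using curve_closed_bounded_lift[OF xl, of y] y by blast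
   obtain eps where eps: "eps > 0" "\<And>Q. Q \<in> curve f ==> dist Q (l, b) < eps ==> joined (l, b) Q"
    using joined_near[OF k(3)] by blast
   have "(%n. (x (k n), y (k n))) \<longlonglongrightarrow> (l, b)"
    using LIMSEQ_subseq_LIMSEQ[OF xl k(1)] k(2) by (intro tendsto_Pair) (simp_all add: o_def)
   then obtain n where "dist (x (k n), y (k n)) (l, b) < eps" using eps(1) unfolding lim_sequentially by blast
   then have "joined (l, b) (x (k n), y (k n))" using eps(2) y by blast
   then have "joined P (l, b)" using y joined_sym joined_trans by blast
   then show "l \<in> X" using k(3) by (auto simp: X_def)
  qed
  moreover have "fst P \<in> X" using P joined_near[OF P] unfolding X_def by (auto intro!: exI[of _ "snd P"])
  ultimately have "X = UNIV" using clopen by blast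
  then obtain y where y: "(e, y) \<in> curve f" "joined P (e, y)" by (auto simp: X_def)
  then have "y = 0" using e by (simp add: curve_def)
  with y show ?thesis by simp
 qed
 then show ?thesis using joined_sym joined_trans P Q by blast
qed

lemma divisor_integral_0: "divisor_integral f 0 0" unfolding divisor_integral_def by (intro exI[of _ "[]"]) auto

lemma divisor_integral_add: assumes "divisor_integral f D z" "divisor_integral f D' z'" shows "divisor_integral f (D + D') (z + z')"
proof -
 obtain qs qs' where "\<forall>q\<in>set qs. valid_path q \<and> path_image q \<subseteq> curve f"
  "D = (\<Sum>q\<leftarrow>qs. frag_of (pathfinish q) - frag_of (pathstart q))" "z = (\<Sum>q\<leftarrow>qs. omega_integral f q)"
  "\<forall>q\<in>set qs'. valid_path q \<and> path_image q \<subseteq> curve f"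
  "D' = (\<Sum>q\<leftarrow>qs'. frag_of (pathfinish q) - frag_of (pathstart q))" "z' = (\<Sum>q\<leftarrow>qs'. omega_integral f q)"
  using assms unfolding divisor_integral_def by blast
 then show ?thesis unfolding divisor_integral_def by (intro exI[of _ "qs @ qs'"]) auto
qed

lemma divisor_integral_sum: assumes "finite A" "\<And>i. i \<in> A ==> divisor_integral f (D i) (z i)"
 shows "divisor_integral f (\<Sum>i\<in>A. D i) (\<Sum>i\<in>A. z i)"
 using assms by (induction A rule: finite_induct) (auto intro: divisor_integral_0 divisor_integral_add)

lemma divisor_integral_path: assumes "valid_path q" "path_image q \<subseteq> curve f"
 shows "divisor_integral f (frag_of (pathfinish q) - frag_of (pathstart q)) (omega_integral f q)"
 unfolding divisor_integral_def using assms by (intro exI[of _ "[q]"]) auto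

lemma divisor_integral_divisors0: assumes "divisor_integral f D z" shows "D \<in> divisors0 f"
proof -
 obtain qs where qs: "\<forall>q\<in>set qs. valid_path q \<and> path_image q \<subseteq> curve f"
  "D = (\<Sum>q\<leftarrow>qs. frag_of (pathfinish q) - frag_of (pathstart q))" using assms unfolding divisor_integral_def by blast
 have "(\<Sum>q\<leftarrow>qs. frag_of (pathfinish q) - frag_of (pathstart q)) \<in> divisors0 f" using qs(1)
 proof (induction qs)
  case (Cons q qs)
  have "pathfinish q \<in> curve f" "pathstart q \<in> curve f" using Cons.prems pathfinish_in_path_image pathstart_in_path_image by auto
  then show ?case using Cons by (auto intro!: divisors0_add divisors0_frag)
 qed simp
 then show ?thesis using qs(2) by simp
qed

text \<open>In degree 0, \<open>D\<close> is the sum of the \<open>c_P (P - B)\<close> over its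
  points, with a branch point \<open>B = (e, 0)\<close> as common base point, and every
  \<open>P - B\<close> is the boundary of a path.\<close>

lemma divisor_integral_exists: assumes D: "D \<in> divisors0 f" shows "\<exists>z :: (complex, 'n::enum) vec. divisor_integral f D z"
proof -
 define S where "S = {D. \<exists>z :: (complex, 'n) vec. divisor_integral f D z}"
 have S0: "0 \<in> S" and Sa: "\<And>D E. D \<in> S ==> E \<in> S ==> D + E \<in> S"
  unfolding S_def using divisor_integral_0 divisor_integral_add by blast+
 have Sf: "frag_of P - frag_of Q \<in> S" if "P \<in> curve f" "Q \<in> curve f" for P Q
  using curve_joined[OF that(2,1)] divisor_integral_path unfolding joined_def S_def by blast
 obtain e where "poly f e = 0" using fundamental_theorem_of_algebra[of f] degree_f by (auto simp: constant_degree)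
 then have e: "(e, 0) \<in> curve f" by (simp add: curve_def)
 have Sn: "frag_cmul (int n) E \<in> S" if "E \<in> S" for n E using that by (induction n) (simp_all add: S0 frag_cmul_distrib Sa)
 have Sz: "frag_cmul n (frag_of P - frag_of (e, 0)) \<in> S" if P: "P \<in> curve f" for n P
 proof (cases n rule: int_cases2)
  case (nonneg k)
  then show ?thesis using Sn[OF Sf[OF P e]] by simp
 next
  case (nonpos k)
  have "frag_cmul n (frag_of P - frag_of (e, 0)) = frag_cmul (int k) (frag_of (e, 0) - frag_of P)"
   unfolding nonpos by (rule poly_mapping_eqI) (simp add: lookup_minus algebra_simps)
  then show ?thesis using Sn[OF Sf[OF e P]] by simp
 qed
 let ?K = "keys D" and ?c = "lookup D"
 have "(\<Sum>P\<in>A. frag_cmul (?c P) (frag_of P - frag_of (e, 0))) \<in> S" if "finite A" "A \<subseteq> curve f" for A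
  using that by (induction A rule: finite_induct) (auto intro!: S0 Sa Sz)
 then have "(\<Sum>P\<in>?K. frag_cmul (?c P) (frag_of P - frag_of (e, 0))) \<in> S" using D by (simp add: divisors0_def)
 moreover have "(\<Sum>P\<in>?K. frag_cmul (?c P) (frag_of P - frag_of (e, 0))) = D"
 proof (rule poly_mapping_eqI)
  fix Q
  have fr: "lookup (frag_of P :: divisor) Q = (if P = Q then 1 else 0)" for P by (simp add: lookup_single when_def)
  have "(\<Sum>P\<in>?K. ?c P * (if P = Q then 1 else 0)) = ?c Q" by (simp add: in_keys_iff if_distrib cong: if_cong)
  moreover have "(\<Sum>P\<in>?K. ?c P * (if (e, 0) = Q then 1 else 0)) = 0"
   using D by (simp add: divisors0_def div_degree_def flip: sum_distrib_right)
  ultimately show "lookup (\<Sum>P\<in>?K. frag_cmul (?c P) (frag_of P - frag_of (e, 0))) Q = ?c Q"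
   by (simp only: lookup_sum lookup_minus lookup_frag_cmul fr right_diff_distrib sum_subtractf diff_zero)
 qed
 ultimately show ?thesis by (auto simp: S_def)
qed

end

section \<open>Periods and the projection onto the generalized Jacobian\<close>

context hyperelliptic
begin

lemma abel_sum_integral:
 fixes a :: "'n::enum => complex" assumes c: "coords a et B F" and B: "\<And>i. convex (B i)" and x: "\<And>i. x $ i \<in> B i"
 shows "divisor_integral f (moved a et x) (abel_sum F x)"
proof -
 have "divisor_integral f (frag_of (x $ i, et i (x $ i)) - frag_of (a i, et i (a i))) (diff_vec (F i) (x $ i) :: (complex, 'n) vec)" for i
 proof -
  obtain q where q: "valid_path q" "path_image q \<subseteq> curve f" "pathstart q = (a i, et i (a i))"
   "pathfinish q = (x $ i, et i (x $ i))"
   and G: "\<And>G. (\<forall>j. \<forall>t\<in>B i. DERIV (G j) t :> t ^ j * (1 / et i t)) ==>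
    omega_integral f q = (diff_vec G (x $ i) - diff_vec G (a i) :: (complex, 'n) vec)"
   using chart_path[OF coordsD(2)[OF c] B coordsD(3)[OF c] x] by blast
  have "omega_integral f q = (diff_vec (F i) (x $ i) - diff_vec (F i) (a i) :: (complex, 'n) vec)"
   by (rule G) (use coordsD(6)[OF c] in simp)
  also have "diff_vec (F i) (a i) = (0 :: (complex, 'n) vec)" by (simp add: diff_vec_def vec_eq_iff coordsD(4)[OF c])
  finally have om: "omega_integral f q = (diff_vec (F i) (x $ i) :: (complex, 'n) vec)" by simp
  have "divisor_integral f (frag_of (pathfinish q) - frag_of (pathstart q)) (omega_integral f q :: (complex, 'n) vec)"
   by (rule divisor_integral_path[OF q(1,2)])
  then show ?thesis unfolding om q(3,4) .
 qed
 then have "divisor_integral f (moved a et x) (\<Sum>i\<in>UNIV. diff_vec (F i) (x $ i) :: (complex, 'n) vec)"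
  unfolding moved_def by (intro divisor_integral_sum) auto
 also have "(\<Sum>i\<in>UNIV. diff_vec (F i) (x $ i)) = abel_sum F x" by (simp add: abel_sum_def diff_vec_def vec_eq_iff)
 finally show ?thesis .
qed

text \<open>Abel sums fill a neighbourhood of 0, and every vector is an integral multiple of a small
  one; repeating the same displacement realizes the multiple.\<close>

lemma divisor_integral_surj:
 fixes u :: "(complex, 'n::enum) vec" shows "\<exists>D. divisor_integral f D u"
proof -
 have "finite {x. poly f x = 0}" using degree_f by (intro poly_roots_finite) auto
 then obtain a :: "'n => complex" where a: "inj a" "\<And>i. poly f (a i) ~= 0"
  using exists_points[of "{x. poly f x = 0}", where 'n = 'n] by blast
 have "\<And>i. (csqrt (poly f (a i)))\<^sup>2 = poly f (a i)" "\<And>i. csqrt (poly f (a i)) ~= 0" using a by auto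
 then obtain et B F where c: "coords a et B F" and B: "\<And>i. \<exists>r>0. B i = ball (a i) r"
  using coords_exist[OF a(1), of "%i. csqrt (poly f (a i))" 1] by auto
 obtain U V J where U: "\<forall>x\<in>U. inj (%i. x $ i) \<and> (\<forall>i. x $ i \<in> B i)" and V: "open V" "0 \<in> V"
  and J: "\<forall>u\<in>V. J u \<in> U \<and> abel_sum F (J u) = u" using coords_inverse[OF c] by blast
 have "(%n. (1 / real (Suc n)) *\<^sub>R u) \<longlonglongrightarrow> 0 *\<^sub>R u"
  using LIMSEQ_inverse_real_of_nat by (intro tendsto_intros) (simp add: inverse_eq_divide)
 then have "\<forall>\<^sub>F n in sequentially. (1 / real (Suc n)) *\<^sub>R u \<in> V" using V by (auto dest: topological_tendstoD)
 then obtain n where n: "(1 / real (Suc n)) *\<^sub>R u \<in> V" by (auto simp: eventually_sequentially)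
 let ?w = "(1 / real (Suc n)) *\<^sub>R u"
 have "convex (B i)" for i using B by (metis convex_ball)
 then have "divisor_integral f (moved a et (J ?w)) (abel_sum F (J ?w))" using U J n by (intro abel_sum_integral[OF c]) auto
 then have "divisor_integral f (\<Sum>k<Suc n. moved a et (J ?w)) (\<Sum>k<Suc n. ?w)" using J n by (intro divisor_integral_sum) auto
 moreover have "(\<Sum>k<Suc n. ?w) = u"
  by (simp only: sum_constant_scaleR card_lessThan scaleR_scaleR) simp
 ultimately have "divisor_integral f (\<Sum>k<Suc n. moved a et (J ?w)) u" by (simp only:)
 then show ?thesis by blast
qed

lemma period_lattice_0: "0 \<in> period_lattice f"
proof -
 let ?C = "homologous_rel_set 1 (top_of_set (curve f)) {} 0"
 have "?C \<in> carrier (homology_group 1 (top_of_set (curve f)))"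
  using carrier_relative_homology_group[of 1 "top_of_set (curve f)" "{}"] by simp
 then show ?thesis unfolding period_lattice_def by (auto intro!: exI[of _ "0 :: (complex \<times> complex) chain"] exI[of _ ?C])
qed

text \<open>Evaluating the faces of a singular 1-simplex at the only point of the 0-simplex turns
  the boundary of a chain into the divisor of its end points, so the latter is 0 for a cycle. Face 0
  gives the end point, face 1 the starting point.\<close>

lemma cycle_boundary: assumes "singular_relcycle 1 X {} c" shows "(\<Sum>sg\<in>keys c. frag_cmul (lookup c sg)
  (frag_of (pathfinish (simplex_path sg)) - frag_of (pathstart (simplex_path sg)))) = 0"
proof -
 define e :: "nat => real" where "e = (%i. if i = 0 then 1 else 0)"
 have e: "e \<in> standard_simplex 0" by (simp add: e_def standard_simplex_def)
 have s0: "singular_face 1 0 sg e = pathfinish (simplex_path sg)" for sg :: "(nat => real) => 'a"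
 proof -
  have "simplical_face 0 e = (%i. if i = 0 then 0 else if i = 1 then 1 else 0)"
   by (auto simp: simplical_face_def e_def fun_eq_iff)
  then show ?thesis using e unfolding singular_face_def simplex_path_def pathfinish_def by (auto intro!: arg_cong[of _ _ sg])
 qed
 have s1: "singular_face 1 1 sg e = pathstart (simplex_path sg)" for sg :: "(nat => real) => 'a"
 proof -
  have "simplical_face 1 e = (%i. if i = 0 then 1 else 0)" by (auto simp: simplical_face_def e_def fun_eq_iff)
  then show ?thesis using e unfolding singular_face_def simplex_path_def pathstart_def by (auto intro!: arg_cong[of _ _ sg])
 qed
 have "chain_boundary 1 c = 0" using assms by (simp add: singular_cycle)
 then have "frag_extend (%tau. frag_of (tau e)) (frag_extend (%sg. frag_of (singular_face 1 0 sg) - frag_of (singular_face 1 1 sg)) c) = 0"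
  by (simp add: chain_boundary_def)
 then have "frag_extend (%tau. frag_of (tau e)) (\<Sum>sg\<in>keys c. frag_cmul (lookup c sg)
   (frag_of (singular_face 1 0 sg) - frag_of (singular_face 1 1 sg))) = 0" by (simp only: frag_extend_def[of _ c])
 also have "frag_extend (%tau. frag_of (tau e)) (\<Sum>sg\<in>keys c. frag_cmul (lookup c sg)
   (frag_of (singular_face 1 0 sg) - frag_of (singular_face 1 1 sg))) = (\<Sum>sg\<in>keys c. frag_cmul (lookup c sg)
   (frag_of (singular_face 1 0 sg e) - frag_of (singular_face 1 1 sg e)))"
  by (subst frag_extend_sum) (auto simp only: finite_keys o_def frag_extend_cmul frag_extend_diff frag_extend_of)
 finally show ?thesis by (simp only: s0 s1)
qed

lemma prin_cmul: "E \<in> prin ==> frag_cmul k E \<in> prin"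
proof (cases k rule: int_cases2)
 case (nonneg n)
 have "E \<in> prin ==> frag_cmul (int n) E \<in> prin"
  by (induction n) (auto simp: frag_cmul_distrib intro: prin_0 prin_add)
 then show "E \<in> prin ==> ?thesis" using nonneg by simp
next
 case (nonpos n)
 have "E \<in> prin ==> frag_cmul (int n) E \<in> prin"
  by (induction n) (auto simp: frag_cmul_distrib intro: prin_0 prin_add)
 moreover assume "E \<in> prin"
 ultimately show ?thesis using nonpos prin_uminus by fastforce
qed

text \<open>The homomorphism sends the integral over a cycle to the class of its end points with
  multiplicities, and these cancel. What homology contributes is the vanishing of the
  boundary.\<close>

lemma period_exp: assumes card: "CARD('n::enum) = g + 1" and E: "exp_like (E :: (complex, 'n) vec => divisor)"
  and l: "l \<in> period_lattice f" shows "E l \<in> prin"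
proof -
 obtain c C where C: "C \<in> carrier (homology_group 1 (top_of_set (curve f)))" "c \<in> C"
  and v: "\<And>sg. sg \<in> keys c ==> valid_path (simplex_path sg)"
  and l: "l = (\<Sum>sg\<in>keys c. of_int (lookup c sg) *s omega_integral f (simplex_path sg))"
  using l unfolding period_lattice_def by blast
 obtain c' where c': "singular_relcycle 1 (top_of_set (curve f)) {} c'" "homologous_rel 1 (top_of_set (curve f)) {} c' c"
  using C carrier_relative_homology_group[of 1 "top_of_set (curve f)" "{}"] by auto
 then have cyc: "singular_relcycle 1 (top_of_set (curve f)) {} c" using homologous_rel_singular_relcycle_1 by blast
 have im: "path_image (simplex_path sg) \<subseteq> curve f" if "sg \<in> keys c" for sg
 proof -
  have "singular_simplex 1 (top_of_set (curve f)) sg" using cyc that by (auto simp: singular_cycle singular_chain_def)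
  then have "sg x \<in> curve f" if "x \<in> standard_simplex 1" for x
   using that by (auto simp: singular_simplex_def continuous_map_def Pi_iff topspace_standard_simplex)
  moreover have "(%i. if i = 0 then 1 - t else if i = 1 then t else 0) \<in> standard_simplex 1"
   if "t \<in> {0..1}" for t :: real using that by (auto simp: standard_simplex_def)
  ultimately show ?thesis by (auto simp: path_image_def simplex_path_def)
 qed
 let ?K = "keys c" and ?c = "lookup c" and ?w = "%sg. omega_integral f (simplex_path sg) :: (complex, 'n) vec"
  and ?d = "%sg. frag_of (pathfinish (simplex_path sg)) - frag_of (pathstart (simplex_path sg))"
 have 1: "E l - (\<Sum>sg\<in>?K. E (of_int (?c sg) *s ?w sg)) \<in> prin" unfolding l by (rule exp_sum[OF E])
 have 2: "(\<Sum>sg\<in>?K. E (of_int (?c sg) *s ?w sg) - frag_cmul (?c sg) (E (?w sg))) \<in> prin" by (intro prin_sum exp_of_int E)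
 have 3: "(\<Sum>sg\<in>?K. frag_cmul (?c sg) (E (?w sg) - ?d sg)) \<in> prin" by (intro prin_sum prin_cmul path_exp[OF card E] v im)
 have cm: "frag_cmul k (X - Y) = frag_cmul k X - frag_cmul k Y" for k and X Y :: divisor
  by (rule poly_mapping_eqI) (simp add: lookup_minus algebra_simps)
 have "(\<Sum>sg\<in>?K. frag_cmul (?c sg) (E (?w sg) - ?d sg)) =
  (\<Sum>sg\<in>?K. frag_cmul (?c sg) (E (?w sg))) - (\<Sum>sg\<in>?K. frag_cmul (?c sg) (?d sg))"
  by (simp only: cm[of _ "E _" "?d _"] sum_subtractf)
 then have 4: "(\<Sum>sg\<in>?K. frag_cmul (?c sg) (E (?w sg))) \<in> prin" using 3 cycle_boundary[OF cyc] by (simp only: diff_zero)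
 have "X - Y + (Y - Z) + Z = X" for X Y Z :: divisor by simp
 then show ?thesis using prin_add[OF prin_add[OF 1 2[unfolded sum_subtractf]] 4] by (simp only:)
qed

text \<open>Existence in the definite description is witnessed by \<open>D\<close> and the period 0.
  For uniqueness, suppose the integrals of \<open>D\<close> and \<open>D'\<close> differ by a
  period: \<open>E\<close> takes a principal value on the difference, and \<open>E\<close> recovers
  the classes of \<open>D\<close> and \<open>D'\<close> from their integrals.\<close>

theorem jac_proj_eq: assumes card: "CARD('n::enum) = g + 1" and D: "divisor_integral f D (u :: (complex, 'n) vec)"
 shows "jac_proj g f u = modulus_equiv g f `` {D}"
proof -
 define E where "E = (abel_exp :: (complex, 'n) vec => divisor)"
 have E: "exp_like E" unfolding E_def by (rule exp_like_abel_exp[OF card])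
 note eq = equiv_modulus_equiv
 have D0: "D \<in> divisors0 f" by (rule divisor_integral_divisors0[OF D])
 show ?thesis unfolding jac_proj_def
 proof (rule the_equality)
  show "modulus_equiv g f `` {D} \<in> gen_jacobian g f \<and>
   (\<exists>E\<in>modulus_equiv g f `` {D}. \<exists>z. divisor_integral f E z \<and> u - z \<in> period_lattice f)"
   using D period_lattice_0 D0 by (auto simp: gen_jacobian_def quotientI modulus_equiv_iff prin_0 intro!: bexI[of _ D] exI[of _ u])
 next
  fix c assume c: "c \<in> gen_jacobian g f \<and> (\<exists>E\<in>c. \<exists>z. divisor_integral f E z \<and> u - z \<in> period_lattice f)"
  then obtain D' z where D': "D' \<in> c" "divisor_integral f D' z" "u - z \<in> period_lattice f" by blast
  have "E u - D \<in> prin" "E z - D' \<in> prin" "E (u - z) \<in> prin"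
   using divisor_integral_exp[OF card E] D D' period_exp[OF card E] by blast+
  then have "E (u - z) - (E u - E z) \<in> prin" "E (u - z) \<in> prin" "E u - D - (E z - D') \<in> prin"
   using exp_diff[OF E] prin_diff by blast+
  then have "E (u - z) - (E (u - z) - (E u - E z)) - (E u - D - (E z - D')) \<in> prin" using prin_diff by blast
  moreover have "X - (X - (Y - Z)) - (Y - D - (Z - D')) = D - D'" for X Y Z :: divisor by simp
  ultimately have "D - D' \<in> prin" by (simp only:)
  then have "(D, D') \<in> modulus_equiv g f" using D0 divisor_integral_divisors0[OF D'(2)] by (simp add: modulus_equiv_iff)
  then have 1: "modulus_equiv g f `` {D} = modulus_equiv g f `` {D'}" by (rule equiv_class_eq[OF eq])
  have "c \<in> divisors0 f // modulus_equiv g f" using c by (simp add: gen_jacobian_def)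
  then obtain x where x: "c = modulus_equiv g f `` {x}" by (rule quotientE)
  then have "modulus_equiv g f `` {x} = modulus_equiv g f `` {D'}" using D'(1) by (intro equiv_class_eq[OF eq]) simp
  then show "c = modulus_equiv g f `` {D}" using x 1 by simp
 qed
qed

lemma abel_jacobi_eq: assumes card: "CARD('n::enum) = g + 1" and D: "D - D0 \<in> divisors0 f"
 shows "abel_jacobi TYPE('n) g f D0 D = modulus_equiv g f `` {D - D0}" unfolding abel_jacobi_def
 by (intro jac_proj_eq card someI_ex[OF divisor_integral_exists[OF D]])

lemma jac_proj_eqI: assumes card: "CARD('n::enum) = g + 1" and "divisor_integral f D (u :: (complex, 'n) vec)"
  "divisor_integral f D' (u' :: (complex, 'n) vec)" "D - D' \<in> prin" shows "jac_proj g f u = jac_proj g f u'"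
 unfolding jac_proj_eq[OF card assms(2)] jac_proj_eq[OF card assms(3)]
 using assms by (intro equiv_class_eq[OF equiv_modulus_equiv]) (simp add: modulus_equiv_iff divisor_integral_divisors0)

lemma jac_proj_eqD: assumes card: "CARD('n::enum) = g + 1" and "divisor_integral f D (u :: (complex, 'n) vec)"
  "divisor_integral f D' (u' :: (complex, 'n) vec)" "jac_proj g f u = jac_proj g f u'" shows "D - D' \<in> prin"
 using assms(4) unfolding jac_proj_eq[OF card assms(2)] jac_proj_eq[OF card assms(3)]
 using eq_equiv_class[OF _ equiv_modulus_equiv divisor_integral_divisors0[OF assms(3)]] by (simp add: modulus_equiv_iff)

lemma jac_proj_diff_cong: assumes card: "CARD('n::enum) = g + 1" and "jac_proj g f u = jac_proj g f (u' :: (complex, 'n) vec)"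
 shows "jac_proj g f (u + w) = jac_proj g f (u' + w)"
proof -
 obtain D D' C where D: "divisor_integral f D u" "divisor_integral f D' u'" "divisor_integral f C w"
  using divisor_integral_surj[of u] divisor_integral_surj[of u'] divisor_integral_surj[of w] by blast
 have "D + C - (D' + C) \<in> prin" using jac_proj_eqD[OF card D(1,2) assms(2)] by simp
 then show ?thesis by (rule jac_proj_eqI[OF card divisor_integral_add[OF D(1,3)] divisor_integral_add[OF D(2,3)]])
qed

end

section \<open>Orders, boundedness and removable singularities\<close>

lemma meromorphic_factor: assumes "psi meromorphic_on {0::complex}" "\<exists>\<^sub>F t in at 0. psi t ~= 0"
 shows "\<exists>G. G analytic_on {0} \<and> G 0 ~= 0 \<and> (\<forall>\<^sub>F t in at 0. psi t = G t * t powi zorder psi 0)"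
proof -
 have "isolated_singularity_at psi 0" "not_essential psi 0"
  using assms(1) by (auto simp: meromorphic_on_isolated_singularity meromorphic_on_not_essential)
 from zorder_exist[OF this assms(2)] obtain r where r: "r > 0" "zor_poly psi 0 0 ~= 0" "zor_poly psi 0 holomorphic_on cball 0 r"
  "\<And>w. w \<in> cball 0 r - {0} ==> psi w = zor_poly psi 0 w * (w - 0) powi zorder psi 0" by blast
 have "zor_poly psi 0 holomorphic_on ball 0 r" using r(3) by (rule holomorphic_on_subset) auto
 then have "zor_poly psi 0 analytic_on {0}" using r(1) by (auto simp: analytic_on_def)
 moreover have "\<forall>\<^sub>F t in at 0. psi t = zor_poly psi 0 t * t powi zorder psi 0"
  unfolding eventually_at using r(1,4) by (intro exI[of _ r]) auto
 ultimately show ?thesis using r(2) by blast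
qed

lemma isCont_eventually_bounded: assumes "isCont (G :: complex => complex) z"
 shows "\<exists>M>0. \<forall>\<^sub>F t in at z. norm (G t) <= M"
proof -
 have "((%t. norm (G t)) \<longlongrightarrow> norm (G z)) (at z)" using assms by (intro tendsto_norm) (simp add: isCont_def)
 then have "\<forall>\<^sub>F t in at z. norm (G t) < norm (G z) + 1" by (rule order_tendstoD) simp
 then show ?thesis by (intro exI[of _ "norm (G z) + 1"]) (auto elim: eventually_mono intro: add_nonneg_pos)
qed

lemma zorder_bounded: assumes "psi meromorphic_on {0::complex}" "\<exists>\<^sub>F t in at 0. psi t ~= 0" "- int k <= zorder psi 0"
 shows "\<exists>M>0. \<forall>\<^sub>F t in at 0. norm (psi t * t ^ k) <= M"
proof -
 obtain G where G: "G analytic_on {0}" "\<forall>\<^sub>F t in at 0. psi t = G t * t powi zorder psi 0"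
  using meromorphic_factor[OF assms(1,2)] by blast
 define n where "n = nat (zorder psi 0 + int k)"
 have "isCont (%t. G t * t ^ n) 0" by (intro continuous_intros analytic_at_imp_isCont G)
 then obtain M where M: "M > 0" "\<forall>\<^sub>F t in at 0. norm (G t * t ^ n) <= M" using isCont_eventually_bounded by blast
 have "\<forall>\<^sub>F t in at 0. norm (psi t * t ^ k) <= M" using M(2) G(2) eventually_neq_at_within[of 0 0 UNIV]
 proof eventually_elim
  case (elim t)
  have "t powi zorder psi 0 * t ^ k = t powi (zorder psi 0 + int k)" using elim(3) by (simp add: power_int_add)
  also have "\<dots> = t ^ n" using assms(3) by (simp add: n_def power_int_def)
  finally show ?case using elim by (simp add: mult.assoc)
 qed
 then show ?thesis using M by blast
qed

lemma eventually_at_0_uminus: assumes "\<forall>\<^sub>F t in at 0. P t" shows "\<forall>\<^sub>F t in at (0 :: complex). P (- t)"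
 using assms unfolding eventually_at by (auto simp: dist_norm)

text \<open>At a branch point the involution acts on the parameter \<open>y\<close> as
  \<open>t -> - t\<close>. The odd part of a function regular there vanishes at 0, so it is at most
  of the size of \<open>t\<close>.\<close>

lemma zorder_nonneg_odd_part:
 assumes "psi meromorphic_on {0::complex}" "\<exists>\<^sub>F t in at 0. psi t ~= 0" "0 <= zorder psi 0"
 shows "\<exists>M>0. \<forall>\<^sub>F t in at 0. norm (psi t - psi (- t)) <= M * norm t"
proof -
 obtain G where G: "G analytic_on {0}" "\<forall>\<^sub>F t in at 0. psi t = G t * t powi zorder psi 0"
  using meromorphic_factor[OF assms(1,2)] by blast
 define h where "h = (%t. G t * t ^ nat (zorder psi 0))"
 have ev: "\<forall>\<^sub>F t in at 0. psi t = h t" using G(2) by eventually_elim (use assms(3) in \<open>simp add: h_def power_int_def\<close>)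
 then have ev': "\<forall>\<^sub>F t in at 0. psi (- t) = h (- t)" by (rule eventually_at_0_uminus)
 have "h analytic_on {0}" unfolding h_def by (intro analytic_intros G)
 then have dh: "DERIV h 0 :> deriv h 0"
  by (metis analytic_at_imp_isCont analytic_on_imp_differentiable_at DERIV_deriv_iff_field_differentiable insertI1)
 then have "DERIV (%t. h t - h (- t)) 0 :> 2 * deriv h 0"
  by (auto intro!: derivative_eq_intros DERIV_chain2[of h _ "%t. - t"])
 then have "((%t. (h t - h (- t)) / t) \<longlongrightarrow> 2 * deriv h 0) (at 0)" by (simp add: DERIV_def)
 then have "((%t. norm ((h t - h (- t)) / t)) \<longlongrightarrow> norm (2 * deriv h 0)) (at 0)" by (rule tendsto_norm)
 then have "\<forall>\<^sub>F t in at 0. norm ((h t - h (- t)) / t) < norm (2 * deriv h 0) + 1" by (rule order_tendstoD) simp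
 then have "\<forall>\<^sub>F t in at 0. norm (psi t - psi (- t)) <= (norm (2 * deriv h 0) + 1) * norm t"
  using ev ev' eventually_neq_at_within[of 0 0 UNIV] by eventually_elim (simp add: norm_divide field_simps)
 then show ?thesis by (intro exI[of _ "norm (2 * deriv h 0) + 1"]) (auto intro: add_nonneg_pos)
qed

text \<open>A leading term of odd order changes sign under \<open>t -> - t\<close>, so it survives
  in the odd part.\<close>

lemma odd_zorder_not_even: assumes "psi meromorphic_on {0::complex}" "\<exists>\<^sub>F t in at 0. psi t ~= 0" "odd (zorder psi 0)"
 shows "\<forall>\<^sub>F t in at 0. psi t ~= psi (- t)"
proof -
 obtain G where G: "G analytic_on {0}" "G 0 ~= 0" "\<forall>\<^sub>F t in at 0. psi t = G t * t powi zorder psi 0"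
  using meromorphic_factor[OF assms(1,2)] by blast
 have ev': "\<forall>\<^sub>F t in at 0. psi (- t) = G (- t) * (- t) powi zorder psi 0" using G(3) by (rule eventually_at_0_uminus)
 have "isCont G 0" using G by (simp add: analytic_at_imp_isCont)
 then have "isCont (%t. G t + G (- t)) 0" by (auto intro!: continuous_intros isCont_o2[of _ uminus])
 then have "((%t. G t + G (- t)) \<longlongrightarrow> 2 * G 0) (at 0)" by (simp add: isCont_def)
 then have "\<forall>\<^sub>F t in at 0. G t + G (- t) ~= 0" by (rule tendsto_imp_eventually_ne) (use G(2) in simp)
 then show ?thesis using G(3) ev' eventually_neq_at_within[of 0 0 UNIV]
 proof eventually_elim
  case (elim t)
  have "psi t - psi (- t) = (G t + G (- t)) * t powi zorder psi 0" using elim assms(3) by (simp add: power_int_minus_left algebra_simps)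
  then show ?case using elim by auto
 qed
qed

lemma remove_sings_holomorphic: assumes "r > 0" "h holomorphic_on ball z r" "\<And>w. w \<in> ball z r - {z} ==> K w = h w"
 shows "w \<in> ball z r ==> remove_sings K w = h w" "remove_sings K holomorphic_on ball z r"
proof -
 show *: "remove_sings K w = h w" if w: "w \<in> ball z r" for w
 proof (rule remove_sings_eqI)
  have "isCont h w" using assms(2) w by (metis continuous_on_eq_continuous_at holomorphic_on_imp_continuous_on open_ball)
  then have "(h \<longlongrightarrow> h w) (at w)" by (simp add: isCont_def)
  moreover have "\<forall>\<^sub>F x in at w. x \<in> ball z r - {z}"
  proof -
   have "\<forall>\<^sub>F x in at w. x \<in> ball z r" using w by (intro eventually_at_in_open') auto
   moreover have "\<forall>\<^sub>F x in at w. x ~= z" by (rule eventually_neq_at_within)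
   ultimately show ?thesis by eventually_elim simp
  qed
  then have "\<forall>\<^sub>F x in at w. h x = K x" by eventually_elim (simp add: assms(3))
  ultimately show "(K \<longlongrightarrow> h w) (at w)" by (rule Lim_transform_eventually)
 qed
 show "remove_sings K holomorphic_on ball z r" using assms(2) by (rule holomorphic_transform) (simp add: *)
qed

text \<open>Away from \<open>S\<close> boundedness makes the singularities of \<open>F\<close>
  removable. The resulting function is holomorphic off \<open>S\<close> and bounded near
  \<open>S\<close>, hence extends to an entire function that tends to 0. In the application
  \<open>S\<close> consists of the roots of \<open>f\<close>, at which only boundedness is
  established.\<close>

lemma meromorphic_bounded_vanishing:
 fixes F :: "complex => complex" assumes S: "finite S" and mero: "\<And>z. z \<notin> S ==> F meromorphic_on {z}"
  and bd: "\<And>z. \<exists>M. \<forall>\<^sub>F w in at z. norm (F w) <= M" and lim: "(F \<longlongrightarrow> 0) at_infinity" and z: "z \<notin> S"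
 shows "\<forall>\<^sub>F w in at z. F w = 0"
proof -
 \<comment> \<open>\<open>remove_sings\<close> replaces values by limits, since the value of
   \<open>F\<close> at an isolated point carries no information.\<close>
 define K where "K = remove_sings F"
 have regular: "\<exists>r>0. K holomorphic_on ball z r \<and> (\<forall>w\<in>ball z r - {z}. F w = K w) \<and> (F \<longlongrightarrow> K z) (at z)" if z: "z \<notin> S" for z
 proof -
  obtain r where r: "r > 0" "F analytic_on ball z r - {z}"
   using mero[OF z] by (auto simp: isolated_singularity_at_def dest!: meromorphic_on_isolated_singularity)
  then have "F holomorphic_on ball z r - {z}" by (simp add: analytic_imp_holomorphic)
  then obtain h where h: "h holomorphic_on ball z r" "\<forall>w\<in>ball z r - {z}. h w = F w"
   using holomorphic_on_extend_bounded[of F "ball z r" z] bd[of z] r(1) by auto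
  have K: "w \<in> ball z r ==> K w = h w" "K holomorphic_on ball z r" for w
   using remove_sings_holomorphic[OF r(1) h(1), of F] h(2) unfolding K_def by auto
  have "isCont K z" using K(2) r(1) by (metis centre_in_ball continuous_on_eq_continuous_at holomorphic_on_imp_continuous_on open_ball)
  then have "(K \<longlongrightarrow> K z) (at z)" by (simp add: isCont_def)
  moreover have "\<forall>\<^sub>F w in at z. K w = F w"
   unfolding eventually_at using r(1) K(1) h(2) by (intro exI[of _ r]) (auto simp: dist_commute)
  ultimately have "(F \<longlongrightarrow> K z) (at z)" by (rule Lim_transform_eventually)
  then show ?thesis using r(1) K h(2) by (intro exI[of _ r]) auto
 qed
 have Kbd: "norm (K w) <= M" if "w \<notin> S" "\<forall>\<^sub>F x in at w. norm (F x) <= M" for w M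
  using regular[OF that(1)] that(2) by (auto intro!: tendsto_upperbound[OF tendsto_norm])
 have ext: "\<exists>r>0. \<exists>h. h holomorphic_on ball z r \<and> (\<forall>w\<in>ball z r - {z}. K w = h w)" for z
 proof (cases "z \<in> S")
  case False
  then show ?thesis using regular[OF False] by auto
 next
  case True
  obtain M where "\<forall>\<^sub>F w in at z. norm (F w) <= M" using bd by blast
  then obtain r1 where r1: "r1 > 0" "\<And>w. w ~= z ==> dist w z < r1 ==> norm (F w) <= M" by (auto simp: eventually_at)
  obtain r2 where r2: "r2 > 0" "\<And>w. w \<in> S ==> w ~= z ==> r2 <= dist z w"
   using finite_set_avoid[OF S, of z] by blast
  define r where "r = min r1 r2"
  have r: "r > 0" using r1 r2 by (simp add: r_def)
  have off: "w \<notin> S" if "w \<in> ball z r - {z}" for w using r2(2)[of w] that by (auto simp: r_def)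
  have "K field_differentiable (at w within ball z r - {z})" if w: "w \<in> ball z r - {z}" for w
   using regular[OF off[OF w]] by (metis centre_in_ball field_differentiable_at_within holomorphic_on_imp_differentiable_at open_ball)
  then have hol: "K holomorphic_on ball z r - {z}" by (simp add: holomorphic_on_def)
  have "norm (K w) <= M" if w: "w \<in> ball z r - {z}" for w
  proof (rule Kbd[OF off[OF w]])
   have "\<forall>\<^sub>F x in at w. x \<in> ball z r - {z}" using w by (intro eventually_at_in_open') auto
   then show "\<forall>\<^sub>F x in at w. norm (F x) <= M" by eventually_elim (use r1 in \<open>auto simp: r_def dist_commute\<close>)
  qed
  then have "\<forall>\<^sub>F w in at z. norm (K w) <= M"
   unfolding eventually_at using r by (intro exI[of _ r]) (auto simp: dist_commute)
  then obtain h where "h holomorphic_on ball z r" "\<forall>w\<in>ball z r - {z}. h w = K w"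
   using holomorphic_on_extend_bounded[OF hol] r by auto
  then show ?thesis using r by (intro exI[of _ r] conjI exI[of _ h]) auto
 qed
 define G where "G = remove_sings K"
 have G: "\<exists>r>0. G holomorphic_on ball z r" for z using ext[of z] remove_sings_holomorphic(2)[of _ _ z K] unfolding G_def by blast
 have "G field_differentiable (at z)" for z using G[of z] by (metis centre_in_ball holomorphic_on_imp_differentiable_at open_ball)
 then have holG: "G holomorphic_on UNIV" by (simp add: holomorphic_on_def)
 have GK: "G z = K z" if zS: "z \<notin> S" for z
 proof -
  obtain r where "r > 0" "K holomorphic_on ball z r" using regular[OF zS] by blast
  then have "K analytic_on {z}" by (auto simp: analytic_on_def)
  then show ?thesis by (simp add: G_def)
 qed
 have "(G \<longlongrightarrow> 0) at_infinity" unfolding tendsto_iff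
 proof (intro allI impI)
  fix e :: real assume e: "e > 0"
  then have "\<forall>\<^sub>F w in at_infinity. dist (F w) 0 < e / 2" using lim by (intro tendstoD) auto
  then obtain R where R: "\<And>w. R <= norm w ==> norm (F w) < e / 2" by (auto simp: eventually_at_infinity)
  obtain R' where R': "\<And>w. w \<in> S ==> norm w <= R'" using finite_imp_bounded[OF S] by (auto simp: bounded_iff)
  have "norm (G w) < e" if w: "max R R' + 1 <= norm w" for w
  proof -
   have wS: "w \<notin> S" using R' w by fastforce
   have "\<forall>\<^sub>F x in at w. x \<in> {x. R < norm x}" using w by (intro eventually_at_in_open' open_Collect_less continuous_intros) auto
   then have "\<forall>\<^sub>F x in at w. norm (F x) <= e / 2" by eventually_elim (use R in \<open>auto intro: less_imp_le\<close>)
   then have "norm (K w) <= e / 2" by (rule Kbd[OF wS])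
   then show ?thesis using GK[OF wS] e by simp
  qed
  then show "\<forall>\<^sub>F w in at_infinity. dist (G w) 0 < e" unfolding eventually_at_infinity by auto
 qed
 then have G0: "G w = 0" for w by (rule Liouville_weak[OF holG])
 have "\<forall>\<^sub>F w in at z. w \<notin> S"
  using S z by (intro eventually_at_in_open'[of "- S", simplified]) (auto simp: finite_imp_closed)
 moreover have "\<forall>\<^sub>F w in at z. F w = K w"
  using regular[OF z] unfolding eventually_at by (auto simp: dist_commute)
 ultimately show ?thesis by eventually_elim (use GK G0 in auto)
qed

lemma order_le_imp_dvd:
 fixes p q :: "complex poly" assumes "p ~= 0" "\<And>a. order a p <= order a q" shows "p dvd q" using assms
proof (induction "degree p" arbitrary: p q)
 case 0
 then obtain c where "p = [:c:]" by (metis degree_eq_zeroE)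
 moreover from this have "c ~= 0" using 0 by auto
 ultimately show ?case by (intro dvdI[of _ _ "smult (1 / c) q"]) simp
next
 case (Suc n)
 show ?case
 proof (cases "q = 0")
  case False
  obtain a where a: "poly p a = 0" using Suc.hyps(2) fundamental_theorem_of_algebra[of p] by (auto simp: constant_degree)
  then obtain p1 where p1: "p = [:-a, 1:] * p1" by (auto simp: poly_eq_0_iff_dvd dvd_def)
  have "order a q > 0" using Suc.prems a order_root[of p a] by (metis gr0I le_zero_eq)
  then have "poly q a = 0" using order_root by auto
  then obtain q1 where q1: "q = [:-a, 1:] * q1" by (auto simp: poly_eq_0_iff_dvd dvd_def)
  have nz: "p1 ~= 0" "q1 ~= 0" using Suc.prems False p1 q1 by auto
  have "degree ([:-a, 1:] * p1) = 1 + degree p1" using nz by (subst degree_mult_eq) auto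
  then have "degree p1 = n" using Suc.hyps(2) p1 by simp
  moreover have "order b p1 <= order b q1" for b
  proof -
   have *: "r ~= 0 ==> order b ([:-a, 1:] * r) = order b [:-a, 1:] + order b r" for r
    by (rule order_mult) (simp del: mult_pCons_left)
   have "order b ([:-a, 1:] * p1) <= order b ([:-a, 1:] * q1)" using Suc.prems(2)[of b] by (simp only: p1 q1)
   then show ?thesis by (simp only: *[OF nz(1)] *[OF nz(2)])
  qed
  ultimately have "p1 dvd q1" using Suc.hyps(1)[of p1 q1] nz by blast
  then show ?thesis unfolding p1 q1 by (intro mult_dvd_mono dvd_refl)
 qed simp
qed

lemma monic_dvd_antisym:
 fixes p q :: "complex poly" assumes "lead_coeff p = 1" "lead_coeff q = 1" "p dvd q" "q dvd p" shows "p = q"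
proof -
 obtain r where r: "q = p * r" using assms(3) by (auto simp: dvd_def)
 have nz: "p ~= 0" "q ~= 0" using assms by auto
 then have "degree q = degree p + degree r" using r by (auto intro: degree_mult_eq)
 moreover have "degree q <= degree p" using assms(4) nz(1) by (rule dvd_imp_degree_le)
 ultimately have "degree r = 0" by simp
 then obtain c where "r = [:c:]" by (metis degree_eq_zeroE)
 moreover have "lead_coeff r = 1" using assms r by (simp add: lead_coeff_mult)
 ultimately show ?thesis using r by simp
qed

section \<open>Triples of polynomials and semireduced divisors\<close>

context hyperelliptic
begin

definition triple :: "complex poly => complex poly => complex poly => bool" where
 "triple U V W \<longleftrightarrow> lead_coeff U = 1 \<and> degree U = g + 1 \<and> lead_coeff W = 1 \<and> degree W = g + 1 \<and>
   degree V <= g \<and> V\<^sup>2 + U * W = f"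

text \<open>The condition of \<open>Div0\<close> on conjugate points, separated from the degree so
  that divisors can be built up point by point.\<close>

definition semireduced :: "divisor => bool" where
 "semireduced D \<longleftrightarrow> (\<forall>P\<in>keys D. hinv P \<in> keys D --> hinv P = P \<and> lookup D P = 1)"

lemma Div0_iff: "D \<in> Div0 g f \<longleftrightarrow> keys D \<subseteq> curve f \<and> (\<forall>P. 0 <= lookup D P) \<and>
  div_degree D = int g + 1 \<and> semireduced D" by (auto simp: Div0_def semireduced_def)

text \<open>Conjugate points on the graph of \<open>V\<close> coincide, so \<open>V(a) = 0\<close>.
  If \<open>a\<close> were a multiple root of \<open>U\<close>, then \<open>(x - a)^2\<close> would
  divide \<open>f - V^2\<close> and \<open>V^2\<close>, hence \<open>f\<close>.\<close>

lemma mdiv_semireduced: assumes U: "U ~= 0" "U dvd f - V\<^sup>2" shows "semireduced (mdiv U V)" unfolding semireduced_def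
proof (intro ballI impI)
 fix P assume P: "P \<in> keys (mdiv U V)" "hinv P \<in> keys (mdiv U V)"
 then obtain a where a: "poly U a = 0" "P = (a, poly V a)" "- poly V a = poly V a" unfolding keys_mdiv[OF U(1)] hinv_def by auto
 then have V0: "poly V a = 0" by (simp add: equal_neg_zero)
 have "order a U = 1"
 proof (rule ccontr)
  assume "order a U ~= 1"
  then have "2 <= order a U" using a(1) U(1) order_root[of U a] by linarith
  then have "[:-a, 1:]\<^sup>2 dvd U" using order_divides[of a 2 U] by simp
  then have "[:-a, 1:]\<^sup>2 dvd f - V\<^sup>2" using U(2) dvd_trans by blast
  moreover have "[:-a, 1:]\<^sup>2 dvd V\<^sup>2" using V0 by (simp add: poly_eq_0_iff_dvd dvd_power_same)
  ultimately have "[:-a, 1:]\<^sup>2 dvd f" by (simp add: dvd_diff_right_iff flip: dvd_add_right_iff[of _ "V\<^sup>2" "f - V\<^sup>2"])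
  then have 2: "2 <= order a f" using order_divides[of a 2 f] f_nz by simp
  moreover have "poly f a = 0" using 2 order_root[of f a] by auto
  ultimately show False using order_f by simp
 qed
 then show "hinv P = P \<and> lookup (mdiv U V) P = 1" using a V0 U(1) by (simp add: lookup_mdiv hinv_def)
qed

lemma triple_Div0: "triple U V W ==> mdiv U V \<in> Div0 g f"
proof -
 assume t: "triple U V W"
 then have U: "U ~= 0" "U dvd f - V\<^sup>2" by (auto simp: triple_def)
 then have "U dvd V\<^sup>2 - f" by (metis dvd_minus_iff minus_diff_eq)
 then show "mdiv U V \<in> Div0 g f" unfolding Div0_iff using mdiv_semireduced[OF U] keys_mdiv_subset_curve[of U V] U t
  by (auto simp: div_degree_mdiv triple_def lookup_mdiv)
qed

lemma effective_induct: assumes "\<And>P. 0 <= lookup D P" "div_degree D = int (Suc n)"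
 shows "\<exists>P E. D = frag_of P + E \<and> (\<forall>Q. 0 <= lookup E Q) \<and> div_degree E = int n \<and>
  P \<in> keys D \<and> keys E \<subseteq> keys D"
proof -
 obtain P where P: "P \<in> keys D"
  using assms(2) by (metis div_degree_def of_nat_Suc sum.empty ex_in_conv of_nat_0_eq_iff nat.distinct(1))
 then have "0 < lookup D P" using assms(1)[of P] by (simp add: in_keys_iff)
 then have "0 <= lookup (D - frag_of P) Q" for Q using assms(1)[of Q] by (simp add: lookup_minus lookup_single when_def)
 moreover have "keys (D - frag_of P) \<subseteq> keys D"
  using keys_diff_subset[of D "frag_of P"] P by auto
 ultimately show ?thesis using P assms(2)
  by (intro exI[of _ P] exI[of _ "D - frag_of P"]) (auto simp: div_degree_diff)
qed

lemma semireduced_mono: assumes "semireduced D" "\<And>P. 0 <= lookup E P" "\<And>P. lookup E P <= lookup D P" shows "semireduced E"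
 unfolding semireduced_def
proof (intro ballI impI)
 fix P assume P: "P \<in> keys E" "hinv P \<in> keys E"
 have "0 < lookup E P" "0 < lookup E (hinv P)" using P assms(2) by (auto simp: in_keys_iff order_less_le)
 moreover from this have "0 < lookup D P" "0 < lookup D (hinv P)"
  using assms(3) less_le_trans by blast+
 ultimately have "P \<in> keys D" "hinv P \<in> keys D" "0 < lookup E P"
  by (auto simp: in_keys_iff)
 moreover from this have "hinv P = P \<and> lookup D P = 1"
  using assms(1) unfolding semireduced_def by blast
 ultimately show "hinv P = P \<and> lookup E P = 1" using assms(3)[of P] by simp
qed

text \<open>Mumford's representation, built by adding one point \<open>(a, b)\<close> at a time.
  Replacing \<open>V\<close> by \<open>V + c U\<close> keeps the values over the roots of
  \<open>U\<close>; \<open>c\<close> has to give the value \<open>b\<close> at \<open>a\<close> and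
  make \<open>x - a\<close> divide the new \<open>W\<close>. For \<open>U(a)\<close> nonzero
  interpolation does both. For \<open>U(a) = 0\<close> semireducedness forces
  \<open>b = V(a)\<close> to be nonzero, and \<open>c = W(a) / (2 b)\<close> works.\<close>

lemma semireduced_mdiv_exists: assumes "keys D \<subseteq> curve f" "\<And>P. 0 <= lookup D P" "div_degree D = int n" "semireduced D"
 shows "\<exists>U V W. lead_coeff U = 1 \<and> V\<^sup>2 + U * W = f \<and> D = mdiv U V" using assms
proof (induction n arbitrary: D)
 case 0
 have "lookup D P = 0" for P
 proof (cases "P \<in> keys D")
  case True
  then show ?thesis using 0(2,3) sum_nonneg_eq_0_iff[OF finite_keys, of D "lookup D"] by (simp add: div_degree_def)
 qed (simp add: in_keys_iff)
 then have "D = mdiv 1 0" by (intro poly_mapping_eqI) simp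
 then show ?case by (intro exI[of _ 1] exI[of _ 0] exI[of _ f]) simp
next
 case (Suc n)
 obtain P E where PE: "D = frag_of P + E" "\<And>Q. 0 <= lookup E Q" "div_degree E = int n" "P \<in> keys D" "keys E \<subseteq> keys D"
  using effective_induct[OF Suc.prems(2,3)] by blast
 have DE: "lookup D Q = (if P = Q then 1 else 0) + lookup E Q" for Q unfolding PE(1) by (simp add: lookup_add lookup_single when_def)
 have "semireduced E" by (rule semireduced_mono[OF Suc.prems(4) PE(2)]) (simp add: DE)
 then obtain U V W where U: "lead_coeff U = 1" "V\<^sup>2 + U * W = f" "E = mdiv U V" using Suc.IH[of E] PE Suc.prems(1) by blast
 then have Unz: "U ~= 0" by auto
 obtain a b where P: "P = (a, b)" by force
 have b: "b\<^sup>2 = poly f a" using PE(4) Suc.prems(1) P by (auto simp: curve_def)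
 have "\<exists>c. poly (V + smult c U) a = b \<and> [:-a, 1:] dvd W - smult (2 * c) V - smult (c\<^sup>2) U"
 proof (cases "poly U a = 0")
  case False
  define c where "c = (b - poly V a) / poly U a"
  have 1: "poly (V + smult c U) a = b" using False by (simp add: c_def)
  have "poly U a * poly (W - smult (2 * c) V - smult (c\<^sup>2) U) a = poly f a - (poly (V + smult c U) a)\<^sup>2"
   unfolding U(2)[symmetric] by (simp add: algebra_simps power2_eq_square)
  then have "poly (W - smult (2 * c) V - smult (c\<^sup>2) U) a = 0" using False 1 b by simp
  then show ?thesis unfolding poly_eq_0_iff_dvd[symmetric] using 1 by blast
 next
  case True
  have f: "poly f a = (poly V a)\<^sup>2" unfolding U(2)[symmetric] by (simp add: True)
  have k: "(a, poly V a) \<in> keys E" unfolding U(3) keys_mdiv[OF Unz] using True by blast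
  then have pos: "0 < lookup E (a, poly V a)" using PE(2) by (simp add: in_keys_iff order_less_le)
  have "b ~= - poly V a \<or> b ~= 0 \<and> b = poly V a"
  proof (rule ccontr)
   assume "\<not> ?thesis"
   then have *: "b = - poly V a" "hinv (a, b) = (a, poly V a)" by (auto simp: hinv_def)
   have "hinv P \<in> keys D" using *(2) k PE(5) P by auto
   then have h: "hinv P = P \<and> lookup D P = 1" using Suc.prems(4) PE(4) unfolding semireduced_def by blast
   then have "(a, poly V a) = P" using *(2) P by simp
   then have "lookup D P \<ge> 2" using DE[of P] pos by simp
   then show False using h by simp
  qed
  then have bV: "b = poly V a" using b f by (auto simp: power2_eq_iff)
  have "b ~= 0"
  proof
   assume "b = 0"
   then have "hinv P = P" "P = (a, poly V a)" using P bV by (auto simp: hinv_def)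
   then have "lookup D P = 1" "lookup D P \<ge> 2" using Suc.prems(4) PE(4) DE[of P] pos unfolding semireduced_def by auto
   then show False by simp
  qed
  then have "poly (W - smult (2 * (poly W a / (2 * b))) V - smult ((poly W a / (2 * b))\<^sup>2) U) a = 0" using bV True by simp
  moreover have "poly (V + smult (poly W a / (2 * b)) U) a = b" using bV True by simp
  ultimately show ?thesis unfolding poly_eq_0_iff_dvd[symmetric] by blast
 qed
 then obtain c W' where c: "poly (V + smult c U) a = b" "W - smult (2 * c) V - smult (c\<^sup>2) U = [:-a, 1:] * W'"
  by (auto simp: dvd_def)
 have "(V + smult c U)\<^sup>2 + ([:-a, 1:] * U) * W' = (V + smult c U)\<^sup>2 + U * ([:-a, 1:] * W')" by (simp only: ac_simps)
 also have "\<dots> = f" unfolding c(2)[symmetric] U(2)[symmetric] by (rule poly_ext) (simp add: power2_eq_square algebra_simps)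
 finally have 1: "(V + smult c U)\<^sup>2 + ([:-a, 1:] * U) * W' = f" .
 have "mdiv ([:-a, 1:] * U) (V + smult c U) = mdiv [:-a, 1:] (V + smult c U) + mdiv U (V + smult c U)"
  by (rule mdiv_mult) (use Unz in auto)
 also have "mdiv U (V + smult c U) = mdiv U V" by (rule mdiv_cong) simp
 finally have 2: "D = mdiv ([:-a, 1:] * U) (V + smult c U)" using c(1) U(3) PE(1) P by (simp only: mdiv_linear)
 have "lead_coeff ([:-a, 1:] * U) = 1" by (simp only: lead_coeff_mult U(1)) simp
 then show ?case using 1 2 by blast
qed

text \<open>Reducing \<open>V\<close> modulo \<open>U\<close> leaves the divisor unchanged and
  lowers the degree to at most \<open>g\<close>. Then \<open>V^2\<close> has smaller degree than
  \<open>f\<close>, which fixes the degree and the leading coefficient of \<open>W\<close>.\<close>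

lemma Div0_triple: assumes "D \<in> Div0 g f" shows "\<exists>U V W. triple U V W \<and> D = mdiv U V"
proof -
 have D: "keys D \<subseteq> curve f" "\<And>P. 0 <= lookup D P" "div_degree D = int (g + 1)" "semireduced D"
  using assms by (auto simp: Div0_iff)
 obtain U V W where U: "lead_coeff U = 1" "V\<^sup>2 + U * W = f" "D = mdiv U V" using semireduced_mdiv_exists[OF D] by blast
 then have Unz: "U ~= 0" by auto
 have dU: "degree U = g + 1" using D(3) div_degree_mdiv[OF Unz] U(3) by simp
 define V' where "V' = V mod U"
 have VV': "V = V div U * U + V'" by (simp add: V'_def)
 have dV': "degree V' <= g" using degree_mod_less[OF Unz, of V] dU by (auto simp: V'_def)
 have "poly V a = poly V' a" if "poly U a = 0" for a using arg_cong[OF VV', of "%p. poly p a"] that by simp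
 then have D': "D = mdiv U V'" unfolding U(3) by (rule mdiv_cong)
 have "U dvd V - V'" by (metis VV' add_diff_cancel_right' dvd_triv_right)
 then have "U dvd (V - V') * (V + V')" by simp
 moreover have "f - V'\<^sup>2 = U * W + (V - V') * (V + V')" unfolding U(2)[symmetric]
  by (simp add: power2_eq_square algebra_simps)
 ultimately have "U dvd f - V'\<^sup>2" by simp
 then obtain W' where W': "f - V'\<^sup>2 = U * W'" by (auto simp: dvd_def)
 have d2: "degree (V'\<^sup>2) < degree f" using degree_power_le[of V' 2] dV' degree_f by simp
 have dd: "degree (f - V'\<^sup>2) = 2 * g + 2" using degree_add_eq_left[of "- (V'\<^sup>2)" f] d2 degree_f by simp
 have lc: "lead_coeff (f - V'\<^sup>2) = 1" unfolding dd using lead_f d2 degree_f by (simp add: coeff_eq_0)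
 have Wnz: "W' ~= 0" using W' lc by auto
 have "degree U + degree W' = 2 * g + 2" using dd W' degree_mult_eq[OF Unz Wnz] by simp
 moreover have "lead_coeff W' = 1" using lc W' U(1) by (simp add: lead_coeff_mult)
 moreover have "V'\<^sup>2 + U * W' = f" using W' by (metis add_diff_cancel_left' add.commute diff_add_cancel)
 ultimately have "triple U V' W'" using U(1) dU dV' by (simp add: triple_def)
 then show ?thesis using D' by blast
qed

text \<open>The multiplicities determine \<open>U\<close>. For \<open>V\<close> it is shown that
  \<open>U\<close> divides \<open>V - V'\<close>, whose degree is smaller. At a simple root equality
  of values is enough. At a multiple root \<open>V\<close> is nonzero by semireducedness, so
  \<open>V + V'\<close> does not vanish there and the divisibility of \<open>V^2 - V'^2\<close>
  passes to \<open>V - V'\<close>.\<close>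

lemma triple_unique: assumes t: "triple U V W" "triple U' V' W'" and eq: "mdiv U V = mdiv U' V'" shows "U = U' \<and> V = V' \<and> W = W'"
proof -
 have nz: "U ~= 0" "U' ~= 0" using t by (auto simp: triple_def)
 have lk: "(if b = poly V a then int (order a U) else 0) = (if b = poly V' a then int (order a U') else 0)" for a b
  using arg_cong[OF eq, of "%D. lookup D (a, b)"] by (simp only: lookup_mdiv[OF nz(1)] lookup_mdiv[OF nz(2)])
 have ord: "order a U = order a U'" for a using lk[of "poly V a" a] lk[of "poly V' a" a] by (auto split: if_splits)
 have UU: "U = U'" using order_le_imp_dvd[OF nz(1), of U'] order_le_imp_dvd[OF nz(2), of U] ord t
  by (intro monic_dvd_antisym) (auto simp: triple_def)
 have "U dvd V - V'"
 proof (cases "V = V'")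
  case False
  show ?thesis
  proof (rule order_le_imp_dvd[OF nz(1)])
   fix a
   show "order a U <= order a (V - V')"
   proof (cases "poly U a = 0")
    case True
    then have "order a U ~= 0" using nz(1) order_root by auto
    then have VV: "poly V a = poly V' a" using lk[of "poly V a" a] by (auto split: if_splits)
    then have 1: "1 <= order a (V - V')" using False order_root[of "V - V'" a] by (simp add: Suc_leI)
    show ?thesis
    proof (cases "order a U = 1")
     case False
     have "poly V a ~= 0"
     proof
      assume "poly V a = 0"
      then have "(a, 0) \<in> keys (mdiv U V)" unfolding keys_mdiv[OF nz(1)] using True by auto
      moreover have "semireduced (mdiv U V)" using triple_Div0[OF t(1)] by (simp add: Div0_iff)
      ultimately have "lookup (mdiv U V) (a, 0) = 1" by (auto simp: semireduced_def hinv_def)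
      then show False using False lookup_mdiv[OF nz(1), of V a 0] \<open>poly V a = 0\<close> by simp
     qed
     then have n0: "poly (V + V') a ~= 0" using VV by simp
     have "U * (W' - W) = (V - V') * (V + V')" using t UU by (simp add: triple_def power2_eq_square algebra_simps)
     then have "U dvd (V - V') * (V + V')" by (metis dvd_triv_left)
     moreover have nn: "(V - V') * (V + V') ~= 0" using n0 \<open>V ~= V'\<close> by (metis eq_iff_diff_eq_0 mult_eq_0_iff poly_0)
     ultimately have "order a U <= order a ((V - V') * (V + V'))" by (intro dvd_imp_order_le)
     also have "\<dots> = order a (V - V')" using nn n0 by (subst order_mult) (auto simp: order_0I)
     finally show ?thesis .
    qed (use 1 in simp)
   qed (simp add: order_0I)
  qed
 qed simp
 moreover have "degree (V - V') < degree U"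
  using t degree_diff_le[of V g V'] by (auto simp: triple_def)
 ultimately have VV: "V = V'" using dvd_imp_degree_le[of U "V - V'"] by (metis eq_iff_diff_eq_0 not_le)
 have "V\<^sup>2 + U * W = V\<^sup>2 + U * W'" using t UU VV by (simp only: triple_def)
 then have "U * W = U * W'" by (rule add_left_imp_eq)
 then show ?thesis using UU VV nz by simp
qed

end

section \<open>Equivalent divisors in \<open>Div0\<close> are equal\<close>

lemma eventually_poly_nonzero: assumes "p ~= (0 :: complex poly)" shows "\<forall>\<^sub>F x in at z. poly p x ~= 0"
proof -
 have "finite {x. poly p x = 0}" using assms by (rule poly_roots_finite)
 from finite_set_avoid[OF this, of z]
 obtain d where "d > 0" "\<And>x. x \<in> {x. poly p x = 0} ==> x ~= z ==> d <= dist z x" by blast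
 then have "d > 0" "\<And>x. x ~= z ==> dist x z < d ==> poly p x ~= 0"
  by (auto simp: dist_commute not_le[symmetric])
 then show ?thesis unfolding eventually_at by blast
qed

lemma isCont_eventually_nonzero:
 "isCont (G :: complex => complex) z ==> G z ~= 0 ==> \<forall>\<^sub>F t in at z. G t ~= 0"
 unfolding isCont_def by (rule tendsto_imp_eventually_ne)

context hyperelliptic
begin

lemma nonbranch_local_param: assumes ca: "chart_at (x0, y0) fst (%t. t) et (%t. 1 / et t) r eps"
 shows "local_param f (x0, y0) (%t. (x0 + t, et (x0 + t)))" "local_param f (x0, - y0) (%t. (x0 + t, - et (x0 + t)))"
  "et analytic_on {x0}" "et x0 = y0" "\<forall>\<^sub>F t in at x0. (et t)\<^sup>2 = poly f t"
proof -
 have ch: "chart (%t. t) et (%t. 1 / et t) (ball x0 r)" and r: "r > 0" and et: "et x0 = y0"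
  using ca by (auto simp: chart_at_def)
 show "et x0 = y0" by (rule et)
 show an: "et analytic_on {x0}" using chart_holomorphic(2)[OF ch] r by (auto simp: analytic_on_def)
 have "\<forall>\<^sub>F t in nhds x0. t \<in> ball x0 r" using r by (intro eventually_nhds_in_open) auto
 then have ev: "\<forall>\<^sub>F t in nhds x0. (et t)\<^sup>2 = poly f t"
  by eventually_elim (use ch in \<open>auto simp: chart_def\<close>)
 then show "\<forall>\<^sub>F t in at x0. (et t)\<^sup>2 = poly f t" by (simp add: eventually_nhds_conv_at)
 have "\<forall>\<^sub>F t in nhds 0. (et (x0 + t))\<^sup>2 = poly f (x0 + t)"
  using ev by (subst (asm) nhds_to_0) (simp add: eventually_filtermap add.commute)
 moreover have "deriv (%t. x0 + t) 0 = 1" by (rule DERIV_imp_deriv) (auto intro!: derivative_eq_intros)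
 moreover have "(%t. et (x0 + t)) analytic_on {0}"
  by (rule analytic_on_compose_gen[of "%t. x0 + t" _ et "{x0}", unfolded o_def]) (auto intro!: analytic_intros an)
 moreover have "(%t. x0 + t) analytic_on {0}" by (intro analytic_intros)
 ultimately show "local_param f (x0, y0) (%t. (x0 + t, et (x0 + t)))"
  "local_param f (x0, - y0) (%t. (x0 + t, - et (x0 + t)))"
  using et by (auto simp: local_param_def curve_def intro!: analytic_intros)
qed

text \<open>Besides the parameter \<open>s = y\<close>, this provides the passage from
  \<open>s\<close> to \<open>x\<close>: a point \<open>x\<close> close to \<open>x0\<close> is
  \<open>xi (csqrt (f x))\<close>, so what holds at \<open>xi s\<close> for all small nonzero
  \<open>s\<close> holds for all \<open>x\<close> near \<open>x0\<close>. The identity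
  \<open>xi (- s) = xi s\<close> expresses the involution.\<close>

lemma branch_local_param: assumes ca: "chart_at (x0, 0) snd xi (%t. t) rho r eps"
 shows "local_param f (x0, 0) (%s. (xi s, s))" "xi analytic_on {0}" "xi 0 = x0"
  "\<forall>\<^sub>F s in at 0. s\<^sup>2 = poly f (xi s) \<and> xi (- s) = xi s"
  "\<And>P. \<forall>\<^sub>F s in at 0. P (xi s) ==> \<forall>\<^sub>F x in at x0. P x"
proof -
 have ch: "chart xi (%t. t) rho (ball 0 r)" and r: "r > 0" "eps > 0" and xi: "xi 0 = x0"
  and near': "\<And>Q. Q \<in> curve f ==> dist Q (x0, 0) < eps ==> (xi (snd Q), snd Q) = Q"
  using ca by (auto simp: chart_at_def)
 then have near: "xi (snd Q) = fst Q" if "Q \<in> curve f" "dist Q (x0, 0) < eps" for Q using that by (metis fst_conv)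
 show "xi 0 = x0" by (rule xi)
 show an: "xi analytic_on {0}" using chart_holomorphic(1)[OF ch] r by (auto simp: analytic_on_def)
 have "\<forall>\<^sub>F s in nhds 0. s \<in> ball 0 r" using r by (intro eventually_nhds_in_open) auto
 then have ev: "\<forall>\<^sub>F s in nhds 0. s\<^sup>2 = poly f (xi s)"
  by eventually_elim (use ch in \<open>auto simp: chart_def\<close>)
 have "deriv (%s. s) (0::complex) = 1" by (rule DERIV_imp_deriv) (auto intro!: derivative_eq_intros)
 then show "local_param f (x0, 0) (%s. (xi s, s))" using ev xi an by (auto simp: local_param_def curve_def intro!: analytic_intros)
 have lim: "((%s. (xi s, - s)) \<longlongrightarrow> (xi 0, - 0)) (at 0)"
  using analytic_at_imp_isCont[OF an] by (intro tendsto_intros) (auto simp: isCont_def)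
 then have "\<forall>\<^sub>F s in at 0. dist (xi s, - s) (x0, 0) < eps" using r xi by (auto dest: tendstoD)
 moreover have "\<forall>\<^sub>F s in at 0. s\<^sup>2 = poly f (xi s)" using ev by (simp add: eventually_nhds_conv_at)
 ultimately show "\<forall>\<^sub>F s in at 0. s\<^sup>2 = poly f (xi s) \<and> xi (- s) = xi s"
 proof eventually_elim
  case (elim s)
  then show ?case using near[of "(xi s, - s)"] by (simp add: curve_def)
 qed
 fix P assume P: "\<forall>\<^sub>F s in at 0. P (xi s)"
 then obtain d where d: "d > 0" "\<And>s. s ~= 0 ==> norm s < d ==> P (xi s)"
  by (auto simp: eventually_at dist_norm)
 have f0: "poly f x0 = 0" using ev xi by (auto simp: eventually_nhds_conv_at)
 have "((%x. sqrt (norm (poly f x))) \<longlongrightarrow> sqrt (norm (poly f x0))) (at x0)" by (intro tendsto_intros)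
 then have c: "((%x. norm (csqrt (poly f x))) \<longlongrightarrow> 0) (at x0)" using f0 by simp
 then have "\<forall>\<^sub>F x in at x0. norm (csqrt (poly f x)) < d" using d by (intro order_tendstoD) auto
 moreover have "((%x. (x, csqrt (poly f x))) \<longlongrightarrow> (x0, 0)) (at x0)"
  using tendsto_norm_zero_cancel[OF c] by (intro tendsto_intros)
 then have "\<forall>\<^sub>F x in at x0. dist (x, csqrt (poly f x)) (x0, 0) < eps" using r by (auto dest: tendstoD)
 moreover have "\<forall>\<^sub>F x in at x0. poly f x ~= 0"
  by (rule eventually_poly_nonzero[OF f_nz])
 ultimately show "\<forall>\<^sub>F x in at x0. P x"
 proof eventually_elim
  case (elim x)
  have "xi (csqrt (poly f x)) = x" using near[of "(x, csqrt (poly f x))"] elim(2) by (simp add: curve_def)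
  then show ?case using d(2)[of "csqrt (poly f x)"] elim by simp
 qed
qed

lemma Div0_branch_order: assumes t: "triple U V W" and x: "poly f x = 0" shows "order x U <= 1"
proof (cases "poly U x = 0")
 case True
 have U: "U ~= 0" using t by (auto simp: triple_def)
 have "(poly V x)\<^sup>2 = poly f x" using t True by (auto simp: triple_def)
 then have V: "poly V x = 0" using x by simp
 then have "(x, 0) \<in> keys (mdiv U V)" unfolding keys_mdiv[OF U] using True by auto
 then have "lookup (mdiv U V) (x, 0) = 1" using triple_Div0[OF t] by (auto simp: Div0_iff semireduced_def hinv_def)
 then show ?thesis using lookup_mdiv[OF U, of V x 0] V by simp
qed (simp add: order_0I)

text \<open>The quotient \<open>(phi - phi o hinv) / y\<close> is invariant under the involution, so
  it is a function of \<open>x\<close> and independent of the choice of the square root. The factor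
  \<open>U\<close> clears its poles.\<close>

definition odd_part :: "(complex \<times> complex => complex) => complex poly => complex => complex" where
 "odd_part phi U x = (phi (x, csqrt (poly f x)) - phi (x, - csqrt (poly f x))) / csqrt (poly f x) * poly U x"

lemma odd_part_eq: "y\<^sup>2 = poly f x ==> odd_part phi U x = (phi (x, y) - phi (x, - y)) / y * poly U x"
proof -
 assume "y\<^sup>2 = poly f x"
 then have "y\<^sup>2 = (csqrt (poly f x))\<^sup>2" by simp
 then have "y = csqrt (poly f x) \<or> y = - csqrt (poly f x)" by (simp only: power2_eq_iff)
 moreover have "(a - b) / (- c) * d = (b - a) / c * d" for a b c d :: complex
  by (simp add: diff_divide_distrib)
 ultimately show ?thesis by (auto simp: odd_part_def)
qed

lemma mult_bounded:
 assumes "\<exists>M>0. \<forall>\<^sub>F t in F. norm (a t :: complex) <= M" "\<exists>M>0. \<forall>\<^sub>F t in F. norm (b t :: complex) <= M"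
 shows "\<exists>M. \<forall>\<^sub>F t in F. norm (a t * b t) <= M"
proof -
 obtain M N where "M > 0" "\<forall>\<^sub>F t in F. norm (a t) <= M" "N > 0" "\<forall>\<^sub>F t in F. norm (b t) <= N" using assms by blast
 then have "\<forall>\<^sub>F t in F. norm (a t * b t) <= M * N"
  by - (rule eventually_elim2, assumption+, auto simp: norm_mult intro!: mult_mono)
 then show ?thesis by blast
qed

lemma diff_bounded:
 assumes "\<exists>M>0. \<forall>\<^sub>F t in F. norm (a t :: complex) <= M" "\<exists>M>0. \<forall>\<^sub>F t in F. norm (b t :: complex) <= M"
 shows "\<exists>M>0. \<forall>\<^sub>F t in F. norm (a t - b t) <= M"
proof -
 obtain M N where "M > 0" "\<forall>\<^sub>F t in F. norm (a t) <= M" "N > 0" "\<forall>\<^sub>F t in F. norm (b t) <= N" using assms by blast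
 then have "\<forall>\<^sub>F t in F. norm (a t - b t) <= M + N"
  by - (rule eventually_elim2, assumption+, auto intro!: norm_triangle_le_diff)
 then show ?thesis using \<open>M > 0\<close> \<open>N > 0\<close> by (intro exI[of _ "M + N"]) auto
qed

context
 fixes phi E U V W assumes phi: "modulus_function g f phi E" and t: "triple U V W"
  and EU: "\<And>P. - lookup (mdiv U V) P <= lookup E P"
begin

lemma U_nz: "U ~= 0" using t by (auto simp: triple_def)

lemma modulusD: assumes "local_param f P c" "P \<in> curve f"
 shows "(%t. phi (c t)) meromorphic_on {0}" "\<exists>\<^sub>F t in at 0. phi (c t) ~= 0"
  "zorder (%t. phi (c t)) 0 = lookup E P" "- int (order (fst P) U) <= zorder (%t. phi (c t)) 0"
proof -
 show *: "(%t. phi (c t)) meromorphic_on {0}" "\<exists>\<^sub>F t in at 0. phi (c t) ~= 0"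
  "zorder (%t. phi (c t)) 0 = lookup E P" using phi assms unfolding modulus_function_def by blast+
 show "- int (order (fst P) U) <= zorder (%t. phi (c t)) 0"
  using *(3) EU[of P] lookup_mdiv[OF U_nz, of V "fst P" "snd P"] by (auto split: if_splits)
qed

text \<open>Over \<open>x0\<close> lie two points, each with a pole of order at most
  \<open>order x0 U\<close>, which the factor \<open>U\<close> cancels. If the odd part vanishes
  near \<open>x0\<close>, then \<open>phi\<close> takes equal values on the two sheets and so has
  equal orders.\<close>

lemma odd_part_nonbranch: assumes x0: "poly f x0 ~= 0"
 shows "odd_part phi U meromorphic_on {x0}" "\<exists>M. \<forall>\<^sub>F w in at x0. norm (odd_part phi U w) <= M"
  "\<forall>\<^sub>F w in at x0. odd_part phi U w = 0 ==> y0\<^sup>2 = poly f x0 ==>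
   lookup E (x0, y0) = lookup E (x0, - y0)"
proof -
 have main: "odd_part phi U meromorphic_on {x0} \<and> (\<exists>M. \<forall>\<^sub>F w in at x0. norm (odd_part phi U w) <= M) \<and>
  ((\<forall>\<^sub>F w in at x0. odd_part phi U w = 0) --> lookup E (x0, y0) = lookup E (x0, - y0))"
  if y0: "y0\<^sup>2 = poly f x0" for y0
 proof -
  have y00: "y0 ~= 0" using x0 y0 by auto
  have P: "(x0, y0) \<in> curve f" "(x0, - y0) \<in> curve f" using y0 by (auto simp: curve_def)
  obtain et r eps where ca: "chart_at (x0, y0) fst (%t. t) et (%t. 1 / et t) r eps"
   using nonbranch_chart[OF P(1) y00] by blast
  note lp = nonbranch_local_param[OF ca]
  define psi1 psi2 where "psi1 = (%t. phi (x0 + t, et (x0 + t)))" and "psi2 = (%t. phi (x0 + t, - et (x0 + t)))"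
  have m1: "psi1 meromorphic_on {0}" "\<exists>\<^sub>F t in at 0. psi1 t ~= 0" "zorder psi1 0 = lookup E (x0, y0)"
    "- int (order x0 U) <= zorder psi1 0"
   and m2: "psi2 meromorphic_on {0}" "\<exists>\<^sub>F t in at 0. psi2 t ~= 0" "zorder psi2 0 = lookup E (x0, - y0)"
    "- int (order x0 U) <= zorder psi2 0"
   using modulusD[OF lp(1) P(1)] modulusD[OF lp(2) P(2)] unfolding psi1_def psi2_def by simp_all
  have eq: "\<forall>\<^sub>F x in at x0. odd_part phi U x = (psi1 (x - x0) - psi2 (x - x0)) / et x * poly U x"
   using lp(5) by eventually_elim (simp add: odd_part_eq psi1_def psi2_def)
  have sh: "(%x. x - x0) analytic_on {x0}" "(%x. x - x0) ` {x0} \<subseteq> {0}" by (intro analytic_intros) simp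
  have "poly U analytic_on {x0}" by (intro analytic_intros)
  then have "poly U meromorphic_on {x0}" by (rule analytic_on_imp_meromorphic_on)
  moreover note meromorphic_on_compose[OF m1(1) sh] meromorphic_on_compose[OF m2(1) sh]
  ultimately have "(%x. (psi1 (x - x0) - psi2 (x - x0)) / et x * poly U x) meromorphic_on {x0}"
   by (intro meromorphic_on_mult meromorphic_on_divide meromorphic_on_diff analytic_on_imp_meromorphic_on[OF lp(3)])
  moreover have "odd_part phi U meromorphic_on {x0} \<longleftrightarrow> (%x. (psi1 (x - x0) - psi2 (x - x0)) / et x * poly U x) meromorphic_on {x0}"
   by (rule meromorphic_on_cong) (use eq in simp_all)
  ultimately have mer: "odd_part phi U meromorphic_on {x0}" by blast
  define k where "k = order x0 U"
  obtain R where R: "U = [:-x0, 1:] ^ k * R" using order_1[of x0 U] unfolding k_def by (auto simp: dvd_def)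
  have eq0: "\<forall>\<^sub>F s in at 0. odd_part phi U (s + x0) = (psi1 s - psi2 s) / et (s + x0) * poly U (s + x0)"
   using eq unfolding eventually_at_to_0[of _ x0] by simp
  have "\<exists>M>0. \<forall>\<^sub>F s in at 0. norm (psi1 s * s ^ k) <= M" "\<exists>M>0. \<forall>\<^sub>F s in at 0. norm (psi2 s * s ^ k) <= M"
   unfolding k_def by (rule zorder_bounded[OF m1(1,2,4)], rule zorder_bounded[OF m2(1,2,4)])
  then have 1: "\<exists>M>0. \<forall>\<^sub>F s in at 0. norm (psi1 s * s ^ k - psi2 s * s ^ k) <= M" by (rule diff_bounded)
  have "isCont (%s. et (s + x0)) 0"
  proof (rule isCont_o2[where g = et])
   show "isCont (%s. s + x0) 0" by (intro continuous_intros)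
   show "isCont et (0 + x0)" using analytic_at_imp_isCont[OF lp(3)] by simp
  qed
  then have "isCont (%s. poly R (s + x0) / et (s + x0)) 0" using lp(4) y00 by (intro continuous_intros) auto
  from mult_bounded[OF 1 isCont_eventually_bounded[OF this]]
  obtain M where "\<forall>\<^sub>F s in at 0. norm ((psi1 s * s ^ k - psi2 s * s ^ k) * (poly R (s + x0) / et (s + x0))) <= M" by blast
  then have "\<forall>\<^sub>F s in at 0. norm (odd_part phi U (s + x0)) <= M" using eq0
  proof eventually_elim
   case (elim s)
   have "odd_part phi U (s + x0) = (psi1 s * s ^ k - psi2 s * s ^ k) * (poly R (s + x0) / et (s + x0))"
    unfolding elim(2) by (subst R) (simp add: algebra_simps diff_divide_distrib)
   then show ?case using elim(1) by (simp only:)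
  qed
  then have bd: "\<exists>M. \<forall>\<^sub>F w in at x0. norm (odd_part phi U w) <= M" unfolding eventually_at_to_0[of _ x0] by blast
  have "lookup E (x0, y0) = lookup E (x0, - y0)" if z: "\<forall>\<^sub>F w in at x0. odd_part phi U w = 0"
  proof -
   have "\<forall>\<^sub>F s in at 0. odd_part phi U (s + x0) = 0" using z unfolding eventually_at_to_0[of _ x0] .
   moreover have "\<forall>\<^sub>F s in at 0. poly U (s + x0) ~= 0"
    using eventually_poly_nonzero[OF U_nz, of x0] unfolding eventually_at_to_0[of _ x0] .
   moreover have "\<forall>\<^sub>F s in at 0. et (s + x0) ~= 0"
    using \<open>isCont (%s. et (s + x0)) 0\<close> lp(4) y00 by (intro isCont_eventually_nonzero) auto
   ultimately have "\<forall>\<^sub>F s in at 0. psi1 s = psi2 s" using eq0 by eventually_elim auto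
   then have "zorder psi1 0 = zorder psi2 0" by (intro zorder_cong refl)
   then show ?thesis using m1(3) m2(3) by simp
  qed
  then show ?thesis using mer bd by blast
 qed
 show "odd_part phi U meromorphic_on {x0}" "\<exists>M. \<forall>\<^sub>F w in at x0. norm (odd_part phi U w) <= M"
  using main[of "csqrt (poly f x0)"] by auto
 show "lookup E (x0, y0) = lookup E (x0, - y0)" if "\<forall>\<^sub>F w in at x0. odd_part phi U w = 0" "y0\<^sup>2 = poly f x0"
  using main[OF that(2)] that(1) by blast
qed

text \<open>If \<open>U(x0)\<close> is nonzero, \<open>phi\<close> is regular at the branch point
  and its odd part is of the size of \<open>s = y\<close>, by which it is divided. Otherwise the
  root of \<open>U\<close> is simple by \<open>Div0_branch_order\<close>, \<open>phi\<close> has at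
  most a simple pole in \<open>s\<close>, and \<open>U\<close> contributes a factor
  \<open>s^2\<close>. An odd order of \<open>phi\<close> gives an odd leading term, so the odd part
  is nonzero.\<close>

lemma odd_part_branch: assumes x0: "poly f x0 = 0" shows "\<exists>M. \<forall>\<^sub>F w in at x0. norm (odd_part phi U w) <= M"
  "odd (lookup E (x0, 0)) ==> \<forall>\<^sub>F w in at x0. odd_part phi U w ~= 0"
proof -
 have P: "(x0, 0) \<in> curve f" using x0 by (auto simp: curve_def)
 obtain xi rho r eps where ca: "chart_at (x0, 0) snd xi (%t. t) rho r eps" using branch_chart[OF P] by blast
 note lp = branch_local_param[OF ca]
 define psi where "psi = (%s. phi (xi s, s))"
 have m: "psi meromorphic_on {0}" "\<exists>\<^sub>F t in at 0. psi t ~= 0" "zorder psi 0 = lookup E (x0, 0)"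
   "- int (order x0 U) <= zorder psi 0" using modulusD[OF lp(1) P] unfolding psi_def by simp_all
 have s0: "\<forall>\<^sub>F s :: complex in at 0. s ~= 0" by (rule eventually_neq_at_within)
 have eq: "\<forall>\<^sub>F s in at 0. odd_part phi U (xi s) = (psi s - psi (- s)) / s * poly U (xi s)"
  using lp(4) by eventually_elim (auto simp: odd_part_eq psi_def)
 have cxi: "isCont xi 0" using lp(2) by (rule analytic_at_imp_isCont)
 have "\<exists>M. \<forall>\<^sub>F s in at 0. norm (odd_part phi U (xi s)) <= M"
 proof (cases "order x0 U = 0")
  case True
  then have "0 <= zorder psi 0" using m(4) by simp
  from zorder_nonneg_odd_part[OF m(1,2) this]
  obtain M where M: "M > 0" "\<forall>\<^sub>F t in at 0. norm (psi t - psi (- t)) <= M * norm t" by blast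
  have "\<forall>\<^sub>F t in at 0. norm ((psi t - psi (- t)) / t) <= M"
   using M(2) s0 by eventually_elim (simp add: norm_divide field_simps)
  then have "\<exists>M>0. \<forall>\<^sub>F t in at 0. norm ((psi t - psi (- t)) / t) <= M" using M by blast
  moreover have "isCont (%s. poly U (xi s)) 0" using cxi by (intro continuous_intros)
  note isCont_eventually_bounded[OF this]
  ultimately have "\<exists>M. \<forall>\<^sub>F s in at 0. norm ((psi s - psi (- s)) / s * poly U (xi s)) <= M" by (rule mult_bounded)
  then obtain M where "\<forall>\<^sub>F s in at 0. norm ((psi s - psi (- s)) / s * poly U (xi s)) <= M" by blast
  then have "\<forall>\<^sub>F s in at 0. norm (odd_part phi U (xi s)) <= M" using eq by eventually_elim simp
  then show ?thesis by blast
 next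
  case False
  then have o: "order x0 U = 1" using Div0_branch_order[OF t x0] by simp
  then obtain R where R: "U = [:-x0, 1:] * R" using order_1[of x0 U] by (auto simp: dvd_def)
  obtain f1 where f1: "f = [:-x0, 1:] * f1" using x0 by (auto simp: poly_eq_0_iff_dvd dvd_def)
  have "pderiv f = [:-x0, 1:] * pderiv f1 + f1" unfolding f1 pderiv_mult by (simp add: pderiv_pCons)
  then have f10: "poly f1 x0 ~= 0" using pderiv_f_nz[OF x0] by simp
  have "\<exists>M>0. \<forall>\<^sub>F s in at 0. norm (psi s * s ^ 1) <= M" by (rule zorder_bounded[OF m(1,2)]) (use m(4) o in simp)
  then obtain M where M: "M > 0" "\<forall>\<^sub>F s in at 0. norm (psi s * s) <= M" by auto
  then have "\<forall>\<^sub>F s in at 0. norm (psi (- s) * - s) <= M" by (intro eventually_at_0_uminus)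
  then have "\<exists>M>0. \<forall>\<^sub>F s in at 0. norm (psi s * s - psi (- s) * s) <= M" using M by (intro diff_bounded) auto
  moreover have "isCont (%s. poly R (xi s) / poly f1 (xi s)) 0"
   using cxi f10 lp(3) by (intro continuous_intros) auto
  note isCont_eventually_bounded[OF this]
  ultimately have "\<exists>M. \<forall>\<^sub>F s in at 0. norm ((psi s * s - psi (- s) * s) * (poly R (xi s) / poly f1 (xi s))) <= M"
   by (rule mult_bounded)
  then obtain M where "\<forall>\<^sub>F s in at 0. norm ((psi s * s - psi (- s) * s) * (poly R (xi s) / poly f1 (xi s))) <= M" by blast
  moreover have "\<forall>\<^sub>F s in at 0. poly f1 (xi s) ~= 0"
  proof -
   have "isCont (%s. poly f1 (xi s)) 0" using cxi by (intro continuous_intros)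
   then show ?thesis using f10 lp(3) by (intro isCont_eventually_nonzero) auto
  qed
  ultimately have "\<forall>\<^sub>F s in at 0. norm (odd_part phi U (xi s)) <= M"
   using eq s0 lp(4)
  proof eventually_elim
   case (elim s)
   have "s\<^sup>2 = (xi s - x0) * poly f1 (xi s)" using elim(5) arg_cong[OF f1, of "%p. poly p (xi s)"] by (simp add: algebra_simps)
   then have "xi s - x0 = s\<^sup>2 / poly f1 (xi s)" using elim(2) by (simp add: field_simps)
   then have "poly U (xi s) = s\<^sup>2 / poly f1 (xi s) * poly R (xi s)" by (simp add: R flip: left_diff_distrib)
   then have "odd_part phi U (xi s) = (psi s * s - psi (- s) * s) * (poly R (xi s) / poly f1 (xi s))"
    unfolding elim(3) using elim(4) by (simp add: power2_eq_square algebra_simps diff_divide_distrib)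
   then show ?case using elim(1) by simp
  qed
  then show ?thesis by blast
 qed
 then obtain M where "\<forall>\<^sub>F s in at 0. norm (odd_part phi U (xi s)) <= M" by blast
 then have "\<forall>\<^sub>F w in at x0. norm (odd_part phi U w) <= M" by (rule lp(5))
 then show "\<exists>M. \<forall>\<^sub>F w in at x0. norm (odd_part phi U w) <= M" by blast
 assume "odd (lookup E (x0, 0))"
 then have "\<forall>\<^sub>F s in at 0. psi s ~= psi (- s)" using m(3) by (intro odd_zorder_not_even[OF m(1,2)]) simp
 moreover have "\<forall>\<^sub>F s in at 0. poly U (xi s) ~= 0"
 proof -
  have "\<forall>\<^sub>F x in at x0. poly U x ~= 0" by (rule eventually_poly_nonzero[OF U_nz])
  moreover have "filterlim xi (at x0) (at 0)"
   unfolding filterlim_at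
  proof
   show "\<forall>\<^sub>F s in at 0. xi s \<in> UNIV \<and> xi s ~= x0" using lp(4) s0 by eventually_elim (use x0 in auto)
  qed (use cxi lp(3) in \<open>simp add: isCont_def\<close>)
  ultimately show ?thesis by (rule eventually_compose_filterlim)
 qed
 ultimately have "\<forall>\<^sub>F s in at 0. odd_part phi U (xi s) ~= 0"
  using eq s0 by eventually_elim simp
 then show "\<forall>\<^sub>F w in at x0. odd_part phi U w ~= 0" by (rule lp(5))
qed

text \<open>In \<open>t = 1/x\<close> the factor \<open>U / y\<close> tends to 1, and
  \<open>phi\<close> tends to 1 at both points at infinity, so the difference in the odd part tends
  to 0. This is where the modulus enters.\<close>

lemma odd_part_infinity: "(odd_part phi U \<longlongrightarrow> 0) at_infinity"
proof -
 define q where "q = (%t. poly f (1 / t) * t ^ (2 * g + 2))"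
 have q: "(q \<longlongrightarrow> 1) (at 0)" using tendsto_poly_recip[of f "2 * g + 2"] lead_f degree_f by (simp add: q_def)
 have "((%t. csqrt (q t)) \<longlongrightarrow> csqrt 1) (at 0)"
  by (intro isCont_tendsto_compose[OF _ q] continuous_at_csqrt) (simp add: complex_nonpos_Reals_iff)
 then have cq: "((%t. csqrt (q t)) \<longlongrightarrow> 1) (at 0)" by simp
 have t0: "\<forall>\<^sub>F t :: complex in at 0. t ~= 0" by (rule eventually_neq_at_within)
 have sq: "(csqrt (q t) / t ^ (g + 1))\<^sup>2 = poly f (1 / t)" if "t ~= 0" for t
 proof -
  have "(t ^ (g + 1))\<^sup>2 = t ^ ((g + 1) * 2)" by (rule power_mult[symmetric])
  also have "(g + 1) * 2 = 2 * g + 2" by simp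
  finally show ?thesis using that unfolding power_divide power2_csqrt q_def by simp
 qed
 define c where "c = (%s t. (1 / t, s * (csqrt (q t) / t ^ (g + 1))))"
 have "infinity_param g f s (c s)" if "s \<in> {1, -1}" for s unfolding infinity_param_def
 proof
  show "\<forall>\<^sub>F t in at 0. fst (c s t) = 1 / t \<and> c s t \<in> curve f"
   using t0 by eventually_elim (use that sq in \<open>auto simp: c_def curve_def\<close>)
  have "((%t. s * csqrt (q t)) \<longlongrightarrow> s * 1) (at 0)" by (intro tendsto_intros cq)
  moreover have "\<forall>\<^sub>F t in at 0. s * csqrt (q t) = snd (c s t) * t ^ (g + 1)"
   using t0 by eventually_elim (simp add: c_def)
  ultimately have "((%t. snd (c s t) * t ^ (g + 1)) \<longlongrightarrow> s * 1) (at 0)" by (rule Lim_transform_eventually)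
  then show "((%t. snd (c s t) * t ^ (g + 1)) \<longlongrightarrow> s) (at 0)" by simp
 qed
 then have "((%t. phi (c 1 t)) \<longlongrightarrow> 1) (at 0)" "((%t. phi (c (-1) t)) \<longlongrightarrow> 1) (at 0)"
  using phi unfolding modulus_function_def by auto
 moreover have "((%t. poly U (1 / t) * t ^ (g + 1)) \<longlongrightarrow> 1) (at 0)"
  using tendsto_poly_recip[of U "g + 1"] t by (auto simp: triple_def)
 ultimately have "((%t. (phi (c 1 t) - phi (c (-1) t)) * (poly U (1 / t) * t ^ (g + 1)) / csqrt (q t)) \<longlongrightarrow> (1 - 1) * 1 / 1) (at 0)"
  by (intro tendsto_intros cq) auto
 moreover have "\<forall>\<^sub>F t in at 0. (phi (c 1 t) - phi (c (-1) t)) * (poly U (1 / t) * t ^ (g + 1)) / csqrt (q t) = (odd_part phi U \<circ> inverse) t"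
  using t0
 proof eventually_elim
  case (elim t)
  have "inverse t = 1 / t" by (simp add: inverse_eq_divide)
  then show ?case unfolding o_def c_def using elim odd_part_eq[OF sq[OF elim], of phi U] by (simp only:) (simp add: field_simps)
 qed
 ultimately have "((odd_part phi U \<circ> inverse) \<longlongrightarrow> (1 - 1) * 1 / 1) (at 0)" by (rule Lim_transform_eventually)
 then show ?thesis by (simp add: lim_at_infinity_0)
qed

text \<open>The odd part is bounded near every point and vanishes at infinity, so by Liouville it is
  zero near every abscissa that is not a root of \<open>f\<close>. Equal values on the two sheets
  give the first claim; an odd order at a branch point would make the odd part nonzero close
  by.\<close>

lemma divisor_even: assumes "P \<in> curve f" shows "lookup E (hinv P) = lookup E P" "snd P = 0 ==> even (lookup E P)"
proof -
 have fin: "finite {x. poly f x = 0}" using f_nz by (rule poly_roots_finite)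
 have bd: "\<exists>M. \<forall>\<^sub>F w in at z. norm (odd_part phi U w) <= M" for z
  using odd_part_nonbranch(2) odd_part_branch(1) by blast
 have van: "\<forall>\<^sub>F w in at z. odd_part phi U w = 0" if "poly f z ~= 0" for z
  by (rule meromorphic_bounded_vanishing[OF fin _ bd odd_part_infinity]) (use that odd_part_nonbranch(1) in auto)
 obtain x y where P: "P = (x, y)" "y\<^sup>2 = poly f x" using assms by (cases P) (auto simp: curve_def)
 show "lookup E (hinv P) = lookup E P"
 proof (cases "poly f x = 0")
  case False
  then show ?thesis using odd_part_nonbranch(3)[OF False van[OF False] P(2)] P by (simp add: hinv_def)
 qed (use P in \<open>simp add: hinv_def\<close>)
 show "even (lookup E P)" if "snd P = 0"
 proof (rule ccontr)
  assume "odd (lookup E P)"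
  then have x: "poly f x = 0" "odd (lookup E (x, 0))" using P that by auto
  from odd_part_branch(2)[OF this]
  obtain d1 where d1: "d1 > 0" "\<And>w. w ~= x ==> dist w x < d1 ==> odd_part phi U w ~= 0" by (auto simp: eventually_at)
  obtain d2 where d2: "d2 > 0" "\<And>w. w ~= x ==> dist w x < d2 ==> poly f w ~= 0"
   using eventually_poly_nonzero[OF f_nz, of x] by (auto simp: eventually_at)
  \<comment> \<open>Close to \<open>x\<close> but not a root of \<open>f\<close>: near
    \<open>x1\<close> the odd part would be both zero and nonzero.\<close>
  define x1 where "x1 = x + of_real (min d1 d2 / 2)"
  have x1: "x1 ~= x" "dist x1 x < d1" "dist x1 x < d2" using d1 d2 by (auto simp: x1_def dist_norm)
  have "\<forall>\<^sub>F w in at x1. w \<in> ball x d1 - {x}" using x1 by (intro eventually_at_in_open') (auto simp: dist_commute)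
  then have "\<forall>\<^sub>F w in at x1. False"
   using van[OF d2(2)[OF x1(1,3)]] by eventually_elim (use d1(2) in \<open>auto simp: dist_commute\<close>)
  then show False by simp
 qed
qed

end

text \<open>\<open>D - D'\<close> has equal coefficients at conjugate points and even ones at branch
  points. Each of \<open>D\<close>, \<open>D'\<close> contains at most one of two distinct conjugate
  points, which leaves no freedom off the branch points; at a branch point both coefficients are 0
  or 1 and differ by an even number.\<close>

theorem Div0_unique: assumes D: "D \<in> Div0 g f" "D' \<in> Div0 g f" and E: "D - D' \<in> prin" shows "D = D'"
proof -
 obtain U V W where t: "triple U V W" "D' = mdiv U V" using Div0_triple[OF D(2)] by blast
 obtain phi where phi: "modulus_function g f phi (D - D')" using E by (auto simp: prin_def)
 have pos: "0 <= lookup D P" "0 <= lookup D' P" for P using D unfolding Div0_iff by blast+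
 have EU: "- lookup (mdiv U V) P <= lookup (D - D') P" for P using pos[of P] t(2) by (simp add: lookup_minus)
 note even = divisor_even[OF phi t(1) EU]
 show ?thesis
 proof (rule poly_mapping_eqI)
  fix P
  show "lookup D P = lookup D' P"
  proof (cases "P \<in> curve f")
   case False
   then have "P \<notin> keys D" "P \<notin> keys D'" using D by (auto simp: Div0_iff)
   then show ?thesis by (simp add: in_keys_iff)
  next
   case True
   have sr: "hinv P = P \<and> lookup C P = 1" if "C \<in> Div0 g f" "0 < lookup C P" "0 < lookup C (hinv P)" for C P
   proof -
    have "P \<in> keys C" "hinv P \<in> keys C" using that(2,3) by (simp_all add: in_keys_iff)
    then show ?thesis using that(1) unfolding Div0_iff semireduced_def by blast
   qed
   show ?thesis
   proof (cases "snd P = 0")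
    case False
    then have ne: "hinv P ~= P" by (cases P) (auto simp: hinv_def)
    have "\<not> (0 < lookup D P \<and> 0 < lookup D (hinv P))" "\<not> (0 < lookup D' P \<and> 0 < lookup D' (hinv P))"
     using sr[OF D(1)] sr[OF D(2)] ne by blast+
    then show ?thesis using even(1)[OF True] pos[of P] pos[of "hinv P"] unfolding lookup_minus by arith
   next
    case y: True
    then have h: "hinv P = P" by (cases P) (auto simp: hinv_def)
    have "lookup C P <= 1" if "C \<in> Div0 g f" for C using sr[OF that, of P] h by (cases "0 < lookup C P") auto
    note this[OF D(1)] this[OF D(2)]
    moreover note pos[of P]
    moreover have "even (lookup D P - lookup D' P)"
     using even(2)[OF True y] by (simp only: lookup_minus)
    ultimately show ?thesis by presburger
   qed
  qed
 qed
qed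

end

section \<open>The phase space as a space of triples of polynomials\<close>

text \<open>The conventions in the change of variables: \<open>gam_sign\<close> records that the
  coordinates with \<open>i >= 1\<close> enter the polynomials with a minus sign, and
  \<open>gam_scale\<close> that \<open>gamma_(0,3)\<close> is
  \<open>(1 + m) omega_3\<close>.\<close>

definition gam_sign :: "nat => complex" where "gam_sign i = (if i = 0 then 1 else -1)"

definition gam_scale :: "real => nat => 3 => complex" where
 "gam_scale m i k = (if i = 0 \<and> k = 3 then 1 + of_real m else 1)"

lemma gam_eq: "gam m z i k = gam_scale m i k * z $ (ix i, k)" by (auto simp: gam_def gam_scale_def)

lemma gam_scale_nz: "m ~= -1 ==> gam_scale m i k ~= 0"
proof -
 assume "m ~= -1"
 then have "complex_of_real (1 + m) ~= 0" unfolding of_real_eq_0_iff by linarith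
 then show ?thesis by (simp add: gam_scale_def)
qed

lemma coeff_phase_poly: "coeff (monom (c 0) g - (\<Sum>i=1..g. monom (c i) (g - i))) n =
  (if n <= g then gam_sign (g - n) * c (g - n) else (0 :: complex))"
proof -
 have "coeff (\<Sum>i=1..g. monom (c i) (g - i)) n = (\<Sum>i\<in>{1..g}. if g - i = n then c i else 0)" by (simp add: coeff_sum)
 also have "\<dots> = (\<Sum>i\<in>{1..g}. if i = g - n then (if n < g then c i else 0) else 0)" by (rule sum.cong) auto
 also have "\<dots> = (if n < g then c (g - n) else 0)" by auto
 finally show ?thesis by (auto simp: gam_sign_def)
qed

lemma coeff_V: "coeff (V_poly g m z) n = (if n <= g then gam_sign (g - n) * gam m z (g - n) 1 else 0)"
 unfolding V_poly_def by (rule coeff_phase_poly)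

lemma coeff_U: "coeff (U_poly g m z) n = (if n = g + 1 then 1 else 0) +
  (if n <= g then gam_sign (g - n) * (gam m z (g - n) 3 - \<i> * gam m z (g - n) 2) else 0)"
 unfolding U_poly_def add_diff_eq[symmetric] coeff_add by (subst coeff_phase_poly[of "%i. gam m z i 3 - \<i> * gam m z i 2"]) auto

lemma coeff_W: "coeff (W_poly g m z) n = (if n = g + 1 then 1 else 0) +
  (if n <= g then gam_sign (g - n) * (gam m z (g - n) 3 + \<i> * gam m z (g - n) 2) else 0)"
 unfolding W_poly_def add_diff_eq[symmetric] coeff_add by (subst coeff_phase_poly[of "%i. gam m z i 3 + \<i> * gam m z i 2"]) auto

lemma degree_V: "degree (V_poly g m z) <= g" by (rule degree_le) (simp add: coeff_V)

lemma degree_U: "degree (U_poly g m z) = g + 1" and lead_coeff_U: "lead_coeff (U_poly g m z) = 1"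
proof -
 have "degree (U_poly g m z) <= g + 1" by (rule degree_le) (simp add: coeff_U)
 moreover have "coeff (U_poly g m z) (g + 1) = 1" by (simp add: coeff_U)
 ultimately show "degree (U_poly g m z) = g + 1" by (metis le_antisym le_degree zero_neq_one)
 then show "lead_coeff (U_poly g m z) = 1" by (simp add: coeff_U)
qed

lemma degree_W: "degree (W_poly g m z) = g + 1" and lead_coeff_W: "lead_coeff (W_poly g m z) = 1"
proof -
 have "degree (W_poly g m z) <= g + 1" by (rule degree_le) (simp add: coeff_W)
 moreover have "coeff (W_poly g m z) (g + 1) = 1" by (simp add: coeff_W)
 ultimately show "degree (W_poly g m z) = g + 1" by (metis le_antisym le_degree zero_neq_one)
 then show "lead_coeff (W_poly g m z) = 1" by (simp add: coeff_W)
qed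

text \<open>The part of \<open>U_poly\<close> linear in the phase point. At a tangent vector it is
  the derivative of \<open>U_poly\<close> in that direction; \<open>V_poly\<close> is already
  linear.\<close>

definition dU_poly :: "nat => real => complex ^ ('n::enum \<times> 3) => complex poly" where
 "dU_poly g m h = U_poly g m h - monom 1 (g + 1)"

definition dW_poly :: "nat => real => complex ^ ('n::enum \<times> 3) => complex poly" where
 "dW_poly g m h = W_poly g m h - monom 1 (g + 1)"

lemma coeff_dU: "coeff (dU_poly g m z) n = (if n <= g then gam_sign (g - n) * (gam m z (g - n) 3 - \<i> * gam m z (g - n) 2) else 0)"
 by (simp add: dU_poly_def coeff_U)

lemma coeff_dW: "coeff (dW_poly g m z) n = (if n <= g then gam_sign (g - n) * (gam m z (g - n) 3 + \<i> * gam m z (g - n) 2) else 0)"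
 by (simp add: dW_poly_def coeff_W)

lemma degree_dU: "degree (dU_poly g m z) <= g" and degree_dW: "degree (dW_poly g m z) <= g"
 by (auto intro!: degree_le simp: coeff_dU coeff_dW)

lemma degree_polys: "degree (U_poly g m z) <= g + 1" "degree (V_poly g m z) <= g + 1" "degree (W_poly g m z) <= g + 1"
 using degree_V[of g m z] by (simp_all add: degree_U degree_W)

lemma top_coeffs: "coeff (U_poly g m z) (g + 1) = 1" "coeff (V_poly g m z) (g + 1) = 0" "coeff (W_poly g m z) (g + 1) = 1"
 using degree_V[of g m z] lead_coeff_U[of g m z] lead_coeff_W[of g m z] by (simp_all add: degree_U degree_W coeff_eq_0)

text \<open>Only coefficients up to \<open>x^g\<close> are read, so the same formula inverts the
  change of variables for a monic triple and for a tangent triple of degree at most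
  \<open>g\<close>.\<close>

definition of_polys :: "nat => real => complex poly => complex poly => complex poly => complex ^ ('n::enum \<times> 3)" where
 "of_polys g m U V W = (\<chi> a. let i = pos (fst a); k = snd a; n = g - i in
   gam_sign i / gam_scale m i k * (if k = 1 then coeff V n else if k = 2 then (coeff W n - coeff U n) / (2 * \<i>)
   else (coeff U n + coeff W n) / 2))"

lemma gam_of_polys: assumes card: "CARD('n::enum) = g + 1" and m: "m ~= -1" and i: "i <= g"
 shows "gam m (of_polys g m U V W :: 'n phase) i k = gam_sign i *
   (if k = 1 then coeff V (g - i) else if k = 2 then (coeff W (g - i) - coeff U (g - i)) / (2 * \<i>)
   else (coeff U (g - i) + coeff W (g - i)) / 2)"
proof -
 have "pos (ix i :: 'n) = i" using i card by (intro pos_ix) simp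
 then show ?thesis using gam_scale_nz[OF m] by (simp add: gam_eq of_polys_def Let_def)
qed

lemma gam_sign_sq: "gam_sign i * (gam_sign i * c) = c" by (simp add: gam_sign_def)

lemma gam_combine: assumes "\<And>c. s * (s * c) = (c :: complex)" shows "s * (s * ((u + w) / 2) - \<i> * (s * ((w - u) / (2 * \<i>)))) = u"
  "s * (s * ((u + w) / 2) + \<i> * (s * ((w - u) / (2 * \<i>)))) = w"
proof -
 have "\<i> * (s * ((w - u) / (2 * \<i>))) = s * ((w - u) / 2)" by (simp add: mult.left_commute[of s \<i>])
 then have "s * (s * ((u + w) / 2) - \<i> * (s * ((w - u) / (2 * \<i>)))) = s * (s * ((u + w) / 2 - (w - u) / 2))"
  "s * (s * ((u + w) / 2) + \<i> * (s * ((w - u) / (2 * \<i>)))) = s * (s * ((u + w) / 2 + (w - u) / 2))"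
  by (simp_all only: right_diff_distrib distrib_left)
 then show "s * (s * ((u + w) / 2) - \<i> * (s * ((w - u) / (2 * \<i>)))) = u"
  "s * (s * ((u + w) / 2) + \<i> * (s * ((w - u) / (2 * \<i>)))) = w" unfolding assms by (simp_all add: field_simps)
qed

lemma polys_of_polys: assumes card: "CARD('n::enum) = g + 1" and m: "m ~= -1"
  and d: "degree U <= g" "degree V <= g" "degree W <= g" shows "V_poly g m (of_polys g m U V W :: 'n phase) = V"
  "dU_poly g m (of_polys g m U V W :: 'n phase) = U" "dW_poly g m (of_polys g m U V W :: 'n phase) = W"
proof -
 have z: "n > g ==> coeff U n = 0 \<and> coeff V n = 0 \<and> coeff W n = 0" for n using d by (auto intro: coeff_eq_0)
 have 3: "((3 :: 3) = 1) = False" "((3 :: 3) = 2) = False" "((2 :: 3) = 1) = False" by auto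
 have le: "g - n <= g" "n <= g ==> g - (g - n) = n" for n by auto
 show "V_poly g m (of_polys g m U V W :: 'n phase) = V" by (rule poly_eqI) (simp add: coeff_V gam_of_polys[OF card m] gam_sign_sq z)
 have U: "n <= g ==> gam_sign (g - n) * (gam m (of_polys g m U V W :: 'n phase) (g - n) 3 -
   \<i> * gam m (of_polys g m U V W :: 'n phase) (g - n) 2) = coeff U n" for n
  by (simp only: gam_of_polys[OF card m le(1)] le(2) 3 if_False if_True refl gam_combine(1)[OF gam_sign_sq])
 show "dU_poly g m (of_polys g m U V W :: 'n phase) = U" by (rule poly_eqI) (simp only: coeff_dU, use z U in auto)
 have W: "n <= g ==> gam_sign (g - n) * (gam m (of_polys g m U V W :: 'n phase) (g - n) 3 +
   \<i> * gam m (of_polys g m U V W :: 'n phase) (g - n) 2) = coeff W n" for n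
  by (simp only: gam_of_polys[OF card m le(1)] le(2) 3 if_False if_True refl gam_combine(2)[OF gam_sign_sq])
 show "dW_poly g m (of_polys g m U V W :: 'n phase) = W" by (rule poly_eqI) (simp only: coeff_dW, use z W in auto)
qed

lemma of_polys_inverse: assumes card: "CARD('n::enum) = g + 1" and m: "m ~= -1"
 shows "of_polys g m (dU_poly g m z) (V_poly g m z) (dW_poly g m z) = (z :: 'n phase)"
proof -
 have "of_polys g m (dU_poly g m z) (V_poly g m z) (dW_poly g m z) $ (j, k) = z $ (j, k)" for j k
 proof -
  have j: "g - pos j <= g" "g - (g - pos j) = pos j" using pos_props(2)[of j] card by simp_all
  let ?s = "gam_sign (pos j)" and ?c = "%k. gam_scale m (pos j) k"
  have V: "coeff (V_poly g m z) (g - pos j) = ?s * (?c 1 * z $ (j, 1))"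
   and U: "coeff (dU_poly g m z) (g - pos j) = ?s * (?c 3 * z $ (j, 3) - \<i> * (?c 2 * z $ (j, 2)))"
   and W: "coeff (dW_poly g m z) (g - pos j) = ?s * (?c 3 * z $ (j, 3) + \<i> * (?c 2 * z $ (j, 2)))"
   unfolding coeff_V coeff_dU coeff_dW j gam_eq by simp_all
  have c: "x / c * (c * y) = x * y" "x / c * (x * (c * y)) = x * (x * y)" if "c ~= 0" for x y c :: complex using that by simp_all
  have s: "(s * (a + b) - s * (a - b)) / (2 * \<i>) = s * (b / \<i>)" "(s * (a - b) + s * (a + b)) / 2 = s * a" for s a b :: complex
   by (simp_all add: field_simps)
  have 3: "((3 :: 3) = 1) = False" "((3 :: 3) = 2) = False" "((2 :: 3) = 1) = False" by auto
  consider "k = 1" | "k = 2" | "k = 3" using exhaust_3[of k] by blast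
  then show ?thesis
  proof cases
   case 1
   then show ?thesis unfolding of_polys_def vec_lambda_beta Let_def fst_conv snd_conv V
    by (simp only: if_True refl c[OF gam_scale_nz[OF m]] gam_sign_sq)
  next
   case 2
   have "\<i> * (?c 2 * z $ (j, 2)) / \<i> = ?c 2 * z $ (j, 2)" by simp
   then show ?thesis using 2 unfolding of_polys_def vec_lambda_beta Let_def fst_conv snd_conv U W s
    by (simp only: if_True if_False 3 refl c[OF gam_scale_nz[OF m]] gam_sign_sq)
  next
   case 3
   then show ?thesis unfolding of_polys_def vec_lambda_beta Let_def fst_conv snd_conv U W s
    by (simp only: if_False \<open>((3 :: 3) = 1) = False\<close> \<open>((3 :: 3) = 2) = False\<close> c[OF gam_scale_nz[OF m]] gam_sign_sq)
  qed
 qed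
 then show ?thesis by (simp add: vec_eq_iff)
qed

lemma phase_eqI:
 fixes z z' :: "complex ^ ('n::enum \<times> 3)" assumes card: "CARD('n) = g + 1" and m: "m ~= -1"
  and "dU_poly g m z = dU_poly g m z'" "V_poly g m z = V_poly g m z'" "dW_poly g m z = dW_poly g m z'" shows "z = z'"
 using assms(3-) by (subst (1 2) of_polys_inverse[OF card m, symmetric]) (simp only:)

lemma gam_linear: "gam m (z + z') i k = gam m z i k + gam m z' i k" "gam m (c *s z) i k = c * gam m z i k"
 by (simp_all add: gam_eq distrib_left)

lemma linear_polys: "V_poly g m (z + z') = V_poly g m z + V_poly g m z'" "V_poly g m (c *s z) = smult c (V_poly g m z)"
 "dU_poly g m (z + z') = dU_poly g m z + dU_poly g m z'" "dU_poly g m (c *s z) = smult c (dU_poly g m z)"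
 "dW_poly g m (z + z') = dW_poly g m z + dW_poly g m z'" "dW_poly g m (c *s z) = smult c (dW_poly g m z)"
proof -
 have 1: "s * (a + a' - \<i> * (b + b')) = s * (a - \<i> * b) + s * (a' - \<i> * b')"
  "s * (a + a' + \<i> * (b + b')) = s * (a + \<i> * b) + s * (a' + \<i> * b')"
  "s * (c * a - \<i> * (c * b)) = c * (s * (a - \<i> * b))" "s * (c * a + \<i> * (c * b)) = c * (s * (a + \<i> * b))"
  for s a b a' b' c :: complex by (simp_all add: algebra_simps)
 have 2: "coeff (V_poly g m (z + z')) n = coeff (V_poly g m z + V_poly g m z') n"
  "coeff (V_poly g m (c *s z)) n = coeff (smult c (V_poly g m z)) n"
  "coeff (dU_poly g m (z + z')) n = coeff (dU_poly g m z + dU_poly g m z') n"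
  "coeff (dU_poly g m (c *s z)) n = coeff (smult c (dU_poly g m z)) n"
  "coeff (dW_poly g m (z + z')) n = coeff (dW_poly g m z + dW_poly g m z') n"
  "coeff (dW_poly g m (c *s z)) n = coeff (smult c (dW_poly g m z)) n" for n
  unfolding coeff_V coeff_dU coeff_dW gam_linear coeff_add coeff_smult 1 by (cases "n <= g"; simp add: distrib_left mult.left_commute)+
 show "V_poly g m (z + z') = V_poly g m z + V_poly g m z'" "V_poly g m (c *s z) = smult c (V_poly g m z)"
  "dU_poly g m (z + z') = dU_poly g m z + dU_poly g m z'" "dU_poly g m (c *s z) = smult c (dU_poly g m z)"
  "dW_poly g m (z + z') = dW_poly g m z + dW_poly g m z'" "dW_poly g m (c *s z) = smult c (dW_poly g m z)" by (rule poly_eqI, rule 2)+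
qed

lemma linear_polys_sum: "V_poly g m (\<Sum>i\<in>A. z i) = (\<Sum>i\<in>A. V_poly g m (z i))"
 "dU_poly g m (\<Sum>i\<in>A. z i) = (\<Sum>i\<in>A. dU_poly g m (z i))"
 "dW_poly g m (\<Sum>i\<in>A. z i) = (\<Sum>i\<in>A. dW_poly g m (z i))"
proof -
 have 0: "V_poly g m 0 = 0" "dU_poly g m 0 = 0" "dW_poly g m 0 = 0" using linear_polys(2,4,6)[of g m 0 0] by simp_all
 show "V_poly g m (\<Sum>i\<in>A. z i) = (\<Sum>i\<in>A. V_poly g m (z i))"
  "dU_poly g m (\<Sum>i\<in>A. z i) = (\<Sum>i\<in>A. dU_poly g m (z i))"
  "dW_poly g m (\<Sum>i\<in>A. z i) = (\<Sum>i\<in>A. dW_poly g m (z i))"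
  by (induction A rule: infinite_finite_induct) (simp_all add: 0 linear_polys)
qed

lemma of_polys_linear: "of_polys g m (U + U') (V + V') (W + W') = of_polys g m U V W + of_polys g m U' V' W'"
 "of_polys g m (smult c U) (smult c V) (smult c W) = c *s of_polys g m U V W"
proof -
 have 1: "t * ((w + w' - (u + u')) / d) = t * ((w - u) / d) + t * ((w' - u') / d)"
  "t * ((u + u' + (w + w')) / d) = t * ((u + w) / d) + t * ((u' + w') / d)"
  "t * ((c * w - c * u) / d) = c * (t * ((w - u) / d))" "t * ((c * u + c * w) / d) = c * (t * ((u + w) / d))"
  for t u w u' w' c d :: complex
  by (simp_all add: add_divide_distrib diff_divide_distrib distrib_left right_diff_distrib mult.left_commute)
 have 2: "of_polys g m (U + U') (V + V') (W + W') $ a = (of_polys g m U V W + of_polys g m U' V' W') $ a"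
  "of_polys g m (smult c U) (smult c V) (smult c W) $ a = (c *s of_polys g m U V W) $ a" for a
  unfolding of_polys_def vec_lambda_beta vector_add_component vector_smult_component Let_def coeff_add coeff_smult
  by (cases "snd a = 1"; cases "snd a = 2"; simp only: if_True if_False 1 distrib_left mult.left_commute)+
 show "of_polys g m (U + U') (V + V') (W + W') = of_polys g m U V W + of_polys g m U' V' W'"
  "of_polys g m (smult c U) (smult c V) (smult c W) = c *s of_polys g m U V W" unfolding vec_eq_iff using 2 by blast+
qed

lemma holo_at_phase_coeff [holo_intros]: "holo_at (%z. coeff (V_poly g m z) n) z" "holo_at (%z. coeff (U_poly g m z) n) z"
 "holo_at (%z. coeff (W_poly g m z) n) z"
 unfolding coeff_V coeff_U coeff_W gam_eq by (cases "n <= g"; simp only: if_True if_False; intro holo_intros)+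

lemma phase_triple_eq:
 fixes z :: "complex ^ ('n::enum \<times> 3)" assumes "lead_coeff U = 1" "degree U = g + 1"
 shows "U_poly g m z = U \<longleftrightarrow> dU_poly g m z = U - monom 1 (g + 1)"
  "W_poly g m z = U \<longleftrightarrow> dW_poly g m z = U - monom 1 (g + 1)" by (auto simp: dU_poly_def dW_poly_def)

lemma degree_monic_diff: assumes "lead_coeff U = 1" "degree U = g + 1" shows "degree (U - monom 1 (g + 1) :: complex poly) <= g"
proof (rule degree_le, intro allI impI)
 fix i assume "i > g"
 then show "coeff (U - monom 1 (g + 1)) i = 0" using assms by (cases "i = g + 1") (auto simp: coeff_eq_0)
qed

lemma polys_of_monic: assumes card: "CARD('n::enum) = g + 1" and m: "m ~= -1"
  and U: "lead_coeff U = 1" "degree U = g + 1" and W: "lead_coeff W = 1" "degree W = g + 1" and V: "degree V <= g"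
 shows "V_poly g m (of_polys g m U V W :: 'n phase) = V" "U_poly g m (of_polys g m U V W :: 'n phase) = U"
  "W_poly g m (of_polys g m U V W :: 'n phase) = W"
proof -
 have "(Suc g = g - pos j) = False" for j :: 'n by simp
 then have "(of_polys g m U V W :: 'n phase) =
   of_polys g m (U - monom 1 (g + 1)) V (W - monom 1 (g + 1))" by (simp add: of_polys_def vec_eq_iff Let_def)
 then show "V_poly g m (of_polys g m U V W :: 'n phase) = V" "U_poly g m (of_polys g m U V W :: 'n phase) = U"
  "W_poly g m (of_polys g m U V W :: 'n phase) = W" using polys_of_polys[OF card m degree_monic_diff[OF U] V degree_monic_diff[OF W]]
  by (simp_all add: phase_triple_eq[OF U] phase_triple_eq[OF W])
qed

lemma of_polys_phase: assumes card: "CARD('n::enum) = g + 1" and m: "m ~= -1"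
 shows "of_polys g m (U_poly g m z) (V_poly g m z) (W_poly g m z) = (z :: 'n phase)"
proof -
 note p = polys_of_monic[OF card m lead_coeff_U[of g m z] degree_U[of g m z] lead_coeff_W[of g m z] degree_W[of g m z] degree_V[of g m z]]
 show ?thesis by (rule phase_eqI[OF card m]) (simp_all add: dU_poly_def dW_poly_def p)
qed

subsection \<open>The level sets\<close>

lemma f_coeff_Hk:
 "coeff (V_poly g m z ^ 2 + U_poly g m z * W_poly g m z) n = (if n <= 2 * g + 1 then 2 * Hk g m (2 * int g - int n) z else if n = 2 * g + 2 then 1 else 0)"
proof (cases "n <= 2 * g + 1")
 case True
 then show ?thesis by (simp add: Hk_def)
next
 case False
 have dV: "degree (V_poly g m z ^ 2) <= 2 * g" using degree_power_le[of "V_poly g m z" 2] degree_V[of g m z] by simp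
 then have "coeff (V_poly g m z ^ 2) n = 0" using False by (intro coeff_eq_0) simp
 moreover have "lead_coeff (U_poly g m z * W_poly g m z) = 1" by (simp only: lead_coeff_mult lead_coeff_U lead_coeff_W) simp
 moreover have "degree (U_poly g m z * W_poly g m z) = 2 * g + 2"
  using lead_coeff_U[of g m z] lead_coeff_W[of g m z] by (subst degree_mult_eq) (auto simp: degree_U degree_W)
 ultimately show ?thesis using False by (cases "n = 2 * g + 2") (auto simp: coeff_eq_0)
qed

lemma coeff_spectral_poly: "coeff (spectral_poly g m hm1 h hs) n = (if n = 2 * g + 2 then 1 else if n = 2 * g + 1 then 2 * hm1
   else if n = 2 * g then 2 * h + of_real (m / (1 + m)) * hm1\<^sup>2 else if n < 2 * g then 2 * hs (2 * g - n) else 0)"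
proof -
 have "coeff (\<Sum>k=1..2*g. monom (2 * hs k) (2*g - k)) n = (\<Sum>k\<in>{1..2*g}. if 2*g - k = n then 2 * hs k else 0)"
  by (simp add: coeff_sum)
 also have "\<dots> = (\<Sum>k\<in>{1..2*g}. if k = 2*g - n then (if n < 2*g then 2 * hs k else 0) else 0)" by (rule sum.cong) auto
 also have "\<dots> = (if n < 2*g then 2 * hs (2*g - n) else 0)" by auto
 finally show ?thesis by (auto simp: spectral_poly_def)
qed

lemma spectral_poly_hyperelliptic: assumes "rsquarefree (spectral_poly g m hm1 h hs)" shows "hyperelliptic g (spectral_poly g m hm1 h hs)"
proof
 show "degree (spectral_poly g m hm1 h hs) = 2 * g + 2"
 proof (rule antisym)
  show "degree (spectral_poly g m hm1 h hs) <= 2 * g + 2" by (rule degree_le) (simp add: coeff_spectral_poly)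
  show "2 * g + 2 <= degree (spectral_poly g m hm1 h hs)" by (rule le_degree) (simp add: coeff_spectral_poly)
 qed
 then show "lead_coeff (spectral_poly g m hm1 h hs) = 1" by (simp add: coeff_spectral_poly)
qed (rule assms)

text \<open>The coefficient of \<open>x^(2g)\<close> in the spectral polynomial is
  \<open>2 H_0\<close> rewritten through \<open>H = H_0 - m / (2 (1 + m)) H_(-1)^2\<close>; the
  others below the leading one are the \<open>H_k\<close> themselves, doubled.\<close>

lemma level_set_iff: assumes m: "m ~= -1" shows "z \<in> level_set g m hm1 h hs \<longleftrightarrow>
  V_poly g m z ^ 2 + U_poly g m z * W_poly g m z = spectral_poly g m hm1 h hs"
proof -
 let ?P = "V_poly g m z ^ 2 + U_poly g m z * W_poly g m z"
 define r :: complex where "r = of_real (m / (2 * (1 + m)))"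
 have m': "of_real (m / (1 + m)) = 2 * r"
 proof -
  have "x / y = 2 * (x / (2 * y))" for x y :: real by simp
  then have "m / (1 + m) = 2 * (m / (2 * (1 + m)))" .
  then show ?thesis unfolding r_def by (simp only: of_real_mult of_real_numeral)
 qed
 have e: "2 * A = 2 * h + 2 * r * C \<longleftrightarrow> A - r * C = h" for A C
 proof -
  have "2 * A = 2 * h + 2 * r * C \<longleftrightarrow> 2 * A = 2 * (h + r * C)" by (simp only: distrib_left mult.assoc)
  also have "\<dots> \<longleftrightarrow> A = h + r * C" by (simp del: distrib_left_numeral)
  finally show ?thesis by (simp add: diff_eq_eq)
 qed
 have "?P = spectral_poly g m hm1 h hs \<longleftrightarrow> (\<forall>n\<le>2*g+1. 2 * Hk g m (2 * int g - int n) z = coeff (spectral_poly g m hm1 h hs) n)"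
 proof -
  have "coeff (spectral_poly g m hm1 h hs) n = (if n = 2 * g + 2 then 1 else 0)" if "\<not> n <= 2 * g + 1" for n
   using that by (simp add: coeff_spectral_poly)
  then show ?thesis unfolding poly_eq_iff f_coeff_Hk by metis
 qed
 also have "\<dots> \<longleftrightarrow> 2 * Hk g m (-1) z = 2 * hm1 \<and> 2 * Hk g m 0 z = 2 * h + of_real (m / (1 + m)) * hm1\<^sup>2 \<and>
  (\<forall>n<2*g. 2 * Hk g m (2 * int g - int n) z = 2 * hs (2 * g - n))" (is "?A \<longleftrightarrow> ?B")
 proof
  assume A: ?A
  show ?B using A[rule_format, of "2*g+1"] A[rule_format, of "2*g"] A by (auto simp: coeff_spectral_poly)
 next
  assume B: ?B
  show ?A
  proof (intro allI impI)
   fix n assume "n <= 2 * g + 1"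
   then consider "n < 2 * g" | "n = 2 * g" | "n = 2 * g + 1" by linarith
   then show "2 * Hk g m (2 * int g - int n) z = coeff (spectral_poly g m hm1 h hs) n"
    by cases (use B in \<open>auto simp: coeff_spectral_poly\<close>)
  qed
 qed
 also have "(\<forall>n<2*g. 2 * Hk g m (2 * int g - int n) z = 2 * hs (2 * g - n)) \<longleftrightarrow> (\<forall>k\<in>{1..2*g}. Hk g m (int k) z = hs k)" (is "?C \<longleftrightarrow> ?D")
 proof
  assume C: ?C
  show ?D
  proof
   fix k assume "k \<in> {1..2*g}"
   then show "Hk g m (int k) z = hs k" using C[rule_format, of "2 * g - k"] by (simp add: of_nat_diff)
  qed
 next
  assume D: ?D
  show ?C
  proof (intro allI impI)
   fix n assume "n < 2 * g"
   then show "2 * Hk g m (2 * int g - int n) z = 2 * hs (2 * g - n)" using D[rule_format, of "2 * g - n"] by (simp add: of_nat_diff)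
  qed
 qed
 also have "2 * Hk g m (-1) z = 2 * hm1 \<and> 2 * Hk g m 0 z = 2 * h + of_real (m / (1 + m)) * hm1\<^sup>2 \<and> ?D \<longleftrightarrow> z \<in> level_set g m hm1 h hs"
  unfolding level_set_def Htop_def m' e r_def[symmetric] by auto
 finally show ?thesis by simp
qed

section \<open>Moving the points of a divisor\<close>

text \<open>The uniform bound on the degree makes evaluation at a point a sum over a fixed range,
  hence holomorphic.\<close>

definition holo_poly :: "(complex ^ 'a => complex poly) => complex ^ 'a => bool" where
 "holo_poly P z \<longleftrightarrow> (\<exists>N. \<forall>w. degree (P w) <= N) \<and> (\<forall>k. holo_at (%w. coeff (P w) k) z)"

lemma holo_poly_coeff: "holo_poly P z ==> holo_at (%w. coeff (P w) k) z" by (simp add: holo_poly_def)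

named_theorems holo_poly_intros

lemma holo_poly_const [holo_poly_intros]: "holo_poly (%w. p) z" unfolding holo_poly_def by (auto intro: holo_at_const)

lemma holo_poly_add [holo_poly_intros]: assumes "holo_poly P z" "holo_poly Q z" shows "holo_poly (%w. P w + Q w) z"
proof -
 obtain M N where "\<forall>w. degree (P w) <= M" "\<forall>w. degree (Q w) <= N" using assms by (auto simp: holo_poly_def)
 then have "degree (P w + Q w) <= max M N" for w by (intro degree_add_le) (auto intro: le_max_iff_disj[THEN iffD2])
 moreover have "holo_at (%w. coeff (P w + Q w) k) z" for k
  unfolding coeff_add using assms by (intro holo_at_add holo_poly_coeff)
 ultimately show ?thesis unfolding holo_poly_def by blast
qed

lemma holo_poly_smult [holo_poly_intros]: assumes "holo_at c z" "holo_poly P z" shows "holo_poly (%w. smult (c w) (P w)) z"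
proof -
 obtain M where "\<forall>w. degree (P w) <= M" using assms by (auto simp: holo_poly_def)
 then have "degree (smult (c w) (P w)) <= M" for w using degree_smult_le order_trans by blast
 moreover have "holo_at (%w. coeff (smult (c w) (P w)) k) z" for k
  unfolding coeff_smult using assms by (intro holo_at_mult holo_poly_coeff)
 ultimately show ?thesis unfolding holo_poly_def by blast
qed

lemma holo_poly_diff [holo_poly_intros]: assumes "holo_poly P z" "holo_poly Q z" shows "holo_poly (%w. P w - Q w) z"
 using holo_poly_add[OF assms(1) holo_poly_smult[OF holo_at_const[of "-1"] assms(2)]] by simp

lemma holo_poly_mult [holo_poly_intros]: assumes "holo_poly P z" "holo_poly Q z" shows "holo_poly (%w. P w * Q w) z"
proof -
 obtain M N where "\<forall>w. degree (P w) <= M" "\<forall>w. degree (Q w) <= N" using assms by (auto simp: holo_poly_def)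
 then have "degree (P w * Q w) <= M + N" for w using degree_mult_le[of "P w" "Q w"] by (meson add_mono order_trans)
 moreover have "holo_at (%w. coeff (P w * Q w) k) z" for k
  unfolding coeff_mult using assms by (intro holo_at_sum holo_at_mult holo_poly_coeff)
 ultimately show ?thesis unfolding holo_poly_def by blast
qed

lemma holo_poly_linear [holo_poly_intros]: assumes "holo_at x z" shows "holo_poly (%w. [:- x w, 1:]) z"
proof -
 have "[:- x w, 1:] = [:0, 1:] - smult (x w) [:1:]" for w by simp
 then show ?thesis using assms by (simp only:) (intro holo_poly_intros)
qed

lemma holo_at_poly: assumes "holo_poly P z" "holo_at x z" shows "holo_at (%w. poly (P w) (x w)) z"
proof -
 obtain N where "\<forall>w. degree (P w) <= N" using assms by (auto simp: holo_poly_def)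
 then have "poly (P w) (x w) = (\<Sum>i\<le>N. coeff (P w) i * x w ^ i)" for w
  unfolding poly_altdef by (intro sum.mono_neutral_left) (auto simp: coeff_eq_0)
 then show ?thesis using assms by (simp only:) (intro holo_at_sum holo_at_mult holo_at_power holo_poly_coeff)
qed

lemma coeff_synthetic_div: "coeff (synthetic_div p c) k = coeff p (Suc k) + c * coeff (synthetic_div p c) (Suc k)"
proof -
 have "coeff (p + smult c (synthetic_div p c)) (Suc k) = coeff (pCons (poly p c) (synthetic_div p c)) (Suc k)"
  by (simp only: synthetic_div_correct)
 then show ?thesis by simp
qed

text \<open>Descending induction on the index: Horner's recursion expresses each coefficient of the
  quotient through the next higher one, and all vanish beyond the degree bound.\<close>

lemma holo_poly_synthetic_div [holo_poly_intros]: assumes P: "holo_poly P z" and x: "holo_at x z"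
 shows "holo_poly (%w. synthetic_div (P w) (x w)) z"
proof -
 obtain N where N: "\<forall>w. degree (P w) <= N" using P by (auto simp: holo_poly_def)
 then have d: "degree (synthetic_div (P w) (x w)) <= N" for w by (simp add: degree_synthetic_div le_diff_conv)
   (metis le_SucI le_trans diff_le_self)
 have "holo_at (%w. coeff (synthetic_div (P w) (x w)) k) z" for k
 proof (induction "N + 1 - k" arbitrary: k)
  case 0
  then have "coeff (synthetic_div (P w) (x w)) k = 0" for w using d[of w] by (intro coeff_eq_0) simp
  then show ?case by (simp add: holo_at_const)
 next
  case (Suc n)
  then have "holo_at (%w. coeff (synthetic_div (P w) (x w)) (Suc k)) z" by simp
  then show ?case by (subst coeff_synthetic_div) (intro holo_at_add holo_at_mult holo_poly_coeff[OF P] x)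
 qed
 then show ?thesis using d unfolding holo_poly_def by blast
qed

lemma synthetic_div_root: "poly p (c :: complex) = 0 ==> p = [:- c, 1:] * synthetic_div p c"
 using synthetic_div_correct'[of c p] by simp

context hyperelliptic
begin

lemma tripleI: assumes U: "lead_coeff U = 1" "degree U = g + 1" and V: "degree V <= g" and eq: "V\<^sup>2 + U * W = f"
 shows "triple U V W"
proof -
 have nz: "U ~= 0" using U by auto
 have d2: "degree (V\<^sup>2) < degree f" using degree_power_le[of V 2] V degree_f by simp
 have UW: "U * W = f - V\<^sup>2" using eq by (metis add_diff_cancel_left')
 have dd: "degree (U * W) = 2 * g + 2" unfolding UW using degree_add_eq_left[of "- (V\<^sup>2)" f] d2 degree_f by simp
 then have lc: "lead_coeff (U * W) = 1" unfolding dd unfolding UW using lead_f d2 degree_f by (simp add: coeff_eq_0)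
 then have Wnz: "W ~= 0" by auto
 have "degree U + degree W = 2 * g + 2" using dd degree_mult_eq[OF nz Wnz] by simp
 moreover have "lead_coeff W = 1" using lc U(1) by (simp add: lead_coeff_mult)
 ultimately show ?thesis using assms by (simp add: triple_def)
qed

text \<open>The definitions up to \<open>step_W\<close> exchange a point: \<open>(a, b)\<close> is
  adjoined to the divisor of \<open>(U, V)\<close>, the resulting \<open>g + 2\<close> points are
  rotated until they contain \<open>(x, y)\<close>, and that point is split off.
  \<open>step_L\<close> interpolates \<open>V\<close> over the roots of \<open>U\<close> and
  \<open>b\<close> at \<open>a\<close>; its coefficient at \<open>x^(g+1)\<close> is
  \<open>step_k\<close>.\<close>

definition "step_k U V a b = (b - poly V a) / poly U a"

definition "step_L U V a b = V + smult (step_k U V a b) U"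

text \<open>The cofactor \<open>K\<close> in \<open>L^2 - f = (X - a) U K\<close>.\<close>

definition "step_K U V W a b =
 synthetic_div (smult (2 * step_k U V a b) V + smult ((step_k U V a b)\<^sup>2) U - W) a"

text \<open>The rotation parameter of \<open>(x, y)\<close> in the form \<open>- p / (y + L)\<close>
  with \<open>p = (X - a) U\<close>; at \<open>(a, b)\<close> the denominator is
  \<open>2 b\<close>.\<close>

definition "step_beta U V W a b x y = - (x - a) * poly U x / (y + poly (step_L U V a b) x)"

definition "step_R U V W a b x y = [:- a, 1:] * U + smult (2 * step_beta U V W a b x y) (step_L U V a b)
 + smult ((step_beta U V W a b x y)\<^sup>2) (step_K U V W a b)"

definition "step_U U V W a b x y = synthetic_div (step_R U V W a b x y) x"

text \<open>\<open>L + beta K\<close> interpolates the new divisor and has the coefficient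
  \<open>step_k\<close> at \<open>x^(g+1)\<close>; subtracting \<open>step_k\<close> times the new
  monic \<open>U\<close> brings the degree down to \<open>g\<close>.\<close>

definition "step_V U V W a b x y = step_L U V a b + smult (step_beta U V W a b x y) (step_K U V W a b)
 - smult (step_k U V a b) (step_U U V W a b x y)"

text \<open>Determined by \<open>V^2 + U W = f\<close> for the new triple: insert the new
  \<open>V\<close> and use \<open>(L + beta K)^2 - f = (X - x) U K\<close> with the new
  \<open>U\<close>.\<close>

definition "step_W U V W a b x y = smult (2 * step_k U V a b) (step_L U V a b + smult (step_beta U V W a b x y) (step_K U V W a b))
 - [:- x, 1:] * step_K U V W a b - smult ((step_k U V a b)\<^sup>2) (step_U U V W a b x y)"

lemma step_base: assumes t: "triple U V W" and ab: "b\<^sup>2 = poly f a" "poly U a ~= 0" shows "poly (step_L U V a b) a = b"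
  "[:- a, 1:] * step_K U V W a b = smult (2 * step_k U V a b) V + smult ((step_k U V a b)\<^sup>2) U - W"
  "(step_L U V a b)\<^sup>2 - f = ([:- a, 1:] * U) * step_K U V W a b"
proof -
 let ?k = "step_k U V a b" and ?M = "smult (2 * step_k U V a b) V + smult ((step_k U V a b)\<^sup>2) U - W"
 show L: "poly (step_L U V a b) a = b" using ab by (simp add: step_L_def step_k_def)
 have f: "V\<^sup>2 + U * W = f" using t by (simp add: triple_def)
 have eq: "(step_L U V a b)\<^sup>2 - f = U * ?M"
  unfolding f[symmetric] step_L_def by (rule poly_ext) (simp add: power2_eq_square algebra_simps)
 have "poly U a * poly ?M a = poly ((step_L U V a b)\<^sup>2 - f) a" unfolding eq by simp
 also have "\<dots> = 0" using L ab by simp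
 finally have "poly ?M a = 0" using ab by simp
 then show M: "[:- a, 1:] * step_K U V W a b = ?M" unfolding step_K_def by (rule synthetic_div_root[symmetric])
 show "(step_L U V a b)\<^sup>2 - f = ([:- a, 1:] * U) * step_K U V W a b" unfolding eq M[symmetric] by (simp only: ac_simps)
qed

lemma step_degrees: assumes t: "triple U V W" and ab: "b\<^sup>2 = poly f a" "poly U a ~= 0"
 shows "degree (step_L U V a b) <= g + 1" "degree (step_K U V W a b) <= g"
proof -
 have d: "degree U = g + 1" "degree V <= g" "degree W = g + 1" using t by (auto simp: triple_def)
 show "degree (step_L U V a b) <= g + 1"
  unfolding step_L_def using d by (intro degree_add_le) (auto intro: order_trans[OF degree_smult_le])
 have "degree (smult (2 * step_k U V a b) V + smult ((step_k U V a b)\<^sup>2) U - W) <= g + 1"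
  using d by (intro degree_add_le degree_diff_le) (auto intro: order_trans[OF degree_smult_le])
 then show "degree (step_K U V W a b) <= g" unfolding step_K_def degree_synthetic_div by simp
qed

lemma step_identity: assumes t: "triple U V W" and ab: "b\<^sup>2 = poly f a" "poly U a ~= 0" "b ~= 0"
 shows "step_beta U V W a b a b = 0" "step_U U V W a b a b = U" "step_V U V W a b a b = V" "step_W U V W a b a b = W"
proof -
 show beta: "step_beta U V W a b a b = 0" by (simp add: step_beta_def)
 have "step_R U V W a b a b = [:- a, 1:] * U" by (simp add: step_R_def beta)
 moreover have "poly ([:- a, 1:] * U) a = 0" by simp
 ultimately have "[:- a, 1:] * step_U U V W a b a b = [:- a, 1:] * U"
  using synthetic_div_root[of "step_R U V W a b a b" a] by (simp only: step_U_def)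
 then show U: "step_U U V W a b a b = U" by (rule mult_left_cancel[THEN iffD1, rotated]) simp
 show "step_V U V W a b a b = V" unfolding step_V_def U beta step_L_def by simp
 show "step_W U V W a b a b = W" unfolding step_W_def U beta step_base(2)[OF t ab(1,2)] step_L_def
  by (rule poly_ext) (simp add: power2_eq_square algebra_simps)
qed

lemma step_root: assumes t: "triple U V W" and ab: "b\<^sup>2 = poly f a" "poly U a ~= 0" and xy: "y\<^sup>2 = poly f x"
  and nz: "y + poly (step_L U V a b) x ~= 0"
 shows "poly (step_L U V a b + smult (step_beta U V W a b x y) (step_K U V W a b)) x = y"
  "step_R U V W a b x y = [:- x, 1:] * step_U U V W a b x y"
proof -
 let ?L = "step_L U V a b" and ?K = "step_K U V W a b" and ?B = "step_beta U V W a b x y"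
 have "(poly ?L x)\<^sup>2 - y\<^sup>2 = (x - a) * poly U x * poly ?K x"
  using arg_cong[OF step_base(3)[OF t ab], of "%p. poly p x"] xy by (simp add: algebra_simps)
 then have LK: "(poly ?L x - y) * (y + poly ?L x) = (x - a) * poly U x * poly ?K x" by (simp add: power2_eq_square algebra_simps)
 have B: "?B * (y + poly ?L x) = - (x - a) * poly U x" using nz by (simp add: step_beta_def)
 have "(?B * poly ?K x) * (y + poly ?L x) = - ((poly ?L x - y) * (y + poly ?L x))"
 proof -
  have r: "(?B * poly ?K x) * (y + poly ?L x) = (?B * (y + poly ?L x)) * poly ?K x" by (simp only: ac_simps)
  show ?thesis unfolding r LK B by (simp add: algebra_simps)
 qed
 then have "(?B * poly ?K x + (poly ?L x - y)) * (y + poly ?L x) = 0" by (simp add: distrib_right)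
 then have "?B * poly ?K x + (poly ?L x - y) = 0" using nz by (metis mult_eq_0_iff)
 then have BK: "?B * poly ?K x = y - poly ?L x" by (simp add: algebra_simps)
 then show "poly (?L + smult ?B ?K) x = y" by simp
 have "poly (step_R U V W a b x y) x = (x - a) * poly U x + ?B * (2 * poly ?L x + ?B * poly ?K x)"
  by (simp add: step_R_def power2_eq_square algebra_simps)
 also have "\<dots> = (x - a) * poly U x + ?B * (y + poly ?L x)" unfolding BK by simp
 also have "\<dots> = 0" unfolding B by (simp add: algebra_simps)
 finally show "step_R U V W a b x y = [:- x, 1:] * step_U U V W a b x y" unfolding step_U_def by (rule synthetic_div_root)
qed

text \<open>\<open>prin_rotate\<close> compares the divisors before and after the rotation. The
  former is the old divisor plus \<open>(a, b)\<close>, the latter the new one plus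
  \<open>(x, y)\<close>.\<close>

lemma step_triple: assumes t: "triple U V W" and ab: "b\<^sup>2 = poly f a" "poly U a ~= 0" and xy: "y\<^sup>2 = poly f x"
  and nz: "y + poly (step_L U V a b) x ~= 0" shows "triple (step_U U V W a b x y) (step_V U V W a b x y) (step_W U V W a b x y)"
  "mdiv (step_U U V W a b x y) (step_V U V W a b x y) - mdiv U V + (frag_of (x, y) - frag_of (a, b)) \<in> prin"
proof -
 let ?L = "step_L U V a b" and ?K = "step_K U V W a b" and ?B = "step_beta U V W a b x y"
  and ?U = "step_U U V W a b x y" and ?R = "step_R U V W a b x y" and ?k = "step_k U V a b"
 have U: "lead_coeff U = 1" "degree U = g + 1" and V: "degree V <= g" and W: "degree W = g + 1" using t by (auto simp: triple_def)
 have Unz: "U ~= 0" using U by auto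
 have dp: "degree ([:- a, 1:] * U) = g + 2" using Unz U by (subst degree_mult_eq) auto
 have lp: "lead_coeff ([:- a, 1:] * U) = 1" using U by (simp only: lead_coeff_mult) simp
 note dL = step_degrees(1)[OF t ab] and dK = step_degrees(2)[OF t ab]
 have dr: "degree (smult (2 * ?B) ?L + smult (?B\<^sup>2) ?K) < g + 2"
  using dL dK by (intro le_less_trans[OF degree_add_le[of _ "g + 1"]]) (auto intro: order_trans[OF degree_smult_le])
 have R: "?R = [:- a, 1:] * U + (smult (2 * ?B) ?L + smult (?B\<^sup>2) ?K)" by (simp add: step_R_def add.assoc)
 have dR: "degree ?R = g + 2" unfolding R using dr dp by (subst degree_add_eq_left) auto
 have lR: "lead_coeff ?R = 1"  unfolding dR by (subst R, subst coeff_add, subst coeff_eq_0[OF dr]) (use lp dp in simp)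
 note RU = step_root(2)[OF t ab xy nz]
 have Unz': "?U ~= 0" using RU lR by auto
 have "degree ?R = 1 + degree ?U" unfolding RU using Unz' by (subst degree_mult_eq) auto
 then have dU: "degree ?U = g + 1" using dR by simp
 have lU: "lead_coeff ?U = 1" using lR unfolding RU by (simp only: lead_coeff_mult) simp
 have dV: "degree (step_V U V W a b x y) <= g"
 proof (rule degree_le, intro allI impI)
  fix i assume i: "i > g"
  show "coeff (step_V U V W a b x y) i = 0"
  proof (cases "i = g + 1")
   case True
   then show ?thesis using U V lU dU dK by (simp add: step_V_def step_L_def coeff_eq_0)
  next
   case False
   then show ?thesis using i dL dK dU by (simp add: step_V_def coeff_eq_0)
  qed
 qed
 have "(step_V U V W a b x y)\<^sup>2 + ?U * step_W U V W a b x y = (?L + smult ?B ?K)\<^sup>2 - ([:- x, 1:] * ?U) * ?K"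
  unfolding step_V_def step_W_def by (rule poly_ext) (simp add: power2_eq_square algebra_simps)
 also have "\<dots> = ?L\<^sup>2 - ([:- a, 1:] * U) * ?K"
  unfolding RU[symmetric] step_R_def by (rule poly_ext) (simp add: power2_eq_square algebra_simps)
 also have "\<dots> = f" unfolding step_base(3)[OF t ab, symmetric] by simp
 finally show "triple ?U (step_V U V W a b x y) (step_W U V W a b x y)" by (intro tripleI lU dU dV)
 have "mdiv ?R (?L + smult ?B ?K) - mdiv ([:- a, 1:] * U) ?L \<in> prin"
  unfolding step_R_def by (rule prin_rotate[OF step_base(3)[OF t ab]]) (use dp dL in simp_all)
 moreover have "mdiv ?R (?L + smult ?B ?K) = mdiv [:- x, 1:] (?L + smult ?B ?K) + mdiv ?U (?L + smult ?B ?K)"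
  unfolding RU by (rule mdiv_mult) (use Unz' in auto)
 moreover have "mdiv [:- x, 1:] (?L + smult ?B ?K) = frag_of (x, y)"
  by (simp only: mdiv_linear step_root(1)[OF t ab xy nz])
 moreover have "mdiv ?U (?L + smult ?B ?K) = mdiv ?U (step_V U V W a b x y)"
  by (rule mdiv_cong) (simp add: step_V_def)
 moreover have "mdiv ([:- a, 1:] * U) ?L = mdiv [:- a, 1:] ?L + mdiv U ?L"
  by (rule mdiv_mult) (use Unz in auto)
 moreover have "mdiv [:- a, 1:] ?L = frag_of (a, b)"
  by (simp only: mdiv_linear step_base(1)[OF t ab])
 moreover have "mdiv U ?L = mdiv U V"
  by (rule mdiv_cong) (simp add: step_L_def)
 ultimately have "frag_of (x, y) + mdiv ?U (step_V U V W a b x y) - (frag_of (a, b) + mdiv U V) \<in> prin"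
  by (simp only:)
 moreover have "X + Y - (A + B) = Y - B + (X - A)" for X Y A B :: divisor by simp
 ultimately show "mdiv ?U (step_V U V W a b x y) - mdiv U V + (frag_of (x, y) - frag_of (a, b)) \<in> prin"
  by (simp only:)
qed

lemma holo_poly_step: assumes "holo_poly U z" "holo_poly V z" "holo_poly W z" "holo_at x z" "holo_at y z" "poly (U z) a ~= 0"
  "y z + poly (step_L (U z) (V z) a b) (x z) ~= 0" shows "holo_poly (%w. step_U (U w) (V w) (W w) a b (x w) (y w)) z"
  "holo_poly (%w. step_V (U w) (V w) (W w) a b (x w) (y w)) z"
  "holo_poly (%w. step_W (U w) (V w) (W w) a b (x w) (y w)) z" "holo_at (%w. poly (step_L (U w) (V w) a b) (x w)) z"
proof -
 note c = holo_at_const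
 have k: "holo_at (%w. step_k (U w) (V w) a b) z"
  unfolding step_k_def using assms by (intro holo_at_divide holo_at_diff c holo_at_poly)
 have L: "holo_poly (%w. step_L (U w) (V w) a b) z" unfolding step_L_def by (intro holo_poly_intros assms k)
 have K: "holo_poly (%w. step_K (U w) (V w) (W w) a b) z"
  unfolding step_K_def by (intro holo_poly_intros assms k c holo_at_mult holo_at_power)
 show "holo_at (%w. poly (step_L (U w) (V w) a b) (x w)) z" by (intro holo_at_poly L assms)
 have B: "holo_at (%w. step_beta (U w) (V w) (W w) a b (x w) (y w)) z" unfolding step_beta_def
  by (intro holo_at_divide holo_at_diff holo_at_mult holo_at_uminus holo_at_add c holo_at_poly L assms)
 have "holo_poly (%w. step_R (U w) (V w) (W w) a b (x w) (y w)) z"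
  unfolding step_R_def by (intro holo_poly_intros assms k c holo_at_mult holo_at_power B L K)
 then show SU: "holo_poly (%w. step_U (U w) (V w) (W w) a b (x w) (y w)) z"
  unfolding step_U_def by (intro holo_poly_synthetic_div assms)
 show "holo_poly (%w. step_V (U w) (V w) (W w) a b (x w) (y w)) z"
  unfolding step_V_def by (intro holo_poly_intros assms k c holo_at_mult holo_at_power B L K SU)
 show "holo_poly (%w. step_W (U w) (V w) (W w) a b (x w) (y w)) z"
  unfolding step_W_def by (intro holo_poly_intros assms k c holo_at_mult holo_at_power B L K SU)
qed

end

text \<open>The right hand sides of the Lax equation with parameter \<open>a\<close>.\<close>
definition "lax_U U V a = synthetic_div (smult (poly V a) U - smult (poly U a) V) (a :: complex)"
definition "lax_V U W a = smult (1 / 2) (synthetic_div (smult (poly U a) W - smult (poly W a) U) (a :: complex))"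
definition "lax_W V W a = synthetic_div (smult (poly W a) V - smult (poly V a) W) (a :: complex)"

lemma poly_synthetic_div: "poly p a = 0 ==> x ~= a ==> poly (synthetic_div p a) x = poly p x / (x - a :: complex)"
 using arg_cong[OF synthetic_div_root[of p a], of "%p. poly p x"] by (simp add: field_simps)

lemma poly_lax: assumes "x ~= a" shows "poly (lax_U U V a) x = (poly U x * poly V a - poly V x * poly U a) / (x - a)"
  "poly (lax_V U W a) x = (poly U a * poly W x - poly U x * poly W a) / (2 * (x - a))"
  "poly (lax_W V W a) x = (poly V x * poly W a - poly W x * poly V a) / (x - a)"
 unfolding lax_U_def lax_V_def lax_W_def using assms by (simp_all add: poly_synthetic_div mult.commute)

lemma holo_at_eventually_nonzero: "holo_at F z ==> F z ~= 0 ==> \<forall>\<^sub>F w in nhds z. F w ~= 0"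
 using tendsto_imp_eventually_ne[of F "F z" "at z" 0] holo_at_isCont[of F z] by (simp add: isCont_def eventually_nhds_conv_at)

definition update :: "('n => complex) => 'n => complex => (complex, 'n::finite) vec" where
 "update a j t = (\<chi> i. if i = j then t else a i)"

lemma update_self [simp]: "update a j (a j) = (\<chi> i. a i)" by (auto simp: update_def)

lemma update_nth [simp]: "update a j t $ i = (if i = j then t else a i)" by (simp add: update_def)

lemma eventually_update: assumes "\<forall>\<^sub>F w in nhds (\<chi> i. a i). P w"
 shows "\<forall>\<^sub>F t in nhds (a j). P (update a j t)"
proof -
 have "(update a j \<longlongrightarrow> (\<chi> i. a i)) (nhds (a j))"
 proof (rule vec_tendstoI)
  show "((%s. update a j s $ i) \<longlongrightarrow> (\<chi> i. a i) $ i) (nhds (a j))" for i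
   by (cases "i = j") (simp_all add: filterlim_ident)
 qed
 then show ?thesis using assms by (simp add: filterlim_iff)
qed

lemma eventually_coord: assumes "\<forall>\<^sub>F t in nhds (z $ i). P t"
 shows "\<forall>\<^sub>F w in nhds z. P ((w :: (complex, 'n::finite) vec) $ i)"
proof -
 have "((%w. w $ i) \<longlongrightarrow> z $ i) (nhds z)" by (intro tendsto_vec_nth filterlim_ident)
 then show ?thesis using assms by (simp add: filterlim_iff)
qed

context hyperelliptic
begin

text \<open>The Lax right hand side with parameter \<open>a\<close> is the velocity of the triple
  when the exchanged point leaves \<open>(a, b)\<close> with speed measured by
  \<open>dx / y\<close>, whence the denominator \<open>b\<close>. As \<open>beta\<close> vanishes at
  \<open>t = a\<close>, its square contributes nothing.\<close>

lemma step_derivative: assumes t: "triple U V W" and ab: "b\<^sup>2 = poly f a" "poly U a ~= 0" "b ~= 0"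
  and et: "et a = b" "DERIV et a :> et'" "\<forall>\<^sub>F t in nhds a. (et t)\<^sup>2 = poly f t" and x: "x ~= a"
 shows "DERIV (%t. poly (step_U U V W a b t (et t)) x) a :> poly (lax_U U V a) x / b"
  "DERIV (%t. poly (step_V U V W a b t (et t)) x) a :> poly (lax_V U W a) x / b"
  "DERIV (%t. poly (step_W U V W a b t (et t)) x) a :> poly (lax_W V W a) x / b"
proof -
 let ?L = "step_L U V a b" and ?K = "step_K U V W a b" and ?k = "step_k U V a b"
 let ?B = "%t. step_beta U V W a b t (et t)"
 note La = step_base(1)[OF t ab(1,2)]
 have kU: "?k * poly U a = b - poly V a" using ab by (simp add: step_k_def)
 have Lx: "poly ?L x = poly V x + ?k * poly U x" by (simp add: step_L_def)
 have Kx: "(x - a) * poly ?K x = 2 * ?k * poly V x + ?k\<^sup>2 * poly U x - poly W x"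
  using arg_cong[OF step_base(2)[OF t ab(1,2)], of "%p. poly p x"] by (simp add: algebra_simps)
 have Ka: "2 * ?k * poly V a + ?k\<^sup>2 * poly U a = poly W a"
  using arg_cong[OF step_base(2)[OF t ab(1,2)], of "%p. poly p a"] by (simp add: algebra_simps)
 \<comment> \<open>\<open>beta = - (t - a) U(t) / (y + L(t))\<close>, and the denominator is
   \<open>2 b\<close> at \<open>t = a\<close>.\<close>
 have B: "DERIV ?B a :> - (poly U a / (2 * b))" unfolding step_beta_def using ab et(1) La
  by (auto intro!: derivative_eq_intros et(2) simp: field_simps power2_eq_square)
 have B0: "?B a = 0" by (simp add: step_beta_def)
 have "isCont (%t. et t + poly ?L t) a" using DERIV_isCont[OF et(2)] by (intro continuous_intros)
 moreover have "et a + poly ?L a ~= 0" using et(1) La ab by simp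
 ultimately have "\<forall>\<^sub>F t in at a. et t + poly ?L t ~= 0" by (rule isCont_eventually_nonzero)
 then have "\<forall>\<^sub>F t in nhds a. et t + poly ?L t ~= 0"
  using \<open>et a + poly ?L a ~= 0\<close> by (simp add: eventually_nhds_conv_at)
 moreover have "\<forall>\<^sub>F t in nhds a. t ~= x" using x by (intro t1_space_nhds) auto
 ultimately have ev: "\<forall>\<^sub>F t in nhds a. ((x - a) * poly U x + 2 * ?B t * poly ?L x + (?B t)\<^sup>2 * poly ?K x) / (x - t) = poly (step_U U V W a b t (et t)) x"
  using et(3)
 proof eventually_elim
  case (elim s)
  show ?case using arg_cong[OF step_root(2)[OF t ab(1,2) elim(3,1)], of "%p. poly p x"] elim(2)
   by (simp add: step_R_def field_simps)
 qed
 have "((%t. ((x - a) * poly U x + 2 * ?B t * poly ?L x + (?B t)\<^sup>2 * poly ?K x) / (x - t)) has_field_derivative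
  (2 * - (poly U a / (2 * b)) * poly ?L x + poly U x) / (x - a)) (at a)"
 proof -
  have aux: "DERIV (%t. (c + 2 * B t * p + (B t)\<^sup>2 * q) / (x - t)) a :> (2 * D * p * (x - a) + c) / (x - a)\<^sup>2"
   if "DERIV B a :> D" "B a = 0" for B D c p q using x that by (auto intro!: derivative_eq_intros simp: power2_eq_square)
  have "(q * (x - a) + (x - a) * u) / (x - a)\<^sup>2 = (q + u) / (x - a)" for q u
  proof -
   have "q * (x - a) + (x - a) * u = (q + u) * (x - a)" by (simp add: algebra_simps)
   then show ?thesis using x by (simp only: power2_eq_square) simp
  qed
  then show ?thesis by (intro DERIV_cong[OF aux[OF B B0]])
 qed
 moreover have eqU: "(2 * - (poly U a / (2 * b)) * poly ?L x + poly U x) / (x - a) = poly (lax_U U V a) x / b"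
 proof -
  have "b * poly U x - poly U a * poly ?L x = b * poly U x - poly U a * poly V x - (?k * poly U a) * poly U x"
   unfolding Lx by (simp add: algebra_simps)
  also have "\<dots> = poly U x * poly V a - poly V x * poly U a" unfolding kU by (simp add: algebra_simps)
  finally show ?thesis using ab(3) x by (simp add: poly_lax field_simps)
 qed
 ultimately have "((%t. ((x - a) * poly U x + 2 * ?B t * poly ?L x + (?B t)\<^sup>2 * poly ?K x) / (x - t)) has_field_derivative
  poly (lax_U U V a) x / b) (at a)" by simp
 then show dU: "DERIV (%t. poly (step_U U V W a b t (et t)) x) a :> poly (lax_U U V a) x / b"
  using DERIV_cong_ev[OF refl ev refl] by blast
 have "((%t. poly (step_V U V W a b t (et t)) x) has_field_derivative
  - (poly U a / (2 * b)) * poly ?K x - ?k * (poly (lax_U U V a) x / b)) (at a)" unfolding step_V_def poly_diff poly_add poly_smult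
  by (rule derivative_eq_intros B dU refl)+ simp
 moreover have "- (poly U a / (2 * b)) * poly ?K x - ?k * (poly (lax_U U V a) x / b) = poly (lax_V U W a) x / b"
 proof -
  have "- poly U a * ((x - a) * poly ?K x) - 2 * ?k * (poly U x * poly V a - poly V x * poly U a) =
   poly U a * poly W x - poly U x * (2 * ?k * poly V a + ?k\<^sup>2 * poly U a)" unfolding Kx by (simp add: algebra_simps)
  then have e: "- poly U a * ((x - a) * poly ?K x) - 2 * ?k * (poly U x * poly V a - poly V x * poly U a) =
   poly U a * poly W x - poly U x * poly W a" unfolding Ka .
  have "poly (lax_V U W a) x / b = (- poly U a * ((x - a) * poly ?K x) - 2 * ?k * (poly U x * poly V a - poly V x * poly U a)) / (2 * (x - a)) / b"
   unfolding poly_lax[OF x] e ..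
  also have "\<dots> = - (poly U a / (2 * b)) * poly ?K x - ?k * (poly (lax_U U V a) x / b)"
   unfolding poly_lax[OF x] using x ab(3) by (simp add: divide_simps)
  finally show ?thesis ..
 qed
 ultimately show "DERIV (%t. poly (step_V U V W a b t (et t)) x) a :> poly (lax_V U W a) x / b"
  by simp
 have "((%t. poly (step_W U V W a b t (et t)) x) has_field_derivative
  2 * ?k * (- (poly U a / (2 * b)) * poly ?K x) + poly ?K x - ?k\<^sup>2 * (poly (lax_U U V a) x / b)) (at a)"
  unfolding step_W_def poly_diff poly_add poly_smult poly_mult poly_pCons poly_0
  by (rule derivative_eq_intros B dU refl)+ (simp add: algebra_simps)
 moreover have "2 * ?k * (- (poly U a / (2 * b)) * poly ?K x) + poly ?K x - ?k\<^sup>2 * (poly (lax_U U V a) x / b) = poly (lax_W V W a) x / b"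
 proof -
  have "- (?k * poly U a) * ((x - a) * poly ?K x) + b * ((x - a) * poly ?K x) - ?k\<^sup>2 * (poly U x * poly V a - poly V x * poly U a) =
   poly V a * ((x - a) * poly ?K x) - ?k\<^sup>2 * (poly U x * poly V a - poly V x * poly U a)" unfolding kU by (simp add: algebra_simps)
  also have "\<dots> = poly V x * (2 * ?k * poly V a + ?k\<^sup>2 * poly U a) - poly W x * poly V a"
   unfolding Kx by (simp add: algebra_simps)
  finally have e: "- (?k * poly U a) * ((x - a) * poly ?K x) + b * ((x - a) * poly ?K x) - ?k\<^sup>2 * (poly U x * poly V a - poly V x * poly U a) =
   poly V x * poly W a - poly W x * poly V a" unfolding Ka .
  have "poly (lax_W V W a) x / b = (- (?k * poly U a) * ((x - a) * poly ?K x) + b * ((x - a) * poly ?K x) - ?k\<^sup>2 * (poly U x * poly V a - poly V x * poly U a)) / (x - a) / b"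
   unfolding poly_lax[OF x] e ..
  also have "\<dots> = 2 * ?k * (- (poly U a / (2 * b)) * poly ?K x) + poly ?K x - ?k\<^sup>2 * (poly (lax_U U V a) x / b)"
   unfolding poly_lax[OF x] using x ab(3) by (simp add: divide_simps) (simp add: algebra_simps)
  finally show ?thesis ..
 qed
 ultimately show "DERIV (%t. poly (step_W U V W a b t (et t)) x) a :> poly (lax_W V W a) x / b"
  by simp
qed

definition points_for :: "complex poly => ('n => complex) => ('n => complex => complex) => bool" where
 "points_for U a et \<longleftrightarrow> (\<forall>i. poly U (a i) ~= 0 \<and> et i (a i) ~= 0 \<and>
   (\<exists>B. open B \<and> a i \<in> B \<and> et i holomorphic_on B \<and> (\<forall>t\<in>B. (et i t)\<^sup>2 = poly f t)))"

lemma points_forD: assumes "points_for U a et" shows "poly U (a i) ~= 0" "et i (a i) ~= 0" "(et i (a i))\<^sup>2 = poly f (a i)"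
  "\<forall>\<^sub>F t in nhds (a i). (et i t)\<^sup>2 = poly f t" "\<exists>D. DERIV (et i) (a i) :> D"
  "holo_at (%w. et i (w $ i)) (\<chi> i. a i)"
proof -
 obtain B where B: "open B" "a i \<in> B" "et i holomorphic_on B" "\<forall>t\<in>B. (et i t)\<^sup>2 = poly f t"
  and *: "poly U (a i) ~= 0" "et i (a i) ~= 0" using assms unfolding points_for_def by blast
 show "poly U (a i) ~= 0" "et i (a i) ~= 0" "(et i (a i))\<^sup>2 = poly f (a i)" using B * by auto
 show "\<forall>\<^sub>F t in nhds (a i). (et i t)\<^sup>2 = poly f t" using B unfolding eventually_nhds by blast
 show "\<exists>D. DERIV (et i) (a i) :> D" using B by (auto simp: holomorphic_on_open)
 show "holo_at (%w. et i (w $ i)) (\<chi> i. a i)" by (rule holo_at_compose[OF holo_at_coord B(3,1)]) (simp add: B)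
qed

text \<open>The points are exchanged one after another. A step whose point stays at
  \<open>a i\<close> is the identity, so along the \<open>j\<close>-th coordinate line only the
  \<open>j\<close>-th exchange is visible, applied to the original triple; this reduces the partial
  derivatives to those of a single step.\<close>

lemma multi_step:
 fixes a :: "'n::finite => complex" assumes t: "triple U0 V0 W0" and p: "points_for U0 a et" and fin: "finite A"
 shows "\<exists>U V W. holo_poly U (\<chi> i. a i) \<and> holo_poly V (\<chi> i. a i) \<and> holo_poly W (\<chi> i. a i) \<and>
  (\<forall>w. (\<forall>i\<in>A. w $ i = a i) --> U w = U0 \<and> V w = V0 \<and> W w = W0) \<and>
  (\<forall>j\<in>A. \<forall>\<^sub>F s in nhds (a j). U (update a j s) = step_U U0 V0 W0 (a j) (et j (a j)) s (et j s) \<and>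
    V (update a j s) = step_V U0 V0 W0 (a j) (et j (a j)) s (et j s) \<and>
    W (update a j s) = step_W U0 V0 W0 (a j) (et j (a j)) s (et j s)) \<and>
  (\<forall>\<^sub>F w in nhds (\<chi> i. a i). triple (U w) (V w) (W w) \<and>
    mdiv (U w) (V w) - mdiv U0 V0 + (\<Sum>i\<in>A. frag_of (w $ i, et i (w $ i)) - frag_of (a i, et i (a i))) \<in> prin)" using fin
proof (induction A rule: finite_induct)
 case empty
 show ?case
  by (intro exI[of _ "%_. U0"] exI[of _ "%_. V0"] exI[of _ "%_. W0"]) (auto simp: t prin_0 intro: holo_poly_const)
next
 case (insert i A)
 let ?a = "\<chi> i. a i" and ?b = "et i (a i)"
 obtain U V W where h: "holo_poly U ?a" "holo_poly V ?a" "holo_poly W ?a"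
  and fix0: "\<And>w. (\<forall>i\<in>A. w $ i = a i) ==> U w = U0 \<and> V w = V0 \<and> W w = W0"
  and line: "\<And>j. j \<in> A ==> \<forall>\<^sub>F s in nhds (a j). U (update a j s) = step_U U0 V0 W0 (a j) (et j (a j)) s (et j s) \<and>
    V (update a j s) = step_V U0 V0 W0 (a j) (et j (a j)) s (et j s) \<and>
    W (update a j s) = step_W U0 V0 W0 (a j) (et j (a j)) s (et j s)"
  and ev: "\<forall>\<^sub>F w in nhds ?a. triple (U w) (V w) (W w) \<and>
    mdiv (U w) (V w) - mdiv U0 V0 + (\<Sum>i\<in>A. frag_of (w $ i, et i (w $ i)) - frag_of (a i, et i (a i))) \<in> prin"
  using insert.IH by blast
 have Ua: "U ?a = U0" "V ?a = V0" "W ?a = W0" using fix0[of ?a] by auto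
 note p' = points_forD[OF p, of i]
 define SU where "SU = (%w. step_U (U w) (V w) (W w) (a i) ?b (w $ i) (et i (w $ i)))"
 define SV where "SV = (%w. step_V (U w) (V w) (W w) (a i) ?b (w $ i) (et i (w $ i)))"
 define SW where "SW = (%w. step_W (U w) (V w) (W w) (a i) ?b (w $ i) (et i (w $ i)))"
 have nzU: "poly (U ?a) (a i) ~= 0" using Ua p' by simp
 have nzL: "et i (?a $ i) + poly (step_L (U ?a) (V ?a) (a i) ?b) (?a $ i) ~= 0" using step_base(1)[OF t p'(3,1)] p'(2) Ua by simp
 note hs = holo_poly_step[OF h holo_at_coord[of i] p'(6) nzU nzL]
 have hS: "holo_poly SU ?a" "holo_poly SV ?a" "holo_poly SW ?a" unfolding SU_def SV_def SW_def by (rule hs)+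
 have idS: "SU w = U w \<and> SV w = V w \<and> SW w = W w" if "triple (U w) (V w) (W w)" "poly (U w) (a i) ~= 0" "w $ i = a i" for w
  unfolding SU_def SV_def SW_def that(3) using step_identity[OF that(1) p'(3) that(2) p'(2)] by simp
 have evU: "\<forall>\<^sub>F w in nhds ?a. poly (U w) (a i) ~= 0"
  by (intro holo_at_eventually_nonzero holo_at_poly h holo_at_const nzU)
 have evL: "\<forall>\<^sub>F w in nhds ?a. et i (w $ i) + poly (step_L (U w) (V w) (a i) ?b) (w $ i) ~= 0"
  by (intro holo_at_eventually_nonzero holo_at_add hs(4) p'(6)) (rule nzL)
 have evet: "\<forall>\<^sub>F w in nhds ?a. (et i (w $ i))\<^sup>2 = poly f (w $ i)" by (rule eventually_coord) (use p'(4) in simp)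
 have 1: "SU w = U0 \<and> SV w = V0 \<and> SW w = W0" if w: "\<forall>j\<in>insert i A. w $ j = a j" for w
  using idS[of w] fix0[of w] w t p'(1) by simp
 have 2: "\<forall>\<^sub>F s in nhds (a j). SU (update a j s) = step_U U0 V0 W0 (a j) (et j (a j)) s (et j s) \<and>
    SV (update a j s) = step_V U0 V0 W0 (a j) (et j (a j)) s (et j s) \<and>
    SW (update a j s) = step_W U0 V0 W0 (a j) (et j (a j)) s (et j s)" if j: "j \<in> insert i A" for j
 proof (cases "j = i")
  case True
  have "U (update a i s) = U0 \<and> V (update a i s) = V0 \<and> W (update a i s) = W0" for s by (rule fix0) (use insert.hyps in auto)
  then show ?thesis unfolding True SU_def SV_def SW_def by simp
 next
  case False
  then have "j \<in> A" using j by simp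
  from line[OF this] eventually_update[OF ev, of j] eventually_update[OF evU, of j]
  show ?thesis
  proof eventually_elim
   case (elim s)
   have "SU (update a j s) = U (update a j s) \<and> SV (update a j s) = V (update a j s) \<and> SW (update a j s) = W (update a j s)"
    using elim False by (intro idS) auto
   then show ?case using elim by simp
  qed
 qed
 have 3: "\<forall>\<^sub>F w in nhds ?a. triple (SU w) (SV w) (SW w) \<and>
    mdiv (SU w) (SV w) - mdiv U0 V0 + (\<Sum>i\<in>insert i A. frag_of (w $ i, et i (w $ i)) - frag_of (a i, et i (a i))) \<in> prin"
  using ev evU evL evet
 proof eventually_elim
  case (elim w)
  note st = step_triple[OF conjunct1[OF elim(1)] p'(3) elim(2,4,3)]
  let ?s = "%i. frag_of (w $ i, et i (w $ i)) - frag_of (a i, et i (a i)) :: divisor"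
  have "mdiv (SU w) (SV w) - mdiv (U w) (V w) + ?s i + (mdiv (U w) (V w) - mdiv U0 V0 + (\<Sum>i\<in>A. ?s i)) \<in> prin"
   unfolding SU_def SV_def by (rule prin_add[OF st(2)]) (use elim(1) in blast)
  moreover have "X - Y + s + (Y - Z + S) = X - Z + (s + S)" for X Y Z s S :: divisor by simp
  moreover have "(\<Sum>i\<in>insert i A. ?s i) = ?s i + (\<Sum>i\<in>A. ?s i)" using insert.hyps by simp
  ultimately have "mdiv (SU w) (SV w) - mdiv U0 V0 + (\<Sum>i\<in>insert i A. ?s i) \<in> prin" by (simp only:)
  then show ?case using st(1) unfolding SU_def SV_def SW_def by blast
 qed
 show ?case using hS 1 2 3 by blast
qed

end

lemma poly_eq_except:
 fixes p q :: "complex poly" assumes "finite S" "\<And>x. x \<notin> S ==> poly p x = poly q x" shows "p = q"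
proof -
 have "infinite (- S)" using assms(1) by (simp add: infinite_UNIV_char_0)
 moreover have "- S \<subseteq> {x. poly (p - q) x = 0}" using assms(2) by auto
 ultimately have "infinite {x. poly (p - q) x = 0}" using finite_subset by blast
 then show ?thesis using poly_roots_finite[of "p - q"] by auto
qed

lemma phase_curve_derivative:
 fixes ze :: "complex => complex ^ ('n::enum \<times> 3)" assumes "\<And>c. DERIV (%s. ze s $ c) s0 :> D $ c"
 shows "DERIV (%s. poly (U_poly g m (ze s)) x) s0 :> poly (dU_poly g m D) x"
  "DERIV (%s. poly (V_poly g m (ze s)) x) s0 :> poly (V_poly g m D) x"
  "DERIV (%s. poly (W_poly g m (ze s)) x) s0 :> poly (dW_poly g m D) x"
proof -
 have U: "poly (U_poly g m z) x = (\<Sum>n\<le>g. coeff (dU_poly g m z) n * x ^ n) + x ^ (g + 1)"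
  and dU: "poly (dU_poly g m z) x = (\<Sum>n\<le>g. coeff (dU_poly g m z) n * x ^ n)"
  and V: "poly (V_poly g m z) x = (\<Sum>n\<le>g. coeff (V_poly g m z) n * x ^ n)"
  and W: "poly (W_poly g m z) x = (\<Sum>n\<le>g. coeff (dW_poly g m z) n * x ^ n) + x ^ (g + 1)"
  and dW: "poly (dW_poly g m z) x = (\<Sum>n\<le>g. coeff (dW_poly g m z) n * x ^ n)" for z :: "'n phase"
 proof -
  have *: "poly p x = (\<Sum>n\<le>g. coeff p n * x ^ n)" if "degree p <= g" for p
   unfolding poly_altdef using that by (intro sum.mono_neutral_left) (auto simp: coeff_eq_0)
  show dU: "poly (dU_poly g m z) x = (\<Sum>n\<le>g. coeff (dU_poly g m z) n * x ^ n)" by (rule *[OF degree_dU])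
  show "poly (V_poly g m z) x = (\<Sum>n\<le>g. coeff (V_poly g m z) n * x ^ n)" by (rule *[OF degree_V])
  show dW: "poly (dW_poly g m z) x = (\<Sum>n\<le>g. coeff (dW_poly g m z) n * x ^ n)" by (rule *[OF degree_dW])
  show "poly (U_poly g m z) x = (\<Sum>n\<le>g. coeff (dU_poly g m z) n * x ^ n) + x ^ (g + 1)"
  proof -
   have "poly (U_poly g m z) x = poly (dU_poly g m z) x + x ^ (g + 1)" by (simp add: dU_poly_def poly_monom)
   then show ?thesis unfolding dU .
  qed
  show "poly (W_poly g m z) x = (\<Sum>n\<le>g. coeff (dW_poly g m z) n * x ^ n) + x ^ (g + 1)"
  proof -
   have "poly (W_poly g m z) x = poly (dW_poly g m z) x + x ^ (g + 1)" by (simp add: dW_poly_def poly_monom)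
   then show ?thesis unfolding dW .
  qed
 qed
 have c: "DERIV (%s. gam m (ze s) i k) s0 :> gam m D i k" for i k unfolding gam_eq by (intro DERIV_cmult assms)
 have dc: "DERIV (%s. coeff (dU_poly g m (ze s)) n) s0 :> coeff (dU_poly g m D) n"
  "DERIV (%s. coeff (V_poly g m (ze s)) n) s0 :> coeff (V_poly g m D) n"
  "DERIV (%s. coeff (dW_poly g m (ze s)) n) s0 :> coeff (dW_poly g m D) n" for n unfolding coeff_dU coeff_V coeff_dW
  by (cases "n <= g"; simp only: if_True if_False; intro DERIV_cmult DERIV_diff DERIV_add DERIV_const c)+
 have s: "DERIV (%s. \<Sum>n\<le>g. F n (ze s) * x ^ n) s0 :> (\<Sum>n\<le>g. F n D * x ^ n)"
  if "\<And>n. DERIV (%s. F n (ze s)) s0 :> F n D" for F by (intro DERIV_sum DERIV_cmult_right that)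
 show "DERIV (%s. poly (U_poly g m (ze s)) x) s0 :> poly (dU_poly g m D) x"
  unfolding U dU using DERIV_add[OF s[OF dc(1)] DERIV_const[of "x ^ (g + 1)"]] by simp
 show "DERIV (%s. poly (V_poly g m (ze s)) x) s0 :> poly (V_poly g m D) x" unfolding V by (rule s[OF dc(2)])
 show "DERIV (%s. poly (W_poly g m (ze s)) x) s0 :> poly (dW_poly g m D) x"
  unfolding W dW using DERIV_add[OF s[OF dc(3)] DERIV_const[of "x ^ (g + 1)"]] by simp
qed

lemma holo_at_has_derivative: assumes "holo_at F z" shows "\<exists>D. FDERIV F z :> (%h. \<Sum>a\<in>UNIV. D a * h $ a)"
proof -
 obtain S where S: "z \<in> S" "holo_on F S" using assms unfolding holo_at_def by blast
 then obtain D where "\<forall>z\<in>S. FDERIV F z :> (%h. \<Sum>a\<in>UNIV. D a z * h $ a)" unfolding holo_on_def by blast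
 then show ?thesis using S(1) by (intro exI[of _ "%a. D a z"]) blast
qed

lemma holo_at_of_polys: assumes "holo_poly U z" "holo_poly V z" "holo_poly W z"
 shows "holo_at (%w. (of_polys g m (U w) (V w) (W w) :: complex ^ ('n::enum \<times> 3)) $ c) z"
proof -
 define s where "s = gam_sign (pos (fst c)) / gam_scale m (pos (fst c)) (snd c)"
 define n where "n = g - pos (fst c)"
 have h: "holo_at (%w. coeff (U w) n) z" "holo_at (%w. coeff (V w) n) z" "holo_at (%w. coeff (W w) n) z"
  using assms by (auto intro: holo_poly_coeff)
 have *: "holo_at (%w. s * coeff (V w) n) z" "holo_at (%w. s * ((coeff (W w) n - coeff (U w) n) / (2 * \<i>))) z"
  "holo_at (%w. s * ((coeff (U w) n + coeff (W w) n) / 2)) z" by (rule holo_at_mult[OF holo_at_const h(2)],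
    rule holo_at_mult[OF holo_at_const holo_at_divide[OF holo_at_diff[OF h(3,1)] holo_at_const]], simp,
    rule holo_at_mult[OF holo_at_const holo_at_divide[OF holo_at_add[OF h(1,3)] holo_at_const]], simp)
 show ?thesis unfolding of_polys_def vec_lambda_beta Let_def s_def[symmetric] n_def[symmetric]
 proof (cases "snd c = 1")
  case True
  show "holo_at (%w. s * (if snd c = 1 then coeff (V w) n
   else if snd c = 2 then (coeff (W w) n - coeff (U w) n) / (2 * \<i>) else (coeff (U w) n + coeff (W w) n) / 2)) z"
   unfolding if_P[OF True] by (rule *(1))
 next
  case False
  show "holo_at (%w. s * (if snd c = 1 then coeff (V w) n
   else if snd c = 2 then (coeff (W w) n - coeff (U w) n) / (2 * \<i>) else (coeff (U w) n + coeff (W w) n) / 2)) z"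
   unfolding if_not_P[OF False] by (cases "snd c = 2") (simp_all only: if_True if_False simp_thms *)
 qed
qed

lemma update_derivative:
 fixes F :: "(complex, 'n::finite) vec => complex"
 assumes "FDERIV F (\<chi> i. a i) :> (%h. \<Sum>i\<in>UNIV. D i * h $ i)"
 shows "DERIV (%s. F (update a j s)) (a j) :> D j"
proof -
 have u: "FDERIV (update a j) (a j) :> (%h. h *s axis j 1)" unfolding has_derivative_vec_iff
  by (auto simp: axis_def intro!: derivative_eq_intros)
 have "FDERIV (%s. F (update a j s)) (a j) :> (%h. \<Sum>i\<in>UNIV. D i * (h *s axis j 1) $ i)"
  by (rule has_derivative_compose[OF u]) (use assms in simp)
 moreover have "(%h. \<Sum>i\<in>UNIV. D i * (h *s axis j 1) $ i) = (*) (D j)"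
  by (auto simp: axis_def if_distrib fun_eq_iff cong: if_cong)
 ultimately show ?thesis by (simp add: has_field_derivative_def)
qed

section \<open>Independence of the Lax vectors and parametrization of the level set\<close>

context hyperelliptic
begin

text \<open>A common root of all three polynomials would be a double root of
  \<open>V^2 + U W = f\<close>.\<close>

lemma triple_no_common_root: assumes t: "triple U V W" and r: "poly U r = 0" "poly V r = 0" shows "poly W r ~= 0"
proof
 assume "poly W r = 0"
 then have "[:-r, 1:]\<^sup>2 dvd U * W" "[:-r, 1:]\<^sup>2 dvd V\<^sup>2"
  unfolding power2_eq_square by (intro mult_dvd_mono; use r in \<open>simp add: poly_eq_0_iff_dvd\<close>)+
 then have "[:-r, 1:]\<^sup>2 dvd f" using t unfolding triple_def by (metis dvd_add)
 then have "2 <= order r f" using order_divides[of r 2 f] f_nz by simp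
 then show False using order_f[of r] order_root[of f r] by auto
qed

text \<open>Multiplying the two relations by the product of the \<open>x - a_j\<close> turns them
  into \<open>U M_V = V M_U\<close> and \<open>U M_W = W M_U\<close>. At a root of \<open>U\<close>
  one of \<open>V\<close>, \<open>W\<close> is nonzero, so \<open>U\<close> divides
  \<open>M_U\<close>, whose degree is at most \<open>g\<close>. Hence \<open>M_U = 0\<close>, and
  its value at \<open>a i\<close> is a nonzero multiple of \<open>c i\<close>.\<close>

lemma lax_independent:
 assumes t: "triple U V W" and I: "finite I" "inj_on a I" "card I <= g + 1" and U: "\<And>i. i \<in> I ==> poly U (a i) ~= 0"
  and 0: "(\<Sum>i\<in>I. smult (c i) (lax_U U V (a i))) = 0" "(\<Sum>i\<in>I. smult (c i) (lax_V U W (a i))) = 0" and i: "i \<in> I"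
 shows "c i = 0"
proof -
 define A where "A = (%i. \<Prod>j\<in>I - {i}. [:- a j, 1:])"
 define M where "M = (%P. \<Sum>i\<in>I. smult (c i * poly P (a i)) (A i))"
 have A: "(x - a i) * poly (A i) x = poly (\<Prod>j\<in>I. [:- a j, 1:]) x" if "i \<in> I" for i x
  unfolding A_def prod.remove[OF I(1) that, of "%j. [:- a j, 1:]"] poly_mult by simp
 have eq: "poly P x * poly (M Q) x - poly Q x * poly (M P) x =
   poly (\<Prod>j\<in>I. [:- a j, 1:]) x * (\<Sum>i\<in>I. c i * ((poly P x * poly Q (a i) - poly Q x * poly P (a i)) / (x - a i)))"
  if "x \<notin> a ` I" for P Q x
 proof -
  have "poly P x * (c i * poly Q (a i) * poly (A i) x) - poly Q x * (c i * poly P (a i) * poly (A i) x) =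
   poly (\<Prod>j\<in>I. [:- a j, 1:]) x * (c i * ((poly P x * poly Q (a i) - poly Q x * poly P (a i)) / (x - a i)))"
   if i: "i \<in> I" for i
  proof -
   have "x - a i ~= 0" using i \<open>x \<notin> a ` I\<close> by auto
   then show ?thesis unfolding A[OF i, of x, symmetric] by (simp add: field_simps)
  qed
  then show ?thesis unfolding M_def poly_sum poly_smult sum_distrib_left sum_subtractf[symmetric] by (rule sum.cong[OF refl])
 qed
 have UV: "U * M V - V * M U = 0"
 proof (rule poly_eq_except[of "a ` I"])
  fix x assume x: "x \<notin> a ` I"
  have "(\<Sum>i\<in>I. c i * ((poly U x * poly V (a i) - poly V x * poly U (a i)) / (x - a i))) = poly (\<Sum>i\<in>I. smult (c i) (lax_U U V (a i))) x"
   unfolding poly_sum poly_smult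
  proof (rule sum.cong[OF refl])
   fix i assume "i \<in> I"
   then have "x ~= a i" using x by auto
   then show "c i * ((poly U x * poly V (a i) - poly V x * poly U (a i)) / (x - a i)) = c i * poly (lax_U U V (a i)) x"
    by (simp add: poly_lax)
  qed
  then show "poly (U * M V - V * M U) x = poly 0 x" using eq[OF x, of U V] 0(1) by simp
 qed (use I in simp)
 have UW: "U * M W - W * M U = 0"
 proof (rule poly_eq_except[of "a ` I"])
  fix x assume x: "x \<notin> a ` I"
  have "(\<Sum>i\<in>I. c i * ((poly U x * poly W (a i) - poly W x * poly U (a i)) / (x - a i))) =
    -2 * poly (\<Sum>i\<in>I. smult (c i) (lax_V U W (a i))) x" unfolding poly_sum poly_smult sum_distrib_left
  proof (rule sum.cong[OF refl])
   fix i assume "i \<in> I"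
   then have "x ~= a i" using x by auto
   then show "c i * ((poly U x * poly W (a i) - poly W x * poly U (a i)) / (x - a i)) = -2 * (c i * poly (lax_V U W (a i)) x)"
    by (simp add: poly_lax divide_simps) (simp add: algebra_simps)
  qed
  then show "poly (U * M W - W * M U) x = poly 0 x" using eq[OF x, of U W] 0(2) by simp
 qed (use I in simp)
 have Unz: "U ~= 0" and dU: "degree U = g + 1" using t by (auto simp: triple_def)
 have "M U = 0"
 proof (rule ccontr)
  assume MU: "M U ~= 0"
  have "U dvd M U"
  proof (rule order_le_imp_dvd[OF Unz])
   fix r
   have *: "order r U <= order r (M U)" if "poly Q r ~= 0" "U dvd Q * M U" for Q
   proof -
    have Q: "Q ~= 0" "order r Q = 0" using that(1) by (auto simp: order_0I)
    then have "order r U <= order r (Q * M U)" using that(2) MU by (intro dvd_imp_order_le) auto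
    then show ?thesis using Q MU by (simp add: order_mult)
   qed
   show "order r U <= order r (M U)"
   proof (cases "poly U r = 0")
    case True
    show ?thesis
    proof (cases "poly V r = 0")
     case False
     have "V * M U = U * M V" using UV by simp
     then show ?thesis by (intro *[OF False]) simp
    next
     case V: True
     have "W * M U = U * M W" using UW by simp
     then show ?thesis by (intro *[OF triple_no_common_root[OF t True V]]) simp
    qed
   qed (simp add: order_0I)
  qed
  then have "g + 1 <= degree (M U)" using MU dU by (metis dvd_imp_degree_le)
  moreover have "degree (A i) <= g" if "i \<in> I" for i
   unfolding A_def using I that by (subst degree_linear_prod) (auto simp: card_Diff_singleton)
  then have "degree (M U) <= g" unfolding M_def by (intro degree_sum_le I order_trans[OF degree_smult_le])
  ultimately show False by simp
 qed
 then have "0 = poly (M U) (a i)" by simp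
 also have "\<dots> = (\<Sum>k\<in>I. c k * poly U (a k) * poly (A k) (a i))" by (simp add: M_def poly_sum)
 also have "\<dots> = c i * poly U (a i) * poly (A i) (a i)"
 proof -
  have "poly (A k) (a i) = 0" if "k \<in> I - {i}" for k unfolding A_def poly_prod using I i that by (intro prod_zero bexI[of _ i]) auto
  then show ?thesis using sum.remove[OF I(1) i, of "%k. c k * poly U (a k) * poly (A k) (a i)"] by simp
 qed
 finally have "c i * poly U (a i) * poly (A i) (a i) = 0" by simp
 moreover have "poly (A i) (a i) ~= 0"
  unfolding A_def poly_prod using I i by (auto simp: prod_zero_iff inj_on_def)
 ultimately show ?thesis using U[OF i] by simp
qed

end

locale level = hyperelliptic g f for g f +
 fixes m :: real and ty :: "'n::enum itself" assumes card: "CARD('n) = g + 1" and m: "m ~= -1"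
begin

abbreviation (input) UU :: "'n phase => _" where "UU == U_poly g m"
abbreviation (input) VV :: "'n phase => _" where "VV == V_poly g m"
abbreviation (input) WW :: "'n phase => _" where "WW == W_poly g m"
abbreviation (input) dUU :: "'n phase => _" where "dUU == dU_poly g m"
abbreviation (input) dWW :: "'n phase => _" where "dWW == dW_poly g m"
abbreviation (input) ofp :: "_ => _ => _ => 'n phase" where "ofp == of_polys g m"

definition lvl :: "('n phase) set" where "lvl = {z. VV z ^ 2 + UU z * WW z = f}"

definition zdiv :: "'n phase => divisor" where "zdiv z = mdiv (UU z) (VV z)"

lemma lvl_triple: "z \<in> lvl \<longleftrightarrow> triple (UU z) (VV z) (WW z)"
 using lead_coeff_U[of g m z] lead_coeff_W[of g m z] by (auto simp: lvl_def triple_def degree_U degree_W degree_V)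

definition lax_vec :: "'n phase => complex => 'n phase" where
 "lax_vec z a = ofp (lax_U (UU z) (VV z) a) (lax_V (UU z) (WW z) a)
   (lax_W (VV z) (WW z) a)"

lemma polys_lax_vec: "dUU (lax_vec z a) = lax_U (UU z) (VV z) a"
 "VV (lax_vec z a) = lax_V (UU z) (WW z) a" "dWW (lax_vec z a) = lax_W (VV z) (WW z) a"
proof -
 note d = degree_polys[of g m z]
 have "degree (smult c P - smult c' Q) <= g + 1" if "degree P <= g + 1" "degree Q <= g + 1" for c c' :: complex and P Q
  using that by (intro degree_diff_le) (auto intro: order_trans[OF degree_smult_le])
 then have "degree (lax_U (UU z) (VV z) a) <= g" "degree (lax_V (UU z) (WW z) a) <= g"
  "degree (lax_W (VV z) (WW z) a) <= g" unfolding lax_U_def lax_V_def lax_W_def using d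
  by (auto intro!: order_trans[OF degree_smult_le] simp: degree_synthetic_div le_diff_conv)
 then show "dUU (lax_vec z a) = lax_U (UU z) (VV z) a"
  "VV (lax_vec z a) = lax_V (UU z) (WW z) a" "dWW (lax_vec z a) = lax_W (VV z) (WW z) a"
  unfolding lax_vec_def using polys_of_polys[OF card m] by blast+
qed

lemma lax_vec_independent:
 assumes z: "z \<in> lvl" and a: "inj (a :: 'n => complex)" "\<And>i. poly (UU z) (a i) ~= 0"
  and 0: "(\<Sum>i\<in>UNIV. c i *s lax_vec z (a i)) = 0" shows "c i = 0"
proof (rule lax_independent[OF z[unfolded lvl_triple], of UNIV a])
 have "dUU (0 :: 'n phase) = 0" "VV (0 :: 'n phase) = 0" using linear_polys(2,4)[of g m 0 "0 :: 'n phase"] by simp_all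
 then show "(\<Sum>i\<in>UNIV. smult (c i) (lax_U (UU z) (VV z) (a i))) = 0"
  "(\<Sum>i\<in>UNIV. smult (c i) (lax_V (UU z) (WW z) (a i))) = 0"
  using arg_cong[OF 0, of "dUU"] arg_cong[OF 0, of "VV"] by (simp_all add: linear_polys_sum linear_polys polys_lax_vec)
qed (use card a in auto)

text \<open>Both the divisor and the derivative come from exchanging points. The derivative is
  assembled from its columns, and a column is the velocity along one coordinate line, given by
  \<open>step_derivative\<close>.\<close>

theorem local_parametrization: assumes z0: "z0 \<in> lvl" and p: "points_for (UU z0) (a :: 'n => complex) et"
 shows "\<exists>Z. (\<forall>c. holo_at (%w. Z w $ c) (\<chi> i. a i)) \<and> Z (\<chi> i. a i) = z0 \<and>
  (\<forall>\<^sub>F w in nhds (\<chi> i. a i). Z w \<in> lvl \<and> zdiv (Z w) - zdiv z0 + moved a et w \<in> prin) \<and>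
  FDERIV Z (\<chi> i. a i) :> (%h. \<Sum>i\<in>UNIV. (h $ i / et i (a i)) *s lax_vec z0 (a i))"
proof -
 let ?a = "\<chi> i. a i"
 note t = z0[unfolded lvl_triple]
 obtain U V W where h: "holo_poly U ?a" "holo_poly V ?a" "holo_poly W ?a"
  and base: "\<forall>w. (\<forall>i\<in>UNIV. w $ i = a i) --> U w = UU z0 \<and> V w = VV z0 \<and> W w = WW z0"
  and line: "\<forall>j\<in>UNIV. \<forall>\<^sub>F s in nhds (a j).
    U (update a j s) = step_U (UU z0) (VV z0) (WW z0) (a j) (et j (a j)) s (et j s) \<and>
    V (update a j s) = step_V (UU z0) (VV z0) (WW z0) (a j) (et j (a j)) s (et j s) \<and>
    W (update a j s) = step_W (UU z0) (VV z0) (WW z0) (a j) (et j (a j)) s (et j s)"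
  and ev: "\<forall>\<^sub>F w in nhds ?a. triple (U w) (V w) (W w) \<and> mdiv (U w) (V w) - mdiv (UU z0) (VV z0) +
    (\<Sum>i\<in>UNIV. frag_of (w $ i, et i (w $ i)) - frag_of (a i, et i (a i))) \<in> prin"
  using multi_step[OF t p finite_class.finite_UNIV] by blast
 define Z :: "(complex, 'n) vec => 'n phase" where "Z = (%w. ofp (U w) (V w) (W w))"
 have polys: "UU (Z w) = U w" "VV (Z w) = V w" "WW (Z w) = W w" if "triple (U w) (V w) (W w)" for w
  using that unfolding Z_def triple_def by (auto intro!: polys_of_monic card m)
 have hZ: "holo_at (%w. Z w $ c) ?a" for c unfolding Z_def by (rule holo_at_of_polys[OF h])
 have Za: "Z ?a = z0" using base by (simp add: Z_def of_polys_phase[OF card m])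
 have ev': "\<forall>\<^sub>F w in nhds ?a. Z w \<in> lvl \<and> zdiv (Z w) - zdiv z0 + moved a et w \<in> prin"
  using ev by eventually_elim (simp add: lvl_triple polys zdiv_def moved_def)
 have "\<forall>c. \<exists>D. FDERIV (%w. Z w $ c) ?a :> (%h. \<Sum>i\<in>UNIV. D i * h $ i)"
  using holo_at_has_derivative[OF hZ] by blast
 then obtain D where D: "\<forall>c. FDERIV (%w. Z w $ c) ?a :> (%h. \<Sum>i\<in>UNIV. D c i * h $ i)"
  by (rule choice[THEN exE])
 have col: "(\<chi> c. D c j) = (1 / et j (a j)) *s lax_vec z0 (a j)" for j
 proof -
  let ?D = "(\<chi> c. D c j) :: 'n phase"
  have dZ: "DERIV (%s. Z (update a j s) $ c) (a j) :> ?D $ c" for c using update_derivative[OF D[rule_format, of c], of j] by simp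
  note pj = points_forD[OF p, of j]
  obtain et' where et': "DERIV (et j) (a j) :> et'" using pj(5) by blast
  have eqs: "\<forall>\<^sub>F s in nhds (a j).
    UU (Z (update a j s)) = step_U (UU z0) (VV z0) (WW z0) (a j) (et j (a j)) s (et j s) \<and>
    VV (Z (update a j s)) = step_V (UU z0) (VV z0) (WW z0) (a j) (et j (a j)) s (et j s) \<and>
    WW (Z (update a j s)) = step_W (UU z0) (VV z0) (WW z0) (a j) (et j (a j)) s (et j s)"
   using line[rule_format, OF UNIV_I, of j] eventually_update[OF ev, of j] by eventually_elim (simp add: polys)
  have "poly (dUU ?D) x = poly (smult (1 / et j (a j)) (lax_U (UU z0) (VV z0) (a j))) x \<and>
   poly (VV ?D) x = poly (smult (1 / et j (a j)) (lax_V (UU z0) (WW z0) (a j))) x \<and>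
   poly (dWW ?D) x = poly (smult (1 / et j (a j)) (lax_W (VV z0) (WW z0) (a j))) x" if x: "x ~= a j" for x
  proof -
   note s = step_derivative[OF t pj(3,1,2) refl et' pj(4) x]
   have e: "\<forall>\<^sub>F s in nhds (a j). poly (UU (Z (update a j s))) x = poly (step_U (UU z0) (VV z0) (WW z0) (a j) (et j (a j)) s (et j s)) x"
    "\<forall>\<^sub>F s in nhds (a j). poly (VV (Z (update a j s))) x = poly (step_V (UU z0) (VV z0) (WW z0) (a j) (et j (a j)) s (et j s)) x"
    "\<forall>\<^sub>F s in nhds (a j). poly (WW (Z (update a j s))) x = poly (step_W (UU z0) (VV z0) (WW z0) (a j) (et j (a j)) s (et j s)) x"
    using eqs by (eventually_elim, simp)+
   note d = phase_curve_derivative[where ze = "%s. Z (update a j s)" and D = ?D and m = m and g = g and x = x, OF dZ]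
   show ?thesis using DERIV_unique[OF d(1)[THEN DERIV_cong_ev[OF refl e(1) refl, THEN iffD1]] s(1)]
     DERIV_unique[OF d(2)[THEN DERIV_cong_ev[OF refl e(2) refl, THEN iffD1]] s(2)]
     DERIV_unique[OF d(3)[THEN DERIV_cong_ev[OF refl e(3) refl, THEN iffD1]] s(3)] by simp
  qed
  then have "dUU ?D = smult (1 / et j (a j)) (lax_U (UU z0) (VV z0) (a j))"
   "VV ?D = smult (1 / et j (a j)) (lax_V (UU z0) (WW z0) (a j))"
   "dWW ?D = smult (1 / et j (a j)) (lax_W (VV z0) (WW z0) (a j))" by (intro poly_eq_except[of "{a j}"]; simp)+
  then show ?thesis by (intro phase_eqI[OF card m]) (simp_all add: linear_polys polys_lax_vec)
 qed
 have col': "D c j = (1 / et j (a j)) * lax_vec z0 (a j) $ c" for c j using arg_cong[OF col[of j], of "%v. v $ c"] by simp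
 have "FDERIV Z ?a :> (%h. \<Sum>i\<in>UNIV. (h $ i / et i (a i)) *s lax_vec z0 (a i))" unfolding has_derivative_vec_iff
 proof
  fix c
  have eq: "(%h. (\<Sum>i\<in>UNIV. (h $ i / et i (a i)) *s lax_vec z0 (a i)) $ c) = (%h. \<Sum>i\<in>UNIV. D c i * h $ i)"
   by (auto simp: fun_eq_iff col' intro!: sum.cong)
  show "FDERIV (%w. Z w $ c) ?a :> (%h. (\<Sum>i\<in>UNIV. (h $ i / et i (a i)) *s lax_vec z0 (a i)) $ c)"
   unfolding eq by (rule D[rule_format])
 qed
 then show ?thesis using hZ Za ev' by blast
qed

end

section \<open>The complex structure of the level sets\<close>

lemma sum_pos: "CARD('n::enum) = g + 1 ==> (\<Sum>j\<in>(UNIV :: 'n set). h (pos j)) = (\<Sum>n\<le>g. h n)"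
 using sum.reindex[OF pos_inj[where 'n = 'n], of h] by (simp add: pos_image lessThan_Suc_atMost)

lemma poly_eq_sum: "degree p <= n ==> poly p x = (\<Sum>i\<le>n. coeff p i * x ^ i)" for p :: "complex poly"
 unfolding poly_altdef by (intro sum.mono_neutral_left) (auto simp: coeff_eq_0)

context level
begin

text \<open>The upper right entry of the Lax matrix after conjugation with a constant unipotent
  matrix; the diagonal entry becomes \<open>V + c W\<close>. The coefficients of \<open>U\<close>
  itself fail to be local coordinates where \<open>U\<close> and \<open>V\<close> have a common
  root, and a suitable conjugation removes such roots.\<close>

definition "pencil c z = UU z - smult (2 * c) (VV z) - smult (c\<^sup>2) (WW z)"

definition proj :: "complex => 'n phase => (complex, 'n) vec" where
 "proj c z = (\<chi> j. coeff (pencil c z) (pos j))"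

definition "defect z = VV z ^ 2 + UU z * WW z - f"

text \<open>A square system: \<open>g + 1\<close> coefficients of the pencil serve as coordinates on
  the level set, and \<open>2 g + 2\<close> coefficients of \<open>V^2 + U W - f\<close> cut it out.
  The coefficient of \<open>x^(2g+2)\<close> vanishes identically.\<close>

definition slice :: "complex => 'n phase => 'n phase" where
 "slice c z = (\<chi> a. if snd a = 1 then proj c z $ fst a else
   coeff (defect z) (if snd a = 2 then pos (fst a) else pos (fst a) + g + 1))"

lemma poly_pencil: "poly (pencil c z) x = (\<Sum>j\<in>UNIV. slice c z $ (j, 1) * x ^ pos j) + (1 - c\<^sup>2) * x ^ (g + 1)"
proof -
 have "degree (pencil c z) <= g + 1" unfolding pencil_def using degree_V[of g m z]
  by (intro degree_diff_le) (auto intro!: order_trans[OF degree_smult_le] simp: degree_U degree_W)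
 then have "poly (pencil c z) x = (\<Sum>n\<le>g + 1. coeff (pencil c z) n * x ^ n)" by (rule poly_eq_sum)
 also have "coeff (pencil c z) (g + 1) = 1 - c\<^sup>2" by (simp add: pencil_def coeff_U coeff_V coeff_W)
 then have "(\<Sum>n\<le>g + 1. coeff (pencil c z) n * x ^ n) = (\<Sum>n\<le>g. coeff (pencil c z) n * x ^ n) + (1 - c\<^sup>2) * x ^ (g + 1)"
  by simp
 finally show ?thesis by (simp add: sum_pos[OF card, of "%n. coeff (pencil c z) n * x ^ n", symmetric] slice_def proj_def)
qed

lemma poly_defect: "poly (defect z) x =
 (\<Sum>j\<in>UNIV. slice c z $ (j, 2) * x ^ pos j) + (\<Sum>j\<in>UNIV. slice c z $ (j, 3) * x ^ (pos j + g + 1))"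
proof -
 have top: "\<forall>n>2 * g + 1. coeff (defect z) n = 0"
 proof (intro allI impI)
  fix n assume "n > 2 * g + 1"
  then show "coeff (defect z) n = 0"
   unfolding defect_def coeff_diff f_coeff_Hk using lead_f degree_f by (cases "n = 2 * g + 2") (auto simp: coeff_eq_0)
 qed
 have "poly (defect z) x = (\<Sum>n\<le>2 * g + 1. coeff (defect z) n * x ^ n)" by (rule poly_eq_sum[OF degree_le[OF top]])
 also have "\<dots> = (\<Sum>n\<le>g. coeff (defect z) n * x ^ n) + (\<Sum>n\<in>{g + 1..2 * g + 1}. coeff (defect z) n * x ^ n)"
 proof -
  have "{..2 * g + 1} = {..g} \<union> {g + 1..2 * g + 1}" by auto
  then show ?thesis by (simp add: sum.union_disjoint)
 qed
 also have "(\<Sum>n\<in>{g + 1..2 * g + 1}. coeff (defect z) n * x ^ n) = (\<Sum>n\<le>g. coeff (defect z) (n + g + 1) * x ^ (n + g + 1))"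
  by (rule sum.reindex_bij_witness[of _ "%n. n + g + 1" "%n. n - (g + 1)"]) auto
 finally show ?thesis unfolding sum_pos[OF card, symmetric] by (simp add: slice_def)
qed

lemma slice_lvl: "z \<in> lvl \<longleftrightarrow> (\<forall>j k. k ~= 1 --> slice c z $ (j, k) = 0)"
proof
 assume "\<forall>j k. k ~= 1 --> slice c z $ (j, k) = 0"
 then have "defect z = 0" by (intro poly_ext) (simp add: poly_defect[of z _ c])
 then show "z \<in> lvl" by (simp add: lvl_def defect_def)
qed (simp add: lvl_def slice_def defect_def)

lemma holo_at_phase_compose: assumes "\<And>c. holo_at (%w. Z w $ c) a"
 shows "holo_at (%w. coeff (UU (Z w :: 'n phase)) n) a" "holo_at (%w. coeff (VV (Z w)) n) a"
  "holo_at (%w. coeff (WW (Z w)) n) a" "holo_at (%w. proj c (Z w) $ j) a"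
proof -
 show h: "holo_at (%w. coeff (UU (Z w)) n) a" "holo_at (%w. coeff (VV (Z w)) n) a"
  "holo_at (%w. coeff (WW (Z w)) n) a" for n
  unfolding coeff_V coeff_U coeff_W gam_eq by (cases "n <= g"; simp only: if_True if_False; intro holo_intros assms)+
 show "holo_at (%w. proj c (Z w) $ j) a"
  unfolding proj_def pencil_def vec_lambda_beta coeff_diff coeff_smult by (intro holo_intros h)
qed

lemma holo_at_slice: "holo_at (%z. slice c z $ a) z"
proof -
 note h = holo_at_phase_compose[of "%z. z", OF holo_at_coord]
 have "holo_at (%z. coeff (defect z) n) z" for n
  unfolding defect_def power2_eq_square coeff_diff coeff_add coeff_mult by (intro holo_intros h)
 then show ?thesis unfolding slice_def vec_lambda_beta by (cases "snd a = 1") (simp_all add: h(4))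
qed

text \<open>By \<open>f = (V + c W)^2 + pencil W\<close>, a common root \<open>r\<close> is a root
  of \<open>f\<close>; moreover \<open>W(r)\<close> is nonzero, so \<open>c = - V(r) / W(r)\<close>.
  This excludes finitely many \<open>c\<close>, and \<open>c^2 ~= 1\<close> keeps the degree of the
  pencil at \<open>g + 1\<close>.\<close>

lemma generic_pencil: assumes z: "z \<in> lvl"
 shows "\<exists>c. c\<^sup>2 ~= 1 \<and> (\<forall>r. poly (pencil c z) r = 0 --> poly (VV z + smult c (WW z)) r ~= 0)"
proof -
 let ?U = "UU z" and ?V = "VV z" and ?W = "WW z"
 note t = z[unfolded lvl_triple]
 have "finite ({1, -1} \<union> (%r. - poly ?V r / poly ?W r) ` {r. poly f r = 0})" using poly_roots_finite[OF f_nz] by simp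
 from ex_new_if_finite[OF infinite_UNIV_char_0 this]
 obtain c where "c \<notin> {1, -1} \<union> (%r. - poly ?V r / poly ?W r) ` {r. poly f r = 0}" by blast
 then have c: "c ~= 1" "c ~= -1" "\<And>r. poly f r = 0 ==> c ~= - poly ?V r / poly ?W r" by auto
 have "poly (?V + smult c ?W) r ~= 0" if r: "poly (pencil c z) r = 0" for r
 proof
  assume V: "poly (?V + smult c ?W) r = 0"
  have "f = (?V + smult c ?W)\<^sup>2 + pencil c z * ?W"
   using z unfolding lvl_def pencil_def by (intro poly_ext) (auto simp: power2_eq_square algebra_simps)
  then have f: "poly f r = 0" using V r by simp
  show False
  proof (cases "poly ?W r = 0")
   case True
   then have "poly ?V r = 0" "poly ?U r = 0" using V r by (simp_all add: pencil_def)
   then show False using triple_no_common_root[OF t] True by blast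
  next
   case False
   have "c * poly ?W r = - poly ?V r" using V by (simp add: eq_neg_iff_add_eq_0 add.commute)
   then show False using c(3)[OF f] False by (simp add: field_simps)
  qed
 qed
 moreover have "c\<^sup>2 ~= 1" using c(1,2) by (simp add: power2_eq_1_iff)
 ultimately show ?thesis by blast
qed

text \<open>A kernel vector fixes the pencil and the defining equation to first order. In conjugated
  variables this reads \<open>2 V_c dV_c + U_c dW = 0\<close>. As \<open>U_c\<close> and
  \<open>V_c\<close> have no common root, \<open>U_c\<close> divides \<open>dV_c\<close>, which has
  smaller degree, so \<open>dV_c\<close>, then \<open>dW\<close>, then the rest vanish.\<close>

lemma slice_derivative:
 assumes z: "z \<in> lvl" and c: "c\<^sup>2 ~= 1" "\<And>r. poly (pencil c z) r = 0 ==> poly (VV z + smult c (WW z)) r ~= 0"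
  and D: "FDERIV (slice c) z :> D" "Vector_Spaces.linear (*s) (*s) D" and h: "D h = 0" shows "h = 0"
proof -
 let ?U = "UU z" and ?V = "VV z" and ?W = "WW z"
  and ?dU = "dUU h" and ?dV = "VV h" and ?dW = "dWW h"
 define ze where "ze = (%t. z + t *s h)"
 have ze: "DERIV (%t. ze t $ a) 0 :> h $ a" for a unfolding ze_def by (auto intro!: derivative_eq_intros)
 have ze0: "ze 0 = z" by (simp add: ze_def)
 have "FDERIV ze 0 :> (%t. t *s h)" unfolding has_derivative_vec_iff
 proof
  show "FDERIV (%t. ze t $ a) 0 :> (%t. (t *s h) $ a)" for a
   using ze[of a] by (simp add: has_field_derivative_def mult_commute_abs)
 qed
 then have "FDERIV (%t. slice c (ze t)) 0 :> (%t. D (t *s h))" by (rule has_derivative_compose) (use D ze0 in simp)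
 moreover have "(%t. D (t *s h)) = (%t. t *s D h)" using D(2) unfolding clinear_iff by blast
 ultimately have "FDERIV (%t. slice c (ze t)) 0 :> (%t. t *s D h)" by (simp only:)
 then have "FDERIV (%t. slice c (ze t) $ a) 0 :> (%t. (t *s D h) $ a)" for a unfolding has_derivative_vec_iff by blast
 then have s: "DERIV (%t. slice c (ze t) $ a) 0 :> 0" for a using h by (simp add: has_field_derivative_def lambda_zero)
 note d = phase_curve_derivative[where ze = ze and m = m and g = g, OF ze, unfolded ze0]
 have "poly (?dU - smult (2 * c) ?dV - smult (c\<^sup>2) ?dW) x = 0" for x
 proof (rule DERIV_unique[of "%t. poly (pencil c (ze t)) x" _ 0])
  show "DERIV (%t. poly (pencil c (ze t)) x) 0 :> 0" unfolding poly_pencil by (auto intro!: derivative_eq_intros s)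
  show "DERIV (%t. poly (pencil c (ze t)) x) 0 :> poly (?dU - smult (2 * c) ?dV - smult (c\<^sup>2) ?dW) x"
   unfolding pencil_def poly_diff poly_smult by (intro DERIV_diff DERIV_cmult d)
 qed
 then have dUc: "?dU = smult (2 * c) ?dV + smult (c\<^sup>2) ?dW" by (intro poly_ext) (simp add: algebra_simps)
 have "poly (2 * ?V * ?dV + ?U * ?dW + ?W * ?dU) x = 0" for x
 proof (rule DERIV_unique[of "%t. poly (defect (ze t)) x" _ 0])
  show "DERIV (%t. poly (defect (ze t)) x) 0 :> 0" unfolding poly_defect[where c = c] by (auto intro!: derivative_eq_intros s)
  show "DERIV (%t. poly (defect (ze t)) x) 0 :> poly (2 * ?V * ?dV + ?U * ?dW + ?W * ?dU) x"
   unfolding defect_def poly_diff poly_add poly_mult poly_power by (auto intro!: derivative_eq_intros d simp: ze0 algebra_simps)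
 qed
 then have K: "2 * ?V * ?dV + ?U * ?dW + ?W * ?dU = 0" by (intro poly_ext) (simp del: poly_add poly_mult)
 let ?Uc = "pencil c z" and ?Vc = "?V + smult c ?W" and ?dVc = "?dV + smult c ?dW"
 have "2 * ?Vc * ?dVc + ?Uc * ?dW = 2 * ?V * ?dV + ?U * ?dW + ?W * ?dU"
  unfolding dUc pencil_def by (rule poly_ext) (simp add: algebra_simps power2_eq_square)
 then have Kc: "2 * ?Vc * ?dVc + ?Uc * ?dW = 0" by (simp only: K)
 have top: "coeff ?Uc (g + 1) = 1 - c\<^sup>2" by (simp add: pencil_def coeff_U coeff_V coeff_W)
 then have Ucnz: "?Uc ~= 0" and dUc': "g + 1 <= degree ?Uc" using c(1) by (auto intro: le_degree)
 have dVc: "?dVc = 0"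
 proof (rule ccontr)
  assume nz: "?dVc ~= 0"
  have "?Uc dvd ?dVc"
  proof (rule order_le_imp_dvd[OF Ucnz])
   fix r
   show "order r ?Uc <= order r ?dVc"
   proof (cases "poly ?Uc r = 0")
    case True
    have "poly (2 * ?Vc) r = 2 * poly ?Vc r" by (simp only: poly_mult poly_numeral)
    then have V: "poly (2 * ?Vc) r ~= 0" using c(2)[OF True] by (simp only: mult_eq_0_iff) simp
    have "2 * ?Vc * ?dVc = - (?Uc * ?dW)" using Kc by (simp only: eq_neg_iff_add_eq_0)
    then have "?Uc dvd 2 * ?Vc * ?dVc" by (metis dvd_minus_iff dvd_triv_left)
    moreover have Qnz: "2 * ?Vc ~= 0" using V by (metis poly_0)
    ultimately have "order r ?Uc <= order r (2 * ?Vc * ?dVc)" using nz by (metis dvd_imp_order_le mult_eq_0_iff)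
    also have "\<dots> = order r (2 * ?Vc) + order r ?dVc" using nz Qnz by (intro order_mult) (metis mult_eq_0_iff)
    also have "order r (2 * ?Vc) = 0" using V by (rule order_0I)
    finally show ?thesis by simp
   qed (simp add: order_0I)
  qed
  then have "g + 1 <= degree ?dVc" using dUc' nz dvd_imp_degree_le by (meson order_trans)
  moreover have "degree ?dVc <= g"
   by (intro degree_add_le degree_V order_trans[OF degree_smult_le degree_dW])
  ultimately show False by simp
 qed
 then have dW: "?dW = 0" using Kc Ucnz by simp
 then have "?dV = 0" "?dU = 0" using dVc dUc by simp_all
 moreover have "dUU (0 :: 'n phase) = 0" "VV (0 :: 'n phase) = 0" "dWW (0 :: 'n phase) = 0"
  using linear_polys(2,4,6)[of g m 0 "0 :: 'n phase"] by simp_all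
 ultimately show "h = 0" using dW by (intro phase_eqI[OF card m]) simp_all
qed

lemma slice_chart: assumes z: "z \<in> lvl"
 shows "\<exists>c N N' xi D. open N \<and> z \<in> N \<and> holomorphic_map (slice c) N \<and> holomorphic_map xi N' \<and> slice c ` N = N' \<and>
  (\<forall>w\<in>N. xi (slice c w) = w) \<and> FDERIV (slice c) z :> D \<and> (\<forall>h. D h = 0 --> h = 0)"
proof -
 obtain c where c: "c\<^sup>2 ~= 1" "\<And>r. poly (pencil c z) r = 0 ==> poly (VV z + smult c (WW z)) r ~= 0"
  using generic_pencil[OF z] by blast
 have "holomorphic_map (slice c) UNIV" by (rule holomorphic_map_holo) (auto intro: holo_at_slice)
 then obtain D where D: "FDERIV (slice c) z :> D" "Vector_Spaces.linear (*s) (*s) D" unfolding holomorphic_map_def by blast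
 note inj = slice_derivative[OF z c D]
 have "\<exists>N N' xi. open N \<and> z \<in> N \<and> N \<subseteq> UNIV \<and> open N' \<and> slice c ` N = N' \<and> (\<forall>w\<in>N. xi (slice c w) = w) \<and>
  (\<forall>y\<in>N'. xi y \<in> N \<and> slice c (xi y) = y) \<and> holomorphic_map (slice c) N \<and> holomorphic_map xi N'"
  by (rule holomorphic_inverse_function[OF holo_at_slice open_UNIV UNIV_I D(1) inj])
 then obtain N N' xi where *: "open N" "z \<in> N" "slice c ` N = N'" "\<forall>w\<in>N. xi (slice c w) = w"
  "holomorphic_map (slice c) N" "holomorphic_map xi N'" by (elim exE conjE)
 have "\<forall>h. D h = 0 --> h = 0" using inj by blast
 with * D(1) have "open N \<and> z \<in> N \<and> holomorphic_map (slice c) N \<and> holomorphic_map xi N' \<and> slice c ` N = N' \<and>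
  (\<forall>w\<in>N. xi (slice c w) = w) \<and> FDERIV (slice c) z :> D \<and> (\<forall>h. D h = 0 --> h = 0)" by (intro conjI)
 then show ?thesis by (intro exI)
qed

theorem lvl_submanifold: "complex_submanifold (g + 1) lvl" unfolding complex_submanifold_def
proof
 fix z assume "z \<in> lvl"
 then obtain c N N' xi where *: "z \<in> N" "holomorphic_map (slice c) N" "holomorphic_map xi N'" "slice c ` N = N'"
  "\<forall>w\<in>N. xi (slice c w) = w" using slice_chart[of z] by blast
 let ?B = "range (%j :: 'n. (j, 1 :: 3))"
 have "card ?B = g + 1" by (subst card_image) (auto simp: inj_on_def card)
 moreover have "\<forall>w\<in>N. w \<in> lvl \<longleftrightarrow> (\<forall>a. a \<notin> ?B --> slice c w $ a = 0)"
  unfolding slice_lvl[of _ c] by auto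
 ultimately show "\<exists>N N' B. \<exists>psi xi :: 'n phase => 'n phase. z \<in> N \<and> holomorphic_map psi N \<and> holomorphic_map xi N' \<and>
    psi ` N = N' \<and> (\<forall>z\<in>N. xi (psi z) = z) \<and> card B = g + 1 \<and> (\<forall>z\<in>N. (z \<in> lvl) = (\<forall>a. a \<notin> B --> psi z $ a = 0))"
  using * by blast
qed

end

section \<open>Local coordinates on the level set given by moving points\<close>

context level
begin

lemma zdiv_inj: assumes "z \<in> lvl" "w \<in> lvl" "zdiv z - zdiv w \<in> prin" shows "z = w"
proof -
 note t = assms(1,2)[unfolded lvl_triple]
 have "zdiv z = zdiv w" using Div0_unique[OF triple_Div0[OF t(1)] triple_Div0[OF t(2)]] assms(3) by (simp add: zdiv_def)
 then have eq: "UU z = UU w" "VV z = VV w" "WW z = WW w"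
  using triple_unique[OF t] by (auto simp: zdiv_def)
 have "z = ofp (UU w) (VV w) (WW w)"
  unfolding eq[symmetric] by (rule of_polys_phase[OF card m, symmetric])
 then show ?thesis by (simp add: of_polys_phase[OF card m])
qed

lemma zdiv_surj: assumes "D \<in> Div0 g f" shows "\<exists>z\<in>lvl. zdiv z = D"
proof -
 obtain U V W where t: "triple U V W" "D = mdiv U V" using Div0_triple[OF assms] by blast
 then have *: "UU (ofp U V W :: 'n phase) = U"
  "VV (ofp U V W :: 'n phase) = V" "WW (ofp U V W :: 'n phase) = W"
  unfolding triple_def by (auto intro!: polys_of_monic card m)
 then show ?thesis using t by (intro bexI[of _ "ofp U V W"]) (simp_all add: zdiv_def lvl_triple)
qed

text \<open>Near \<open>z0\<close> the level set is parametrized by \<open>Z\<close>, with inverse \<open>X\<close>, so that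
 the divisor of \<open>w\<close> differs from that of \<open>z0\<close> by points moving from \<open>a\<close> to \<open>X w\<close>.\<close>
definition local_coords :: "_ => ('n => complex) => _" where
 "local_coords z0 a et B F Z X N \<longleftrightarrow> coords a et B F \<and> (\<forall>i. convex (B i)) \<and> open N \<and> z0 \<in> N \<and>
   holomorphic_map X N \<and> X z0 = (\<chi> i. a i) \<and> (\<forall>w\<in>N. \<forall>i. X w $ i \<in> B i) \<and>
   (\<forall>w\<in>N \<inter> lvl. Z (X w) = w \<and> zdiv w - zdiv z0 + moved a et (X w) \<in> prin \<and>
    inj (($) (X w)) \<and> (\<forall>i. poly (UU w) (X w $ i) ~= 0) \<and>
    FDERIV Z (X w) :> (%h. \<Sum>i\<in>UNIV. (h $ i / et i (X w $ i)) *s lax_vec w (X w $ i))) \<and>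
   (\<exists>O'. open O' \<and> (\<chi> i. a i) \<in> O' \<and> holomorphic_map Z O' \<and> (\<forall>x\<in>O'. Z x \<in> lvl \<and> zdiv (Z x) - zdiv z0 + moved a et x \<in> prin))"

text \<open>\<open>Z\<close> is an immersion because the Lax vectors at the points are independent.
  To obtain an inverse on an open subset of the ambient space, \<open>Z\<close> is composed with the
  projection \<open>proj\<close>, which gives coordinates on the level set, and the inverse function
  theorem is applied in \<complex>^(g+1).\<close>

theorem local_coords_exist: assumes z0: "z0 \<in> lvl" shows "\<exists>a et B F Z X N. local_coords z0 a et B F Z X N"
proof -
 let ?U0 = "UU z0"
 have "?U0 ~= 0" using lead_coeff_U[of g m z0] by auto
 then have "finite {x. poly (f * ?U0) x = 0}" using f_nz by (intro poly_roots_finite) auto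
 then obtain a :: "'n => complex" where a: "inj a" "\<And>i. poly f (a i) ~= 0" "\<And>i. poly ?U0 (a i) ~= 0"
  using exists_points[of "{x. poly (f * ?U0) x = 0}", where 'n = 'n] by auto
 have "\<And>i. (csqrt (poly f (a i)))\<^sup>2 = poly f (a i)" "\<And>i. csqrt (poly f (a i)) ~= 0" using a by auto
 then obtain et B F where c: "coords a et B F" and B: "\<And>i. \<exists>r>0. B i = ball (a i) r"
  using coords_exist[OF a(1), of "%i. csqrt (poly f (a i))" 1] by auto
 have conv: "convex (B i)" for i using B[of i] by auto
 have pts: "points_for (UU w) (($) x) et" if "\<And>i. x $ i \<in> B i" "\<And>i. poly (UU w) (x $ i) ~= 0" for x w
  unfolding points_for_def
 proof (intro allI conjI)
  fix i
  show "poly (UU w) (x $ i) ~= 0" "et i (x $ i) ~= 0" using that coordsD(7)[OF c] by auto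
  have "(et i t)\<^sup>2 = poly f t" if "t \<in> B i" for t using coordsD(8)[OF c that] by (simp add: curve_def)
  then show "\<exists>B. open B \<and> x $ i \<in> B \<and> et i holomorphic_on B \<and> (\<forall>t\<in>B. (et i t)\<^sup>2 = poly f t)"
   using coordsD(5)[OF c] that(1) chart_holomorphic(2)[OF coordsD(2)[OF c]] by blast
 qed
 let ?a = "\<chi> i. a i"
 have "points_for ?U0 (($) ?a) et" by (rule pts) (use a coordsD(3)[OF c] in auto)
 moreover have "($) ?a = a" by (simp add: fun_eq_iff)
 ultimately have "points_for ?U0 a et" by (simp only:)
 from local_parametrization[OF z0 this]
 obtain Z where Z: "\<forall>c. holo_at (%w. Z w $ c) ?a" "Z ?a = z0"
  "\<forall>\<^sub>F w in nhds ?a. Z w \<in> lvl \<and> zdiv (Z w) - zdiv z0 + moved a et w \<in> prin"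
  and Z': "FDERIV Z ?a :> (%h. \<Sum>i\<in>UNIV. (h $ i / et i (a i)) *s lax_vec z0 (a i))" by blast
 have "\<forall>\<^sub>F x in nhds ?a. \<forall>c. holo_at (%w. Z w $ c) x"
  by (rule eventually_all_finite) (use Z(1) holo_at_eventually in blast)
 moreover have "holo_poly (%w. UU (Z w)) ?a"
  unfolding holo_poly_def using Z(1) by (auto simp: degree_U intro: holo_at_phase_compose)
 then have "\<forall>\<^sub>F x in nhds ?a. poly (UU (Z x)) (x $ i) ~= 0" for i
  by (intro holo_at_eventually_nonzero holo_at_poly holo_at_coord) (use a Z(2) in auto)
 then have "\<forall>\<^sub>F x in nhds ?a. \<forall>i. poly (UU (Z x)) (x $ i) ~= 0" by (rule eventually_all_finite)
 moreover have "\<forall>\<^sub>F x in nhds ?a. \<forall>i. x $ i \<in> B i"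
  by (rule eventually_all_finite, rule eventually_coord) (use coordsD(3,5)[OF c] in \<open>auto intro: eventually_nhds_in_open\<close>)
 moreover have "\<forall>\<^sub>F x in nhds ?a. inj (($) x)"
 proof -
  obtain U V J where "open U" "?a \<in> U" "\<forall>x\<in>U. inj (%i. x $ i) \<and> (\<forall>i. x $ i \<in> B i)"
   using coords_inverse[OF c] by blast
  then show ?thesis unfolding eventually_nhds by auto
 qed
 ultimately have "\<forall>\<^sub>F x in nhds ?a. (Z x \<in> lvl \<and> zdiv (Z x) - zdiv z0 + moved a et x \<in> prin) \<and> (\<forall>c. holo_at (%w. Z w $ c) x) \<and>
   (\<forall>i. poly (UU (Z x)) (x $ i) ~= 0) \<and> (\<forall>i. x $ i \<in> B i) \<and> inj (($) x)"
  using Z(3) by eventually_elim blast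
 then obtain O' where O': "open O'" "?a \<in> O'" "\<And>x. x \<in> O' ==> Z x \<in> lvl" "\<And>x. x \<in> O' ==> zdiv (Z x) - zdiv z0 + moved a et x \<in> prin"
  "\<And>x c. x \<in> O' ==> holo_at (%w. Z w $ c) x" "\<And>x i. x \<in> O' ==> poly (UU (Z x)) (x $ i) ~= 0"
  "\<And>x i. x \<in> O' ==> x $ i \<in> B i" "\<And>x. x \<in> O' ==> inj (($) x)"
  unfolding eventually_nhds by auto
 \<comment> \<open>\<open>local_parametrization\<close> gives the derivative at its base point only.
   At another \<open>x\<close> it is applied afresh at \<open>Z x\<close>; the new parametrization
   agrees with \<open>Z\<close> near \<open>x\<close>, as both yield points of the level set with
   equivalent divisors.\<close>
 have deriv: "FDERIV Z x :> (%h. \<Sum>i\<in>UNIV. (h $ i / et i (x $ i)) *s lax_vec (Z x) (x $ i))" if x: "x \<in> O'" for x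
 proof -
  note p = pts[of x "Z x", OF O'(7,6)[OF x]]
  have xx: "(\<chi> i. x $ i) = x" by (simp add: vec_eq_iff)
  obtain Z1 where Z1: "\<forall>\<^sub>F w in nhds x. Z1 w \<in> lvl \<and> zdiv (Z1 w) - zdiv (Z x) + moved (($) x) et w \<in> prin"
   "FDERIV Z1 x :> (%h. \<Sum>i\<in>UNIV. (h $ i / et i (x $ i)) *s lax_vec (Z x) (x $ i))"
   using local_parametrization[OF O'(3)[OF x] p] unfolding xx by blast
  have "\<forall>\<^sub>F w in nhds x. w \<in> O'" using O'(1) x by (rule eventually_nhds_in_open)
  with Z1(1) have ev: "\<forall>\<^sub>F w in nhds x. Z1 w = Z w"
  proof eventually_elim
   case (elim w)
   have mv: "moved a et w - moved a et x = moved (($) x) et w" unfolding moved_def sum_subtractf[symmetric] by (rule sum.cong) auto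
   have "zdiv (Z1 w) - zdiv (Z x) + moved (($) x) et w - (zdiv (Z w) - zdiv z0 + moved a et w - (zdiv (Z x) - zdiv z0 + moved a et x)) \<in> prin"
    using elim O'(4)[OF x] O'(4)[of w] by (intro prin_diff) auto
   moreover have "P - Q + (S - R) - (T - z + S - (Q - z + R)) = P - T" for P Q R S T z :: divisor by simp
   ultimately have "zdiv (Z1 w) - zdiv (Z w) \<in> prin" unfolding mv[symmetric] by (simp only:)
   then show ?case using elim O'(3) by (intro zdiv_inj) auto
  qed
  then have "\<forall>\<^sub>F w in at x. Z1 w = Z w" "Z1 x = Z x" by (simp_all add: eventually_nhds_conv_at)
  then show ?thesis using Z1(2) by (intro has_derivative_transform_eventually[OF Z1(2)]) auto
 qed
 have holZ: "holomorphic_map Z O'" by (rule holomorphic_map_holo) (use O' in auto)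
 obtain cc N N' xi D where ch: "open N" "z0 \<in> N" "holomorphic_map (slice cc) N" "\<forall>w\<in>N. xi (slice cc w) = w"
  and D: "FDERIV (slice cc) z0 :> D" "\<And>h. D h = 0 ==> h = 0" using slice_chart[OF z0] by blast
 define L where "L = (%h. \<Sum>i\<in>UNIV. (h $ i / et i (a i)) *s lax_vec z0 (a i))"
 have dpZ: "FDERIV (%x. slice cc (Z x)) ?a :> (%h. D (L h))"
  unfolding L_def by (rule has_derivative_compose[OF Z']) (use D(1) Z(2) in simp)
 \<comment> \<open>On the level set the other components of \<open>slice\<close> are 0, so their
   derivatives along \<open>Z\<close> vanish and the projection keeps the derivative
   injective.\<close>
 define PL where "PL = (%h. (\<chi> j. D (L h) $ (j, 1)) :: (complex, 'n) vec)"
 have dP: "FDERIV (%x. proj cc (Z x)) ?a :> PL" unfolding has_derivative_vec_iff PL_def vec_lambda_beta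
  using dpZ[unfolded has_derivative_vec_iff, rule_format, of "(_, 1)"] by (simp add: slice_def)
 have injP: "h = 0" if h: "PL h = 0" for h
 proof -
  have "D (L h) $ (j, k) = 0" for j k
  proof (cases "k = 1")
   case True
   then show ?thesis using arg_cong[OF h, of "%v. v $ j"] by (simp add: PL_def)
  next
   case False
   have "FDERIV (%x. slice cc (Z x) $ (j, k)) ?a :> (%h. 0)"
    by (rule has_derivative_transform_within_open[OF has_derivative_const O'(1,2)]) (use O'(3) slice_lvl[of _ cc] False in auto)
   then have "(%h. D (L h) $ (j, k)) = (%h. 0)"
    using dpZ[unfolded has_derivative_vec_iff, rule_format, of "(j, k)"] has_derivative_unique by blast
   then show ?thesis by (rule fun_cong)
  qed
  then have "D (L h) $ c = 0 $ c" for c by (cases c) simp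
  then have "D (L h) = 0" unfolding vec_eq_iff by blast
  then have "L h = 0" by (rule D(2))
  then have "h $ i / et i (a i) = 0" for i
   unfolding L_def by (intro lax_vec_independent[OF z0 a(1,3), where c = "%i. h $ i / et i (a i)"])
  then show "h = 0" using coordsD(7)[OF c coordsD(3)[OF c]] by (simp add: vec_eq_iff)
 qed
 have hP: "holo_at (%x. proj cc (Z x) $ j) ?a" for j by (rule holo_at_phase_compose(4)) (use Z(1) in blast)
 obtain U1 V1 G where U1: "open U1" "?a \<in> U1" "U1 \<subseteq> O'" "open V1" "(%x. proj cc (Z x)) ` U1 = V1"
  "\<forall>x\<in>U1. G (proj cc (Z x)) = x" "\<forall>y\<in>V1. G y \<in> U1 \<and> proj cc (Z (G y)) = y" "holomorphic_map G V1"
  using holomorphic_inverse_function[OF hP O'(1,2) dP injP] by blast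
 \<comment> \<open>Through \<open>proj\<close> the inverse is holomorphic on an ambient
   neighbourhood, but it inverts \<open>Z\<close> only on the level set.\<close>
 define X where "X = (%w. G (proj cc w))"
 have "holomorphic_map (proj cc) UNIV"
  by (rule holomorphic_map_holo) (use holo_at_phase_compose(4)[of "%z. z", OF holo_at_coord] in auto)
 then have contp: "continuous_on UNIV (proj cc)" and hp: "holomorphic_map (proj cc) UNIV" by (auto intro: holomorphic_map_continuous)
 define N1 where "N1 = N \<inter> proj cc -` V1"
 have oN1: "open N1" unfolding N1_def using ch(1) U1(4) contp by (intro open_Int open_vimage)
 have hX1: "holomorphic_map X N1" unfolding X_def using hp U1(8) oN1 by (intro holomorphic_map_compose[of "proj cc" N1 G V1])
   (auto intro: holomorphic_map_subset simp: N1_def)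
 have XU: "X w \<in> U1" "proj cc (Z (X w)) = proj cc w" if "w \<in> N1" for w using that U1(7) by (auto simp: X_def N1_def)
 have contZX: "continuous_on N1 (%w. Z (X w))"
  by (rule continuous_on_compose2[OF holomorphic_map_continuous[OF holZ] holomorphic_map_continuous[OF hX1]]) (use XU U1(3) in auto)
 \<comment> \<open>For \<open>w\<close> in the level set, \<open>Z (X w)\<close> and
   \<open>w\<close> have the same image under \<open>slice\<close>; both must lie in
   \<open>N\<close>, where \<open>slice\<close> is injective.\<close>
 define N2 where "N2 = N1 \<inter> (%w. Z (X w)) -` N"
 have oN2: "open N2" unfolding N2_def using continuous_open_preimage[OF contZX oN1 ch(1)] .
 have X0: "X z0 = ?a" using U1(2,6) Z(2) unfolding X_def by metis
 have "proj cc z0 \<in> V1" using U1(2,5) Z(2) by (metis image_eqI)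
 then have z0N: "z0 \<in> N2" using ch(2) X0 Z(2) by (simp add: N2_def N1_def)
 have main: "Z (X w) = w" if w: "w \<in> N2 \<inter> lvl" for w
 proof -
  have w': "w \<in> N1" "Z (X w) \<in> N" "Z (X w) \<in> lvl" "w \<in> N" "w \<in> lvl"
   using w XU(1)[of w] U1(3) O'(3) by (auto simp: N2_def N1_def)
  have "slice cc (Z (X w)) $ (j, k) = slice cc w $ (j, k)" for j k
  proof (cases "k = 1")
   case True
   then show ?thesis using XU(2)[OF w'(1)] by (simp add: slice_def)
  next
   case False
   then show ?thesis using w'(3,5) unfolding slice_lvl[of _ cc] by simp
  qed
  then have "slice cc (Z (X w)) = slice cc w" by (simp add: vec_eq_iff)
  then show ?thesis using ch(4) w'(2,4) by metis
 qed
 have "local_coords z0 a et B F Z X N2" unfolding local_coords_def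
 proof (intro conjI ballI allI)
  show "coords a et B F" "\<And>i. convex (B i)" "open N2" "z0 \<in> N2" "X z0 = (\<chi> i. a i)" by (fact c, simp add: conv, fact oN2, fact z0N, fact X0)
  show "holomorphic_map X N2" using hX1 oN2 by (rule holomorphic_map_subset) (simp add: N2_def)
  show "X w $ i \<in> B i" if "w \<in> N2" for w i using that XU(1)[of w] U1(3) O'(7) by (auto simp: N2_def)
  fix w assume w: "w \<in> N2 \<inter> lvl"
  then have x: "X w \<in> O'" using XU(1) U1(3) by (auto simp: N2_def)
  note Zw = main[OF w]
  show "Z (X w) = w" by (rule Zw)
  show "zdiv w - zdiv z0 + moved a et (X w) \<in> prin" using O'(4)[OF x] Zw by simp
  show "inj (($) (X w))" "\<And>i. poly (UU w) (X w $ i) ~= 0" using O'(6,8)[OF x] Zw by auto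
  show "FDERIV Z (X w) :> (%h. \<Sum>i\<in>UNIV. (h $ i / et i (X w $ i)) *s lax_vec w (X w $ i))"
   using deriv[OF x] unfolding Zw .
 qed (use O'(1-4) holZ in blast)
 then show ?thesis by (intro exI)
qed

end

section \<open>The biholomorphism onto the complement of the theta divisor\<close>

context level
begin

definition Phi :: "divisor => 'n phase => divisor set" where "Phi D0 z = modulus_equiv g f `` {zdiv z - D0}"

lemma zdiv_Div0: "z \<in> lvl ==> zdiv z \<in> Div0 g f" unfolding lvl_triple zdiv_def by (rule triple_Div0)

lemma Div0_diff: "D \<in> Div0 g f ==> D0 \<in> Div0 g f ==> D - D0 \<in> divisors0 f"
 using keys_diff_subset[of D D0] by (auto simp: divisors0_def Div0_def div_degree_diff)

lemma class_eq_iff: assumes "D \<in> divisors0 f" "E \<in> divisors0 f"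
 shows "modulus_equiv g f `` {D} = modulus_equiv g f `` {E} \<longleftrightarrow> D - E \<in> prin"
 using eq_equiv_class_iff[OF equiv_modulus_equiv assms] assms by (simp add: modulus_equiv_iff)

text \<open>The sign is reversed because \<open>M\<close> is what has to be added to the divisor of
  \<open>w\<close> to return to the class of the divisor of \<open>z\<close>.\<close>

lemma Phi_move: assumes D0: "D0 \<in> Div0 g f" and z: "z \<in> lvl" "w \<in> lvl" and u: "jac_proj g f u = Phi D0 z"
  and M: "divisor_integral f M (s :: (complex, 'n) vec)" "zdiv w - zdiv z + M \<in> prin" shows "Phi D0 w = jac_proj g f (u - s)"
proof -
 note d = Div0_diff[OF zdiv_Div0[OF z(1)] D0] Div0_diff[OF zdiv_Div0[OF z(2)] D0]
 obtain D E where D: "divisor_integral f D u" and E: "divisor_integral f E (u - s)"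
  using divisor_integral_surj[of u] divisor_integral_surj[of "u - s"] by blast
 note DE = divisor_integral_divisors0[OF D] divisor_integral_divisors0[OF E]
 have "divisor_integral f (E + M) u" using divisor_integral_add[OF E M(1)] by simp
 then have 1: "E + M - D \<in> prin" by (rule jac_proj_eqD[OF card _ D refl])
 have 2: "D - (zdiv z - D0) \<in> prin" using u unfolding jac_proj_eq[OF card D] Phi_def class_eq_iff[OF DE(1) d(1)] .
 have "E + M - D + (D - (zdiv z - D0)) - (zdiv w - zdiv z + M) \<in> prin" by (rule prin_diff[OF prin_add[OF 1 2] M(2)])
 moreover have "E + M - D + (D - (z - Q)) - (w - z + M) = E - (w - Q)" for z w Q :: divisor by simp
 ultimately have "E - (zdiv w - D0) \<in> prin" by (simp only:)
 then show ?thesis unfolding jac_proj_eq[OF card E] Phi_def using class_eq_iff[OF DE(2) d(2)] by blast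
qed

lemma jac_proj_surj: "z \<in> lvl ==> D0 \<in> Div0 g f ==> \<exists>u :: (complex, 'n) vec. jac_proj g f u = Phi D0 z"
 unfolding Phi_def using divisor_integral_exists[OF Div0_diff[OF zdiv_Div0], where 'n = 'n] jac_proj_eq[OF card] by metis

lemma Phi_local_coords: assumes D0: "D0 \<in> Div0 g f" and lc: "local_coords z0 a et B F Z X N" and z0: "z0 \<in> lvl"
  and u: "jac_proj g f u = Phi D0 z0" and w: "w \<in> N \<inter> lvl" shows "Phi D0 w = jac_proj g f (u - abel_sum F (X w))"
proof (rule Phi_move[OF D0 z0 _ u])
 show "divisor_integral f (moved a et (X w)) (abel_sum F (X w))" using lc w unfolding local_coords_def by (intro abel_sum_integral) auto
 show "zdiv w - zdiv z0 + moved a et (X w) \<in> prin" using lc w unfolding local_coords_def by blast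
qed (use w in blast)

lemma Phi_bij: assumes D0: "D0 \<in> Div0 g f" shows "bij_betw (Phi D0) lvl (gen_jacobian g f - theta_divisor TYPE('n) g f D0)"
proof -
 have AJ: "abel_jacobi TYPE('n) g f D0 D = modulus_equiv g f `` {D - D0}" if "D \<in> Div0 g f" for D
  by (rule abel_jacobi_eq[OF card Div0_diff[OF that D0]])
 have "abel_jacobi TYPE('n) g f D0 ` Div0 g f \<subseteq> gen_jacobian g f"
  unfolding gen_jacobian_def using AJ Div0_diff[OF _ D0] by (auto intro: quotientI)
 moreover have "Phi D0 ` lvl = abel_jacobi TYPE('n) g f D0 ` Div0 g f"
 proof -
  have "Phi D0 ` lvl = (%D. modulus_equiv g f `` {D - D0}) ` (zdiv ` lvl)" unfolding Phi_def image_image ..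
  also have "zdiv ` lvl = Div0 g f" using zdiv_Div0 zdiv_surj by blast
  also have "(%D. modulus_equiv g f `` {D - D0}) ` Div0 g f = abel_jacobi TYPE('n) g f D0 ` Div0 g f"
   by (rule image_cong) (simp_all add: AJ)
  finally show ?thesis .
 qed
 moreover have "inj_on (Phi D0) lvl"
 proof (rule inj_onI)
  fix z w assume *: "z \<in> lvl" "w \<in> lvl" "Phi D0 z = Phi D0 w"
  then have "zdiv z - D0 - (zdiv w - D0) \<in> prin" unfolding Phi_def using class_eq_iff Div0_diff[OF zdiv_Div0 D0] by blast
  moreover have "z - Q - (w - Q) = z - w" for z w Q :: divisor by simp
  ultimately have "zdiv z - zdiv w \<in> prin" by (simp only:)
  then show "z = w" using * by (intro zdiv_inj)
 qed
 ultimately show ?thesis unfolding bij_betw_def theta_divisor_def by auto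
qed

lemma holomorphic_abel_sum: assumes c: "coords (a :: 'n => complex) et B F"
 shows "holomorphic_map (abel_sum F) {x. \<forall>i. x $ i \<in> B i}"
proof (rule holomorphic_map_holo)
 have "{x. \<forall>i. x $ i \<in> B i} = (\<Inter>i. (%x. x $ i) -` B i)" by auto
 then show "open {x :: (complex, 'n) vec. \<forall>i. x $ i \<in> B i}"
  by (simp only:) (intro open_INT finite ballI open_vimage coordsD(5)[OF c] continuous_intros)
qed (use abel_sum_derivative(2)[OF c] in blast)

lemma holomorphic_map_reflect: "holomorphic_map (%w. u - w) UNIV"
 by (rule holomorphic_map_holo) (auto simp: vector_minus_component intro!: holo_intros)

text \<open>Near \<open>u\<close> the inverse sends \<open>v\<close> to
  \<open>Z (J (u - v))\<close>: \<open>J\<close> finds points with Abel sum \<open>u - v\<close>,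
  and \<open>Z\<close> the point of the level set whose divisor class is diminished by their
  displacement.\<close>

lemma Phi_inverse_local: assumes D0: "D0 \<in> Div0 g f" and u: "jac_proj g f (u :: (complex, 'n) vec) \<in> Phi D0 ` lvl"
 shows "\<exists>W Y. open W \<and> u \<in> W \<and> holomorphic_map Y W \<and> (\<forall>v\<in>W. Y v \<in> lvl \<and> Phi D0 (Y v) = jac_proj g f v)"
proof -
 obtain z0 where z0: "z0 \<in> lvl" "jac_proj g f u = Phi D0 z0" using u by auto
 obtain a et B F Z X N where lc: "local_coords z0 a et B F Z X N" using local_coords_exist[OF z0(1)] by blast
 then have c: "coords a et B F" "\<And>i. convex (B i)" unfolding local_coords_def by blast+
 obtain O' where O': "open O'" "(\<chi> i. a i) \<in> O'" "holomorphic_map Z O'"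
  "\<And>x. x \<in> O' ==> Z x \<in> lvl \<and> zdiv (Z x) - zdiv z0 + moved a et x \<in> prin"
  using lc unfolding local_coords_def by blast
 obtain U V J where UV: "(\<chi> i. a i) \<in> U" "\<forall>x\<in>U. inj (%i. x $ i) \<and> (\<forall>i. x $ i \<in> B i)" "open V" "0 \<in> V"
  "\<forall>x\<in>U. J (abel_sum F x) = x" "\<forall>u\<in>V. J u \<in> U \<and> abel_sum F (J u) = u" "holomorphic_map J V"
  using coords_inverse[OF c(1)] by blast
 have J0: "J 0 = (\<chi> i. a i)" using UV(1,5) abel_sum_a[OF c(1)] by metis
 define V' where "V' = V \<inter> J -` O'"
 have V': "open V'" unfolding V'_def by (rule continuous_open_preimage[OF holomorphic_map_continuous[OF UV(7)] UV(3) O'(1)])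
 define W where "W = (%v. u - v) -` V'"
 have W: "open W" unfolding W_def by (rule open_vimage[OF V']) (intro continuous_intros)
 have "holomorphic_map (%v. J (u - v)) W"
  by (rule holomorphic_map_compose[OF holomorphic_map_subset[OF holomorphic_map_reflect W] UV(7)]) (auto simp: W_def V'_def)
 then have "holomorphic_map (%v. Z (J (u - v))) W" by (rule holomorphic_map_compose[OF _ O'(3)]) (auto simp: W_def V'_def)
 moreover have "u \<in> W" using J0 UV(4) O'(2) by (simp add: W_def V'_def)
 moreover have "Z (J (u - v)) \<in> lvl \<and> Phi D0 (Z (J (u - v))) = jac_proj g f v" if v: "v \<in> W" for v
 proof -
  have x: "u - v \<in> V" "J (u - v) \<in> O'" using v by (auto simp: W_def V'_def)
  then have "divisor_integral f (moved a et (J (u - v))) (u - v)" using abel_sum_integral[OF c, of "J (u - v)"] UV(2,6) by metis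
  then show ?thesis using Phi_move[OF D0 z0(1) _ z0(2), of "Z (J (u - v))"] O'(4)[OF x(2)] by fastforce
 qed
 ultimately show ?thesis using W by (intro exI[of _ W] exI[of _ "%v. Z (J (u - v))"]) blast
qed

theorem Phi_biholomorphic: assumes D0: "D0 \<in> Div0 g f"
 shows "biholomorphic_onto (jac_proj g f :: (complex, 'n) vec => divisor set) (Phi D0) lvl
  (gen_jacobian g f - theta_divisor TYPE('n) g f D0)"
proof -
 note bij = Phi_bij[OF D0]
 let ?M = "gen_jacobian g f - theta_divisor TYPE('n) g f D0" and ?p = "jac_proj g f :: (complex, 'n) vec => divisor set"
 have M: "?M = Phi D0 ` lvl" using bij by (simp add: bij_betw_def)
 have "\<exists>N L. z \<in> N \<and> holomorphic_map L N \<and> (\<forall>w\<in>N \<inter> lvl. Phi D0 w = ?p (L w))" if z: "z \<in> lvl" for z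
 proof -
  obtain u :: "(complex, 'n) vec" where u: "jac_proj g f u = Phi D0 z" using jac_proj_surj[OF z D0] by blast
  obtain a et B F Z X N where lc: "local_coords z a et B F Z X N" using local_coords_exist[OF z] by blast
  then have c: "coords a et B F" "open N" "z \<in> N" "holomorphic_map X N" "\<forall>w\<in>N. \<forall>i. X w $ i \<in> B i"
   unfolding local_coords_def by blast+
  have "holomorphic_map (%w. abel_sum F (X w)) N"
   by (rule holomorphic_map_compose[OF c(4) holomorphic_abel_sum[OF c(1)]]) (use c(5) in auto)
  then have "holomorphic_map (%w. u - abel_sum F (X w)) N" by (rule holomorphic_map_compose[OF _ holomorphic_map_reflect]) simp
  then show ?thesis using c(3) Phi_local_coords[OF D0 lc z u] by (intro exI[of _ N] exI[of _ "%w. u - abel_sum F (X w)"]) blast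
 qed
 moreover have "holomorphic_map (%u. inv_into lvl (Phi D0) (?p u)) (?p -` ?M)"
  unfolding holomorphic_map_def
 proof (intro conjI ballI)
  \<comment> \<open>The local inverses also show that the complement of the theta divisor has an
    open preimage.\<close>
  have sub: "u \<in> ?p -` ?M ==> \<exists>W. open W \<and> u \<in> W \<and> W \<subseteq> ?p -` ?M" for u
   using Phi_inverse_local[OF D0, of u] unfolding M by (metis imageI subsetI vimage_eq)
  then show "open (?p -` ?M)" by (subst open_subopen) blast
  fix u assume "u \<in> ?p -` ?M"
  then obtain W Y where W: "open W" "u \<in> W" "holomorphic_map Y W" "\<forall>v\<in>W. Y v \<in> lvl \<and> Phi D0 (Y v) = ?p v"
   using Phi_inverse_local[OF D0, of u] unfolding M by blast
  obtain L where L: "Vector_Spaces.linear (*s) (*s) L" "FDERIV Y u :> L" using W(2,3) unfolding holomorphic_map_def by blast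
  have "Y v = inv_into lvl (Phi D0) (?p v)" if "v \<in> W" for v using W(4) that bij_betw_inv_into_left[OF bij] by metis
  then have "FDERIV (%u. inv_into lvl (Phi D0) (?p u)) u :> L" by (intro has_derivative_transform_within_open[OF L(2) W(1,2)])
  then show "\<exists>L. Vector_Spaces.linear (*s) (*s) L \<and> FDERIV (%u. inv_into lvl (Phi D0) (?p u)) u :> L"
   using L(1) by blast
 qed
 ultimately show ?thesis unfolding biholomorphic_onto_def using bij by blast
qed

end

section \<open>Lax equations and linear flows\<close>

lemma lagrange_basis:
 fixes S :: "complex set" assumes S: "finite S"
 shows "\<exists>L. \<forall>p. degree p < card S --> p = (\<Sum>a\<in>S. smult (poly p a) (L a))"
proof -
 have "\<exists>L. degree L <= card S - 1 \<and> (\<forall>b\<in>S. poly L b = (if b = a then 1 else 0))" for a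
  by (rule poly_interpolation[OF S])
 then obtain L where L: "\<And>a. degree (L a) <= card S - 1" "\<And>a b. b \<in> S ==> poly (L a) b = (if b = a then 1 else 0)"
  by metis
 have "p = (\<Sum>a\<in>S. smult (poly p a) (L a))" if p: "degree p < card S" for p
 proof -
  have "p - (\<Sum>a\<in>S. smult (poly p a) (L a)) = 0"
  proof (rule poly_eq_0_of_roots[OF S])
   fix b assume b: "b \<in> S"
   have "(\<Sum>a\<in>S. poly p a * (if b = a then 1 else 0)) = poly p b" using b S by (simp add: if_distrib cong: if_cong)
   then show "poly (p - (\<Sum>a\<in>S. smult (poly p a) (L a))) b = 0" using L(2)[OF b] by (simp add: poly_sum)
  next
   have "degree (\<Sum>a\<in>S. smult (poly p a) (L a)) <= card S - 1" by (intro degree_sum_le S order_trans[OF degree_smult_le L(1)])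
   then show "degree (p - (\<Sum>a\<in>S. smult (poly p a) (L a))) < card S"
    using p by (intro le_less_trans[OF degree_diff_le[of _ "card S - 1"]]) auto
  qed
  then show ?thesis by simp
 qed
 then show ?thesis by blast
qed

text \<open>The functional sending \<open>x^k\<close> to \<open>d k\<close> on polynomials of degree
  below \<open>card S\<close> is a combination of evaluations at the nodes; its values on the
  Lagrange basis are the weights.\<close>

lemma moments_solve:
 fixes S :: "complex set" assumes S: "finite S" shows "\<exists>c. \<forall>k<card S. (\<Sum>a\<in>S. c a * a ^ k) = d k"
proof -
 obtain L where L: "\<And>p. degree p < card S ==> p = (\<Sum>a\<in>S. smult (poly p a) (L a))" using lagrange_basis[OF S] by blast
 have "(\<Sum>a\<in>S. (\<Sum>j<card S. coeff (L a) j * d j) * a ^ k) = d k" if k: "k < card S" for k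
 proof -
  have c: "(\<Sum>a\<in>S. a ^ k * coeff (L a) j) = (if j = k then 1 else 0)" for j
   using arg_cong[OF L[of "monom 1 k"], of "%p. coeff p j"] k
   by (simp add: degree_monom_eq poly_monom coeff_sum eq_commute[of k])
  have "(\<Sum>a\<in>S. (\<Sum>j<card S. coeff (L a) j * d j) * a ^ k) = (\<Sum>a\<in>S. \<Sum>j<card S. d j * (a ^ k * coeff (L a) j))"
   unfolding sum_distrib_right by (simp only: ac_simps)
  also have "\<dots> = (\<Sum>j<card S. d j * (\<Sum>a\<in>S. a ^ k * coeff (L a) j))" unfolding sum_distrib_left by (rule sum.swap)
  also have "\<dots> = d k" unfolding c using k by (simp add: if_distrib cong: if_cong)
  finally show ?thesis .
 qed
 then show ?thesis by (intro exI[of _ "%a. \<Sum>j<card S. coeff (L a) j * d j"]) blast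
qed

text \<open>For \<open>P\<close>, \<open>Q\<close> of degree at most \<open>n\<close> and
  \<open>k >= 1\<close> this is the coefficient of \<open>a^(k-1)\<close> in the Bezoutian
  \<open>(P(x) Q(a) - Q(x) P(a)) / (x - a)\<close>.\<close>

definition lax_coeff :: "nat => complex poly => complex poly => nat => complex poly" where
 "lax_coeff n P Q k = (\<Sum>l=k..n. monom 1 (l - k) * (smult (coeff P l) Q - smult (coeff Q l) P))"

text \<open>Write the numerator as \<open>(P(x) - P(a)) Q(x) - (Q(x) - Q(a)) P(x)\<close> and divide
  each \<open>x^l - a^l\<close> by \<open>x - a\<close>.\<close>

lemma lax_expansion: assumes d: "degree P <= n + 1" "degree Q <= n + 1"
 shows "synthetic_div (smult (poly Q a) P - smult (poly P a) Q) a = (\<Sum>k\<le>n. smult (a ^ k) (lax_coeff (n + 1) P Q (k + 1)))"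
proof (rule poly_eq_except[of "{a}"])
 fix x assume "x \<notin> {a}"
 then have x: "x ~= a" by simp
 define p q where "p = poly P x" and "q = poly Q x"
 define h where "h = (%l. coeff P l * q - coeff Q l * p)"
 have "(\<Sum>k\<le>n. a ^ k * (\<Sum>l=k+1..n+1. x ^ (l - (k + 1)) * h l)) = (\<Sum>k\<le>n. \<Sum>l\<le>n+1. if k < l then a ^ k * x ^ (l - Suc k) * h l else 0)"
  unfolding sum_distrib_left by (intro sum.cong sum.mono_neutral_cong_left) auto
 also have "\<dots> = (\<Sum>l\<le>n+1. \<Sum>k\<le>n. if k < l then a ^ k * x ^ (l - Suc k) * h l else 0)" by (rule sum.swap)
 also have "\<dots> = (\<Sum>l\<le>n+1. \<Sum>k<l. a ^ k * x ^ (l - Suc k) * h l)" by (intro sum.cong sum.mono_neutral_cong_right) auto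
 also have "(x - a) * \<dots> = (\<Sum>l\<le>n+1. (x ^ l - a ^ l) * h l)"
  unfolding sum_distrib_left[of "x - a"] sum_distrib_right[symmetric]
 proof (rule sum.cong[OF refl])
  fix l
  have "a ^ l - x ^ l = (a - x) * (\<Sum>k<l. x ^ (l - Suc k) * a ^ k)" by (rule power_diff_sumr2)
  then have "x ^ l - a ^ l = (x - a) * (\<Sum>k<l. a ^ k * x ^ (l - Suc k))" by (simp add: algebra_simps)
  then show "(x - a) * ((\<Sum>k<l. a ^ k * x ^ (l - Suc k)) * h l) = (x ^ l - a ^ l) * h l" by simp
 qed
 also have "\<dots> = (poly P x - poly P a) * q - (poly Q x - poly Q a) * p"
  unfolding poly_eq_sum[OF d(1)] poly_eq_sum[OF d(2)] h_def sum_distrib_right sum_subtractf[symmetric]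
  by (rule sum.cong) (simp_all add: algebra_simps)
 finally have "(x - a) * (\<Sum>k\<le>n. a ^ k * (\<Sum>l=k+1..n+1. x ^ (l - (k + 1)) * h l)) = poly P x * poly Q a - poly Q x * poly P a"
  by (simp add: p_def q_def algebra_simps)
 moreover have "poly (\<Sum>k\<le>n. smult (a ^ k) (lax_coeff (n + 1) P Q (k + 1))) x = (\<Sum>k\<le>n. a ^ k * (\<Sum>l=k+1..n+1. x ^ (l - (k + 1)) * h l))"
  unfolding lax_coeff_def poly_sum poly_smult poly_mult poly_diff poly_monom h_def p_def q_def by simp
 ultimately show "poly (synthetic_div (smult (poly Q a) P - smult (poly P a) Q) a) x = poly (\<Sum>k\<le>n. smult (a ^ k) (lax_coeff (n + 1) P Q (k + 1))) x"
  using x by (simp add: poly_synthetic_div field_simps)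
qed simp

context level
begin

definition lax_R :: "'n phase => nat => 'n phase" where
 "lax_R z k = ofp (lax_coeff (g + 1) (UU z) (VV z) k)
   (smult (1 / 2) (lax_coeff (g + 1) (WW z) (UU z) k)) (lax_coeff (g + 1) (VV z) (WW z) k)"

lemma lax_vec_expansion: "lax_vec z a = (\<Sum>k\<le>g. a ^ k *s lax_R z (k + 1))"
proof -
 note d = degree_polys[of g m z]
 have s: "ofp (\<Sum>k\<in>A. U k) (\<Sum>k\<in>A. V k) (\<Sum>k\<in>A. W k) = (\<Sum>k\<in>A. ofp (U k) (V k) (W k) :: 'n phase)"
  if "finite A" for A :: "nat set" and U V W using that
 proof (induction A rule: finite_induct)
  case empty
  show ?case by (simp add: of_polys_def vec_eq_iff Let_def)
 qed (simp add: of_polys_linear(1))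
 have "smult (1 / 2) (\<Sum>k\<le>g. smult (a ^ k) (F k)) = (\<Sum>k\<le>g. smult (a ^ k) (smult (1 / 2) (F k)))" for F :: "nat => complex poly"
  by (rule poly_ext) (simp add: poly_sum sum_distrib_left mult.left_commute)
 then show ?thesis
  unfolding lax_vec_def lax_U_def lax_V_def lax_W_def lax_R_def lax_expansion[OF d(1,2)] lax_expansion[OF d(3,1)] lax_expansion[OF d(2,3)]
  by (simp only: s[OF finite_atMost] of_polys_linear(2))
qed

text \<open>Only the moments \<open>sum_i c_i x_i^k\<close> with \<open>k <= g\<close> matter. For
  weights \<open>x_i' / y_i\<close> they are the velocities of the integrals of
  \<open>x^k dx / y\<close>, which is why the flows become linear.\<close>

lemma lax_vec_moments: "(\<Sum>i\<in>I. c i *s lax_vec z (x i)) = (\<Sum>k\<le>g. (\<Sum>i\<in>I. c i * x i ^ k) *s lax_R z (k + 1))"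
proof -
 have "(\<Sum>i\<in>I. c i *s lax_vec z (x i)) = (\<Sum>i\<in>I. \<Sum>k\<le>g. (c i * x i ^ k) *s lax_R z (k + 1))"
  unfolding lax_vec_expansion by (simp add: vec_eq_iff sum_distrib_left mult.assoc)
 also have "\<dots> = (\<Sum>k\<le>g. \<Sum>i\<in>I. (c i * x i ^ k) *s lax_R z (k + 1))" by (rule sum.swap)
 finally show ?thesis by (simp add: vec_eq_iff sum_distrib_right)
qed

lemma lax_R_span: assumes "finite S" "card S = g + 1"
 shows "\<exists>c. (\<Sum>k\<le>g. d k *s lax_R z (k + 1)) = (\<Sum>a\<in>S. c a *s lax_vec z a)"
proof -
 obtain c where c: "\<And>k. k < g + 1 ==> (\<Sum>a\<in>S. c a * a ^ k) = d k" using moments_solve[OF assms(1), of d] assms(2) by auto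
 have "(\<Sum>a\<in>S. c a *s lax_vec z a) = (\<Sum>k\<le>g. d k *s lax_R z (k + 1))"
  unfolding lax_vec_moments by (rule sum.cong[OF refl]) (simp add: c)
 then show ?thesis by metis
qed

lemma lax_R_independent: assumes z: "z \<in> lvl" and 0: "(\<Sum>k\<le>g. d k *s lax_R z (k + 1)) = 0" and k: "k <= g" shows "d k = 0"
proof -
 have "UU z ~= 0" using lead_coeff_U[of g m z] by auto
 then obtain a :: "'n => complex" where a: "inj a" "\<And>i. poly (UU z) (a i) ~= 0"
  using exists_points[of "{x. poly (UU z) x = 0}", where 'n = 'n] poly_roots_finite by blast
 have "card (range a) = g + 1" using card_image[OF a(1)] card by simp
 then obtain c where c: "\<And>k. k < g + 1 ==> (\<Sum>x\<in>range a. c x * x ^ k) = d k"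
  using moments_solve[of "range a" d] by auto
 have r: "(\<Sum>x\<in>range a. h x) = (\<Sum>i\<in>UNIV. h (a i))" for h :: "complex => complex" using sum.reindex[OF a(1), of h] by simp
 have "(\<Sum>i\<in>UNIV. c (a i) *s lax_vec z (a i)) = (\<Sum>k\<le>g. d k *s lax_R z (k + 1))"
  unfolding lax_vec_moments by (rule sum.cong[OF refl]) (simp add: c[unfolded r])
 then have "c (a i) = 0" for i using lax_vec_independent[OF z a, of "%i. c (a i)"] 0 by simp
 then show ?thesis using c[of k] k unfolding r by simp
qed

text \<open>The coefficients of the \<open>lax_R\<close> may depend on the first integral
  \<open>H_(-1)\<close>, because its square occurs in \<open>Htop\<close>. On a level set they are
  constants.\<close>

definition lax_field :: "('n phase => 'n phase) => (complex => nat => complex) => bool" where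
 "lax_field X d \<longleftrightarrow> (\<forall>z. X z = (\<Sum>k\<le>g. d (Hk g m (-1) z) k *s lax_R z (k + 1)))"

text \<open>Every combination of Lax vectors preserves \<open>V^2 + U W\<close>, half the trace of
  the square of the Lax matrix. Connectedness of the time domain carries the value from
  \<open>t0\<close> to all of \<open>I\<close>.\<close>

lemma lax_field_lvl:
 assumes X: "lax_field X d" and I: "open I" "connected I" "t0 \<in> I" "integral_curve X I ze" "ze t0 \<in> lvl" and t: "t \<in> I"
 shows "ze t \<in> lvl"
proof -
 define F :: "'n phase => complex poly" where "F = (%z. VV z ^ 2 + UU z * WW z)"
 have "poly (F (ze t)) x = poly (F (ze t0)) x" for x
 proof -
  have "DERIV (%s. poly (F (ze s)) x) s :> 0" if s: "s \<in> I" for s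
  proof -
   let ?z = "ze s" and ?h = "X (ze s)"
   have ic: "\<And>c. DERIV (%s. ze s $ c) s :> ?h $ c" using I(4) s unfolding integral_curve_def by blast
   note d = phase_curve_derivative[where ze = ze and D = ?h and m = m and g = g and x = x, OF ic]
   \<comment> \<open>The nodes \<open>x + 1\<close>, ..., \<open>x + g + 1\<close> differ from
     \<open>x\<close>, so that the formulas of \<open>poly_lax\<close> apply at
     \<open>x\<close>.\<close>
   define S where "S = (%k. x + of_nat (Suc k)) ` {..<g + 1}"
   have "inj_on (%k. x + of_nat (Suc k)) {..<g + 1}" by (auto simp: inj_on_def)
   then have S: "finite S" "card S = g + 1" "x \<notin> S" unfolding S_def by (auto simp: card_image simp del: of_nat_Suc)
   obtain c where "(\<Sum>k\<le>g. d (Hk g m (-1) ?z) k *s lax_R ?z (k + 1)) = (\<Sum>a\<in>S. c a *s lax_vec ?z a)"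
    using lax_R_span[OF S(1,2)] by blast
   then have c: "?h = (\<Sum>a\<in>S. c a *s lax_vec ?z a)" using X unfolding lax_field_def by simp
   have "2 * poly (VV ?z) x * poly (VV ?h) x + poly (UU ?z) x * poly (dWW ?h) x
     + poly (WW ?z) x * poly (dUU ?h) x = 0"
    unfolding c linear_polys_sum linear_polys polys_lax_vec poly_sum poly_smult sum_distrib_left sum.distrib[symmetric]
   proof (rule sum.neutral, rule ballI)
    fix a assume "a \<in> S"
    then have "x ~= a" using S(3) by auto
    then show "2 * poly (VV ?z) x * (c a * poly (lax_V (UU ?z) (WW ?z) a) x) +
      poly (UU ?z) x * (c a * poly (lax_W (VV ?z) (WW ?z) a) x) +
      poly (WW ?z) x * (c a * poly (lax_U (UU ?z) (VV ?z) a) x) = 0"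
     unfolding poly_lax[OF \<open>x ~= a\<close>] by (simp add: divide_simps) (simp add: algebra_simps)
   qed
   then show ?thesis unfolding F_def poly_add poly_mult poly_power by (auto intro!: derivative_eq_intros d simp: algebra_simps)
  qed
  then have "(%s. poly (F (ze s)) x) constant_on I" by (intro has_field_derivative_0_imp_constant_on[OF _ I(2,1)])
  then show ?thesis using t I(3) by (auto simp: constant_on_def)
 qed
 then have "F (ze t) = F (ze t0)" by (rule poly_ext)
 then show ?thesis using I(5) by (simp add: lvl_def F_def)
qed

text \<open>In the coordinates \<open>x_i\<close> the velocity of the curve is the combination of
  the \<open>lax_vec\<close> at \<open>x_i\<close> with weights \<open>e_i = x_i' / y_i\<close>.
  Comparison with \<open>X\<close>, by independence of the \<open>lax_R\<close>, shows that the
  moments of \<open>e\<close> equal \<open>d\<close>; but these moments are the time derivatives of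
  the Abel sum. The minus sign is that of \<open>Phi_move\<close>.\<close>

lemma Phi_flow_local:
 assumes D0: "D0 \<in> Div0 g f" and X: "\<And>z. z \<in> lvl ==> X z = (\<Sum>k\<le>g. d k *s lax_R z (k + 1))"
  and I: "open I" "integral_curve X I ze" "\<And>t. t \<in> I ==> ze t \<in> lvl" and t1: "t1 \<in> I"
 shows "\<exists>r>0. \<exists>u. \<forall>t\<in>ball t1 r. Phi D0 (ze t) = jac_proj g f (u + t *s (\<chi> j. - d (pos j)) :: (complex, 'n) vec)"
proof -
 note z0 = I(3)[OF t1]
 obtain a et B F Z Y N where lc: "local_coords (ze t1) a et B F Z Y N" using local_coords_exist[OF z0] by blast
 then have c: "coords a et B F" "open N" "ze t1 \<in> N" "holomorphic_map Y N" "Y (ze t1) = (\<chi> i. a i)" "\<And>w i. w \<in> N ==> Y w $ i \<in> B i"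
  and w: "\<And>w. w \<in> N ==> w \<in> lvl ==> Z (Y w) = w \<and> inj (($) (Y w)) \<and> (\<forall>i. poly (UU w) (Y w $ i) ~= 0) \<and>
    FDERIV Z (Y w) :> (%h. \<Sum>i\<in>UNIV. (h $ i / et i (Y w $ i)) *s lax_vec w (Y w $ i))"
  unfolding local_coords_def by blast+
 obtain u :: "(complex, 'n) vec" where u: "jac_proj g f u = Phi D0 (ze t1)" using jac_proj_surj[OF z0 D0] by blast
 have dze: "FDERIV ze t :> (%s. s *s X (ze t))" if "t \<in> I" for t unfolding has_derivative_vec_iff
 proof
  show "FDERIV (%t. ze t $ b) t :> (%s. (s *s X (ze t)) $ b)" for b
   using I(2)[unfolded integral_curve_def has_field_derivative_def, rule_format, OF that, of b] by (simp add: mult_commute_abs)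
 qed
 then have "isCont ze t1" using t1 has_derivative_continuous by blast
 then have "\<forall>\<^sub>F t in at t1. ze t \<in> N" using c(2,3) by (auto simp: isCont_def dest: topological_tendstoD)
 moreover have "\<forall>\<^sub>F t in at t1. t \<in> I" using I(1) t1 by (rule eventually_at_in_open')
 ultimately have "\<forall>\<^sub>F t in at t1. ze t \<in> N \<and> t \<in> I" by eventually_elim blast
 then obtain r where r: "r > 0" "\<And>t. t \<in> ball t1 r ==> ze t \<in> N \<and> t \<in> I"
  unfolding eventually_at using c(3) t1 by (metis UNIV_I dist_commute mem_ball)
 have deriv: "DERIV (%t. abel_sum F (Y (ze t)) $ j) t :> d (pos j)" if t: "t \<in> ball t1 r" for t j
 proof -
  let ?z = "ze t" and ?x = "Y (ze t)"
  have tN: "?z \<in> N" "t \<in> I" "?z \<in> lvl" using r(2)[OF t] I(3) by auto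
  obtain L where L: "Vector_Spaces.linear (*s) (*s) L" "FDERIV Y ?z :> L" using c(4) tN(1) unfolding holomorphic_map_def by blast
  define x' where "x' = L (X ?z)"
  have "(%s. L (s *s X ?z)) = (%s. s *s x')" using L(1) unfolding clinear_iff x'_def by blast
  then have dx: "FDERIV (%t. Y (ze t)) t :> (%s. s *s x')" using has_derivative_compose[OF dze[OF tN(2)] L(2)] by simp
  define e where "e = (%i. x' $ i / et i (?x $ i))"
  have "FDERIV (%t. Z (Y (ze t))) t :> (%s. \<Sum>i\<in>UNIV. ((s *s x') $ i / et i (?x $ i)) *s lax_vec ?z (?x $ i))"
   by (rule has_derivative_compose[OF dx]) (use w[OF tN(1,3)] in blast)
  then have "FDERIV ze t :> (%s. \<Sum>i\<in>UNIV. ((s *s x') $ i / et i (?x $ i)) *s lax_vec ?z (?x $ i))"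
   by (rule has_derivative_transform_within_open[OF _ open_ball t]) (use w r(2) I(3) in auto)
  from fun_cong[OF has_derivative_unique[OF this dze[OF tN(2)]], of 1]
  have "X ?z = (\<Sum>i\<in>UNIV. e i *s lax_vec ?z (?x $ i))" by (simp add: e_def)
  then have "(\<Sum>k\<le>g. ((\<Sum>i\<in>UNIV. e i * ?x $ i ^ k) - d k) *s lax_R ?z (k + 1)) = 0"
   unfolding lax_vec_moments X[OF tN(3)] by (simp add: vec_eq_iff algebra_simps sum_subtractf)
  from lax_R_independent[OF tN(3) this, of "pos j"] pos_props(2)[of j] card
  have mom: "(\<Sum>i\<in>UNIV. e i * ?x $ i ^ pos j) = d (pos j)" by simp
  have "FDERIV (%t. abel_sum F (Y (ze t))) t :> (%s. \<chi> j. \<Sum>i\<in>UNIV. ?x $ i ^ pos j / et i (?x $ i) * (s *s x') $ i)"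
   by (rule has_derivative_compose[OF dx abel_sum_derivative(1)[OF c(1)]]) (use c(6)[OF tN(1)] in blast)
  then have "FDERIV (%t. abel_sum F (Y (ze t)) $ j) t :> (%s. \<Sum>i\<in>UNIV. ?x $ i ^ pos j / et i (?x $ i) * (s *s x') $ i)"
   unfolding has_derivative_vec_iff by simp
  moreover have "(%s. \<Sum>i\<in>UNIV. ?x $ i ^ pos j / et i (?x $ i) * (s *s x') $ i) = (*) (d (pos j))"
   unfolding mom[symmetric] e_def by (auto simp: fun_eq_iff sum_distrib_right intro!: sum.cong)
  ultimately show ?thesis by (simp add: has_field_derivative_def)
 qed
 have "abel_sum F (Y (ze t)) $ j = (t - t1) * d (pos j)" if t: "t \<in> ball t1 r" for t j
 proof -
  have "(%t. abel_sum F (Y (ze t)) $ j - (t - t1) * d (pos j)) constant_on ball t1 r"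
   by (rule has_field_derivative_0_imp_constant_on) (auto intro!: derivative_eq_intros deriv)
  then obtain y where "\<And>t. t \<in> ball t1 r ==> abel_sum F (Y (ze t)) $ j - (t - t1) * d (pos j) = y"
   unfolding constant_on_def by blast
  from this[OF t] this[of t1] show ?thesis using c(5) abel_sum_a[OF c(1)] r(1) by simp
 qed
 then have "u - abel_sum F (Y (ze t)) = (\<chi> j. u $ j + t1 * d (pos j)) + t *s (\<chi> j. - d (pos j))" if "t \<in> ball t1 r" for t
  using that by (simp add: vec_eq_iff algebra_simps)
 then show ?thesis using Phi_local_coords[OF D0 lc z0 u] r I(3)
  by (intro exI[of _ r] conjI exI[of _ "\<chi> j. u $ j + t1 * d (pos j)"] ballI) (metis IntI)+
qed

text \<open>The velocity depends only on the level, so the local formulas differ in their constants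
  alone. Two of them that agree in the quotient at one time agree at all times, and connectedness
  extends the formula over \<open>I\<close>.\<close>

theorem Phi_flow: assumes D0: "D0 \<in> Div0 g f" and X: "lax_field X d"
 shows "\<exists>v :: (complex, 'n) vec. \<forall>I ze t0. open I \<and> connected I \<and> t0 \<in> I \<and> integral_curve X I ze \<and> ze t0 \<in> lvl -->
  (\<exists>u. \<forall>t\<in>I. ze t \<in> lvl \<and> Phi D0 (ze t) = jac_proj g f (u + t *s v))"
proof -
 \<comment> \<open>The value of \<open>H_(-1)\<close> on the level set, read off from the
   coefficient of \<open>x^(2g+1)\<close>.\<close>
 define h where "h = coeff f (2 * g + 1) / 2"
 have Xl: "X z = (\<Sum>k\<le>g. d h k *s lax_R z (k + 1))" if "z \<in> lvl" for z
 proof -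
  have "nat (2 * int g - (- 1)) = 2 * g + 1" by simp
  then have "Hk g m (-1) z = h" using that unfolding Hk_def lvl_def h_def by simp
  then show ?thesis using X unfolding lax_field_def by simp
 qed
 define v :: "(complex, 'n) vec" where "v = (\<chi> j. - d h (pos j))"
 have "\<exists>u. \<forall>t\<in>I. ze t \<in> lvl \<and> Phi D0 (ze t) = jac_proj g f (u + t *s v)"
  if I: "open I" "connected I" "t0 \<in> I" "integral_curve X I ze" "ze t0 \<in> lvl" for I ze t0
 proof -
  note lv = lax_field_lvl[OF X I]
  have loc: "\<exists>r>0. \<exists>u. \<forall>t\<in>ball t1 r. Phi D0 (ze t) = jac_proj g f (u + t *s v)" if "t1 \<in> I" for t1
   unfolding v_def by (rule Phi_flow_local[where X = X and d = "d h" and ze = ze, OF D0 Xl I(1,4) lv that])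
  obtain u where u: "Phi D0 (ze t0) = jac_proj g f (u + t0 *s v)" using loc[OF I(3)] by (metis centre_in_ball)
  define Q where "Q = (%t. Phi D0 (ze t) = jac_proj g f (u + t *s v))"
  \<comment> \<open>If two lines with the same direction agree in the Jacobian at the time
    \<open>s\<close>, translation by \<open>(s' - s) v\<close> makes them agree at the time
    \<open>s'\<close>.\<close>
  have same: "Q t \<longleftrightarrow> Q t'" if "\<forall>s\<in>{t, t'}. Phi D0 (ze s) = jac_proj g f (w + s *s v)" for t t' w
  proof -
   have "jac_proj g f (w + s' *s v) = jac_proj g f (u + s' *s v)" if "jac_proj g f (w + s *s v) = jac_proj g f (u + s *s v)" for s s'
    using jac_proj_diff_cong[OF card that, of "(s' - s) *s v"] by (simp add: add.assoc flip: vector_sadd_rdistrib)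
   then show ?thesis using that unfolding Q_def by auto
  qed
  have *: "\<exists>T. open T \<and> t1 \<in> T \<and> (\<forall>t\<in>T. Q t \<longleftrightarrow> Q t1)" if t1: "t1 \<in> I" for t1
  proof -
   from loc[OF t1] obtain r w where r: "r > 0" and w: "\<forall>t\<in>ball t1 r. Phi D0 (ze t) = jac_proj g f (w + t *s v)" by metis
   have "Q t \<longleftrightarrow> Q t1" if "t \<in> ball t1 r" for t
   proof (rule same)
    show "\<forall>s\<in>{t, t1}. Phi D0 (ze s) = jac_proj g f (w + s *s v)" using that w r by simp
   qed
   then show ?thesis using centre_in_ball[of t1 r] open_ball[of t1 r] r by blast
  qed
  have "Q t" if "t \<in> I" for t
  proof (rule connected_induction_simple[where P = Q, OF I(2,3) that])
   show "Q t0" using u by (simp add: Q_def)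
   fix t1 assume "t1 \<in> I"
   with * obtain T where T: "open T" "t1 \<in> T" "\<forall>t\<in>T. Q t \<longleftrightarrow> Q t1" by blast
   then show "\<exists>T. openin (top_of_set I) T \<and> t1 \<in> T \<and> (\<forall>x\<in>T. \<forall>y\<in>T. Q x --> Q y)"
    using \<open>t1 \<in> I\<close> by (intro exI[of _ "I \<inter> T"] conjI openin_open_Int) blast+
  qed
  then show ?thesis using lv unfolding Q_def by blast
 qed
 then show ?thesis by (intro exI[of _ v]) blast
qed

end

section \<open>The Hamiltonian vector fields as combinations of Lax fields\<close>

lemma coeff_lax_coeff: assumes d: "degree P <= g + 1" "degree Q <= g + 1" and n: "n <= g"
 shows "coeff (lax_coeff (g + 1) P Q k) n =
  (\<Sum>j\<le>g. if j <= n then coeff P (k + j) * coeff Q (n - j) - coeff Q (k + j) * coeff P (n - j) else 0)"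
  (is "_ = (\<Sum>j\<le>g. ?T j)")
proof -
 have "coeff (lax_coeff (g + 1) P Q k) n = (\<Sum>l=k..g+1. ?T (l - k))"
  unfolding lax_coeff_def coeff_sum by (rule sum.cong) (auto simp: coeff_monom_mult)
 also have "\<dots> = (\<Sum>j\<le>g. ?T j)"
  by (rule sum.reindex_bij_witness_not_neutral[where S' = "{l\<in>{k..g+1}. n < l - k}" and T' = "{j\<in>{..g}. k + j > g + 1 \<or> n < j}"
   and i = "%j. k + j" and j = "%l. l - k"]) (use n d in \<open>auto simp: coeff_eq_0\<close>)
 finally show ?thesis .
qed

lemma lax_coeff_0: assumes d: "degree P <= n" "degree Q <= n" shows "lax_coeff n P Q 0 = 0"
proof (rule poly_ext)
 fix x
 have "poly (lax_coeff n P Q 0) x = (\<Sum>l\<le>n. coeff P l * x ^ l) * poly Q x - (\<Sum>l\<le>n. coeff Q l * x ^ l) * poly P x"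
  unfolding lax_coeff_def sum_distrib_right sum_subtractf[symmetric] poly_sum atMost_atLeast0
  by (rule sum.cong) (simp_all add: poly_monom algebra_simps)
 then show "poly (lax_coeff n P Q 0) x = poly 0 x" using d by (simp flip: poly_eq_sum)
qed

lemma lax_coeff_top: "lax_coeff n P Q n = smult (coeff P n) Q - smult (coeff Q n) P" by (simp add: lax_coeff_def)

lemma Hk_derivative:
 fixes z h :: "complex ^ ('n::enum \<times> 3)" shows "((%t. Hk g m k (z + t *s h)) has_field_derivative
  coeff (2 * V_poly g m z * V_poly g m h + U_poly g m z * dW_poly g m h + W_poly g m z * dU_poly g m h) (nat (2 * int g - k)) / 2) (at 0)"
proof -
 let ?n = "nat (2 * int g - k)" and ?V = "V_poly g m z" and ?U = "U_poly g m z" and ?W = "W_poly g m z"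
  and ?v = "V_poly g m h" and ?u = "dU_poly g m h" and ?w = "dW_poly g m h"
 have "U_poly g m w = dU_poly g m w + monom 1 (g + 1)" "W_poly g m w = dW_poly g m w + monom 1 (g + 1)" for w :: "'n phase"
  by (simp_all add: dU_poly_def dW_poly_def)
 then have V: "V_poly g m (z + t *s h) = ?V + smult t ?v" and U: "U_poly g m (z + t *s h) = ?U + smult t ?u"
  and W: "W_poly g m (z + t *s h) = ?W + smult t ?w" for t by (simp_all add: linear_polys)
 have "(?V + smult t ?v)\<^sup>2 + (?U + smult t ?u) * (?W + smult t ?w) =
  (?V\<^sup>2 + ?U * ?W) + smult t (2 * ?V * ?v + ?U * ?w + ?W * ?u) + smult (t\<^sup>2) (?v\<^sup>2 + ?u * ?w)" for t
  by (rule poly_ext) (simp add: power2_eq_square algebra_simps)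
 then have H: "Hk g m k (z + t *s h) = (coeff (?V\<^sup>2 + ?U * ?W) ?n + t * coeff (2 * ?V * ?v + ?U * ?w + ?W * ?u) ?n +
   t\<^sup>2 * coeff (?v\<^sup>2 + ?u * ?w) ?n) / 2" for t unfolding Hk_def V U W by (simp only: coeff_add coeff_smult)
 have "DERIV (%t. (a + t * b + t\<^sup>2 * c) / 2) 0 :> b / 2" for a b c :: complex by (auto intro!: derivative_eq_intros)
 then show ?thesis unfolding H .
qed

lemma ham_field_nth: assumes card: "CARD('n::enum) = g + 1"
 shows "ham_field g m K (z :: 'n phase) $ (j0, k0) = gam_sign (pos j0) / gam_scale m (pos j0) k0 *
  (\<Sum>j\<le>g. \<Sum>l\<in>UNIV. pdG m j l K z * (\<Sum>c\<in>UNIV. Lam k0 l c * Gcoord g m (pos j0 + j) c z))"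
proof -
 let ?s = "gam_sign (pos j0) / gam_scale m (pos j0) k0"
 let ?F = "%i k. \<Sum>j\<le>g. \<Sum>l\<in>UNIV. pdG m j l K z * (\<Sum>c\<in>UNIV. Lam k l c * Gcoord g m (i + j) c z)"
 have pd: "pdG m i k (%w. w $ (j0, k0)) z = (if i = pos j0 \<and> k = k0 then ?s else 0)" if i: "i <= g" for i k
 proof -
  have "DERIV (%t. (z + t *s Gdir m i k) $ (j0, k0)) 0 :> (Gdir m i k :: 'n phase) $ (j0, k0)"
   by (auto intro!: derivative_eq_intros)
  then have "pdG m i k (%w. w $ (j0, k0)) z = Gdir m i k $ (j0, k0)" unfolding pdG_def by (rule DERIV_imp_deriv)
  moreover have "ix i = j0 \<longleftrightarrow> i = pos j0" using pos_ix[of i, where 'n = 'n] i card by auto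
  ultimately show ?thesis by (auto simp: Gdir_def axis_def gam_sign_def gam_scale_def)
 qed
 have j0: "pos j0 \<in> {..g}" using pos_props(2)[of j0] card by simp
 have "ham_field g m K z $ (j0, k0) = (\<Sum>i\<le>g. \<Sum>j\<le>g. \<Sum>k\<in>UNIV. \<Sum>l\<in>UNIV. (if i = pos j0 \<and> k = k0 then ?s else 0) * (pdG m j l K z *
   (\<Sum>c\<in>UNIV. Lam k l c * Gcoord g m (i + j) c z)))"
  unfolding ham_field_def poisson_def vec_lambda_beta by (intro sum.cong refl) (simp add: pd mult.assoc)
 also have "\<dots> = (\<Sum>i\<le>g. \<Sum>k\<in>UNIV. (if i = pos j0 \<and> k = k0 then ?s else 0) * ?F i k)"
  by (rule sum.cong[OF refl], subst sum.swap) (simp only: sum_distrib_left)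
 also have "\<dots> = (\<Sum>i\<le>g. if i = pos j0 then ?s * ?F i k0 else 0)"
 proof (rule sum.cong[OF refl])
  have "(\<Sum>k\<in>UNIV. (if i = pos j0 \<and> k = k0 then ?s else 0) * X k) = (if i = pos j0 then ?s * X k0 else 0)" for i and X :: "3 => complex"
   by (cases "i = pos j0") (simp_all add: if_distrib[of "%c. c * _"] cong: if_cong)
  then show "(\<Sum>k\<in>UNIV. (if i = pos j0 \<and> k = k0 then ?s else 0) * ?F i k) = (if i = pos j0 then ?s * ?F i k0 else 0)" for i .
 qed
 also have "\<dots> = ?s * ?F (pos j0) k0" using j0 by simp
 finally show ?thesis .
qed

lemma ham_field_combination: assumes "\<And>j l. pdG m j l K z = pdG m j l K1 z + c * pdG m j l K2 z" and card: "CARD('n::enum) = g + 1"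
 shows "ham_field g m K (z :: 'n phase) = ham_field g m K1 z + c *s ham_field g m K2 z"
proof -
 have "ham_field g m K z $ (j, k) = (ham_field g m K1 z + c *s ham_field g m K2 z) $ (j, k)" for j k
  unfolding vector_add_component vector_smult_component ham_field_nth[OF card] assms(1)
  by (simp only: distrib_left distrib_right sum.distrib sum_distrib_left mult.assoc mult.left_commute)
 then show ?thesis by (simp add: vec_eq_iff)
qed

context level
begin

text \<open>Moving \<open>G_j\<close> changes the polynomials by multiples of
  \<open>x^(g-j)\<close>, so the derivative of the coefficient of index \<open>2g - k\<close>
  involves the coefficients of index \<open>g - k + j\<close> of \<open>U\<close>, \<open>V\<close>,
  \<open>W\<close>.\<close>

lemma pdG_Hk: assumes j: "j <= g" and k: "k <= int g"
 defines "s == nat (int g - k) + j" shows "pdG m j 1 (Hk g m k) (z :: 'n phase) = coeff (VV z) s"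
  "pdG m j 2 (Hk g m k) z = \<i> / 2 * (coeff (UU z) s - coeff (WW z) s)"
  "pdG m j 3 (Hk g m k) z = (coeff (UU z) s + coeff (WW z) s) / 2"
proof -
 let ?X = "monom 1 (g - j) :: complex poly"
 define n where "n = nat (2 * int g - k)"
 have n: "\<not> n < g - j" "n - (g - j) = s" using j k unfolding s_def n_def by auto
 have pj: "pos (ix j :: 'n) = j" using j card by (intro pos_ix) simp
 have c: "g - pos i = g - j \<longleftrightarrow> i = ix j" for i :: 'n
 proof -
  have "g - pos i = g - j \<longleftrightarrow> pos i = j" using pos_props(2)[of i] card j by auto
  also have "\<dots> \<longleftrightarrow> i = ix j" using pj pos_props(1)[of i] by (auto simp: ix_def)
  finally show ?thesis .
 qed
 have 3: "((3 :: 3) = 1) = False" "((3 :: 3) = 2) = False" "((2 :: 3) = 1) = False" "((1 :: 3) = 2) = False"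
   "((1 :: 3) = 3) = False" "((2 :: 3) = 3) = False" by auto
 have "(Gdir m j 1 :: 'n phase) $ (i, k) = ofp 0 ?X 0 $ (i, k)"
  "(Gdir m j 2 :: 'n phase) $ (i, k) = ofp (smult (- \<i>) ?X) 0 (smult \<i> ?X) $ (i, k)"
  "(Gdir m j 3 :: 'n phase) $ (i, k) = ofp ?X 0 ?X $ (i, k)" for i k
 proof -
  have e: "coeff ?X (g - pos i) = (if i = ix j then 1 else 0)" using c[of i] by auto
  from e have G: "(Gdir m j l :: 'n phase) $ (i, k) = (if k = l then gam_sign j / gam_scale m j k * coeff ?X (g - pos i) else 0)" for l
   by (auto simp: Gdir_def axis_def gam_sign_def gam_scale_def)
  have "gam_sign (pos i) / gam_scale m (pos i) k * coeff ?X (g - pos i) = gam_sign j / gam_scale m j k * coeff ?X (g - pos i)"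
   unfolding e using pj by (cases "i = ix j") simp_all
  note G = G[folded this]
  consider "k = 1" | "k = 2" | "k = 3" using exhaust_3[of k] by blast
  then show "(Gdir m j 1 :: 'n phase) $ (i, k) = ofp 0 ?X 0 $ (i, k)"
   "(Gdir m j 2 :: 'n phase) $ (i, k) = ofp (smult (- \<i>) ?X) 0 (smult \<i> ?X) $ (i, k)"
   "(Gdir m j 3 :: 'n phase) $ (i, k) = ofp ?X 0 ?X $ (i, k)"
   unfolding G of_polys_def vec_lambda_beta Let_def fst_conv snd_conv by (cases; simp add: 3 del: coeff_monom)+
 qed
 then have G: "(Gdir m j 1 :: 'n phase) = ofp 0 ?X 0"
  "(Gdir m j 2 :: 'n phase) = ofp (smult (- \<i>) ?X) 0 (smult \<i> ?X)" "(Gdir m j 3 :: 'n phase) = ofp ?X 0 ?X"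
  by (simp_all add: vec_eq_iff)
 have dX: "degree ?X <= g" "degree (smult (- \<i>) ?X) <= g" "degree (smult \<i> ?X) <= g" by (auto simp: degree_monom_eq)
 note P = polys_of_polys[OF card m]
 have cX: "coeff (p * ?X) n = coeff p s" for p using n by (subst mult.commute) (simp add: coeff_monom_mult)
 have c2: "coeff (2 * p * ?X) n = 2 * coeff p s" for p by (simp only: cX mult_2 distrib_right coeff_add)
 have D: "pdG m j l (Hk g m k) z = coeff (2 * VV z * VV (Gdir m j l :: 'n phase) + UU z * dWW (Gdir m j l :: 'n phase) +
   WW z * dUU (Gdir m j l :: 'n phase)) n / 2" for l unfolding pdG_def n_def by (rule DERIV_imp_deriv[OF Hk_derivative])
 show "pdG m j 1 (Hk g m k) z = coeff (VV z) s" unfolding D G(1) using P[of 0 ?X 0] dX by (simp add: c2)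
 show "pdG m j 2 (Hk g m k) z = \<i> / 2 * (coeff (UU z) s - coeff (WW z) s)"
  unfolding D G(2) using P[of "smult (- \<i>) ?X" 0 "smult \<i> ?X"] dX by (simp add: cX right_diff_distrib)
 show "pdG m j 3 (Hk g m k) z = (coeff (UU z) s + coeff (WW z) s) / 2"
  unfolding D G(3) using P[of ?X 0 ?X] dX by (simp add: cX)
qed

lemma Gcoord_polys: "Gcoord g m n 1 z = (if n <= g then coeff (VV z) (g - n) else 0)"
 "Gcoord g m n 2 z = (if n <= g then (coeff (WW z) (g - n) - coeff (UU z) (g - n)) / (2 * \<i>) else 0)"
 "Gcoord g m n 3 z = (if n <= g then (coeff (UU z) (g - n) + coeff (WW z) (g - n)) / 2 else 0)"
proof -
 have "n <= g ==> g - (g - n) = n" "g - n ~= g + 1" by auto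
 moreover have "(s * (a + \<i> * b) - s * (a - \<i> * b)) / (2 * \<i>) = s * b" "(s * (a - \<i> * b) + s * (a + \<i> * b)) / 2 = s * a" for s a b :: complex
  by (simp_all add: field_simps)
 ultimately show "Gcoord g m n 1 z = (if n <= g then coeff (VV z) (g - n) else 0)"
  "Gcoord g m n 2 z = (if n <= g then (coeff (WW z) (g - n) - coeff (UU z) (g - n)) / (2 * \<i>) else 0)"
  "Gcoord g m n 3 z = (if n <= g then (coeff (UU z) (g - n) + coeff (WW z) (g - n)) / 2 else 0)"
  unfolding Gcoord_def coeff_V coeff_U coeff_W by (auto simp: gam_sign_def)
qed

text \<open>The gradient of \<open>H\<^sub>k\<close> with respect to \<open>G\<^sub>j\<close> is \<open>G\<^sub>k\<^sub>-\<^sub>j\<close>, where \<open>G\<^sub>-\<^sub>1 = (0, 0, 1)\<close>, so that the bracket with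
 \<open>H\<^sub>k\<close> is a sum of cross products of coefficients of the Lax matrix.\<close>
theorem ham_field_Hk: assumes k: "k <= int g" shows "ham_field g m (Hk g m k) z = \<i> *s lax_R z (nat (int g - k))"
proof -
 have "ham_field g m (Hk g m k) z $ (j0, k0) = (\<i> *s lax_R z (nat (int g - k))) $ (j0, k0)" for j0 k0
 proof -
  let ?i = "pos j0" and ?r = "nat (int g - k)" and ?U = "coeff (UU z)" and ?V = "coeff (VV z)"
   and ?W = "coeff (WW z)"
  let ?n = "g - ?i"
  have i: "?i <= g" using pos_props(2)[of j0] card by simp
  note d = degree_polys[of g m z]
  define T where "T = (%P Q j. if j <= ?n then P (?r + j) * Q (?n - j) - Q (?r + j) * P (?n - j) else (0 :: complex))"
  have cl: "coeff (lax_coeff (g + 1) P Q ?r) ?n = (\<Sum>j\<le>g. T (coeff P) (coeff Q) j)"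
   if "degree P <= g + 1" "degree Q <= g + 1" for P Q unfolding T_def by (rule coeff_lax_coeff[OF that]) simp
  define R where "R = (%j. if k0 = 1 then 1 / 2 * T ?W ?U j else if k0 = 2 then (T ?V ?W j - T ?U ?V j) / (2 * \<i>) else (T ?U ?V j + T ?V ?W j) / 2)"
  have "lax_R z ?r $ (j0, k0) = gam_sign ?i / gam_scale m ?i k0 * (\<Sum>j\<le>g. R j)"
   unfolding lax_R_def of_polys_def vec_lambda_beta Let_def fst_conv snd_conv coeff_smult cl[OF d(1,2)] cl[OF d(3,1)] cl[OF d(2,3)] R_def
   by (cases "k0 = 1"; cases "k0 = 2")
    (simp_all add: sum_distrib_left sum.distrib sum_subtractf sum_divide_distrib[symmetric] add_divide_distrib diff_divide_distrib right_diff_distrib)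
  moreover have "(\<Sum>l\<in>UNIV. pdG m j l (Hk g m k) z * (\<Sum>c\<in>UNIV. Lam k0 l c * Gcoord g m (?i + j) c z)) = \<i> * R j" if j: "j <= g" for j
  proof -
   have g: "?i + j <= g \<longleftrightarrow> j <= ?n" "g - (?i + j) = ?n - j" using i by auto
   have i2: "a / (2 * \<i>) = - (\<i> * a / 2)" "\<i> * (\<i> * a) = - a" for a :: complex by (simp_all add: field_simps)
   consider "k0 = 1" | "k0 = 2" | "k0 = 3" using exhaust_3[of k0] by blast
   then show ?thesis unfolding R_def T_def sum_3 Lam_def pdG_Hk[OF j k] Gcoord_polys g
    by cases ((cases "j <= ?n"; simp), simp add: algebra_simps add_divide_distrib diff_divide_distrib)+
  qed
  ultimately show ?thesis
   unfolding ham_field_nth[OF card] vector_smult_component by (simp add: sum_distrib_left mult.left_commute)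
 qed
 then show ?thesis by (simp add: vec_eq_iff)
qed

text \<open>For index 0 the defining sums are of the form \<open>P Q - Q P\<close>. In terms of the
  bracket, \<open>H_g\<close> is a Casimir, which covers \<open>H_0\<close> in \<open>Htop\<close>
  for \<open>g = 0\<close>.\<close>

lemma lax_R_0: "lax_R z 0 = 0"
proof -
 note d = degree_polys[of g m z]
 show ?thesis unfolding lax_R_def lax_coeff_0[OF d(1,2)] lax_coeff_0[OF d(3,1)] lax_coeff_0[OF d(2,3)]
  by (simp add: of_polys_def vec_eq_iff Let_def)
qed

text \<open>The field of \<open>H_k\<close> is \<open>\<i>\<close> times \<open>lax_R\<close> of
  index \<open>g - k\<close>, that is the single coefficient \<open>g - k - 1\<close> in
  \<open>lax_field\<close>. For \<open>Htop\<close> the square of \<open>H_(-1)\<close> contributes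
  a multiple of \<open>H_(-1)\<close> times the field of \<open>H_(-1)\<close>, which sits at the
  coefficient \<open>g\<close>.\<close>

theorem hamiltonian_lax_field: assumes "K \<in> (hamiltonians g m :: ('n phase => complex) set)"
 shows "\<exists>d. lax_field (ham_field g m K) d"
proof -
 have single: "(\<Sum>k\<le>g. (if k = k' then c else 0) *s lax_R z (k + 1)) = c *s lax_R z (k' + 1)" if "k' <= g" for z k' c
  using that by (simp add: if_distrib[of "%c. c *s _"] cong: if_cong)
 have H: "\<exists>d. lax_field (ham_field g m (Hk g m k)) d" if k: "k < int g" "-1 <= k" for k
 proof -
  have "nat (int g - k) = nat (int g - k - 1) + 1" "nat (int g - k - 1) <= g" using k by auto
  then show ?thesis unfolding lax_field_def using ham_field_Hk[of k] single[of "nat (int g - k - 1)" \<i>] k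
   by (intro exI[of _ "%_ k'. if k' = nat (int g - k - 1) then \<i> else 0"]) simp
 qed
 consider "K = Hk g m (-1)" | "K = Htop g m" | k where "k \<in> {1..int g - 1}" "K = Hk g m k"
  using assms unfolding hamiltonians_def by blast
 then show ?thesis
 proof cases
  case 2
  define r :: complex where "r = of_real (m / (2 * (1 + m)))"
  have pd: "pdG m j l (Htop g m) z = pdG m j l (Hk g m 0) z + (- 2 * r * Hk g m (-1) z) * pdG m j l (Hk g m (-1)) z" for j l and z :: "'n phase"
  proof -
   have D: "DERIV (%t. Hk g m i (z + t *s Gdir m j l)) 0 :> pdG m j l (Hk g m i) z" for i
    unfolding pdG_def DERIV_imp_deriv[OF Hk_derivative] by (rule Hk_derivative)
   show ?thesis unfolding pdG_def[of m j l "Htop g m"] Htop_def r_def[symmetric]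
    by (rule DERIV_imp_deriv) (auto intro!: derivative_eq_intros D)
  qed
  have "ham_field g m (Htop g m) z = (\<Sum>k\<le>g. ((if k + 1 = g then \<i> else 0) + (if k = g then - 2 * r * Hk g m (-1) z * \<i> else 0)) *s lax_R z (k + 1))" for z
  proof -
   have "(\<Sum>k\<le>g. (if k + 1 = g then \<i> else 0) *s lax_R z (k + 1)) = \<i> *s lax_R z g"
   \<comment> \<open>For \<open>g = 0\<close> no index satisfies \<open>k + 1 = g\<close>, in
     accordance with \<open>lax_R z 0 = 0\<close>.\<close>
   proof (cases g)
    case 0
    then show ?thesis using lax_R_0[of z] by simp
   next
    case (Suc g')
    then show ?thesis using single[of g' \<i> z] by simp
   qed
   moreover have "ham_field g m (Htop g m) z = \<i> *s lax_R z g + (- 2 * r * Hk g m (-1) z) *s (\<i> *s lax_R z (g + 1))"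
    using ham_field_combination[OF pd card, of z] ham_field_Hk[of 0 z] ham_field_Hk[of "-1" z] by (simp add: nat_add_distrib)
   ultimately show ?thesis
    using single[of g "- 2 * r * Hk g m (-1) z * \<i>" z] by (simp add: vec.scale_left_distrib sum.distrib mult.assoc)
  qed
  then show ?thesis unfolding 2 lax_field_def
   by (intro exI[of _ "%s k. (if k + 1 = g then \<i> else 0) + (if k = g then - 2 * r * s * \<i> else 0)"]) simp
 qed (auto intro: H)
qed

end

section \<open>The Lax pairs\<close>

lemma mat_scalar: "(mat c ** A) $ i $ j = c * A $ i $ j" for A :: "complex^'m^'m"
 by (simp add: matrix_matrix_mult_def mat_def if_distrib[of "%c. c * _"] cong: if_cong)

lemma commutator_sum:
 fixes M :: "complex^2^2" shows "(M ** (\<Sum>a\<in>A. mat (c a) ** P a) - (\<Sum>a\<in>A. mat (c a) ** P a) ** M) $ r $ s =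
  (\<Sum>a\<in>A. c a * (M ** P a - P a ** M) $ r $ s)"
proof -
 define Q where "Q = (%a. mat (c a) ** P a)"
 have Q: "Q a $ i $ j = c a * P a $ i $ j" for a i j by (simp add: Q_def mat_scalar)
 show ?thesis unfolding Q_def[symmetric]
  by (simp add: matrix_matrix_mult_def sum_2 sum_component Q sum_distrib_left sum_distrib_right algebra_simps flip: sum.distrib sum_subtractf)
qed

text \<open>\<open>1 / (x - b)\<close> behaves like \<open>- 1 / b\<close>, so after division by
  \<open>b^g\<close> each entry tends to minus its coefficient of \<open>x^(g+1)\<close>: 0 on the
  diagonal, \<open>- 1\<close> for \<open>U\<close> and \<open>W\<close>.\<close>

lemma lax_partner_infinity: "lax_partner g m z None x = vector [vector [0, - 1], vector [- 1, 0]]"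
proof -
 have p: "((%b. 1 / b ^ g * (1 / (x - b) * poly p b)) \<longlongrightarrow> - coeff p (g + 1)) at_infinity" if "degree p <= g + 1" for p
 proof -
  have lim: "((%t. poly p (1 / t) * t ^ (g + 1) / (x * t - 1)) \<longlongrightarrow> coeff p (g + 1) / (x * 0 - 1)) (at 0)"
   by (intro tendsto_intros tendsto_poly_recip that) simp
  have ev: "\<forall>\<^sub>F t in at 0. poly p (1 / t) * t ^ (g + 1) / (x * t - 1) = ((%b. 1 / b ^ g * (1 / (x - b) * poly p b)) \<circ> inverse) t"
   by (rule eventually_at_topological[THEN iffD2], rule exI[of _ UNIV]) (auto simp: field_simps)
  show ?thesis unfolding lim_at_infinity_0 using tendsto_cong[OF ev, THEN iffD1, OF lim] by (simp add: comp_def)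
 qed
 have "((%b. mat (1 / b ^ g) ** (mat (1 / (x - b)) ** lax_matrix g m z b)) \<longlongrightarrow> vector [vector [0, - 1], vector [- 1, 0]]) at_infinity"
 proof (intro vec_tendstoI)
  note c = degree_polys[of g m z] degree_polys(2)[of g m z, folded degree_minus[of "V_poly g m z"]] top_coeffs[of g m z]
  fix i j :: 2
  show "((%b. (mat (1 / b ^ g) ** (mat (1 / (x - b)) ** lax_matrix g m z b)) $ i $ j) \<longlongrightarrow>
   (vector [vector [0, - 1], vector [- 1, 0]] :: complex^2^2) $ i $ j) at_infinity"
   unfolding mat_scalar using exhaust_2[of i] exhaust_2[of j] p[OF c(1)] p[OF c(2)] p[OF c(3)] p[OF c(4)] c(5-7)
   by (auto simp: lax_matrix_def)
 qed
 then show ?thesis unfolding lax_partner_def option.case by (rule tendsto_Lim[OF trivial_limit_at_infinity])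
qed

definition dlax :: "nat => real => complex ^ ('n::enum \<times> 3) => complex => complex^2^2" where
 "dlax g m h x = vector [vector [poly (V_poly g m h) x, poly (dU_poly g m h) x], vector [poly (dW_poly g m h) x, - poly (V_poly g m h) x]]"

lemma dlax_combination: "dlax g m (\<Sum>a\<in>A. c a *s h a) x $ r $ s = (\<Sum>a\<in>A. c a * dlax g m (h a) x $ r $ s)"
 using exhaust_2[of r] exhaust_2[of s] by (auto simp: dlax_def linear_polys_sum linear_polys poly_sum sum_negf)

lemma lax_matrix_derivative: assumes "\<And>c. DERIV (%s. ze s $ c) t :> D $ c"
 shows "DERIV (%s. lax_matrix g m (ze s) x $ i $ j) t :> dlax g m D x $ i $ j"
proof -
 note d = phase_curve_derivative[where ze = ze and D = D and g = g and m = m and x = x, OF assms]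
 show ?thesis using exhaust_2[of i] exhaust_2[of j] d(1,2,3) DERIV_minus[OF d(2)] by (auto simp: lax_matrix_def dlax_def)
qed

context level
begin

text \<open>At infinity the coefficient of \<open>a^g\<close> in \<open>lax_vec z a\<close>, in
  keeping with the division by \<open>a^g\<close> in \<open>lax_partner\<close>.\<close>

definition lax_direction :: "'n phase => complex option => 'n phase" where
 "lax_direction z a = (case a of Some b => lax_vec z b | None => lax_R z (g + 1))"

lemma lax_commutator: assumes "Some x ~= a"
 shows "(lax_matrix g m z x ** lax_partner g m z a x - lax_partner g m z a x ** lax_matrix g m z x) $ r $ s =
  - 2 * dlax g m (lax_direction z a) x $ r $ s"
proof (cases a)
 case (Some b)
 then have "x ~= b" using assms by simp
 define e where "e = 1 / (x - b)"
 have e: "k / (x - b) = k * e" "k / (2 * (x - b)) = k * e / 2" for k by (simp_all add: e_def)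
 then show ?thesis unfolding Some lax_partner_def lax_direction_def option.case using exhaust_2[of r] exhaust_2[of s]
  by (auto simp: matrix_matrix_mult_def mat_def if_distrib[of "%c. c * _"] sum_2 lax_matrix_def dlax_def polys_lax_vec poly_lax[OF \<open>x ~= b\<close>] e simp del: right_diff_distrib_numeral cong: if_cong) (simp_all add: algebra_simps)
next
 case None
 have "degree (UU z - WW z) <= g"
 proof -
  have "UU z - WW z = dUU z - dWW z" by (simp add: dU_poly_def dW_poly_def)
  then show ?thesis using degree_dU[of g m z] degree_dW[of g m z] by (simp add: degree_diff_le)
 qed
 then have d: "degree (VV z) <= g" "degree (- VV z) <= g" "degree (smult (1 / 2) (UU z - WW z)) <= g"
  using degree_V[of g m z] by (auto intro: order_trans[OF degree_smult_le])
 have "lax_R z (g + 1) = ofp (VV z) (smult (1 / 2) (UU z - WW z)) (- VV z)"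
  unfolding lax_R_def lax_coeff_top top_coeffs by simp
 then show ?thesis unfolding None lax_partner_infinity lax_direction_def option.case using exhaust_2[of r] exhaust_2[of s]
  by (auto simp: matrix_matrix_mult_def sum_2 lax_matrix_def dlax_def polys_of_polys[OF card m d(1,3,2)] simp del: right_diff_distrib_numeral)
qed

text \<open>Polynomials of degree at most \<open>g\<close> are determined by \<open>g + 1\<close>
  values, which can be taken outside the finite set \<open>F\<close>; Lagrange interpolation with
  fixed nodes carries derivatives from the values over to the coefficients.\<close>

lemma integral_curve_lax:
 fixes ze :: "complex => 'n phase" assumes F: "finite F"
 shows "integral_curve X I ze \<longleftrightarrow> (\<forall>t\<in>I. \<forall>x. x \<notin> F --> (\<forall>r s.
  DERIV (%tau. lax_matrix g m (ze tau) x $ r $ s) t :> dlax g m (X (ze t)) x $ r $ s))" (is "_ \<longleftrightarrow> ?R")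
proof
 assume "integral_curve X I ze"
 then show ?R unfolding integral_curve_def by (auto intro: lax_matrix_derivative)
next
 assume R: ?R
 obtain S where S: "finite S" "S \<subseteq> - F" "card S = g + 1"
  using infinite_arbitrarily_large[of "- F" "g + 1"] F infinite_UNIV_char_0[where 'a = complex] by (metis finite_compl)
 obtain L where L: "\<And>p. degree p < card S ==> p = (\<Sum>a\<in>S. smult (poly p a) (L a))" using lagrange_basis[OF S(1)] by blast
 have D: "DERIV (%tau. coeff (q tau) n) t :> coeff q' n"
  if "\<And>tau. degree (q tau) <= g" "degree q' <= g" "\<And>x. x \<in> S ==> DERIV (%tau. poly (q tau) x) t :> poly q' x" for q q' n t
 proof -
  have c: "coeff p n = (\<Sum>a\<in>S. poly p a * coeff (L a) n)" if "degree p <= g" for p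
   using arg_cong[OF L[of p], of "%p. coeff p n"] that S(3) by (simp add: coeff_sum)
  show ?thesis unfolding c[OF that(1)] c[OF that(2)] by (intro DERIV_sum DERIV_cmult_right that(3))
 qed
 show "integral_curve X I ze" unfolding integral_curve_def
 proof (intro ballI allI)
  fix t and a :: "'n \<times> 3" assume t: "t \<in> I"
  let ?h = "X (ze t)"
  have M: "DERIV (%tau. lax_matrix g m (ze tau) x $ r $ s) t :> dlax g m ?h x $ r $ s" if "x \<in> S" for x r s
   using R t that S(2) by blast
  have "DERIV (%tau. poly (VV (ze tau)) x) t :> poly (VV ?h) x"
   "DERIV (%tau. poly (UU (ze tau)) x - x ^ (g + 1)) t :> poly (dUU ?h) x - 0"
   "DERIV (%tau. poly (WW (ze tau)) x - x ^ (g + 1)) t :> poly (dWW ?h) x - 0" if x: "x \<in> S" for x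
   using M[OF x, of 1 1] DERIV_diff[OF M[OF x, of 1 2] DERIV_const[of "x ^ (g + 1)"]] DERIV_diff[OF M[OF x, of 2 1] DERIV_const[of "x ^ (g + 1)"]]
   by (simp_all add: lax_matrix_def dlax_def)
  then have q: "DERIV (%tau. coeff (VV (ze tau)) n) t :> coeff (VV ?h) n"
   "DERIV (%tau. coeff (dUU (ze tau)) n) t :> coeff (dUU ?h) n"
   "DERIV (%tau. coeff (dWW (ze tau)) n) t :> coeff (dWW ?h) n" for n
   by (intro D degree_V degree_dU degree_dW; simp add: dU_poly_def dW_poly_def poly_monom)+
  have "((%tau. ofp (dUU (ze tau)) (VV (ze tau)) (dWW (ze tau)) $ a) has_field_derivative
    ofp (dUU ?h) (VV ?h) (dWW ?h) $ a) (at t)" unfolding of_polys_def vec_lambda_beta Let_def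
   by (cases "snd a = 1"; cases "snd a = 2"; simp only: if_True if_False simp_thms) (intro DERIV_cmult DERIV_cdivide DERIV_diff DERIV_add q)+
  then show "DERIV (%tau. ze tau $ a) t :> ?h $ a" unfolding of_polys_inverse[OF card m] .
 qed
qed

text \<open>The commutator with the partner at \<open>a\<close> is \<open>- 2\<close> times
  \<open>lax_direction\<close>, so the factor \<open>2 \<i>\<close> of the Lax equation turns
  weights \<open>c\<close> into \<open>\<i> c\<close>. The weights must have the moments
  \<open>d k / \<i>\<close> for \<open>k <= g\<close>: \<open>g + 1\<close> conditions on
  \<open>g + 1\<close> distinct parameters, which are solvable for any choice of these.\<close>

theorem lax_field_representation: assumes A: "card A = g + 1" and X: "lax_field X d" shows "\<exists>c. lax_representation g m A c X"
proof -
 define S where "S = {b. Some b \<in> A}"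
 define N where "N = A \<inter> {None}"
 have A': "A = Some ` S \<union> N"
 proof (rule Set.set_eqI)
  show "a \<in> A \<longleftrightarrow> a \<in> Some ` S \<union> N" for a by (cases a) (auto simp: S_def N_def)
 qed
 have "finite A" using A card.infinite[of A] by (cases "finite A") auto
 then have fin: "finite S" "finite N" unfolding S_def N_def by (simp_all add: finite_vimageI[of A Some, unfolded vimage_def])
 have disj: "Some ` S \<inter> N = {}" unfolding N_def by blast
 have "card A = card (Some ` S) + card N" unfolding A' by (rule card_Un_disjoint) (simp_all add: fin disj)
 then have cA: "card S + card N = g + 1" using A by (simp add: card_image)
 \<comment> \<open>The finite parameters take care of the moments below \<open>card S\<close>, which
   is \<open>g + 1\<close>, or \<open>g\<close> if infinity is among the parameters. The choice is
   made separately for each value \<open>s\<close> of \<open>H_(-1)\<close>.\<close>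
 define c0 where "c0 = (%s. SOME c. \<forall>k<card S. (\<Sum>a\<in>S. c a * a ^ k) = d s k / \<i>)"
 have c0: "(\<Sum>a\<in>S. c0 s a * a ^ k) = d s k / \<i>" if "k < card S" for s k
  using someI_ex[OF moments_solve[OF fin(1), of "%k. d s k / \<i>"]] that unfolding c0_def by simp
 \<comment> \<open>Infinity contributes to the top moment \<open>k = g\<close> only, so it receives
   what the finite parameters leave over.\<close>
 define c where "c = (%a s. case a of Some b => c0 s b | None => d s g / \<i> - (\<Sum>b\<in>S. c0 s b * b ^ g))"
 have Xc: "X z = (\<Sum>a\<in>A. (\<i> * c a (Hk g m (-1) z)) *s lax_direction z a)" for z
 proof -
  let ?s = "Hk g m (-1) z"
  have "(\<Sum>a\<in>A. (\<i> * c a ?s) *s lax_direction z a) = (\<Sum>a\<in>Some ` S. (\<i> * c a ?s) *s lax_direction z a) + (\<Sum>a\<in>N. (\<i> * c a ?s) *s lax_direction z a)"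
   unfolding A' by (rule sum.union_disjoint) (use fin disj in simp_all)
  also have "(\<Sum>a\<in>Some ` S. (\<i> * c a ?s) *s lax_direction z a) = (\<Sum>k\<le>g. (\<Sum>b\<in>S. \<i> * c0 ?s b * b ^ k) *s lax_R z (k + 1))"
   by (subst sum.reindex) (simp_all add: c_def lax_direction_def lax_vec_moments)
  also have "\<dots> + (\<Sum>a\<in>N. (\<i> * c a ?s) *s lax_direction z a) = (\<Sum>k\<le>g. d ?s k *s lax_R z (k + 1))"
  proof -
   have i: "(\<Sum>b\<in>S. \<i> * c0 ?s b * b ^ k) = \<i> * (\<Sum>b\<in>S. c0 ?s b * b ^ k)" for k by (simp add: sum_distrib_left mult.assoc)
   show ?thesis
   proof (cases "None \<in> A")
    case True
    then have N: "N = {None}" unfolding N_def by blast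
    then have S: "card S = g" using cA by simp
    have "{..g} = insert g {..<g}" by auto
    then have "(\<Sum>k\<le>g. x k *s lax_R z (k + 1)) = x g *s lax_R z (g + 1) + (\<Sum>k<g. x k *s lax_R z (k + 1))" for x by simp
    note split = this
    have "\<i> * (\<Sum>b\<in>S. c0 ?s b * b ^ g) + \<i> * c None ?s = d ?s g" by (simp add: c_def field_simps)
    then show ?thesis unfolding split i N
     by (simp add: c0 S lax_direction_def vec.scale_left_distrib[symmetric] add.commute add.left_commute)
   next
    case False
    then have N: "N = {}" unfolding N_def by blast
    then show ?thesis using cA unfolding i N by (simp add: c0)
   qed
  qed
  finally show ?thesis using X unfolding lax_field_def by simp
 qed
 have "DERIV (%tau. lax_matrix g m (ze tau) x $ r $ s) t :> dlax g m (X (ze t)) x $ r $ s \<longleftrightarrow>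
  ((%tau. 2 * \<i> * lax_matrix g m (ze tau) x $ r $ s) has_field_derivative
   (let M = lax_matrix g m (ze t) x; P = (\<Sum>a\<in>A. mat (c a (Hk g m (-1) (ze t))) ** lax_partner g m (ze t) a x)
    in (M ** P - P ** M) $ r $ s)) (at t)" if x: "Some x \<notin> A" for ze t x r s
 proof -
  let ?c = "%a. c a (Hk g m (-1) (ze t))" and ?d = "%h. dlax g m h x $ r $ s" and ?M = "lax_matrix g m (ze t) x" and ?P = "%a. lax_partner g m (ze t) a x"
  have q: "c * (- 2 * d) = 2 * \<i> * (\<i> * c * d)" for c d :: complex
  proof -
   have "2 * \<i> * (\<i> * c * d) = (\<i> * \<i>) * (2 * (c * d))" by (simp only: ac_simps)
   then show ?thesis by simp
  qed
  have "(?M ** (\<Sum>a\<in>A. mat (?c a) ** ?P a) - (\<Sum>a\<in>A. mat (?c a) ** ?P a) ** ?M) $ r $ s = (\<Sum>a\<in>A. ?c a * (?M ** ?P a - ?P a ** ?M) $ r $ s)"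
   by (rule commutator_sum)
  also have "\<dots> = (\<Sum>a\<in>A. ?c a * (- 2 * ?d (lax_direction (ze t) a)))"
   by (intro sum.cong refl arg_cong2[of _ _ _ _ "(*)"] lax_commutator) (use x in blast)
  also have "\<dots> = 2 * \<i> * (\<Sum>a\<in>A. \<i> * ?c a * ?d (lax_direction (ze t) a))" unfolding sum_distrib_left by (simp only: q)
  also have "\<dots> = 2 * \<i> * ?d (X (ze t))" by (simp only: Xc dlax_combination)
  finally have e: "(?M ** (\<Sum>a\<in>A. mat (?c a) ** ?P a) - (\<Sum>a\<in>A. mat (?c a) ** ?P a) ** ?M) $ r $ s = 2 * \<i> * ?d (X (ze t))" .
  have "DERIV F t :> D \<longleftrightarrow> DERIV (%tau. 2 * \<i> * F tau) t :> 2 * \<i> * D" for F D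
  proof
   assume "DERIV (%tau. 2 * \<i> * F tau) t :> 2 * \<i> * D"
   from DERIV_cmult[OF this, of "1 / (2 * \<i>)"] show "DERIV F t :> D" by simp
  qed (rule DERIV_cmult)
  then show ?thesis unfolding Let_def e .
 qed
 then have "lax_representation g m A c X" unfolding lax_representation_def integral_curve_lax[OF fin(1)] unfolding S_def by simp
 then show ?thesis by blast
qed

end

theorem theorem3p1:
  fixes g :: nat and m :: real and hm1 h :: complex and hs :: "nat \<Rightarrow> complex"
    and D0 :: divisor
  assumes dim: "CARD('n::enum) = g + 1"
    and m: "m \<noteq> -1"
    and no_double_root: "rsquarefree (spectral_poly g m hm1 h hs)"
    and D0: "D0 \<in> Div0 g (spectral_poly g m hm1 h hs)"
  shows "let f = spectral_poly g m hm1 h hs;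
             T = (level_set g m hm1 h hs :: (complex ^ ('n \<times> 3)) set);
             J = gen_jacobian g f;
             p = (jac_proj g f :: (complex, 'n) vec \<Rightarrow> divisor set);
             \<Theta> = theta_divisor TYPE('n) g f D0
         in complex_submanifold (g + 1) T \<and>
            (\<exists>\<Phi>. biholomorphic_onto p \<Phi> T (J - \<Theta>) \<and>
               (\<forall>K\<in>hamiltonians g m. \<exists>v. \<forall>I \<zeta> t0.
                  open I \<and> connected I \<and> t0 \<in> I \<and>
                  integral_curve (ham_field g m K) I \<zeta> \<and> \<zeta> t0 \<in> T \<longrightarrow>
                  (\<exists>u. \<forall>t\<in>I. \<zeta> t \<in> T \<and> \<Phi> (\<zeta> t) = p (u + t *s v)))) \<and>
            (\<forall>A. card A = g + 1 \<longrightarrow>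
               (\<forall>K\<in>(hamiltonians g m :: (complex ^ ('n \<times> 3) \<Rightarrow> complex) set).
                  \<exists>c. lax_representation g m A c (ham_field g m K)))"
proof -
  define f where "f = spectral_poly g m hm1 h hs"
  interpret level g f m "TYPE('n)"
    unfolding f_def using spectral_poly_hyperelliptic[OF no_double_root] dim m by (intro level.intro level_axioms.intro)
  have T: "(level_set g m hm1 h hs :: (complex ^ ('n \<times> 3)) set) = lvl"
    unfolding lvl_def using level_set_iff[OF m, of _ g hm1 h hs, folded f_def] by blast
  have D0': "D0 \<in> Div0 g f" using D0 unfolding f_def .
  have flow: "\<exists>v :: (complex, 'n) vec. \<forall>I \<zeta> t0. open I \<and> connected I \<and> t0 \<in> I \<and> integral_curve (ham_field g m K) I \<zeta> \<and> \<zeta> t0 \<in> lvl \<longrightarrow>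
      (\<exists>u. \<forall>t\<in>I. \<zeta> t \<in> lvl \<and> Phi D0 (\<zeta> t) = jac_proj g f (u + t *s v))"
    and lax: "card A = g + 1 \<Longrightarrow> \<exists>c. lax_representation g m A c (ham_field g m K)"
    if "K \<in> (hamiltonians g m :: (complex ^ ('n \<times> 3) \<Rightarrow> complex) set)" for K A
    using hamiltonian_lax_field[OF that] Phi_flow[OF D0'] lax_field_representation by blast+
  show ?thesis unfolding f_def[symmetric] T Let_def
    by (intro conjI exI[of _ "Phi D0"] ballI allI impI lvl_submanifold Phi_biholomorphic[OF D0'] flow lax)
qed

end
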